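(* Let $k$ be an algebraically closed field of characteristic $2$, let $m,n\in\mathbb{Z}_{\ge0}$, $d\in\mathbb{Z}_{>0}$, and $X=m+nP\in\mathrm{Ver}_4^+$. Then $X$ is $d$-faithful, i.e. the algebra homomorphism $kS_d\to\mathrm{End}(X^{\otimes d})$ given by the braiding is injective (equivalently, $\mathfrak{D}_{\lambda|0}$ does not vanish on $X$ for every $2$-restricted partition $\lambda\vdash d$), if and only if both $m+4n\ge d$ and $m+2n\ge1+\lfloor d/2\rfloor$.
   Context: $\mathrm{Ver}_4^+$ is the symmetric tensor category of finite-dimensional modules over the Hopf algebra $k[\delta]/\delta^2$ ($\delta$ primitive) with braiding $c(v\otimes w)=w\otimes v+\delta w\otimes\delta v$. Its unique simple object is $\mathbf{1}$, with projective cover $P=k[\delta]/\delta^2$, and every object is of the form $m+nP:=m\mathbf{1}\oplus nP$. $S_d$ acts on $X^{\otimes d}$ via the braiding. A partition $\lambda$ is $2$-restricted if $\lambda_i-\lambda_{i+1}\le1$ for all $i$. Let $\mathbf{B}^d\subset\mathrm{Rep}_kS_d$ be the full subcategory of finite direct sums of direct summands of underlying $S_d$-representations $X^{\otimes d}$, $X\in\mathrm{Ver}_4^+$. It contains the Young modules $Y^\lambda$, $\lambda\vdash d$. $\mathfrak{D}_{\lambda|0}$ is the endofunctor $X\mapsto D(X^{\otimes d})$ for $D$ the simple object of the category of $k$-linear functors $\mathbf{B}^d\to\mathrm{Vec}$ with projective cover $\mathrm{Hom}_{S_d}(Y^\lambda,-)$; so $\mathfrak{D}_{\lambda|0}(X)\neq0$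 if and only if $Y^\lambda$ is a direct summand of $X^{\otimes d}$. The indecomposable projective $kS_d$-modules are the $Y^\lambda$ with $\lambda$ $2$-restricted. *)

theory Defs
  imports
    "Jordan_Normal_Form.VS_Connect"
    "HOL-Combinatorics.Permutations"
begin

text \<open>
  Finite-dimensional vector spaces are taken with a chosen basis, so that linear maps are matrices.
  The symmetric group \<open>S\<^sub>d\<close> consists of the permutations of \<open>{0,\<dots>,d-1}\<close>, with product \<open>\<circ>\<close>.
\<close>

definition Sym :: "nat \<Rightarrow> (nat \<Rightarrow> nat) set" where
  "Sym d = {\<sigma>. \<sigma> permutes {..<d}}"


section \<open>The category \<open>Ver\<^sub>4\<^sup>+\<close>\<close>

text \<open>An object is given by the matrix of \<open>\<delta>\<close>. The space \<open>k\<^sup>N\<close> has basis \<open>e\<^sub>0,\<dots>,e\<^bsub>N-1\<^esub>\<close>.\<close>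

definition Ver4p :: "'k::field mat set" where
  "Ver4p = {X. square_mat X \<and> X * X = 0\<^sub>m (dim_row X) (dim_row X)}"

definition unit_obj :: "'k::field mat" where
  "unit_obj = 0\<^sub>m 1 1"

text \<open>The regular module \<open>k[\<delta>]/\<delta>\<^sup>2\<close> in the basis \<open>1, \<delta>\<close>.\<close>

definition P_obj :: "'k::field mat" where
  "P_obj = mat 2 2 (\<lambda>(i, j). if i = 1 \<and> j = 0 then 1 else 0)"

definition mnP :: "nat \<Rightarrow> nat \<Rightarrow> 'k::field mat" where
  "mnP m n = diag_block_mat (replicate m unit_obj @ replicate n P_obj)"

text \<open>Kronecker product: the basis vector \<open>e\<^sub>a \<otimes> e\<^sub>b\<close> of \<open>k\<^sup>M \<otimes> k\<^sup>N\<close> has index \<open>a * N + b\<close>.\<close>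

definition kron :: "'k::field mat \<Rightarrow> 'k mat \<Rightarrow> 'k mat" where
  "kron A B = mat (dim_row A * dim_row B) (dim_col A * dim_col B)
     (\<lambda>(i, j). A $$ (i div dim_row B, j div dim_col B) * B $$ (i mod dim_row B, j mod dim_col B))"

definition flip_mat :: "nat \<Rightarrow> 'k::field mat" where
  "flip_mat N = mat (N * N) (N * N)
     (\<lambda>(i, j). if i div N = j mod N \<and> i mod N = j div N then 1 else 0)"

text \<open>The braiding \<open>c(v \<otimes> w) = w \<otimes> v + \<delta> w \<otimes> \<delta> v\<close> of \<open>X\<close> with itself is the flip after
  \<open>1 + \<delta> \<otimes> \<delta>\<close>.\<close>

definition braiding :: "'k::field mat \<Rightarrow> 'k mat" where
  "braiding X = flip_mat (dim_row X) * (1\<^sub>m (dim_row X * dim_row X) + kron X X)"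

definition braid_at :: "nat \<Rightarrow> 'k::field mat \<Rightarrow> nat \<Rightarrow> 'k mat" where
  "braid_at d X i =
     kron (kron (1\<^sub>m (dim_row X ^ i)) (braiding X)) (1\<^sub>m (dim_row X ^ (d - 2 - i)))"

definition word_perm :: "nat list \<Rightarrow> nat \<Rightarrow> nat" where
  "word_perm w = foldr (\<lambda>i \<sigma>. transpose i (Suc i) \<circ> \<sigma>) w id"

definition word_mat :: "nat \<Rightarrow> 'k::field mat \<Rightarrow> nat list \<Rightarrow> 'k mat" where
  "word_mat d X w = foldr (\<lambda>i A. braid_at d X i * A) w (1\<^sub>m (dim_row X ^ d))"

text \<open>The action of \<open>\<sigma> \<in> S\<^sub>d\<close> on \<open>X\<^bsup>\<otimes>d\<^esup>\<close>: write \<open>\<sigma>\<close> as a product of simple transpositions and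
  compose the corresponding braidings. As the braiding is symmetric, the result does not depend on
  the chosen word.\<close>

definition tensor_rep :: "nat \<Rightarrow> 'k::field mat \<Rightarrow> (nat \<Rightarrow> nat) \<Rightarrow> 'k mat" where
  "tensor_rep d X \<sigma> =
     (THE A. \<exists>w. (\<forall>i \<in> set w. Suc i < d) \<and> word_perm w = \<sigma> \<and> A = word_mat d X w)"


section \<open>\<open>d\<close>-faithful objects\<close>

definition group_algebra :: "nat \<Rightarrow> ((nat \<Rightarrow> nat) \<Rightarrow> 'k::field) set" where
  "group_algebra d = {a. \<forall>\<sigma>. \<sigma> \<notin> Sym d \<longrightarrow> a \<sigma> = 0}"

definition braid_hom :: "nat \<Rightarrow> 'k::field mat \<Rightarrow> ((nat \<Rightarrow> nat) \<Rightarrow> 'k) \<Rightarrow> 'k mat" where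
  "braid_hom d X a = mat (dim_row X ^ d) (dim_row X ^ d)
     (\<lambda>(i, j). \<Sum>\<sigma>\<in>Sym d. a \<sigma> * tensor_rep d X \<sigma> $$ (i, j))"

text \<open>The morphisms of \<open>Ver\<^sub>4\<^sup>+\<close> are the linear maps commuting with \<open>\<delta>\<close>, so injectivity into
  \<open>End(X\<^bsup>\<otimes>d\<^esup>)\<close> is injectivity into all matrices.\<close>

definition faithful_obj :: "nat \<Rightarrow> 'k::field mat \<Rightarrow> bool" where
  "faithful_obj d X \<longleftrightarrow> inj_on (braid_hom d X) (group_algebra d)"


section \<open>Representations of \<open>S\<^sub>d\<close>\<close>

type_synonym 'k srep = "(nat \<Rightarrow> nat) \<Rightarrow> 'k mat"

definition rdim :: "'k::field srep \<Rightarrow> nat" where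
  "rdim M = dim_row (M id)"

definition is_rep :: "nat \<Rightarrow> 'k::field srep \<Rightarrow> bool" where
  "is_rep d M \<longleftrightarrow>
     (\<forall>\<sigma>\<in>Sym d. M \<sigma> \<in> carrier_mat (rdim M) (rdim M)) \<and>
     M id = 1\<^sub>m (rdim M) \<and>
     (\<forall>\<sigma>\<in>Sym d. \<forall>\<tau>\<in>Sym d. M (\<sigma> \<circ> \<tau>) = M \<sigma> * M \<tau>)"

definition Homs :: "nat \<Rightarrow> 'k::field srep \<Rightarrow> 'k srep \<Rightarrow> 'k mat set" where
  "Homs d M N = {f \<in> carrier_mat (rdim N) (rdim M). \<forall>\<sigma>\<in>Sym d. f * M \<sigma> = N \<sigma> * f}"

definition rep_iso :: "nat \<Rightarrow> 'k::field srep \<Rightarrow> 'k srep \<Rightarrow> bool" where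
  "rep_iso d M N \<longleftrightarrow> (\<exists>f \<in> Homs d M N. invertible_mat f)"

definition direct_sum :: "'k::field srep list \<Rightarrow> 'k srep" where
  "direct_sum Ms \<sigma> = diag_block_mat (map (\<lambda>M. M \<sigma>) Ms)"

definition is_summand :: "nat \<Rightarrow> 'k::field srep \<Rightarrow> 'k srep \<Rightarrow> bool" where
  "is_summand d N M \<longleftrightarrow> is_rep d N \<and> (\<exists>N'. is_rep d N' \<and> rep_iso d (direct_sum [N, N']) M)"

definition indecomposable :: "nat \<Rightarrow> 'k::field srep \<Rightarrow> bool" where
  "indecomposable d M \<longleftrightarrow> is_rep d M \<and> rdim M \<noteq> 0 \<and>
     (\<forall>A B. is_rep d A \<and> is_rep d B \<and> rep_iso d (direct_sum [A, B]) M \<longrightarrow> rdim A = 0 \<or> rdim B = 0)"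


section \<open>Young modules\<close>

definition is_partition :: "nat \<Rightarrow> nat list \<Rightarrow> bool" where
  "is_partition d l \<longleftrightarrow> sorted_wrt (\<ge>) l \<and> 0 \<notin> set l \<and> sum_list l = d"

definition row_len :: "nat list \<Rightarrow> nat \<Rightarrow> nat" where
  "row_len l i = (if i < length l then l ! i else 0)"

definition two_restricted :: "nat list \<Rightarrow> bool" where
  "two_restricted l \<longleftrightarrow> (\<forall>i. row_len l i - row_len l (Suc i) \<le> 1)"

text \<open>A tabloid of shape \<open>l\<close> is encoded by the word whose \<open>x\<close>-th letter is the row of \<open>x\<close>.\<close>

definition tabloids :: "nat \<Rightarrow> nat list \<Rightarrow> nat list list" where
  "tabloids d l =
     filter (\<lambda>w. \<forall>i<length l. count_list w i = l ! i) (List.n_lists d [0..<length l])"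

definition perm_word :: "nat \<Rightarrow> (nat \<Rightarrow> nat) \<Rightarrow> nat list \<Rightarrow> nat list" where
  "perm_word d \<sigma> w = map (\<lambda>y. w ! inv_into UNIV \<sigma> y) [0..<d]"

text \<open>The permutation module on tabloids, with basis in the order of the list above.\<close>

definition perm_module :: "nat \<Rightarrow> nat list \<Rightarrow> 'k::field srep" where
  "perm_module d l \<sigma> = mat (length (tabloids d l)) (length (tabloids d l))
     (\<lambda>(a, b). if tabloids d l ! a = perm_word d \<sigma> (tabloids d l ! b) then 1 else 0)"

text \<open>A tableau sends each number to its cell \<open>(row, column)\<close>.\<close>

definition is_tableau :: "nat \<Rightarrow> nat list \<Rightarrow> (nat \<Rightarrow> nat \<times> nat) \<Rightarrow> bool" where
  "is_tableau d l t \<longleftrightarrow> bij_betw t {..<d} {(i, j). i < length l \<and> j < l ! i}"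

definition column_stabilizer :: "nat \<Rightarrow> (nat \<Rightarrow> nat \<times> nat) \<Rightarrow> (nat \<Rightarrow> nat) set" where
  "column_stabilizer d t = {\<tau> \<in> Sym d. \<forall>x<d. snd (t (\<tau> x)) = snd (t x)}"

definition polytabloid :: "nat \<Rightarrow> nat list \<Rightarrow> (nat \<Rightarrow> nat \<times> nat) \<Rightarrow> 'k::field vec" where
  "polytabloid d l t = vec (length (tabloids d l))
     (\<lambda>a. \<Sum>\<tau>\<in>column_stabilizer d t.
        if tabloids d l ! a = perm_word d \<tau> (map (fst \<circ> t) [0..<d]) then of_int (sign \<tau>) else 0)"

definition specht :: "nat \<Rightarrow> nat list \<Rightarrow> 'k::field vec set" where
  "specht d l = LinearCombinations.module.span class_ring
     (module_vec TYPE('k) (length (tabloids d l))) {polytabloid d l t |t. is_tableau d l t}"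

text \<open>James's convention: the Young module of \<open>l\<close> is the indecomposable direct summand of the
  permutation module that contains the Specht module; it is unique up to isomorphism.\<close>

definition is_young_module :: "nat \<Rightarrow> nat list \<Rightarrow> 'k::field srep \<Rightarrow> bool" where
  "is_young_module d l Y \<longleftrightarrow> indecomposable d Y \<and>
     (\<exists>i \<in> Homs d Y (perm_module d l). \<exists>p \<in> Homs d (perm_module d l) Y.
        p * i = 1\<^sub>m (rdim Y) \<and> specht d l \<subseteq> (\<lambda>v. i *\<^sub>v v) ` carrier_vec (rdim Y))"

definition young_module :: "nat \<Rightarrow> nat list \<Rightarrow> 'k::field srep" where
  "young_module d l = (SOME Y. is_young_module d l Y)"


section \<open>The category \<open>B\<^sup>d\<close> and its simple functors\<close>

definition in_B :: "nat \<Rightarrow> 'k::field srep \<Rightarrow> bool" where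
  "in_B d M \<longleftrightarrow> is_rep d M \<and>
     (\<exists>Ms. rep_iso d (direct_sum Ms) M \<and>
        (\<forall>N \<in> set Ms. \<exists>X \<in> Ver4p. is_summand d N (tensor_rep d X)))"

text \<open>Subfunctors of \<open>Hom(Y,-)\<close> on \<open>B\<^sup>d\<close>; their values outside \<open>B\<^sup>d\<close> are fixed to be empty, so that
  equal subfunctors are equal as functions.\<close>

definition hom_functor :: "nat \<Rightarrow> 'k::field srep \<Rightarrow> 'k srep \<Rightarrow> 'k mat set" where
  "hom_functor d Y M = (if in_B d M then Homs d Y M else {})"

definition is_subfunctor :: "nat \<Rightarrow> 'k::field srep \<Rightarrow> ('k srep \<Rightarrow> 'k mat set) \<Rightarrow> bool" where
  "is_subfunctor d Y S \<longleftrightarrow> S \<le> hom_functor d Y \<and>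
     (\<forall>M. in_B d M \<longrightarrow>
        0\<^sub>m (rdim M) (rdim Y) \<in> S M \<and>
        (\<forall>f \<in> S M. \<forall>g \<in> S M. f + g \<in> S M) \<and>
        (\<forall>c. \<forall>f \<in> S M. c \<cdot>\<^sub>m f \<in> S M)) \<and>
     (\<forall>M N. in_B d M \<and> in_B d N \<longrightarrow> (\<forall>f \<in> S M. \<forall>g \<in> Homs d M N. g * f \<in> S N))"

definition is_maximal_subfunctor :: "nat \<Rightarrow> 'k::field srep \<Rightarrow> ('k srep \<Rightarrow> 'k mat set) \<Rightarrow> bool" where
  "is_maximal_subfunctor d Y S \<longleftrightarrow> is_subfunctor d Y S \<and> S \<noteq> hom_functor d Y \<and>
     (\<forall>T. is_subfunctor d Y T \<and> S \<le> T \<longrightarrow> T = S \<or> T = hom_functor d Y)"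

text \<open>The simple functor with projective cover \<open>Hom(Y,-)\<close>, for \<open>Y\<close> indecomposable in \<open>B\<^sup>d\<close>, is the
  quotient of \<open>Hom(Y,-)\<close> by its unique maximal subfunctor.\<close>

definition rad_functor :: "nat \<Rightarrow> 'k::field srep \<Rightarrow> 'k srep \<Rightarrow> 'k mat set" where
  "rad_functor d Y = (THE S. is_maximal_subfunctor d Y S)"

definition simple_functor :: "nat \<Rightarrow> 'k::field srep \<Rightarrow> 'k srep \<Rightarrow> 'k mat set set" where
  "simple_functor d Y M = {{f + r |r. r \<in> rad_functor d Y M} |f. f \<in> hom_functor d Y M}"

text \<open>The underlying set of cosets of \<open>\<DD>\<^bsub>l|0\<^esub>(X)\<close>; the object is zero if and only if there is exactly
  one coset.\<close>

definition frakD :: "nat \<Rightarrow> nat list \<Rightarrow> 'k::field mat \<Rightarrow> 'k mat set set" where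
  "frakD d l X = simple_functor d (young_module d l) (tensor_rep d X)"

definition frakD_vanishes :: "nat \<Rightarrow> nat list \<Rightarrow> 'k::field mat \<Rightarrow> bool" where
  "frakD_vanishes d l X \<longleftrightarrow> is_singleton (frakD d l X)"

end

theory Submission
  imports Defs "HOL-Library.Disjoint_Sets" "Jordan_Normal_Form.Determinant"
begin

text \<open>On words, \<open>\<sigma>\<close> acts on \<open>X\<^bsup>\<otimes>d\<^esup>\<close> by the place permutation combined with one factor
  \<open>1 + \<delta>\<^sub>i \<delta>\<^sub>j\<close> for each inversion. If the inequalities hold, let \<open>f\<close> act by zero. Using one copy of
  \<open>P\<close> on four positions and induction on \<open>n\<close> for the others, one reduces to \<open>S\<^sub>4\<close> and finds that
  \<open>f\<close> is annihilated by \<open>1 + c + c\<^sup>2\<close> for all 3-cycles \<open>c\<close>; the leading term of the action shows that it is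
  annihilated by the sum over the stabiliser of a word with \<open>\<lfloor>(d - 1) / 2\<rfloor>\<close> doubled letters. As \<open>t t' + t' t = 1 + (1 + c + c\<^sup>2)\<close> for transpositions with \<open>t t' = c\<close>, the doublings can be removed
  one by one, which gives \<open>f = 0\<close>.

  For a 2-restricted shape the columns have distinct lengths, so that exactly one pair of a column
  and a row permutation carries the column reversal of a tabloid back to it. Hence every coefficient
  of an element of the group algebra, in particular the one at the identity, can be read off from the
  scalar by which an averaged endomorphism acts on the polytabloid, and a faithful \<open>X\<^bsup>\<otimes>d\<^esup>\<close> contains the
  Young module. Conversely the Young module is not a summand if the product
  \<open>\<rho> \<kappa> \<rho>\<close> of the row, column and row sums acts by zero. For \<open>d > m + 4n\<close> this happens for the shape
  \<open>(1\<^bsup>d\<^esup>)\<close>. Otherwise the inequalities only fail for \<open>m = 0\<close>, \<open>d = 4n\<close>, and the shape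
  \<open>(2\<^bsup>2n-1\<^esup>, 1, 1)\<close> works: there the coefficients of \<open>\<rho> \<kappa> \<rho>\<close> count row transversals, a count that
  becomes even after multiplication by \<open>1 + c + c\<^sup>2\<close> since it is governed by fewer than \<open>d\<close> parity conditions.\<close>

text \<open>Capacity explains the first bound: the sum of all permutations acts by zero once every
  word must repeat a letter outside the image of \<delta> or use a letter inside it four times. A
  summand 1 has capacity 1 and a summand P has 1 + 3, in total m + 4n. For the second bound, a word
  with j doubled letters uses d - j letters, and j = (d - 1) div 2 makes this 1 + d div 2. One more
  doubling for even d would fill all positions with pairs, whereas removing a doubling takes a
  3-cycle through a position outside the pairs. If only the second bound fails, then 2m + 4n \<le> d
  \<le> m + 4n, so m = 0 and d = 4n. The obstacle is the twist. Each correction reads a tensor at a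
  word with two \<delta>-letters fewer, so the number of these letters filters everything: in lowest
  degree \<sigma> is the place permutation, and the next term is a sum over single inversions. With
  two letters on four positions all stabilisers have even order, so the lowest degree misses that
  the norm of \<open>S\<^sub>4\<close> acts nontrivially on the fourth tensor power of P; the second
  term detects it.\<close>

section \<open>Sums over a field of characteristic two\<close>

locale char_two =
  fixes K :: "'k::field itself"
  assumes char_two: "CHAR('k) = 2"
begin

lemma two_eq_0: "(2::'k) = 0"
  using of_nat_CHAR[where 'a='k] char_two by simp

lemma add_self [simp]: "x + x = (0::'k)"
  using two_eq_0 by (metis mult_2 mult_zero_left)

lemma uminus_eq: "- x = (x::'k)"
  using add_self by (metis add_eq_0_iff)

lemma add_self_left [simp]: "x + (x + y) = (y::'k)"
  by (metis add.assoc add_self add_0)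

lemma add_eq_0_iff_eq: "x + y = (0::'k) \<longleftrightarrow> x = y"
  by (metis add_eq_0_iff uminus_eq)

text \<open>Orbits of \<open>h\<close> have two elements and contribute \<open>f x + f x\<close>.
  Most vanishing statements below rest on this, with \<open>h\<close> composing with an involution
  that leaves the summand unchanged.\<close>

lemma sum_involution_eq_0:
  fixes f :: "'b \<Rightarrow> 'k"
  assumes "finite S" "\<And>x. x \<in> S \<Longrightarrow> h x \<in> S" "\<And>x. x \<in> S \<Longrightarrow> h (h x) = x"
    "\<And>x. x \<in> S \<Longrightarrow> h x \<noteq> x" "\<And>x. x \<in> S \<Longrightarrow> f (h x) = f x"
  shows "sum f S = 0"
  using assms
proof (induction "card S" arbitrary: S rule: less_induct)
  case less
  show ?case
  proof (cases "S = {}")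
    case False
    then obtain x where x: "x \<in> S" by blast
    let ?S = "S - {x, h x}"
    note fin = less.prems(1) and mem = less.prems(2) and inv = less.prems(3)
      and ne = less.prems(4) and inv_f = less.prems(5)
    have "sum f ?S = 0"
    proof (rule less.hyps)
      show "card ?S < card S"
        by (rule psubset_card_mono) (use x fin in auto)
      fix y assume y: "y \<in> ?S"
      then have "h y \<in> S" "h (h y) = y" using mem inv by blast+
      moreover have "h y \<noteq> x" "h y \<noteq> h x"
        using y inv[of y] inv[OF x] by (metis DiffE insertCI)+
      ultimately show "h y \<in> ?S" "h (h y) = y" by blast+
      show "h y \<noteq> y" "f (h y) = f y" using y ne inv_f by blast+
    qed (use fin in blast)
    moreover have "sum f S = sum f ?S + sum f {x, h x}"
      using fin x mem[OF x] by (subst sum.subset_diff[of "{x, h x}"]) blast+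
    moreover have "sum f {x, h x} = 0"
      using ne[OF x] inv_f[OF x] by (subst sum.insert) (auto dest: sym)
    ultimately show ?thesis by simp
  qed simp
qed

end

section \<open>The twisted action on functions of words\<close>

text \<open>For \<open>X = m + nP\<close> the letters \<open>0,\<dots>,m-1\<close> are killed by \<open>\<delta>\<close>, and \<open>\<delta>\<close> maps the letter
  \<open>m + 2l\<close> to \<open>m + 2l + 1\<close>. A tensor is the function giving its coefficient at each word; words are
  infinite so that all \<open>d\<close> are treated at once, and only finitely many positions are ever moved.\<close>

definition is_delta :: "nat \<Rightarrow> nat \<Rightarrow> bool" where
  "is_delta m l \<longleftrightarrow> m \<le> l \<and> odd (l - m)"

text \<open>The letter \<open>m + 2l + 1\<close> is the image of its predecessor, so a coefficient
  of the \<delta>-image at a word is a coefficient of the original tensor at the lowered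
  word.\<close>

definition lower :: "nat set \<Rightarrow> (nat \<Rightarrow> nat) \<Rightarrow> nat \<Rightarrow> nat" where
  "lower A w = (\<lambda>i. if i \<in> A then w i - 1 else w i)"

text \<open>\<open>\<delta>\<close> applied at all positions of \<open>A\<close>, read off on coefficients.\<close>

definition delta_at :: "nat \<Rightarrow> nat set \<Rightarrow> ((nat \<Rightarrow> nat) \<Rightarrow> 'k::field) \<Rightarrow> (nat \<Rightarrow> nat) \<Rightarrow> 'k" where
  "delta_at m A \<phi> = (\<lambda>w. if \<forall>i\<in>A. is_delta m (w i) then \<phi> (lower A w) else 0)"

definition twist :: "nat \<Rightarrow> nat set \<Rightarrow> ((nat \<Rightarrow> nat) \<Rightarrow> 'k::field) \<Rightarrow> (nat \<Rightarrow> nat) \<Rightarrow> 'k" where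
  "twist m A \<phi> = (\<lambda>w. \<phi> w + delta_at m A \<phi> w)"

text \<open>The operators commute (\<open>twist_commute\<close>), so a fold over a set is
  meaningful; the inversions of a permutation come without a preferred order.\<close>

definition twists :: "nat \<Rightarrow> nat set set \<Rightarrow> ((nat \<Rightarrow> nat) \<Rightarrow> 'k::field) \<Rightarrow> (nat \<Rightarrow> nat) \<Rightarrow> 'k" where
  "twists m S \<phi> = Finite_Set.fold (twist m) \<phi> S"

text \<open>Unordered pairs let a permutation act by taking images and make the cocycle identity
  \<open>inversions_comp\<close> a symmetric difference.\<close>

definition inversions :: "(nat \<Rightarrow> nat) \<Rightarrow> nat set set" where
  "inversions \<sigma> = {{i, j} |i j. i < j \<and> \<sigma> j < \<sigma> i}"

text \<open>The braiding lets \<open>\<sigma>\<close> act as the place permutation after the product of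
  \<open>1 + \<delta>\<^sub>i \<delta>\<^sub>j\<close> over the inversions \<open>{i, j}\<close> of \<open>\<sigma>\<close>.\<close>

definition tact :: "nat \<Rightarrow> (nat \<Rightarrow> nat) \<Rightarrow> ((nat \<Rightarrow> nat) \<Rightarrow> 'k::field) \<Rightarrow> (nat \<Rightarrow> nat) \<Rightarrow> 'k" where
  "tact m \<sigma> \<phi> = (\<lambda>w. twists m (inversions \<sigma>) \<phi> (w \<circ> \<sigma>))"

lemma is_delta_pred:
  assumes "is_delta m l" shows "\<not> is_delta m (l - 1)"
proof -
  have "odd (l - m)" using assms by (simp add: is_delta_def)
  then obtain k where "l - m = 2 * k + 1" by (rule oddE)
  then have "l - 1 - m = 2 * k" by simp
  then show ?thesis by (simp add: is_delta_def)
qed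

lemma is_delta_pos: "is_delta m l \<Longrightarrow> 0 < l \<and> m < l"
  unfolding is_delta_def by (cases "l = m") auto

text \<open>Where \<open>A\<close> and \<open>B\<close> meet, \<delta> is applied twice at one
  position, and \<delta> squares to zero: a lowered letter is no longer a \<delta>-image.\<close>

lemma delta_at_delta_at:
  "delta_at m A (delta_at m B \<phi>) = (if A \<inter> B = {} then delta_at m (A \<union> B) \<phi> else (\<lambda>w. 0))"
proof (cases "A \<inter> B = {}")
  case True
  then have *: "lower B (lower A w) = lower (A \<union> B) w" for w
    by (auto simp: lower_def fun_eq_iff)
  have "(\<forall>i\<in>B. is_delta m (lower A w i)) \<longleftrightarrow> (\<forall>i\<in>B. is_delta m (w i))" for w
    using True by (auto simp: lower_def disjoint_iff)
  then show ?thesis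
    using True by (auto simp: delta_at_def * fun_eq_iff)
next
  case False
  then obtain i where i: "i \<in> A" "i \<in> B" by blast
  have "\<not> (\<forall>i\<in>B. is_delta m (lower A w i))" if "\<forall>i\<in>A. is_delta m (w i)" for w
    using that i is_delta_pred[of m "w i"] by (auto simp: lower_def)
  then show ?thesis
    using False by (auto simp: delta_at_def fun_eq_iff)
qed

lemma delta_at_add: "delta_at m A (\<lambda>w. \<phi> w + \<psi> w) = (\<lambda>w. delta_at m A \<phi> w + delta_at m A \<psi> w)"
  by (auto simp: delta_at_def)

lemma twist_commute: "twist m A \<circ> twist m B = twist m B \<circ> twist m A"
proof
  fix \<phi> :: "(nat \<Rightarrow> nat) \<Rightarrow> 'a"
  show "(twist m A \<circ> twist m B) \<phi> = (twist m B \<circ> twist m A) \<phi>"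
    by (simp add: twist_def delta_at_add delta_at_delta_at fun_eq_iff Int_commute Un_commute algebra_simps)
qed

interpretation twist_fold: comp_fun_commute "twist m"
  by standard (rule twist_commute)

lemma twists_empty [simp]: "twists m {} \<phi> = \<phi>"
  by (simp add: twists_def)

lemma twists_insert:
  "finite S \<Longrightarrow> A \<notin> S \<Longrightarrow> twists m (insert A S) \<phi> = twist m A (twists m S \<phi>)"
  by (simp add: twists_def)

text \<open>With \<open>D = delta_at m A\<close>,
  \<open>(1 + D)\<^sup>2 = 1 + 2D + D\<^sup>2\<close>; the middle term is zero in characteristic two
  and \<open>D\<close> squares to zero because \<open>A\<close> meets itself. For empty
  \<open>A\<close> the twist would be 1 + 1 = 0.\<close>

lemma (in char_two) twist_twist:
  fixes \<phi> :: "(nat \<Rightarrow> nat) \<Rightarrow> 'k"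
  shows "A \<noteq> {} \<Longrightarrow> twist m A (twist m A \<phi>) = \<phi>"
  by (auto simp: twist_def delta_at_add delta_at_delta_at fun_eq_iff add.assoc)

text \<open>Twists are commuting involutions, so one that occurs on both sides cancels.\<close>

lemma (in char_two) twists_sym_diff:
  fixes \<phi> :: "(nat \<Rightarrow> nat) \<Rightarrow> 'k"
  assumes "finite S" "finite R" "{} \<notin> R"
  shows "twists m R (twists m S \<phi>) = twists m (sym_diff R S) \<phi>"
  using assms(2,3)
proof (induction R)
  case (insert A R)
  have *: "twists m (insert A R) (twists m S \<phi>) = twist m A (twists m (sym_diff R S) \<phi>)"
    using insert by (simp add: twists_insert)
  show ?case
  proof (cases "A \<in> S")
    case True
    then have "sym_diff R S = insert A (sym_diff (insert A R) S)" "A \<notin> sym_diff (insert A R) S"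
      using insert by auto
    moreover have "finite (sym_diff (insert A R) S)" using insert assms by auto
    ultimately have "twists m (sym_diff R S) \<phi> = twist m A (twists m (sym_diff (insert A R) S) \<phi>)"
      by (metis twists_insert)
    moreover have "A \<noteq> {}" using insert.prems by auto
    ultimately show ?thesis by (simp add: * twist_twist)
  next
    case False
    then have "sym_diff (insert A R) S = insert A (sym_diff R S)" "A \<notin> sym_diff R S"
      using insert by auto
    moreover have "finite (sym_diff R S)" using insert assms by auto
    ultimately show ?thesis using * by (simp add: twists_insert)
  qed
qed simp

lemma delta_at_permute:
  "delta_at m A \<phi> (w \<circ> \<sigma>) = delta_at m (\<sigma> ` A) (\<lambda>w. \<phi> (w \<circ> \<sigma>)) w" if "bij \<sigma>"
proof -
  have "lower A (w \<circ> \<sigma>) = lower (\<sigma> ` A) w \<circ> \<sigma>"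
    using that by (auto simp: lower_def fun_eq_iff bij_def inj_image_mem_iff)
  then show ?thesis by (auto simp: delta_at_def)
qed

lemma twist_permute:
  "bij \<sigma> \<Longrightarrow> (\<lambda>w. twist m A \<phi> (w \<circ> \<sigma>)) = twist m (\<sigma> ` A) (\<lambda>w. \<phi> (w \<circ> \<sigma>))"
  by (simp add: twist_def delta_at_permute)

lemma twists_permute:
  assumes "bij \<sigma>" "finite S"
  shows "(\<lambda>w. twists m S \<phi> (w \<circ> \<sigma>)) = twists m ((`) \<sigma> ` S) (\<lambda>w. \<phi> (w \<circ> \<sigma>))"
  using assms(2)
proof (induction S)
  case (insert A S)
  have notin: "\<sigma> ` A \<notin> (`) \<sigma> ` S"
    using insert.hyps assms(1) by (auto simp: bij_def inj_image_eq_iff)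
  have "(\<lambda>w. twists m (insert A S) \<phi> (w \<circ> \<sigma>)) = twist m (\<sigma> ` A) (\<lambda>w. twists m S \<phi> (w \<circ> \<sigma>))"
    unfolding twists_insert[OF insert.hyps] by (rule twist_permute[OF assms(1)])
  also have "\<dots> = twists m (insert (\<sigma> ` A) ((`) \<sigma> ` S)) (\<lambda>w. \<phi> (w \<circ> \<sigma>))"
    unfolding insert.IH using insert.hyps(1) notin by (intro twists_insert[symmetric]) auto
  finally show ?case by (simp only: image_insert)
qed simp

lemma doubleton_in_inversions:
  "i < j \<Longrightarrow> {i, j} \<in> inversions \<sigma> \<longleftrightarrow> \<sigma> j < \<sigma> i"
  by (auto simp: inversions_def doubleton_eq_iff)

lemma inversions_cases:
  assumes "A \<in> inversions \<sigma>" obtains i j where "A = {i, j}" "i < j" "\<sigma> j < \<sigma> i"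
  using assms by (auto simp: inversions_def)

lemma inversions_subset:
  assumes "\<sigma> permutes {a..<b}" shows "inversions \<sigma> \<subseteq> Pow {a..<b}"
proof
  fix A assume "A \<in> inversions \<sigma>"
  then obtain i j where A: "A = {i, j}" "i < j" "\<sigma> j < \<sigma> i" by (rule inversions_cases)
  have fix_out: "\<sigma> x = x" if "x \<notin> {a..<b}" for x using assms that by (rule permutes_not_in)
  have in_iff: "\<sigma> x \<in> {a..<b} \<longleftrightarrow> x \<in> {a..<b}" for x using assms by (rule permutes_in_image)
  have "i \<in> {a..<b}" "j \<in> {a..<b}"
    using A fix_out[of i] fix_out[of j] in_iff[of i] in_iff[of j] by auto
  then show "A \<in> Pow {a..<b}" using A by auto
qed

lemma finite_inversions: "\<sigma> permutes {a..<b} \<Longrightarrow> finite (inversions \<sigma>)"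
  by (rule finite_subset[OF inversions_subset]) auto

lemma empty_notin_inversions: "{} \<notin> inversions \<sigma>"
  by (auto simp: inversions_def)

text \<open>Cocycle identity: the composite reverses a pair exactly when one, but not both, of
  \<open>\<tau>\<close> on the pair and \<open>\<sigma>\<close> on its image does so.\<close>

lemma inversions_comp:
  assumes "inj \<sigma>" "inj \<tau>"
  shows "inversions (\<sigma> \<circ> \<tau>) = sym_diff ((`) \<tau> -` inversions \<sigma>) (inversions \<tau>)" (is "?L = ?R")
proof -
  have two: "A \<in> ?L \<longleftrightarrow> A \<in> ?R" if A: "A = {i, j}" "i < j" for A i j
  proof -
    have ne: "\<tau> i \<noteq> \<tau> j" "\<sigma> (\<tau> i) \<noteq> \<sigma> (\<tau> j)"
      using A assms by (auto simp: inj_eq)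
    have "\<tau> ` A \<in> inversions \<sigma> \<longleftrightarrow> (\<sigma> (\<tau> j) < \<sigma> (\<tau> i)) = (\<tau> i < \<tau> j)"
    proof (cases "\<tau> i < \<tau> j")
      case True
      then show ?thesis
        using A doubleton_in_inversions[OF True, of \<sigma>] by simp
    next
      case False
      then have l: "\<tau> j < \<tau> i" using ne by simp
      have "\<tau> ` A = {\<tau> j, \<tau> i}" using A by auto
      then show ?thesis
        using False ne doubleton_in_inversions[OF l, of \<sigma>] by auto
    qed
    moreover have "A \<in> inversions \<tau> \<longleftrightarrow> \<not> \<tau> i < \<tau> j"
      using A ne doubleton_in_inversions[OF A(2), of \<tau>] by auto
    moreover have "A \<in> ?L \<longleftrightarrow> \<sigma> (\<tau> j) < \<sigma> (\<tau> i)"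
      using A doubleton_in_inversions[OF A(2), of "\<sigma> \<circ> \<tau>"] by (simp only: o_apply)
    ultimately show ?thesis by blast
  qed
  \<comment> \<open>Both sides consist of two-element sets; for the preimage this uses that
    \<open>\<tau>\<close> is injective.\<close>
  have shape: "\<exists>i j. A = {i, j} \<and> i < j" if "A \<in> ?L \<union> ?R" for A
  proof -
    have card: "card B = 2" if "B \<in> inversions \<pi>" for B \<pi>
      using that by (rule inversions_cases) simp
    have "card (\<tau> ` A) = card A" by (rule card_image[OF inj_on_subset[OF assms(2)]]) simp
    moreover have "card (\<tau> ` A) = 2 \<or> card A = 2"
      using that card[of A "\<sigma> \<circ> \<tau>"] card[of A \<tau>] card[of "\<tau> ` A" \<sigma>] by blast
    ultimately have "card A = 2" by linarith
    then obtain i j where ij: "A = {i, j}" "i \<noteq> j" unfolding card_2_iff by blast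
    show ?thesis
    proof (cases "i < j")
      case False
      then have "A = {j, i}" "j < i" using ij by auto
      then show ?thesis by blast
    qed (use ij in blast)
  qed
  show ?thesis
  proof (rule Set.set_eqI)
    fix A
    show "A \<in> ?L \<longleftrightarrow> A \<in> ?R"
    proof (cases "A \<in> ?L \<union> ?R")
      case True
      from shape[OF True] obtain i j where "A = {i, j}" "i < j" by (elim exE conjE)
      then show ?thesis by (rule two)
    next
      case False
      then show ?thesis by blast
    qed
  qed
qed

text \<open>Moving the place permutation of \<open>\<tau>\<close> past the twists of
  \<open>\<sigma>\<close> replaces their pairs by preimages under \<open>\<tau>\<close>, after which
  \<open>inversions_comp\<close> and \<open>twists_sym_diff\<close> merge the two products. This one
  identity stands in for a check of the braid relations.\<close>

lemma (in char_two) tact_comp: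
  fixes \<phi> :: "(nat \<Rightarrow> nat) \<Rightarrow> 'k"
  assumes s: "\<sigma> permutes {a..<b}" and t: "\<tau> permutes {a..<b}"
  shows "tact m (\<sigma> \<circ> \<tau>) \<phi> = tact m \<sigma> (tact m \<tau> \<phi>)"
proof -
  let ?B = "(`) \<tau> -` inversions \<sigma>"
  have bij: "bij \<tau>" "inj \<tau>" "inj \<sigma>" using s t by (auto intro: permutes_bij permutes_inj)
  have im: "(`) \<tau> ` ?B = inversions \<sigma>"
  proof -
    have "A \<in> (`) \<tau> ` ?B" if "A \<in> inversions \<sigma>" for A
    proof -
      have "\<tau> ` (inv_into UNIV \<tau> ` A) = A" using bij by (simp add: image_f_inv_f bij_is_surj)
      then show ?thesis using that by (metis image_eqI vimageI2)
    qed
    then show ?thesis by auto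
  qed
  have finB: "finite ?B"
    by (rule finite_vimageI[OF finite_inversions[OF s]]) (simp add: inj_on_image bij(2))
  have "{} \<notin> ?B" using empty_notin_inversions by (simp add: vimage_def)
  then have merge: "twists m (inversions (\<sigma> \<circ> \<tau>)) \<phi> = twists m ?B (twists m (inversions \<tau>) \<phi>)"
    unfolding inversions_comp[OF bij(3,2)]
    by (rule twists_sym_diff[OF finite_inversions[OF t] finB, symmetric])
  have "(\<lambda>w. twists m ?B \<psi> (w \<circ> \<tau>)) = twists m (inversions \<sigma>) (\<lambda>w. \<psi> (w \<circ> \<tau>))"
    for \<psi> :: "(nat \<Rightarrow> nat) \<Rightarrow> 'k"
    using twists_permute[OF bij(1) finB, of m \<psi>] by (simp only: im)
  note im_perm = this
  have "tact m (\<sigma> \<circ> \<tau>) \<phi> w = tact m \<sigma> (tact m \<tau> \<phi>) w" for w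
  proof -
    have "tact m (\<sigma> \<circ> \<tau>) \<phi> w = twists m ?B (twists m (inversions \<tau>) \<phi>) ((w \<circ> \<sigma>) \<circ> \<tau>)"
      by (simp only: tact_def comp_assoc merge)
    also have "\<dots> = twists m (inversions \<sigma>) (\<lambda>w. twists m (inversions \<tau>) \<phi> (w \<circ> \<tau>)) (w \<circ> \<sigma>)"
      by (rule fun_cong[OF im_perm])
    finally show ?thesis by (simp only: tact_def)
  qed
  then show ?thesis ..
qed

lemma tact_id [simp]: "tact m id \<phi> = \<phi>" "tact m (\<lambda>x. x) \<phi> = \<phi>"
proof -
  have "inversions id = {}" by (auto simp: inversions_def)
  then show *: "tact m id \<phi> = \<phi>" by (simp add: tact_def)
  then show "tact m (\<lambda>x. x) \<phi> = \<phi>" by (simp add: id_def)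
qed

section \<open>Locality of the action and its filtration by \<delta>-letters\<close>

text \<open>The letters in \<open>L\<close> span a direct summand of \<open>X\<close>: both letters
  of a copy of P belong to it or neither does.\<close>

definition closed_letters :: "nat \<Rightarrow> nat set \<Rightarrow> bool" where
  "closed_letters m L \<longleftrightarrow> (\<forall>l. is_delta m l \<longrightarrow> (l \<in> L \<longleftrightarrow> l - 1 \<in> L))"

text \<open>The degree for which the place permutation is the leading term of the action.\<close>

definition delta_count :: "nat \<Rightarrow> nat set \<Rightarrow> (nat \<Rightarrow> nat) \<Rightarrow> nat" where
  "delta_count m I w = card {i \<in> I. is_delta m (w i)}"

definition vanishes_below :: "nat \<Rightarrow> nat set \<Rightarrow> nat \<Rightarrow> ((nat \<Rightarrow> nat) \<Rightarrow> 'k::field) \<Rightarrow> bool" where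
  "vanishes_below m I r \<phi> \<longleftrightarrow> (\<forall>w. delta_count m I w < r \<longrightarrow> \<phi> w = 0)"

lemma is_delta_iff: "is_delta m l \<longleftrightarrow> (\<exists>k. l = m + 2 * k + 1)"
proof
  assume "is_delta m l"
  then have "odd (l - m)" "m \<le> l" by (simp_all add: is_delta_def)
  then obtain k where "l - m = 2 * k + 1" by (metis oddE)
  then show "\<exists>k. l = m + 2 * k + 1" using \<open>m \<le> l\<close> by (intro exI[of _ k]) simp
qed (auto simp: is_delta_def)

lemma closed_letters_lessThan: "closed_letters m {..<m + 2 * n}"
  unfolding closed_letters_def is_delta_iff by auto

lemma twists_mult:
  assumes "finite S" "\<And>A w. A \<in> S \<Longrightarrow> \<forall>i\<in>A. is_delta m (w i) \<Longrightarrow> \<chi> (lower A w) = \<chi> w"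
  shows "twists m S (\<lambda>w. \<chi> w * \<phi> w) = (\<lambda>w. \<chi> w * twists m S \<phi> w)"
  using assms
proof (induction S)
  case (insert A S)
  have "twists m S (\<lambda>w. \<chi> w * \<phi> w) = (\<lambda>w. \<chi> w * twists m S \<phi> w)"
    using insert by blast
  moreover have "\<chi> (lower A w) = \<chi> w" if "\<forall>i\<in>A. is_delta m (w i)" for w
    using insert.prems that by blast
  ultimately show ?case
    using insert.hyps by (auto simp: twists_insert twist_def delta_at_def algebra_simps fun_eq_iff)
qed simp

text \<open>A weight that neither \<open>\<sigma>\<close> nor a lowering in the block changes passes
  through the action. Constants give linearity, indicators of letter sets give restriction to a
  summand, and functions of other positions give outer tensor products.\<close>

lemma tact_mult:
  assumes "\<sigma> permutes {a..<b}" "\<And>w. \<chi> (w \<circ> \<sigma>) = \<chi> w"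
    "\<And>A w. A \<subseteq> {a..<b} \<Longrightarrow> \<forall>i\<in>A. is_delta m (w i) \<Longrightarrow> \<chi> (lower A w) = \<chi> w"
  shows "tact m \<sigma> (\<lambda>w. \<chi> w * \<phi> w) = (\<lambda>w. \<chi> w * tact m \<sigma> \<phi> w)"
proof -
  have "twists m (inversions \<sigma>) (\<lambda>w. \<chi> w * \<phi> w) = (\<lambda>w. \<chi> w * twists m (inversions \<sigma>) \<phi> w)"
    by (rule twists_mult[OF finite_inversions[OF assms(1)]])
      (use assms(3) inversions_subset[OF assms(1)] in blast)
  then show ?thesis by (simp only: tact_def assms(2))
qed

lemma twists_sum:
  assumes "finite S" "finite X"
  shows "twists m S (\<lambda>w. \<Sum>x\<in>X. f x w) = (\<lambda>w. \<Sum>x\<in>X. twists m S (f x) w)"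
  using assms(1)
proof (induction S)
  case (insert A S)
  have "delta_at m A (\<lambda>w. \<Sum>x\<in>X. twists m S (f x) w) = (\<lambda>w. \<Sum>x\<in>X. delta_at m A (twists m S (f x)) w)"
  proof
    fix w
    show "delta_at m A (\<lambda>w. \<Sum>x\<in>X. twists m S (f x) w) w = (\<Sum>x\<in>X. delta_at m A (twists m S (f x)) w)"
    proof (cases "\<forall>i\<in>A. is_delta m (w i)")
      case True
      then show ?thesis by (simp only: delta_at_def if_P)
    next
      case False
      then show ?thesis by (simp only: delta_at_def if_False sum.neutral_const)
    qed
  qed
  then show ?case
    using insert by (simp add: twists_insert twist_def sum.distrib)
qed simp

lemma tact_sum:
  assumes "\<sigma> permutes {a..<b}" "finite X"
  shows "tact m \<sigma> (\<lambda>w. \<Sum>x\<in>X. f x w) = (\<lambda>w. \<Sum>x\<in>X. tact m \<sigma> (f x) w)"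
  unfolding tact_def twists_sum[OF finite_inversions[OF assms(1)] assms(2)] ..

lemma tact_scale:
  assumes "\<sigma> permutes {a..<b}"
  shows "tact m \<sigma> (\<lambda>w. c * \<phi> w) = (\<lambda>w. c * tact m \<sigma> \<phi> w)"
  by (rule tact_mult[OF assms, where \<chi>="\<lambda>w. c"]) simp_all

lemma tact_zero:
  assumes "\<sigma> permutes {a..<b}"
  shows "tact m \<sigma> (\<lambda>w. 0) = (\<lambda>w. 0 :: 'k::field)"
  using tact_scale[OF assms, of m 0 "\<lambda>w. 0 :: 'k"] by simp

lemma tact_add:
  assumes "\<sigma> permutes {a..<b}"
  shows "tact m \<sigma> (\<lambda>w. \<phi> w + \<psi> w) = (\<lambda>w. tact m \<sigma> \<phi> w + tact m \<sigma> \<psi> w)"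
  using tact_sum[OF assms, of "{True, False}" m "\<lambda>x. if x then \<phi> else \<psi>"] by simp

lemma permutes_ball_comp:
  assumes "\<sigma> permutes I"
  shows "(\<forall>i\<in>I. P ((w \<circ> \<sigma>) i)) \<longleftrightarrow> (\<forall>i\<in>I. P (w i))"
proof -
  have "(\<forall>i\<in>I. P ((w \<circ> \<sigma>) i)) \<longleftrightarrow> (\<forall>i\<in>\<sigma> ` I. P (w i))" by simp
  then show ?thesis using permutes_image[OF assms] by simp
qed

lemma closed_letters_lower:
  assumes "closed_letters m L" "\<forall>i\<in>A. is_delta m (w i)"
  shows "lower A w i \<in> L \<longleftrightarrow> w i \<in> L"
  using assms by (auto simp: closed_letters_def lower_def)

lemma tact_restrict:
  fixes \<phi> :: "(nat \<Rightarrow> nat) \<Rightarrow> 'k::field"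
  assumes "\<sigma> permutes {a..<b}" "closed_letters m L" "\<forall>i\<in>{a..<b}. w i \<in> L"
  shows "tact m \<sigma> (\<lambda>w. if \<forall>i\<in>{a..<b}. w i \<in> L then \<phi> w else 0) w = tact m \<sigma> \<phi> w"
proof -
  let ?\<chi> = "\<lambda>w. if \<forall>i\<in>{a..<b}. w i \<in> L then 1 else (0 :: 'k)"
  have "tact m \<sigma> (\<lambda>w. ?\<chi> w * \<phi> w) = (\<lambda>w. ?\<chi> w * tact m \<sigma> \<phi> w)"
  proof (rule tact_mult[OF assms(1)])
    fix w show "?\<chi> (w \<circ> \<sigma>) = ?\<chi> w"
      by (simp only: permutes_ball_comp[OF assms(1), where P="\<lambda>x. x \<in> L"])
  next
    fix A :: "nat set" and w assume "\<forall>i\<in>A. is_delta m (w i)"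
    then show "?\<chi> (lower A w) = ?\<chi> w"
      by (simp only: closed_letters_lower[OF assms(2)])
  qed
  moreover have "(\<lambda>w. ?\<chi> w * \<phi> w) = (\<lambda>w. if \<forall>i\<in>{a..<b}. w i \<in> L then \<phi> w else 0)"
    by (auto simp: fun_eq_iff)
  ultimately have "tact m \<sigma> (\<lambda>w. if \<forall>i\<in>{a..<b}. w i \<in> L then \<phi> w else 0)
      = (\<lambda>w. ?\<chi> w * tact m \<sigma> \<phi> w)" by (simp only:)
  then show ?thesis using assms(3) by (simp only: if_P mult_1)
qed

text \<open>Neither \<open>\<sigma>\<close> nor a lowering leaves the words over a closed letter
  set, so a tensor known only on these words can still be acted on.\<close>

lemma tact_local:
  fixes \<phi> :: "(nat \<Rightarrow> nat) \<Rightarrow> 'k::field"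
  assumes "\<sigma> permutes {a..<b}" "closed_letters m L" "\<forall>i\<in>{a..<b}. w i \<in> L"
    "\<And>v. \<forall>i\<in>{a..<b}. v i \<in> L \<Longrightarrow> \<phi> v = \<psi> v"
  shows "tact m \<sigma> \<phi> w = tact m \<sigma> \<psi> w"
proof -
  have "(\<lambda>w. if \<forall>i\<in>{a..<b}. w i \<in> L then \<phi> w else 0) = (\<lambda>w. if \<forall>i\<in>{a..<b}. w i \<in> L then \<psi> w else 0)"
    using assms(4) by (auto simp: fun_eq_iff)
  then show ?thesis
    using tact_restrict[OF assms(1-3), of \<phi>] tact_restrict[OF assms(1-3), of \<psi>] by (simp only:)
qed

lemma twists_override:
  assumes "finite S" "\<And>A. A \<in> S \<Longrightarrow> A \<subseteq> I"
  shows "twists m S (\<lambda>v. \<phi> (override_on w v I)) = (\<lambda>v. twists m S \<phi> (override_on w v I))"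
  using assms
proof (induction S)
  case (insert A S)
  have A: "A \<subseteq> I" using insert.prems by blast
  have "override_on w (lower A v) I = lower A (override_on w v I)" for v
    using A by (auto simp: override_on_def lower_def fun_eq_iff)
  moreover have "(\<forall>i\<in>A. is_delta m (override_on w v I i)) \<longleftrightarrow> (\<forall>i\<in>A. is_delta m (v i))" for v
    using A by (auto simp: override_on_def subset_iff)
  moreover have "twists m S (\<lambda>v. \<phi> (override_on w v I)) = (\<lambda>v. twists m S \<phi> (override_on w v I))"
    using insert by blast
  ultimately show ?case
    by (simp only: twists_insert[OF insert.hyps] twist_def delta_at_def)
qed simp

text \<open>Positions outside the block are frozen parameters, filled in from
  \<open>w\<close>.\<close>

lemma tact_override:
  assumes "\<sigma> permutes {a..<b}"
  shows "tact m \<sigma> (\<lambda>v. \<phi> (override_on w v {a..<b})) v = tact m \<sigma> \<phi> (override_on w v {a..<b})"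
proof -
  have "override_on w (v \<circ> \<sigma>) {a..<b} = override_on w v {a..<b} \<circ> \<sigma>"
    using permutes_in_image[OF assms] permutes_not_in[OF assms]
    by (auto simp: override_on_def fun_eq_iff)
  moreover have "twists m (inversions \<sigma>) (\<lambda>v. \<phi> (override_on w v {a..<b}))
      = (\<lambda>v. twists m (inversions \<sigma>) \<phi> (override_on w v {a..<b}))"
    by (rule twists_override[OF finite_inversions[OF assms]])
      (use inversions_subset[OF assms] in blast)
  ultimately show ?thesis unfolding tact_def by metis
qed

lemma delta_count_comp:
  assumes "\<sigma> permutes I" shows "delta_count m I (w \<circ> \<sigma>) = delta_count m I w"
proof -
  have "\<sigma> ` {i \<in> I. is_delta m ((w \<circ> \<sigma>) i)} = {i \<in> I. is_delta m (w i)}"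
  proof (intro equalityI subsetI)
    fix j assume "j \<in> {i \<in> I. is_delta m (w i)}"
    then have "inv_into UNIV \<sigma> j \<in> I" "\<sigma> (inv_into UNIV \<sigma> j) = j" "is_delta m (w j)"
      using permutes_inverses(1)[OF assms] permutes_in_image[OF permutes_inv[OF assms]] by auto
    then show "j \<in> \<sigma> ` {i \<in> I. is_delta m ((w \<circ> \<sigma>) i)}" by (auto intro!: image_eqI[of j \<sigma>])
  qed (use permutes_in_image[OF assms] in auto)
  then show ?thesis
    unfolding delta_count_def using card_image[OF inj_on_subset[OF permutes_inj[OF assms]]]
    by (metis subset_UNIV)
qed

lemma delta_count_lower:
  assumes "finite I" "A \<subseteq> I" "\<forall>i\<in>A. is_delta m (w i)"
  shows "delta_count m I w = delta_count m I (lower A w) + card A"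
proof -
  have "{i \<in> I. is_delta m (w i)} = {i \<in> I. is_delta m (lower A w i)} \<union> A"
    using assms(2,3) by (auto simp: lower_def)
  moreover have "{i \<in> I. is_delta m (lower A w i)} \<inter> A = {}"
    using assms(3) is_delta_pred by (auto simp: lower_def)
  ultimately show ?thesis
    using assms finite_subset[OF assms(2,1)] by (simp add: delta_count_def card_Un_disjoint)
qed

lemma delta_at_eq_0:
  assumes "finite I" "A \<subseteq> I" "vanishes_below m I r \<phi>" "delta_count m I w < r + card A"
  shows "delta_at m A \<phi> w = 0"
proof (cases "\<forall>i\<in>A. is_delta m (w i)")
  case True
  then have "delta_count m I (lower A w) < r" using delta_count_lower[OF assms(1,2)] assms(4) by simp
  then show ?thesis using assms(3) by (simp add: delta_at_def vanishes_below_def)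
qed (simp only: delta_at_def if_False)

text \<open>A correction reads the tensor at a word with two \<delta>-letters fewer, where it still
  vanishes.\<close>

lemma twists_leading:
  assumes "finite I" "finite S" "\<And>A. A \<in> S \<Longrightarrow> A \<subseteq> I \<and> card A = 2"
    and "vanishes_below m I r \<phi>" "delta_count m I w < r + 2"
  shows "twists m S \<phi> w = \<phi> w"
  using assms(2,3,5)
proof (induction S arbitrary: w)
  case (insert A S)
  have A: "A \<subseteq> I" "card A = 2" using insert.prems by auto
  have IH: "twists m S \<phi> v = \<phi> v" if "delta_count m I v < r + 2" for v
    using insert.IH insert.prems(1) that by blast
  have "vanishes_below m I r (twists m S \<phi>)"
    using IH assms(4) by (auto simp: vanishes_below_def)
  then have "delta_at m A (twists m S \<phi>) w = 0"
    using delta_at_eq_0[OF assms(1) A(1)] A(2) insert.prems(2) by simp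
  then show ?case using IH[OF insert.prems(2)] insert.hyps by (simp add: twists_insert twist_def)
qed simp

text \<open>When the product of the factors \<open>1 + D\<close> is expanded, a product of two
  corrections would lower four letters and vanishes in this range; only the linear part
  remains.\<close>

lemma twists_second:
  assumes "finite I" "finite S" "\<And>A. A \<in> S \<Longrightarrow> A \<subseteq> I \<and> card A = 2"
    and "vanishes_below m I r \<phi>" "delta_count m I w < r + 4"
  shows "twists m S \<phi> w = \<phi> w + (\<Sum>A\<in>S. delta_at m A \<phi> w)"
  using assms(2,3,5)
proof (induction S arbitrary: w)
  case (insert A S)
  have A: "A \<subseteq> I" "card A = 2" using insert.prems by auto
  have "delta_at m A (twists m S \<phi>) w = delta_at m A \<phi> w"
  proof (cases "\<forall>i\<in>A. is_delta m (w i)")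
    case True
    then have "delta_count m I (lower A w) < r + 2"
      using delta_count_lower[OF assms(1) A(1)] A(2) insert.prems(2) by fastforce
    then have "twists m S \<phi> (lower A w) = \<phi> (lower A w)"
      using twists_leading[OF assms(1) insert.hyps(1) _ assms(4)] insert.prems(1) by blast
    then show ?thesis by (simp only: delta_at_def)
  qed (simp only: delta_at_def if_False)
  then show ?case using insert by (simp add: twists_insert twist_def algebra_simps)
qed simp

lemma inversions_card:
  assumes "\<sigma> permutes {a..<b}" "A \<in> inversions \<sigma>"
  shows "A \<subseteq> {a..<b} \<and> card A = 2"
  using inversions_subset[OF assms(1)] assms(2) by (metis Pow_iff card_2_iff inversions_cases less_irrefl subsetD)

lemma tact_leading:
  assumes "\<sigma> permutes {a..<b}" "vanishes_below m {a..<b} r \<phi>" "delta_count m {a..<b} w < r + 2"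
  shows "tact m \<sigma> \<phi> w = \<phi> (w \<circ> \<sigma>)"
  unfolding tact_def
  by (rule twists_leading[OF finite_atLeastLessThan finite_inversions inversions_card])
    (use assms delta_count_comp[OF assms(1)] in auto)

lemma tact_second:
  assumes "\<sigma> permutes {a..<b}" "vanishes_below m {a..<b} r \<phi>" "delta_count m {a..<b} w < r + 4"
  shows "tact m \<sigma> \<phi> w = \<phi> (w \<circ> \<sigma>) + (\<Sum>A\<in>inversions \<sigma>. delta_at m A \<phi> (w \<circ> \<sigma>))"
  unfolding tact_def
  by (rule twists_second[OF finite_atLeastLessThan finite_inversions inversions_card])
    (use assms delta_count_comp[OF assms(1)] in auto)

section \<open>The kernel of the action\<close>

text \<open>\<open>f\<close> acts by zero on the tensor power, over the positions
  \<open>a..<b\<close>, of the summand spanned by \<open>L\<close>. Only the word is restricted to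
  \<open>L\<close> while all tensors are allowed; by \<open>tact_local\<close> this is the same for
  closed \<open>L\<close>.\<close>

definition kills :: "nat \<Rightarrow> nat \<Rightarrow> nat \<Rightarrow> nat set \<Rightarrow> ((nat \<Rightarrow> nat) \<Rightarrow> 'k::field) \<Rightarrow> bool" where
  "kills m a b L f \<longleftrightarrow>
     (\<forall>\<phi> w. (\<forall>i\<in>{a..<b}. w i \<in> L) \<longrightarrow> (\<Sum>\<sigma> | \<sigma> permutes {a..<b}. f \<sigma> * tact m \<sigma> \<phi> w) = 0)"

lemma killsD:
  "kills m a b L f \<Longrightarrow> \<forall>i\<in>{a..<b}. w i \<in> L \<Longrightarrow>
    (\<Sum>\<sigma> | \<sigma> permutes {a..<b}. f \<sigma> * tact m \<sigma> \<phi> w) = 0"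
  by (simp add: kills_def)

lemma kills_add: "kills m a b L f \<Longrightarrow> kills m a b L g \<Longrightarrow> kills m a b L (\<lambda>\<sigma>. f \<sigma> + g \<sigma>)"
  by (simp add: kills_def distrib_right sum.distrib)

lemma kills_sum: "(\<And>x. x \<in> X \<Longrightarrow> kills m a b L (f x)) \<Longrightarrow> kills m a b L (\<lambda>\<sigma>. \<Sum>x\<in>X. f x \<sigma>)"
  by (induction X rule: infinite_finite_induct) (simp_all add: kills_add, simp_all add: kills_def)

context char_two
begin

text \<open>The kernel is a two-sided ideal: the new function is \<open>f\<close> times the inverse
  of \<open>\<tau>\<close>.\<close>

lemma kills_right:
  fixes f :: "(nat \<Rightarrow> nat) \<Rightarrow> 'k"
  assumes "kills m a b L f" "\<tau> permutes {a..<b}"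
  shows "kills m a b L (\<lambda>\<sigma>. f (\<sigma> \<circ> \<tau>))"
  unfolding kills_def
proof (intro allI impI)
  fix \<phi> :: "(nat \<Rightarrow> nat) \<Rightarrow> 'k" and w assume w: "\<forall>i\<in>{a..<b}. w i \<in> L"
  let ?\<tau>' = "inv_into UNIV \<tau>"
  have \<tau>': "?\<tau>' permutes {a..<b}" using assms(2) by (rule permutes_inv)
  have "(\<Sum>\<sigma> | \<sigma> permutes {a..<b}. f (\<sigma> \<circ> \<tau>) * tact m \<sigma> \<phi> w)
      = (\<Sum>\<sigma> | \<sigma> permutes {a..<b}. f ((\<sigma> \<circ> ?\<tau>') \<circ> \<tau>) * tact m (\<sigma> \<circ> ?\<tau>') \<phi> w)"
    by (rule sum_permutations_compose_right[OF \<tau>'])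
  also have "\<dots> = (\<Sum>\<sigma> | \<sigma> permutes {a..<b}. f \<sigma> * tact m \<sigma> (tact m ?\<tau>' \<phi>) w)"
    using permutes_inv_o(2)[OF assms(2)]
    by (intro sum.cong refl) (simp add: comp_assoc tact_comp[OF _ \<tau>'])
  also have "\<dots> = 0" by (rule killsD[OF assms(1) w])
  finally show "(\<Sum>\<sigma> | \<sigma> permutes {a..<b}. f (\<sigma> \<circ> \<tau>) * tact m \<sigma> \<phi> w) = 0" .
qed

text \<open>Here \<open>L\<close> has to be closed, since the sum that is acted on is known to
  vanish only at words over \<open>L\<close>.\<close>

lemma kills_left:
  fixes f :: "(nat \<Rightarrow> nat) \<Rightarrow> 'k"
  assumes "kills m a b L f" "\<tau> permutes {a..<b}" "closed_letters m L"
  shows "kills m a b L (\<lambda>\<sigma>. f (\<tau> \<circ> \<sigma>))"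
  unfolding kills_def
proof (intro allI impI)
  fix \<phi> :: "(nat \<Rightarrow> nat) \<Rightarrow> 'k" and w assume w: "\<forall>i\<in>{a..<b}. w i \<in> L"
  let ?\<tau>' = "inv_into UNIV \<tau>" and ?S = "{\<sigma>. \<sigma> permutes {a..<b}}"
  have \<tau>': "?\<tau>' permutes {a..<b}" using assms(2) by (rule permutes_inv)
  have fin: "finite ?S" by (simp add: finite_permutations)
  have "(\<Sum>\<sigma>\<in>?S. f (\<tau> \<circ> \<sigma>) * tact m \<sigma> \<phi> w)
      = (\<Sum>\<sigma>\<in>?S. f (\<tau> \<circ> (?\<tau>' \<circ> \<sigma>)) * tact m (?\<tau>' \<circ> \<sigma>) \<phi> w)"
    by (rule setum_permutations_compose_left[OF \<tau>'])
  also have "\<dots> = (\<Sum>\<sigma>\<in>?S. f \<sigma> * tact m ?\<tau>' (tact m \<sigma> \<phi>) w)"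
    using permutes_inv_o(1)[OF assms(2)]
    by (intro sum.cong refl) (simp add: comp_assoc[symmetric] tact_comp[OF \<tau>'])
  also have "\<dots> = tact m ?\<tau>' (\<lambda>v. \<Sum>\<sigma>\<in>?S. f \<sigma> * tact m \<sigma> \<phi> v) w"
    by (simp add: tact_sum[OF \<tau>' fin] tact_scale[OF \<tau>'])
  also have "\<dots> = tact m ?\<tau>' (\<lambda>v. 0) w"
    by (rule tact_local[OF \<tau>' assms(3) w]) (rule killsD[OF assms(1)])
  also have "\<dots> = 0" by (simp add: tact_zero[OF \<tau>'])
  finally show "(\<Sum>\<sigma>\<in>?S. f (\<tau> \<circ> \<sigma>) * tact m \<sigma> \<phi> w) = 0" .
qed

text \<open>Words whose letters lie in \<open>L1\<close> on one block and in \<open>L2\<close> on the next only see the Young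
  subgroup of the two blocks, and there the action is the outer tensor product.\<close>

lemma kills_block:
  fixes f :: "(nat \<Rightarrow> nat) \<Rightarrow> 'k"
  assumes f: "kills m a b L f" and ab: "a \<le> c" "c \<le> b"
    and L: "L1 \<subseteq> L" "L2 \<subseteq> L" "L1 \<inter> L2 = {}" "closed_letters m L1" "closed_letters m L2"
    and w1: "\<forall>i\<in>{a..<c}. w1 i \<in> L1"
  shows "kills m c b L2 (\<lambda>\<tau>. \<Sum>\<sigma> | \<sigma> permutes {a..<c}. f (\<sigma> \<circ> \<tau>) * tact m \<sigma> \<phi>1 w1)"
  unfolding kills_def
proof (intro allI impI)
  fix \<phi>2 :: "(nat \<Rightarrow> nat) \<Rightarrow> 'k" and w2 assume w2: "\<forall>i\<in>{c..<b}. w2 i \<in> L2"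
  let ?I = "{a..<c}" and ?J = "{c..<b}" and ?S = "{\<pi>. \<pi> permutes {a..<b}}"
  let ?split = "\<lambda>v. (\<forall>i\<in>?I. v i \<in> L1) \<and> (\<forall>i\<in>?J. v i \<in> L2)"
  \<comment> \<open>\<open>\<chi>\<close> is the indicator of the words split as \<open>L1\<close>
    on the first block and \<open>L2\<close> on the second; \<open>\<Phi>\<close> is the outer
    product of the two tensors, cut off by it.\<close>
  define \<chi> where "\<chi> v = (if ?split v then 1 else 0 :: 'k)" for v
  let ?oI = "\<lambda>v. override_on w1 v ?I" and ?oJ = "\<lambda>v. override_on w2 v ?J"
  define \<Phi> where "\<Phi> v = \<chi> v * \<phi>1 (?oI v) * \<phi>2 (?oJ v)" for v
  define w where "w = override_on w2 w1 ?I"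
  have oI: "?oI w = w1" and oJ: "?oJ w = w2"
    by (auto simp: w_def override_on_def fun_eq_iff)
  have \<chi>w: "\<chi> w = 1" using w1 w2 by (simp add: \<chi>_def w_def override_on_def)
  have wL: "\<forall>i\<in>{a..<b}. w i \<in> L" using w1 w2 L(1,2) by (auto simp: w_def override_on_def)
  have \<chi>_lower: "\<chi> (lower A v) = \<chi> v" if "\<forall>i\<in>A. is_delta m (v i)" for A v
    by (simp only: \<chi>_def closed_letters_lower[OF L(4) that] closed_letters_lower[OF L(5) that])
  have sI: "\<sigma> permutes {a..<b}" if "\<sigma> permutes ?I" for \<sigma>
    using permutes_subset[OF that] ab by auto
  have sJ: "\<tau> permutes {a..<b}" if "\<tau> permutes ?J" for \<tau>
    using permutes_subset[OF that] ab by auto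
  have \<chi>I: "\<chi> (v \<circ> \<sigma>) = \<chi> v" if s: "\<sigma> permutes ?I" for v \<sigma>
  proof -
    have "(\<forall>i\<in>?J. (v \<circ> \<sigma>) i \<in> L2) \<longleftrightarrow> (\<forall>i\<in>?J. v i \<in> L2)"
      using permutes_not_in[OF s] by simp
    then show ?thesis by (simp only: \<chi>_def permutes_ball_comp[OF s, where P="\<lambda>x. x \<in> L1"])
  qed
  have \<chi>J: "\<chi> (v \<circ> \<tau>) = \<chi> v" if t: "\<tau> permutes ?J" for v \<tau>
  proof -
    have "(\<forall>i\<in>?I. (v \<circ> \<tau>) i \<in> L1) \<longleftrightarrow> (\<forall>i\<in>?I. v i \<in> L1)"
      using permutes_not_in[OF t] by simp
    then show ?thesis by (simp only: \<chi>_def permutes_ball_comp[OF t, where P="\<lambda>x. x \<in> L2"])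
  qed
  have oI_inv: "?oI (v \<circ> \<tau>) = ?oI v" if "\<tau> permutes ?J" for v \<tau>
    using permutes_not_in[OF that] by (auto simp: override_on_def fun_eq_iff)
  have oJ_inv: "?oJ (v \<circ> \<sigma>) = ?oJ v" if "\<sigma> permutes ?I" for v \<sigma>
    using permutes_not_in[OF that] by (auto simp: override_on_def fun_eq_iff)
  have oI_lower: "?oI (lower A v) = ?oI v" if "A \<subseteq> ?J" for A v
    using that by (auto simp: override_on_def lower_def fun_eq_iff)
  have oJ_lower: "?oJ (lower A v) = ?oJ v" if "A \<subseteq> ?I" for A v
    using that by (auto simp: override_on_def lower_def fun_eq_iff)
  have prod: "tact m (\<sigma> \<circ> \<tau>) \<Phi> w = tact m \<sigma> \<phi>1 w1 * tact m \<tau> \<phi>2 w2"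
    if s: "\<sigma> permutes ?I" and t: "\<tau> permutes ?J" for \<sigma> \<tau>
  proof -
    have "tact m \<tau> \<Phi> = (\<lambda>v. (\<chi> v * \<phi>1 (?oI v)) * tact m \<tau> (\<lambda>v. \<phi>2 (?oJ v)) v)"
      unfolding \<Phi>_def
      by (rule tact_mult[OF t]) (simp_all only: \<chi>J[OF t] oI_inv[OF t] \<chi>_lower oI_lower)
    also have "\<dots> = (\<lambda>v. (\<chi> v * tact m \<tau> \<phi>2 (?oJ v)) * \<phi>1 (?oI v))"
      by (simp only: tact_override[OF t] mult_ac)
    finally have 1: "tact m \<tau> \<Phi> = (\<lambda>v. (\<chi> v * tact m \<tau> \<phi>2 (?oJ v)) * \<phi>1 (?oI v))" .
    have "tact m \<sigma> (tact m \<tau> \<Phi>) = (\<lambda>v. (\<chi> v * tact m \<tau> \<phi>2 (?oJ v)) * tact m \<sigma> (\<lambda>v. \<phi>1 (?oI v)) v)"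
      unfolding 1
      by (rule tact_mult[OF s]) (simp_all only: \<chi>I[OF s] oJ_inv[OF s] \<chi>_lower oJ_lower)
    then show ?thesis
      by (simp only: tact_comp[OF sI[OF s] sJ[OF t]] tact_override[OF s] oI oJ \<chi>w mult_1 mult_ac)
  qed
  \<comment> \<open>If a position of the first block leaves it, the permuted word is no longer
    split, and \<open>\<chi>\<close> passes through all twists because lowering preserves both
    letter sets.\<close>
  have off: "tact m \<pi> \<Phi> w = 0" if p: "\<pi> permutes {a..<b}" and ns: "\<not> \<pi> ` ?I \<subseteq> ?I" for \<pi>
  proof -
    obtain i where i: "i \<in> ?I" "\<pi> i \<notin> ?I" using ns by blast
    then have "\<pi> i \<in> ?J" using permutes_in_image[OF p, of i] ab by auto
    then have "w (\<pi> i) \<in> L2" using w2 by (auto simp: w_def override_on_def)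
    then have "\<not> ?split (w \<circ> \<pi>)" using i L(3) by auto
    moreover have "twists m (inversions \<pi>) \<Phi> = (\<lambda>v. \<chi> v * twists m (inversions \<pi>) (\<lambda>v. \<phi>1 (?oI v) * \<phi>2 (?oJ v)) v)"
      unfolding \<Phi>_def mult.assoc by (rule twists_mult[OF finite_inversions[OF p]]) (rule \<chi>_lower)
    ultimately show ?thesis by (simp only: tact_def \<chi>_def if_False mult_zero_left)
  qed
  have "(\<Sum>\<pi>\<in>?S. f \<pi> * tact m \<pi> \<Phi> w) = (\<Sum>\<pi> | \<pi> permutes {a..<b} \<and> \<pi> ` ?I \<subseteq> ?I. f \<pi> * tact m \<pi> \<Phi> w)"
    by (rule sum.mono_neutral_right) (use off finite_permutations in auto)
  also have "\<dots> = (\<Sum>(\<tau>, \<sigma>)\<in>{\<tau>. \<tau> permutes ?J} \<times> {\<sigma>. \<sigma> permutes ?I}.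
      f (\<sigma> \<circ> \<tau>) * (tact m \<sigma> \<phi>1 w1 * tact m \<tau> \<phi>2 w2))"
  proof (rule sum.reindex_bij_witness)
    let ?i = "\<lambda>(\<tau>, \<sigma>). \<sigma> \<circ> (\<tau> :: nat \<Rightarrow> nat)"
      and ?j = "\<lambda>\<pi> :: nat \<Rightarrow> nat. (\<lambda>x. if x \<in> ?J then \<pi> x else x, \<lambda>x. if x \<in> ?I then \<pi> x else x)"
    {
      fix \<pi> assume "\<pi> \<in> {\<pi>. \<pi> permutes {a..<b} \<and> \<pi> ` ?I \<subseteq> ?I}"
      then have p: "\<pi> permutes {a..<b}" and sub: "\<pi> ` ?I \<subseteq> ?I" by auto
      have inj: "inj \<pi>" by (rule permutes_inj[OF p])
      have eqI: "\<pi> ` ?I = ?I" by (rule endo_inj_surj[OF _ sub]) (use inj in \<open>auto intro: inj_on_subset\<close>)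
      have memI: "\<pi> x \<in> ?I \<longleftrightarrow> x \<in> ?I" for x using eqI inj by (metis inj_image_mem_iff)
      have memJ: "\<pi> x \<in> ?J \<longleftrightarrow> x \<in> ?J" for x
        using memI[of x] permutes_in_image[OF p, of x] ab by auto
      have eqJ: "\<pi> ` ?J = ?J"
      proof (rule endo_inj_surj)
        show "\<pi> ` ?J \<subseteq> ?J" using memJ by blast
        show "inj_on \<pi> ?J" using inj by (rule inj_on_subset) simp
      qed simp
      have restr: "(\<lambda>x. if x \<in> S then \<pi> x else x) permutes S" if "\<pi> ` S = S" for S
      proof (rule bij_imp_permutes)
        have "bij_betw \<pi> S S" using that inj by (auto simp: bij_betw_def intro: inj_on_subset)
        then show "bij_betw (\<lambda>x. if x \<in> S then \<pi> x else x) S S"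
          by (rule bij_betw_cong[THEN iffD1, rotated]) simp
      qed simp
      note pJ = restr[OF eqJ] and pI = restr[OF eqI]
      show "?i (?j \<pi>) = \<pi>"
      proof
        fix x
        show "?i (?j \<pi>) x = \<pi> x"
          using memI[of x] memJ[of x] permutes_not_in[OF p, of x] ab
          by (cases "x \<in> ?I"; cases "x \<in> ?J") auto
      qed
      show "?j \<pi> \<in> {\<tau>. \<tau> permutes ?J} \<times> {\<sigma>. \<sigma> permutes ?I}" using pI pJ by simp
      show "(case ?j \<pi> of (\<tau>, \<sigma>) \<Rightarrow> f (\<sigma> \<circ> \<tau>) * (tact m \<sigma> \<phi>1 w1 * tact m \<tau> \<phi>2 w2)) = f \<pi> * tact m \<pi> \<Phi> w"
        using prod[OF pI pJ] \<open>?i (?j \<pi>) = \<pi>\<close> by simp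
    next
      fix x assume "x \<in> {\<tau>. \<tau> permutes ?J} \<times> {\<sigma>. \<sigma> permutes ?I}"
      then obtain \<tau> \<sigma> where x: "x = (\<tau>, \<sigma>)" and t: "\<tau> permutes ?J" and s: "\<sigma> permutes ?I" by auto
      show "?i x \<in> {\<pi>. \<pi> permutes {a..<b} \<and> \<pi> ` ?I \<subseteq> ?I}"
        using permutes_compose[OF sJ[OF t] sI[OF s]] permutes_not_in[OF t] permutes_in_image[OF s]
        by (auto simp: x)
      show "?j (?i x) = x"
      proof -
        have "(if y \<in> ?J then \<sigma> (\<tau> y) else y) = \<tau> y" for y
          using permutes_not_in[OF t, of y] permutes_in_image[OF t, of y] permutes_not_in[OF s, of "\<tau> y"]
          by auto
        moreover have "(if y \<in> ?I then \<sigma> (\<tau> y) else y) = \<sigma> y" for y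
          using permutes_not_in[OF t, of y] permutes_not_in[OF s, of y] by auto
        ultimately show ?thesis unfolding x prod.case o_apply by (simp only:)
      qed
    }
  qed
  also have "\<dots> = (\<Sum>\<tau> | \<tau> permutes ?J. (\<Sum>\<sigma> | \<sigma> permutes ?I. f (\<sigma> \<circ> \<tau>) * tact m \<sigma> \<phi>1 w1) * tact m \<tau> \<phi>2 w2)"
    by (simp add: sum.cartesian_product[symmetric] sum_distrib_right mult.assoc)
  finally show "(\<Sum>\<tau> | \<tau> permutes ?J. (\<Sum>\<sigma> | \<sigma> permutes ?I. f (\<sigma> \<circ> \<tau>) * tact m \<sigma> \<phi>1 w1) * tact m \<tau> \<phi>2 w2) = 0"
    using killsD[OF f wL] by simp
qed

end

section \<open>The 3-cycle relation on four positions\<close>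

definition cyc :: "nat \<Rightarrow> nat \<Rightarrow> nat" where
  "cyc p = transpose p (p + 1) \<circ> transpose (p + 1) (p + 2)"

lemma cyc_apply:
  "cyc p p = p + 1" "cyc p (p + 1) = p + 2" "cyc p (p + 2) = p"
  "i \<noteq> p \<Longrightarrow> i \<noteq> p + 1 \<Longrightarrow> i \<noteq> p + 2 \<Longrightarrow> cyc p i = i"
  by (simp_all add: cyc_def transpose_def)

lemma cyc_permutes: "a \<le> p \<Longrightarrow> p + 2 < b \<Longrightarrow> cyc p permutes {a..<b}"
  unfolding cyc_def by (intro permutes_compose permutes_swap_id) auto

lemma cyc_cube: "cyc p \<circ> cyc p \<circ> cyc p = id"
  by (auto simp: cyc_def transpose_def fun_eq_iff)

context char_two
begin

text \<open>Six permutations have \<open>\<sigma> k = a\<close>, and half of them satisfy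
  \<open>\<sigma> j < \<sigma> i\<close>. Exchanging the values \<open>a + 1\<close> and
  \<open>a + 2\<close> pairs the two with \<open>\<sigma> i = a + 3\<close> and leaves
  \<open>\<pi>\<close> over, so the count is odd.\<close>

lemma norm_indicator_sum:
  fixes a i j k :: nat
  assumes ijk: "i < j" "{i, j, k} = {a, a + 1, a + 2}" "k \<noteq> i" "k \<noteq> j"
    and s0: "\<pi> permutes {a..<a+4}" "\<pi> i = a + 2" "\<pi> j = a + 1" "\<pi> k = a"
  shows "(\<Sum>\<sigma> | \<sigma> permutes {a..<a+4}. if \<sigma> k = a \<and> \<sigma> j < \<sigma> i then 1 else 0) = (1 :: 'k)"
proof -
  let ?S = "{\<sigma>. \<sigma> permutes {a..<a+4}}" and ?E = "\<lambda>\<sigma> :: nat \<Rightarrow> nat. \<sigma> k = a \<and> \<sigma> j < \<sigma> i"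
  let ?t = "transpose (a + 1) (a + 2)"
  have fin: "finite ?S" by (simp add: finite_permutations)
  have t: "?t permutes {a..<a+4}" by (rule permutes_swap_id) auto
  have mem: "i \<in> {a..<a+4}" "j \<in> {a..<a+4}" "k \<in> {a..<a+4}" "i \<noteq> a + 3" "j \<noteq> a + 3" "k \<noteq> a + 3"
  proof -
    have *: "l \<in> {a..<a+4} \<and> l \<noteq> a + 3" if "l \<in> {i, j, k}" for l
      using that unfolding ijk(2) by auto
    show "i \<in> {a..<a+4}" "i \<noteq> a + 3" using *[of i] by blast+
    show "j \<in> {a..<a+4}" "j \<noteq> a + 3" using *[of j] by blast+
    show "k \<in> {a..<a+4}" "k \<noteq> a + 3" using *[of k] by blast+
  qed
  have "{a..<a+4} = insert (a + 3) {a, a + 1, a + 2}" by auto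
  then have block: "{a..<a+4} = {i, j, k, a + 3}" unfolding ijk(2)[symmetric] by blast
  have uniq: "\<sigma> = \<pi>" if s: "\<sigma> permutes {a..<a+4}" and "\<sigma> k = a" "\<sigma> j = a + 1" "\<sigma> i = a + 2" for \<sigma>
  proof -
    have last: "\<rho> (a + 3) = a + 3" if p: "\<rho> permutes {a..<a+4}" "\<rho> k = a" "\<rho> j = a + 1" "\<rho> i = a + 2" for \<rho>
    proof -
      have "\<rho> (a + 3) \<in> {a..<a+4}" using permutes_in_image[OF p(1), of "a + 3"] by simp
      moreover have "\<rho> (a + 3) \<noteq> \<rho> k" "\<rho> (a + 3) \<noteq> \<rho> j" "\<rho> (a + 3) \<noteq> \<rho> i"
        using mem permutes_inj[OF p(1)] by (auto simp: inj_eq)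
      ultimately show ?thesis using p(2-4) by auto
    qed
    show ?thesis
    proof
      fix x
      show "\<sigma> x = \<pi> x"
        using block last[OF that] last[OF s0(1,4,3,2)] that(2-4) s0(2-4)
          permutes_not_in[OF s, of x] permutes_not_in[OF s0(1), of x]
        by (cases "x \<in> {a..<a+4}") auto
    qed
  qed
  have "(\<Sum>\<sigma>\<in>?S. if ?E \<sigma> then 1 else 0) = (\<Sum>\<sigma>\<in>{\<sigma>\<in>?S. ?E \<sigma>}. 1 :: 'k)"
    by (rule sum.inter_filter[OF fin, symmetric])
  also have "\<dots> = (\<Sum>\<sigma>\<in>{\<sigma>\<in>?S. ?E \<sigma>} - {\<pi>}. 1) + 1"
    using fin s0 by (subst sum.remove[of _ \<pi>]) (auto simp: add.commute)
  also have "(\<Sum>\<sigma>\<in>{\<sigma>\<in>?S. ?E \<sigma>} - {\<pi>}. 1 :: 'k) = 0"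
  proof (rule sum_involution_eq_0[where h="\<lambda>\<sigma>. ?t \<circ> \<sigma>"])
    fix \<sigma> assume "\<sigma> \<in> {\<sigma>\<in>?S. ?E \<sigma>} - {\<pi>}"
    then have s: "\<sigma> permutes {a..<a+4}" and k: "\<sigma> k = a" and lt: "\<sigma> j < \<sigma> i" and ne: "\<sigma> \<noteq> \<pi>" by auto
    have "\<sigma> i \<in> {a..<a+4}" "\<sigma> j \<in> {a..<a+4}"
      using permutes_in_image[OF s] mem by auto
    moreover have "\<sigma> i \<noteq> \<sigma> k" "\<sigma> j \<noteq> \<sigma> k" using ijk permutes_inj[OF s] by (auto simp: inj_eq)
    moreover have "\<not> (\<sigma> j = a + 1 \<and> \<sigma> i = a + 2)" using uniq[OF s k] ne by blast
    ultimately have top: "\<sigma> i = a + 3" "\<sigma> j = a + 1 \<or> \<sigma> j = a + 2" using k lt by auto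
    have "(?t \<circ> \<sigma>) i = a + 3" "(?t \<circ> \<sigma>) j < a + 3" "(?t \<circ> \<sigma>) k = a"
      using top k by (auto simp: transpose_def)
    moreover have "?t \<circ> \<sigma> \<noteq> \<pi>"
    proof
      assume "?t \<circ> \<sigma> = \<pi>"
      then have "(?t \<circ> \<sigma>) i = \<pi> i" by (rule fun_cong)
      then show False using s0(2) \<open>(?t \<circ> \<sigma>) i = a + 3\<close> by linarith
    qed
    ultimately show "?t \<circ> \<sigma> \<in> {\<sigma>\<in>?S. ?E \<sigma>} - {\<pi>}"
      using permutes_compose[OF s t] by auto
    show "?t \<circ> (?t \<circ> \<sigma>) = \<sigma>" by (simp add: fun_eq_iff)
    have "(?t \<circ> \<sigma>) j \<noteq> \<sigma> j" using top(2) by (auto simp: transpose_def)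
    then show "?t \<circ> \<sigma> \<noteq> \<sigma>" by metis
  qed (use fin in auto)
  finally show ?thesis by simp
qed

text \<open>The coefficient at \<open>w\<close>, with three \<delta>-letters, of the image of the
  basis tensor of \<open>u\<close>, with one, is a second-order term: exactly two letters are
  lowered. The lowered pair and the position sent to \<open>a\<close> must make up the first three
  positions, in one of three ways; each contributes 1 by \<open>norm_indicator_sum\<close>, and
  three ones do not cancel.\<close>

lemma norm_not_kills:
  assumes x: "\<not> is_delta m x" and y: "is_delta m (x + 1)"
  shows "\<exists>w. \<exists>\<phi> :: (nat \<Rightarrow> nat) \<Rightarrow> 'k. (\<forall>i\<in>{a..<a+4}. w i \<in> {x, x + 1}) \<and>
    (\<Sum>\<sigma> | \<sigma> permutes {a..<a+4}. tact m \<sigma> \<phi> w) \<noteq> 0"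
proof -
  let ?I = "{a..<a+4}" and ?S = "{\<sigma>. \<sigma> permutes {a..<a+4}}"
  have I: "?I = {a, a + 1, a + 2, a + 3}" by auto
  define u where "u i = (if i = a + 3 then x + 1 else x)" for i
  define w where "w i = (if i = a then x else x + 1)" for i
  define \<phi> where "\<phi> v = (if \<forall>i\<in>?I. v i = u i then 1 else 0 :: 'k)" for v
  have count_u: "delta_count m ?I v = 1" if "\<forall>i\<in>?I. v i = u i" for v
  proof -
    have "{i \<in> ?I. is_delta m (v i)} = {a + 3}"
      using that x y by (auto simp: u_def I)
    then show ?thesis by (simp add: delta_count_def)
  qed
  have count_w: "delta_count m ?I w = 3"
  proof -
    have "{i \<in> ?I. is_delta m (w i)} = {a + 1, a + 2, a + 3}"
      using x y by (auto simp: w_def I)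
    then show ?thesis by (simp add: delta_count_def)
  qed
  have van: "vanishes_below m ?I 1 \<phi>"
    using count_u by (fastforce simp: vanishes_below_def \<phi>_def)
  let ?E = "\<lambda>k i j \<sigma>. if \<sigma> k = a \<and> \<sigma> (j :: nat) < \<sigma> i then 1 else 0 :: 'k"
  let ?T = "\<lambda>\<sigma>. ?E a (a + 1) (a + 2) \<sigma> + ?E (a + 1) a (a + 2) \<sigma> + ?E (a + 2) a (a + 1) \<sigma>"
  have main: "tact m \<sigma> \<phi> w = ?T \<sigma>" if s: "\<sigma> permutes ?I" for \<sigma>
  proof -
    have inj: "\<sigma> p = \<sigma> q \<longleftrightarrow> p = q" for p q using permutes_inj[OF s] by (auto simp: inj_eq)
    have a: "a \<in> \<sigma> ` ?I" using permutes_image[OF s] by simp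
    have \<phi>0: "\<phi> (w \<circ> \<sigma>) = 0"
      using count_u[of "w \<circ> \<sigma>"] delta_count_comp[OF s, of m w] count_w by (auto simp: \<phi>_def)
    have delta: "delta_at m A \<phi> (w \<circ> \<sigma>) =
        (if A = {a + 1, a + 2} then of_bool (\<sigma> a = a) else
         if A = {a, a + 2} then of_bool (\<sigma> (a + 1) = a) else
         if A = {a, a + 1} then of_bool (\<sigma> (a + 2) = a) else 0)"
      if A: "A \<in> inversions \<sigma>" for A
    proof -
      obtain i j where ij: "A = {i, j}" "i < j" "i \<in> ?I" "j \<in> ?I"
        using A inversions_card[OF s A] by (auto elim!: inversions_cases)
      have pairs: "(i = a \<and> j = a + 1) \<or> (i = a \<and> j = a + 2) \<or> (i = a \<and> j = a + 3) \<or>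
          (i = a + 1 \<and> j = a + 2) \<or> (i = a + 1 \<and> j = a + 3) \<or> (i = a + 2 \<and> j = a + 3)"
        using ij by auto
      have ws: "is_delta m (w l) \<longleftrightarrow> l \<noteq> a" "w l = (if l = a then x else x + 1)" for l
        using x y by (simp_all add: w_def)
      have "delta_at m A \<phi> (w \<circ> \<sigma>) = of_bool (\<sigma> i \<noteq> a \<and> \<sigma> j \<noteq> a \<and>
          (\<forall>l\<in>?I. (l = i \<or> l = j \<or> \<sigma> l = a) = (l \<noteq> a + 3)))"
      proof -
        have eq: "lower A (w \<circ> \<sigma>) l = u l \<longleftrightarrow> (l = i \<or> l = j \<or> \<sigma> l = a) = (l \<noteq> a + 3)"
          if "\<sigma> i \<noteq> a" "\<sigma> j \<noteq> a" for l
          using that by (auto simp: lower_def ij(1) u_def ws)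
        moreover have delta: "(\<forall>l\<in>A. is_delta m ((w \<circ> \<sigma>) l)) \<longleftrightarrow> \<sigma> i \<noteq> a \<and> \<sigma> j \<noteq> a"
          by (simp add: ij(1) ws(1))
        ultimately show ?thesis
        proof (cases "\<sigma> i \<noteq> a \<and> \<sigma> j \<noteq> a")
          case True
          have "(\<forall>l\<in>?I. lower A (w \<circ> \<sigma>) l = u l) \<longleftrightarrow> (\<forall>l\<in>?I. (l = i \<or> l = j \<or> \<sigma> l = a) = (l \<noteq> a + 3))"
            using True eq by blast
          moreover have "\<forall>l\<in>A. is_delta m ((w \<circ> \<sigma>) l)" using delta True by blast
          ultimately show ?thesis
            using True by (simp only: delta_at_def if_P \<phi>_def of_bool_def simp_thms)
        next
          case False
          then have "\<not> (\<forall>l\<in>A. is_delta m ((w \<circ> \<sigma>) l))" using delta by blast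
          moreover have "\<not> (\<sigma> i \<noteq> a \<and> \<sigma> j \<noteq> a \<and> (\<forall>l\<in>?I. (l = i \<or> l = j \<or> \<sigma> l = a) = (l \<noteq> a + 3)))"
            using False by blast
          ultimately show ?thesis by (simp only: delta_at_def of_bool_def if_not_P if_False)
        qed
      qed
      also have "\<dots> = of_bool (\<sigma> i \<noteq> a \<and> \<sigma> j \<noteq> a \<and> i \<noteq> a + 3 \<and> j \<noteq> a + 3 \<and> \<sigma> (a + 3) \<noteq> a \<and>
          (a = i \<or> a = j \<or> \<sigma> a = a) \<and> (a + 1 = i \<or> a + 1 = j \<or> \<sigma> (a + 1) = a) \<and>
          (a + 2 = i \<or> a + 2 = j \<or> \<sigma> (a + 2) = a))"
      proof -
        have "(\<forall>l\<in>?I. (l = i \<or> l = j \<or> \<sigma> l = a) = (l \<noteq> a + 3)) \<longleftrightarrow>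
          i \<noteq> a + 3 \<and> j \<noteq> a + 3 \<and> \<sigma> (a + 3) \<noteq> a \<and>
          (a = i \<or> a = j \<or> \<sigma> a = a) \<and> (a + 1 = i \<or> a + 1 = j \<or> \<sigma> (a + 1) = a) \<and>
          (a + 2 = i \<or> a + 2 = j \<or> \<sigma> (a + 2) = a)"
          unfolding I by (simp, blast)
        then show ?thesis by (simp only:)
      qed
      finally have d: "delta_at m A \<phi> (w \<circ> \<sigma>) = \<dots>" .
      let ?X = "\<sigma> i \<noteq> a \<and> \<sigma> j \<noteq> a \<and> i \<noteq> a + 3 \<and> j \<noteq> a + 3 \<and> \<sigma> (a + 3) \<noteq> a \<and>
          (a = i \<or> a = j \<or> \<sigma> a = a) \<and> (a + 1 = i \<or> a + 1 = j \<or> \<sigma> (a + 1) = a) \<and>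
          (a + 2 = i \<or> a + 2 = j \<or> \<sigma> (a + 2) = a)"
      have one: "p = q" if "\<sigma> p = a" "\<sigma> q = a" for p q using that inj by metis
      from pairs show ?thesis
      proof (elim disjE conjE)
        assume e: "i = a" "j = a + 1"
        have "?X \<longleftrightarrow> \<sigma> (a + 2) = a" unfolding e using one[of "a + 2" "a"] one[of "a + 2" "a + 1"] one[of "a + 2" "a + 3"] by auto
        then show ?thesis unfolding d unfolding ij(1) e by (simp add: doubleton_eq_iff)
      next
        assume e: "i = a" "j = a + 2"
        have "?X \<longleftrightarrow> \<sigma> (a + 1) = a" unfolding e using one[of "a + 1" "a"] one[of "a + 1" "a + 2"] one[of "a + 1" "a + 3"] by auto
        then show ?thesis unfolding d unfolding ij(1) e by (simp add: doubleton_eq_iff)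
      next
        assume e: "i = a" "j = a + 3"
        then have "\<not> ?X" by simp
        then show ?thesis unfolding d unfolding ij(1) e by (simp add: doubleton_eq_iff)
      next
        assume e: "i = a + 1" "j = a + 2"
        have "?X \<longleftrightarrow> \<sigma> (a) = a" unfolding e using one[of "a" "a + 1"] one[of "a" "a + 2"] one[of "a" "a + 3"] by auto
        then show ?thesis unfolding d unfolding ij(1) e by (simp add: doubleton_eq_iff)
      next
        assume e: "i = a + 1" "j = a + 3"
        then have "\<not> ?X" by simp
        then show ?thesis unfolding d unfolding ij(1) e by (simp add: doubleton_eq_iff)
      next
        assume e: "i = a + 2" "j = a + 3"
        then have "\<not> ?X" by simp
        then show ?thesis unfolding d unfolding ij(1) e by (simp add: doubleton_eq_iff)
      qed
    qed
    have "(\<Sum>A\<in>inversions \<sigma>. delta_at m A \<phi> (w \<circ> \<sigma>)) = ?T \<sigma>"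
    proof -
      have "(\<Sum>A\<in>inversions \<sigma>. delta_at m A \<phi> (w \<circ> \<sigma>)) =
        (\<Sum>A\<in>inversions \<sigma> \<inter> {{a + 1, a + 2}, {a, a + 2}, {a, a + 1}}. delta_at m A \<phi> (w \<circ> \<sigma>))"
        by (rule sum.mono_neutral_right) (auto simp: delta finite_inversions[OF s])
      also have "\<dots> = (\<Sum>A\<in>{{a + 1, a + 2}, {a, a + 2}, {a, a + 1}}. if A \<in> inversions \<sigma> then delta_at m A \<phi> (w \<circ> \<sigma>) else 0)"
        by (rule sum.mono_neutral_cong_left) auto
      also have "\<dots> = (if {a + 1, a + 2} \<in> inversions \<sigma> then of_bool (\<sigma> a = a) else 0)
        + ((if {a, a + 2} \<in> inversions \<sigma> then of_bool (\<sigma> (a + 1) = a) else 0)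
        + (if {a, a + 1} \<in> inversions \<sigma> then of_bool (\<sigma> (a + 2) = a) else 0))"
        by (simp add: delta doubleton_eq_iff)
      finally show ?thesis
        using doubleton_in_inversions[of "a + 1" "a + 2" \<sigma>] doubleton_in_inversions[of a "a + 2" \<sigma>]
          doubleton_in_inversions[of a "a + 1" \<sigma>]
        by (simp add: add.assoc)
    qed
    then show ?thesis using tact_second[OF s van, of w] count_w \<phi>0 by simp
  qed
  have "(\<Sum>\<sigma>\<in>?S. tact m \<sigma> \<phi> w) = (\<Sum>\<sigma>\<in>?S. ?T \<sigma>)" by (rule sum.cong) (use main in auto)
  also have "\<dots> = (\<Sum>\<sigma>\<in>?S. ?E a (a + 1) (a + 2) \<sigma>) + (\<Sum>\<sigma>\<in>?S. ?E (a + 1) a (a + 2) \<sigma>) + (\<Sum>\<sigma>\<in>?S. ?E (a + 2) a (a + 1) \<sigma>)"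
    by (simp only: sum.distrib)
  also have "(\<Sum>\<sigma>\<in>?S. ?E a (a + 1) (a + 2) \<sigma>) = 1"
    by (rule norm_indicator_sum[where \<pi>="transpose (a + 1) (a + 2)"]) (auto intro: permutes_swap_id)
  also have "(\<Sum>\<sigma>\<in>?S. ?E (a + 1) a (a + 2) \<sigma>) = 1"
    by (rule norm_indicator_sum[where \<pi>="cyc a \<circ> cyc a"])
      (use cyc_permutes[of a a "a + 4"] cyc_apply[of a] in \<open>auto intro: permutes_compose\<close>)
  also have "(\<Sum>\<sigma>\<in>?S. ?E (a + 2) a (a + 1) \<sigma>) = 1"
    by (rule norm_indicator_sum[where \<pi>="transpose a (a + 2)"]) (auto intro: permutes_swap_id)
  finally have "(\<Sum>\<sigma>\<in>?S. tact m \<sigma> \<phi> w) \<noteq> 0" by simp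
  moreover have "\<forall>i\<in>?I. w i \<in> {x, x + 1}" by (simp add: w_def)
  ultimately show ?thesis by blast
qed

text \<open>In characteristic two, either \<open>z\<close> is fixed by the involution, or
  \<open>z\<close> plus its translate is nonzero and fixed. The last clause lets invariances
  obtained earlier be carried over.\<close>

lemma double_coset_invariant:
  fixes z :: "(nat \<Rightarrow> nat) \<Rightarrow> 'k"
  assumes z: "kills m a b L z" "\<forall>\<sigma>. \<sigma> permutes {a..<b} \<longrightarrow> z (\<sigma> \<circ> c) = z \<sigma>"
      "\<exists>\<sigma>. \<sigma> permutes {a..<b} \<and> z \<sigma> \<noteq> 0"
    and u: "u permutes {a..<b}" "u \<circ> u = id" and L: "closed_letters m L"
  obtains z' where "kills m a b L z'" "\<forall>\<sigma>. \<sigma> permutes {a..<b} \<longrightarrow> z' (\<sigma> \<circ> c) = z' \<sigma>"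
    "\<exists>\<sigma>. \<sigma> permutes {a..<b} \<and> z' \<sigma> \<noteq> 0"
    "\<forall>\<sigma>. \<sigma> permutes {a..<b} \<longrightarrow> z' (u \<circ> \<sigma>) = z' \<sigma>"
    "z' = z \<or> z' = (\<lambda>\<sigma>. z \<sigma> + z (u \<circ> \<sigma>))"
proof (cases "\<forall>\<sigma>. \<sigma> permutes {a..<b} \<longrightarrow> z (u \<circ> \<sigma>) = z \<sigma>")
  case True
  then show ?thesis using that z by blast
next
  case False
  let ?z = "\<lambda>\<sigma>. z \<sigma> + z (u \<circ> \<sigma>)"
  have uu: "u \<circ> (u \<circ> \<sigma>) = \<sigma>" for \<sigma> using u(2) by (simp add: comp_assoc[symmetric])
  show ?thesis
  proof (rule that)
    show "kills m a b L ?z" by (intro kills_add kills_left z(1) u(1) L)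
    show "\<forall>\<sigma>. \<sigma> permutes {a..<b} \<longrightarrow> ?z (\<sigma> \<circ> c) = ?z \<sigma>"
      using z(2) permutes_compose[OF _ u(1)] by (simp add: comp_assoc[symmetric])
    show "\<exists>\<sigma>. \<sigma> permutes {a..<b} \<and> ?z \<sigma> \<noteq> 0" using False by (auto simp: add_eq_0_iff_eq)
    show "\<forall>\<sigma>. \<sigma> permutes {a..<b} \<longrightarrow> ?z (u \<circ> \<sigma>) = ?z \<sigma>" by (simp add: uu add.commute)
  qed simp
qed

text \<open>Otherwise \<open>f (1 + c + c\<^sup>2)\<close> is a nonzero element of the kernel, fixed
  on the right by \<open>c\<close>. Making it fixed on the left by a Sylow 2-subgroup makes it
  constant, because that subgroup of order 8 times the powers of \<open>c\<close> is all of
  \<open>S\<^sub>4\<close>; but a nonzero constant does not act by zero.\<close>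

lemma kills_four:
  fixes f :: "(nat \<Rightarrow> nat) \<Rightarrow> 'k"
  assumes x: "\<not> is_delta m x" and y: "is_delta m (x + 1)"
    and L: "{x, x + 1} \<subseteq> L" "closed_letters m L" and f: "kills m a (a + 4) L f"
  shows "f id + f (cyc a) + f (cyc a \<circ> cyc a) = 0"
proof (rule ccontr)
  let ?I = "{a..<a+4}" and ?c = "cyc a"
  define z0 where "z0 \<sigma> = f \<sigma> + f (\<sigma> \<circ> ?c) + f (\<sigma> \<circ> (?c \<circ> ?c))" for \<sigma>
  have c: "?c permutes ?I" by (rule cyc_permutes) auto
  have ccc: "?c \<circ> (?c \<circ> ?c) = id" using cyc_cube[of a] by (simp add: comp_assoc)
  have cccx: "\<sigma> \<circ> ?c \<circ> (?c \<circ> ?c) = \<sigma>" for \<sigma> :: "nat \<Rightarrow> nat" by (simp only: comp_assoc ccc comp_id)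
  assume ne: "f id + f (cyc a) + f (cyc a \<circ> cyc a) \<noteq> 0"
  have k0: "kills m a (a + 4) L z0"
    unfolding z0_def by (intro kills_add f kills_right c permutes_compose)
  have r0: "\<forall>\<sigma>. \<sigma> permutes ?I \<longrightarrow> z0 (\<sigma> \<circ> ?c) = z0 \<sigma>"
    by (simp only: z0_def cccx) (simp add: comp_assoc add_ac)
  have n0: "\<exists>\<sigma>. \<sigma> permutes ?I \<and> z0 \<sigma> \<noteq> 0"
    using ne by (intro exI[of _ id]) (simp add: z0_def permutes_id)
  \<comment> \<open>Generators of a dihedral group of order 8. The order of averaging matters:
    \<open>u2\<close> commutes with \<open>u1\<close>, and \<open>u3\<close> exchanges the two, so
    later averages keep the earlier invariances.\<close>
  define u1 where "u1 = transpose a (a + 1)"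
  define u2 where "u2 = transpose (a + 2) (a + 3)"
  define u3 where "u3 = transpose a (a + 2) \<circ> transpose (a + 1) (a + 3)"
  have u: "u1 permutes ?I" "u2 permutes ?I" "u3 permutes ?I"
    unfolding u1_def u2_def u3_def by (auto intro!: permutes_compose permutes_swap_id)
  have sq: "u1 \<circ> u1 = id" "u2 \<circ> u2 = id" "u3 \<circ> u3 = id" and com: "u2 \<circ> u1 = u1 \<circ> u2"
      "u3 \<circ> u1 = u2 \<circ> u3" "u3 \<circ> u2 = u1 \<circ> u3"
    by (auto simp: u1_def u2_def u3_def fun_eq_iff transpose_def)
  have coms: "u2 \<circ> (u1 \<circ> \<sigma>) = u1 \<circ> (u2 \<circ> \<sigma>)" "u3 \<circ> (u1 \<circ> \<sigma>) = u2 \<circ> (u3 \<circ> \<sigma>)"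
      "u3 \<circ> (u2 \<circ> \<sigma>) = u1 \<circ> (u3 \<circ> \<sigma>)" for \<sigma>
    by (simp_all only: comp_assoc[symmetric] com)
  have pc: "u1 \<circ> \<sigma> permutes ?I" "u2 \<circ> \<sigma> permutes ?I" "u3 \<circ> \<sigma> permutes ?I" if "\<sigma> permutes ?I" for \<sigma>
    using u that by (auto intro: permutes_compose)
  obtain z1 where z1: "kills m a (a+4) L z1" "\<forall>\<sigma>. \<sigma> permutes ?I \<longrightarrow> z1 (\<sigma> \<circ> ?c) = z1 \<sigma>"
      "\<exists>\<sigma>. \<sigma> permutes ?I \<and> z1 \<sigma> \<noteq> 0" "\<forall>\<sigma>. \<sigma> permutes ?I \<longrightarrow> z1 (u1 \<circ> \<sigma>) = z1 \<sigma>"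
    and "z1 = z0 \<or> z1 = (\<lambda>\<sigma>. z0 \<sigma> + z0 (u1 \<circ> \<sigma>))"
    by (rule double_coset_invariant[OF k0 r0 n0 u(1) sq(1) L(2)])
  obtain z2 where z2: "kills m a (a+4) L z2" "\<forall>\<sigma>. \<sigma> permutes ?I \<longrightarrow> z2 (\<sigma> \<circ> ?c) = z2 \<sigma>"
      "\<exists>\<sigma>. \<sigma> permutes ?I \<and> z2 \<sigma> \<noteq> 0" "\<forall>\<sigma>. \<sigma> permutes ?I \<longrightarrow> z2 (u2 \<circ> \<sigma>) = z2 \<sigma>"
    and z21: "z2 = z1 \<or> z2 = (\<lambda>\<sigma>. z1 \<sigma> + z1 (u2 \<circ> \<sigma>))"
    by (rule double_coset_invariant[OF z1(1-3) u(2) sq(2) L(2)])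
  have z2u1: "\<forall>\<sigma>. \<sigma> permutes ?I \<longrightarrow> z2 (u1 \<circ> \<sigma>) = z2 \<sigma>"
    using z21 by (elim disjE; intro allI impI; simp only: z1(4) coms pc)
  obtain z3 where z3: "kills m a (a+4) L z3" "\<forall>\<sigma>. \<sigma> permutes ?I \<longrightarrow> z3 (\<sigma> \<circ> ?c) = z3 \<sigma>"
      "\<exists>\<sigma>. \<sigma> permutes ?I \<and> z3 \<sigma> \<noteq> 0" "\<forall>\<sigma>. \<sigma> permutes ?I \<longrightarrow> z3 (u3 \<circ> \<sigma>) = z3 \<sigma>"
    and z32: "z3 = z2 \<or> z3 = (\<lambda>\<sigma>. z2 \<sigma> + z2 (u3 \<circ> \<sigma>))"
    by (rule double_coset_invariant[OF z2(1-3) u(3) sq(3) L(2)])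
  have z3u1: "\<forall>\<sigma>. \<sigma> permutes ?I \<longrightarrow> z3 (u1 \<circ> \<sigma>) = z3 \<sigma>"
    using z32 by (elim disjE; intro allI impI; simp only: z2u1 z2(4) coms pc add.commute)
  have z3u2: "\<forall>\<sigma>. \<sigma> permutes ?I \<longrightarrow> z3 (u2 \<circ> \<sigma>) = z3 \<sigma>"
    using z32 by (elim disjE; intro allI impI; simp only: z2u1 z2(4) coms pc add.commute)
  have fix2: "z3 \<sigma> = z3 id" if s: "\<sigma> permutes ?I" "\<sigma> (a + 3) = a + 3" "\<sigma> (a + 2) = a + 2" for \<sigma>
  proof -
    have inj: "\<sigma> p = \<sigma> q \<longleftrightarrow> p = q" for p q using permutes_inj[OF s(1)] by (auto simp: inj_eq)
    have "\<sigma> a \<in> ?I" "\<sigma> (a + 1) \<in> ?I" using permutes_in_image[OF s(1)] by auto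
    moreover have "\<sigma> a \<noteq> \<sigma> (a + 3)" "\<sigma> a \<noteq> \<sigma> (a + 2)" "\<sigma> (a + 1) \<noteq> \<sigma> (a + 3)" "\<sigma> (a + 1) \<noteq> \<sigma> (a + 2)"
        "\<sigma> a \<noteq> \<sigma> (a + 1)" using inj by simp_all
    ultimately have "\<sigma> a = a \<and> \<sigma> (a + 1) = a + 1 \<or> \<sigma> a = a + 1 \<and> \<sigma> (a + 1) = a" using s by auto
    then have "\<sigma> = id \<or> \<sigma> = u1"
    proof (elim disjE conjE)
      have cases: "i = a \<or> i = a + 1 \<or> i = a + 2 \<or> i = a + 3 \<or> i \<notin> ?I" for i by auto
      {
        assume "\<sigma> a = a" "\<sigma> (a + 1) = a + 1"
        then have "\<sigma> i = id i" for i using cases[of i] s permutes_not_in[OF s(1), of i] by auto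
        then show ?thesis by blast
      next
        assume "\<sigma> a = a + 1" "\<sigma> (a + 1) = a"
        then have "\<sigma> i = u1 i" for i
          using cases[of i] s permutes_not_in[OF s(1), of i] by (auto simp: u1_def transpose_def)
        then show ?thesis by blast
      }
    qed
    then show ?thesis
    proof
      assume "\<sigma> = u1"
      then show ?thesis using z3u1[rule_format, OF permutes_id] by simp
    qed simp
  qed
  \<comment> \<open>Right multiplication by a power of \<open>?c\<close> moves the preimage of
    \<open>a + 2\<close> to \<open>a + 2\<close>.\<close>
  have fix3: "z3 \<sigma> = z3 id" if s: "\<sigma> permutes ?I" "\<sigma> (a + 3) = a + 3" for \<sigma>
  proof -
    have "a + 2 \<in> \<sigma> ` ?I" using permutes_image[OF s(1)] by simp
    then obtain p where p: "p \<in> ?I" "\<sigma> p = a + 2" by auto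
    then have "p \<noteq> a + 3" using s(2) by auto
    then have p: "p = a + 2 \<or> p = a \<or> p = a + 1" using p by auto
    have 3: "?c (a + 3) = a + 3" by (rule cyc_apply) auto
    have sc: "\<sigma> \<circ> ?c permutes ?I" "\<sigma> \<circ> ?c \<circ> ?c permutes ?I" by (intro permutes_compose c s(1))+
    show ?thesis
      using p
    proof (elim disjE)
      assume "p = a + 2" then show ?thesis using fix2[OF s] \<open>\<sigma> p = a + 2\<close> by simp
    next
      assume "p = a"
      then have "(\<sigma> \<circ> ?c) (a + 2) = a + 2" "(\<sigma> \<circ> ?c) (a + 3) = a + 3"
        using \<open>\<sigma> p = a + 2\<close> s(2) by (simp_all only: o_apply cyc_apply(3) 3)
      then show ?thesis using fix2[OF sc(1)] z3(2) s(1) by simp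
    next
      assume "p = a + 1"
      then have "(\<sigma> \<circ> ?c \<circ> ?c) (a + 2) = a + 2" "(\<sigma> \<circ> ?c \<circ> ?c) (a + 3) = a + 3"
        using \<open>\<sigma> p = a + 2\<close> s(2) by (simp_all only: o_apply cyc_apply(1,3) 3)
      then show ?thesis using fix2[OF sc(2)] z3(2) s(1) sc(1) by simp
    qed
  qed
  \<comment> \<open>The dihedral group is transitive on the four values, so left multiplication
    brings the image of \<open>a + 3\<close> back to \<open>a + 3\<close>.\<close>
  have const: "z3 \<sigma> = z3 id" if s: "\<sigma> permutes ?I" for \<sigma>
  proof -
    have "\<sigma> (a + 3) \<in> ?I" using permutes_in_image[OF s, of "a + 3"] by simp
    then have "\<sigma> (a + 3) = a + 3 \<or> \<sigma> (a + 3) = a + 2 \<or> \<sigma> (a + 3) = a + 1 \<or> \<sigma> (a + 3) = a" by auto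
    then show ?thesis
    proof (elim disjE)
      assume "\<sigma> (a + 3) = a + 2"
      then have "(u2 \<circ> \<sigma>) (a + 3) = a + 3" by (simp add: u2_def)
      then show ?thesis using fix3[OF pc(2)[OF s]] z3u2 s by simp
    next
      assume "\<sigma> (a + 3) = a + 1"
      then have "(u3 \<circ> \<sigma>) (a + 3) = a + 3" by (simp add: u3_def transpose_def)
      then show ?thesis using fix3[OF pc(3)[OF s]] z3(4) s by simp
    next
      assume "\<sigma> (a + 3) = a"
      then have "(u3 \<circ> (u1 \<circ> \<sigma>)) (a + 3) = a + 3" by (simp add: u3_def u1_def transpose_def)
      then have "z3 (u3 \<circ> (u1 \<circ> \<sigma>)) = z3 id" using fix3[OF pc(3)[OF pc(1)[OF s]]] by blast
      then show ?thesis using z3(4) z3u1 s pc(1)[OF s] by simp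
    qed (use fix3[OF s] in blast)
  qed
  have nz: "z3 id \<noteq> 0" using z3(3) const by metis
  obtain w and \<phi> :: "(nat \<Rightarrow> nat) \<Rightarrow> 'k" where w: "\<forall>i\<in>?I. w i \<in> {x, x + 1}"
    and neq: "(\<Sum>\<sigma> | \<sigma> permutes ?I. tact m \<sigma> \<phi> w) \<noteq> 0"
    using norm_not_kills[OF x y] by blast
  have "0 = (\<Sum>\<sigma> | \<sigma> permutes ?I. z3 \<sigma> * tact m \<sigma> \<phi> w)"
  proof (rule killsD[OF z3(1), symmetric])
    show "\<forall>i\<in>?I. w i \<in> L" using w L(1) by blast
  qed
  also have "\<dots> = z3 id * (\<Sum>\<sigma> | \<sigma> permutes ?I. tact m \<sigma> \<phi> w)"
    unfolding sum_distrib_left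
  proof (intro sum.cong refl)
    fix \<sigma> assume "\<sigma> \<in> {\<sigma>. \<sigma> permutes ?I}"
    then show "z3 \<sigma> * tact m \<sigma> \<phi> w = z3 id * tact m \<sigma> \<phi> w" using const[of \<sigma>] by simp
  qed
  finally show False using nz neq by simp
qed

end

section \<open>Spreading the 3-cycle relation over a block\<close>

context char_two
begin

lemma closed_letters_pair: "closed_letters m {m + 2 * n, m + 2 * n + 1}"
  unfolding closed_letters_def
proof (intro allI impI)
  fix l assume "is_delta m l"
  then obtain k where k: "l = m + 2 * k + 1" by (auto simp: is_delta_iff)
  have "m + 2 * k + 1 \<noteq> m + 2 * n" "m + 2 * k \<noteq> m + 2 * n + 1" by presburger+
  then show "l \<in> {m + 2 * n, m + 2 * n + 1} \<longleftrightarrow> l - 1 \<in> {m + 2 * n, m + 2 * n + 1}"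
    unfolding k by auto
qed

text \<open>Give the first four positions the letters of the last copy of P and the others the
  remaining letters. The hypothesis on the other positions shows that the restriction of
  \<open>f\<close> to \<open>S\<^sub>4\<close> acts by zero on the fourth tensor power of P.\<close>

lemma kills_cyc_first:
  fixes f :: "(nat \<Rightarrow> nat) \<Rightarrow> 'k"
  assumes f: "kills m a b {..<m + 2 * Suc n} f" and ab: "a + 3 \<le> b"
    and IH: "\<And>g :: (nat \<Rightarrow> nat) \<Rightarrow> 'k. a + 4 \<le> b \<Longrightarrow> kills m (a + 4) b {..<m + 2 * n} g \<Longrightarrow> g id = 0"
  shows "f id + f (cyc a) + f (cyc a \<circ> cyc a) = 0"
proof -
  let ?x = "m + 2 * n" and ?L = "{m + 2 * n, m + 2 * n + 1}"
  have x: "\<not> is_delta m ?x" "is_delta m (?x + 1)" by (simp_all add: is_delta_def)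
  have cl: "closed_letters m ?L" and cl2: "closed_letters m {..<m + 2 * n}"
    by (rule closed_letters_pair closed_letters_lessThan)+
  show ?thesis
  proof (cases "a + 4 \<le> b")
    case True
    have "kills m a (a + 4) ?L f"
      unfolding kills_def
    proof (intro allI impI)
      fix \<phi> :: "(nat \<Rightarrow> nat) \<Rightarrow> 'k" and w assume "\<forall>i\<in>{a..<a+4}. w i \<in> ?L"
      then have "kills m (a + 4) b {..<m + 2 * n} (\<lambda>\<tau>. \<Sum>\<sigma> | \<sigma> permutes {a..<a+4}. f (\<sigma> \<circ> \<tau>) * tact m \<sigma> \<phi> w)"
        by (intro kills_block[OF f _ True _ _ _ cl cl2]) auto
      from IH[OF True this] show "(\<Sum>\<sigma> | \<sigma> permutes {a..<a+4}. f \<sigma> * tact m \<sigma> \<phi> w) = 0"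
        by simp
    qed
    from kills_four[OF x _ cl this] show ?thesis by simp
  next
    case False
    with ab have b: "b = a + 3" by simp
    \<comment> \<open>With only three positions, \<open>f\<close> is extended by zero to
      permutations of four, the fourth position being idle.\<close>
    define f' where "f' \<sigma> = (if \<sigma> permutes {a..<a+3} then f \<sigma> else 0)" for \<sigma>
    have sub: "\<sigma> permutes {a..<a+4}" if "\<sigma> permutes {a..<a+3}" for \<sigma>
      using permutes_subset[OF that] by auto
    have "kills m a (a + 4) ?L f'"
      unfolding kills_def
    proof (intro allI impI)
      fix \<phi> :: "(nat \<Rightarrow> nat) \<Rightarrow> 'k" and w assume w: "\<forall>i\<in>{a..<a+4}. w i \<in> ?L"
      have "(\<Sum>\<sigma> | \<sigma> permutes {a..<a+4}. f' \<sigma> * tact m \<sigma> \<phi> w)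
          = (\<Sum>\<sigma> | \<sigma> permutes {a..<a+3}. f \<sigma> * tact m \<sigma> \<phi> w)"
        by (rule sum.mono_neutral_cong_right) (auto simp: f'_def finite_permutations sub)
      also have "\<dots> = 0"
        by (rule killsD[OF f[unfolded b]]) (use w in force)
      finally show "(\<Sum>\<sigma> | \<sigma> permutes {a..<a+4}. f' \<sigma> * tact m \<sigma> \<phi> w) = 0" .
    qed
    from kills_four[OF x _ cl this] have "f' id + f' (cyc a) + f' (cyc a \<circ> cyc a) = 0" by simp
    moreover have "cyc a permutes {a..<a+3}" by (rule cyc_permutes) auto
    ultimately show ?thesis by (simp add: f'_def permutes_id permutes_compose)
  qed
qed

text \<open>Conjugation carries the relation from the first 3-cycle to every consecutive
  one.\<close>

lemma kills_cyc:
  fixes f :: "(nat \<Rightarrow> nat) \<Rightarrow> 'k"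
  assumes first: "\<And>g :: (nat \<Rightarrow> nat) \<Rightarrow> 'k. kills m a b L g \<Longrightarrow> g id + g (cyc a) + g (cyc a \<circ> cyc a) = 0"
    and L: "closed_letters m L" and p: "a \<le> p" "p + 2 < b"
    and f: "kills m a b L f" and s: "\<sigma> permutes {a..<b}"
  shows "f \<sigma> + f (\<sigma> \<circ> cyc p) + f (\<sigma> \<circ> (cyc p \<circ> cyc p)) = 0"
  using p f s
proof (induction p arbitrary: f \<sigma> rule: dec_induct)
  case base
  show ?case using first[OF kills_left[OF base(2,3) L]] by simp
next
  case (step p)
  \<comment> \<open>\<open>\<pi>\<close> maps \<open>p\<close>, \<open>p + 1\<close>,
    \<open>p + 2\<close> to their successors.\<close>
  define \<pi> where "\<pi> = transpose p (p + 1) \<circ> (transpose (p + 1) (p + 2) \<circ> transpose (p + 2) (p + 3))"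
  have \<pi>: "\<pi> permutes {a..<b}"
    unfolding \<pi>_def using step.hyps(1) step.prems(1) by (intro permutes_compose permutes_swap_id) auto
  let ?\<rho> = "inv_into UNIV \<pi>"
  have conj: "\<pi> \<circ> cyc p = cyc (Suc p) \<circ> \<pi>"
    by (auto simp: \<pi>_def cyc_def transpose_def fun_eq_iff)
  have k: "kills m a b L (\<lambda>\<tau>. f (\<tau> \<circ> ?\<rho>))"
    by (rule kills_right[OF step.prems(2) permutes_inv[OF \<pi>]])
  have inv: "\<pi> \<circ> ?\<rho> = id" by (rule permutes_inv_o(1)[OF \<pi>])
  have "\<sigma> \<circ> \<pi> permutes {a..<b}" by (rule permutes_compose[OF \<pi> step.prems(3)])
  then have "f (\<sigma> \<circ> \<pi> \<circ> ?\<rho>) + f (\<sigma> \<circ> \<pi> \<circ> cyc p \<circ> ?\<rho>) + f (\<sigma> \<circ> \<pi> \<circ> (cyc p \<circ> cyc p) \<circ> ?\<rho>) = 0"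
    by (intro step.IH[OF _ k]) (use step.prems(1) in simp)
  moreover have "\<sigma> \<circ> \<pi> \<circ> ?\<rho> = \<sigma>" by (simp only: comp_assoc inv comp_id)
  moreover have "\<sigma> \<circ> \<pi> \<circ> cyc p \<circ> ?\<rho> = \<sigma> \<circ> cyc (Suc p)"
    by (metis comp_assoc comp_id conj inv)
  moreover have "\<sigma> \<circ> \<pi> \<circ> (cyc p \<circ> cyc p) \<circ> ?\<rho> = \<sigma> \<circ> (cyc (Suc p) \<circ> cyc (Suc p))"
    by (metis comp_assoc comp_id conj inv)
  ultimately show ?case by (simp only:)
qed

text \<open>The leading term of the twisted action is the place permutation action, so an element of the
  kernel annihilates the sum over the stabiliser of a word with at most \<open>D\<close> letters.\<close>

lemma kills_stabiliser_sum:
  fixes f :: "(nat \<Rightarrow> nat) \<Rightarrow> 'k" and \<kappa> :: "nat \<Rightarrow> nat"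
  assumes f: "kills m a b {..<D} f" and \<kappa>: "card (\<kappa> ` {a..<b}) \<le> D"
  shows "(\<Sum>h | h permutes {a..<b} \<and> (\<forall>i\<in>{a..<b}. \<kappa> (h i) = \<kappa> i). f h) = 0"
proof -
  let ?I = "{a..<b}" and ?S = "{h. h permutes {a..<b}}"
  obtain \<iota> :: "nat \<Rightarrow> nat" where \<iota>: "inj_on \<iota> (\<kappa> ` ?I)" "\<iota> ` \<kappa> ` ?I \<subseteq> {..<D}"
    using card_le_inj[of "\<kappa> ` ?I" "{..<D}"] \<kappa> by auto
  define u where "u i = \<iota> (\<kappa> i)" for i
  define \<phi> where "\<phi> v = (if \<forall>i\<in>?I. v i = u i then 1 else 0 :: 'k)" for v
  have uL: "\<forall>i\<in>?I. u i \<in> {..<D}" using \<iota>(2) by (auto simp: u_def)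
  have van: "vanishes_below m ?I (delta_count m ?I u) \<phi>"
    unfolding vanishes_below_def
  proof (intro allI impI)
    fix v assume lt: "delta_count m ?I v < delta_count m ?I u"
    have "\<not> (\<forall>i\<in>?I. v i = u i)"
    proof
      assume "\<forall>i\<in>?I. v i = u i"
      then have "{i \<in> ?I. is_delta m (v i)} = {i \<in> ?I. is_delta m (u i)}" by auto
      then show False using lt by (simp add: delta_count_def)
    qed
    then show "\<phi> v = 0" by (simp only: \<phi>_def if_not_P if_False)
  qed
  have "0 = (\<Sum>\<sigma>\<in>?S. f \<sigma> * tact m \<sigma> \<phi> u)" using killsD[OF f uL] by simp
  also have "\<dots> = (\<Sum>\<sigma>\<in>?S. if \<forall>i\<in>?I. \<kappa> (\<sigma> i) = \<kappa> i then f \<sigma> else 0)"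
  proof (intro sum.cong refl)
    fix \<sigma> assume "\<sigma> \<in> ?S"
    then have s: "\<sigma> permutes ?I" by simp
    have "u (\<sigma> i) = u i \<longleftrightarrow> \<kappa> (\<sigma> i) = \<kappa> i" if "i \<in> ?I" for i
      using \<iota>(1) that permutes_in_image[OF s, of i] unfolding u_def by (metis image_eqI inj_on_eq_iff)
    then have "(\<forall>i\<in>?I. (u \<circ> \<sigma>) i = u i) \<longleftrightarrow> (\<forall>i\<in>?I. \<kappa> (\<sigma> i) = \<kappa> i)" by (metis o_apply)
    then show "f \<sigma> * tact m \<sigma> \<phi> u = (if \<forall>i\<in>?I. \<kappa> (\<sigma> i) = \<kappa> i then f \<sigma> else 0)"
      using tact_leading[OF s van] by (simp add: \<phi>_def)
  qed
  also have "\<dots> = (\<Sum>h | h permutes ?I \<and> (\<forall>i\<in>?I. \<kappa> (h i) = \<kappa> i). f h)"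
    by (subst sum.inter_filter[symmetric]) (simp_all add: finite_permutations)
  finally show ?thesis by simp
qed

section \<open>Removing doubled letters pair by pair\<close>

text \<open>Labels the blocks of the partition into \<open>j\<close> consecutive pairs followed by
  singletons by their least elements; as a word it has \<open>j\<close> doubled letters.\<close>

definition pair_class :: "nat \<Rightarrow> nat \<Rightarrow> nat \<Rightarrow> nat" where
  "pair_class a j i = (if i < a + 2 * j then a + 2 * ((i - a) div 2) else i)"

text \<open>The values \<open>a + 2l + 1\<close> with \<open>l < j\<close> are not labels, which
  saves \<open>j\<close> letters.\<close>

lemma card_pair_class:
  assumes "a + 2 * j \<le> b" shows "card (pair_class a j ` {a..<b}) \<le> b - a - j"
proof -
  let ?O = "(\<lambda>l. a + 2 * l + 1) ` {..<j}"
  have "pair_class a j ` {a..<b} \<subseteq> {a..<b} - ?O"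
  proof
    fix y assume "y \<in> pair_class a j ` {a..<b}"
    then obtain i where i: "i \<in> {a..<b}" "y = pair_class a j i" by blast
    have "2 * ((i - a) div 2) \<le> i - a" by simp
    then show "y \<in> {a..<b} - ?O"
      using i assms by (auto simp: pair_class_def; presburger)
  qed
  moreover have "card ({a..<b} - ?O) = b - a - j"
  proof -
    have "inj_on (\<lambda>l. a + 2 * l + 1) {..<j}" by (auto simp: inj_on_def)
    then have "card ?O = j" by (simp add: card_image)
    moreover have "?O \<subseteq> {a..<b}" using assms by auto
    ultimately show ?thesis by (simp add: card_Diff_subset)
  qed
  ultimately show ?thesis by (metis card_mono finite_Diff finite_atLeastLessThan)
qed

text \<open>For \<open>a + 2 * j \<le> b\<close> this is the elementary abelian group of order
  \<open>2\<^sup>j\<close> generated by the transpositions of the pairs.\<close>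

definition pair_stabiliser :: "nat \<Rightarrow> nat \<Rightarrow> nat \<Rightarrow> (nat \<Rightarrow> nat) set" where
  "pair_stabiliser a b j = {h. h permutes {a..<b} \<and> (\<forall>i\<in>{a..<b}. pair_class a j (h i) = pair_class a j i)}"

lemma pair_class_Suc:
  "pair_class a (Suc j) x = pair_class a (Suc j) y \<longleftrightarrow> pair_class a j x = pair_class a j y \<or>
    {x, y} = {a + 2 * j, a + 2 * j + 1}" if "a \<le> x" "a \<le> y"
proof -
  let ?p = "a + 2 * j"
  have low: "pair_class a (Suc j) z = pair_class a j z" "pair_class a j z < ?p" if "z < ?p" "a \<le> z" for z
  proof -
    have "z - a < j * 2" using that by linarith
    then show "pair_class a (Suc j) z = pair_class a j z" "pair_class a j z < ?p"
      using that less_mult_imp_div_less[of "z - a" j 2] by (auto simp: pair_class_def)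
  qed
  have high: "pair_class a (Suc j) z = z" "pair_class a j z = z" if "?p + 2 \<le> z" for z
    using that by (auto simp: pair_class_def)
  have mid: "pair_class a (Suc j) ?p = ?p" "pair_class a (Suc j) (?p + 1) = ?p"
      "pair_class a j ?p = ?p" "pair_class a j (?p + 1) = ?p + 1"
    by (auto simp: pair_class_def)
  have cases: "z < ?p \<or> z = ?p \<or> z = ?p + 1 \<or> ?p + 2 \<le> z" for z by linarith
  have step: "(z < ?p \<and> pair_class a (Suc j) z = pair_class a j z \<and> pair_class a j z < ?p) \<or>
      (z = ?p \<and> pair_class a (Suc j) z = ?p \<and> pair_class a j z = ?p) \<or>
      (z = ?p + 1 \<and> pair_class a (Suc j) z = ?p \<and> pair_class a j z = ?p + 1) \<or>
      (?p + 2 \<le> z \<and> pair_class a (Suc j) z = z \<and> pair_class a j z = z)" if "a \<le> z" for z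
    using cases[of z] low[OF _ that] high[of z] mid by metis
  have "pair_class a (Suc j) x = pair_class a (Suc j) y \<longleftrightarrow> pair_class a j x = pair_class a j y \<or>
      x = ?p \<and> y = ?p + 1 \<or> x = ?p + 1 \<and> y = ?p"
    using step[OF that(1)] step[OF that(2)] by linarith
  then show ?thesis by (simp only: doubleton_eq_iff)
qed

lemma pair_stabiliser_fixes:
  assumes "h \<in> pair_stabiliser a b j" "a + 2 * j \<le> i"
  shows "h i = i"
proof (cases "i \<in> {a..<b}")
  case True
  then have eq: "pair_class a j (h i) = pair_class a j i" and "h i \<in> {a..<b}"
    using assms(1) permutes_in_image[of h "{a..<b}" i] by (simp_all add: pair_stabiliser_def)
  have "pair_class a j (h i) < a + 2 * j" if "h i < a + 2 * j"
    using that \<open>h i \<in> {a..<b}\<close> by (auto simp: pair_class_def)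
  then show ?thesis using eq assms(2) by (auto simp: pair_class_def split: if_splits)
next
  case False
  moreover have "h permutes {a..<b}" using assms(1) by (simp add: pair_stabiliser_def)
  ultimately show ?thesis by (intro permutes_not_in)
qed

text \<open>The next pair doubles the group: an element fixes \<open>a + 2 * j\<close>, or does so
  after composition with \<open>s\<close>.\<close>

lemma pair_stabiliser_Suc:
  assumes "a + 2 * j + 2 \<le> b"
  defines "s \<equiv> transpose (a + 2 * j) (a + 2 * j + 1)"
  shows "pair_stabiliser a b (Suc j) = pair_stabiliser a b j \<union> (\<lambda>h. h \<circ> s) ` pair_stabiliser a b j"
    "pair_stabiliser a b j \<inter> (\<lambda>h. h \<circ> s) ` pair_stabiliser a b j = {}"
proof -
  let ?p = "a + 2 * j" and ?q = "a + 2 * j + 1" and ?I = "{a..<b}"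
  have s: "s permutes ?I" unfolding s_def by (rule permutes_swap_id) (use assms in auto)
  have ss: "h \<circ> s \<circ> s = h" for h :: "nat \<Rightarrow> nat" by (simp add: s_def comp_assoc)
  have sub: "h \<in> pair_stabiliser a b (Suc j)" if "h \<in> pair_stabiliser a b j" for h
    unfolding pair_stabiliser_def
  proof (intro CollectI conjI ballI)
    show p: "h permutes ?I" using that by (simp add: pair_stabiliser_def)
    fix i assume i: "i \<in> ?I"
    then have "a \<le> i" "a \<le> h i" using permutes_in_image[OF p, of i] by auto
    moreover have "pair_class a j (h i) = pair_class a j i" using that i by (simp add: pair_stabiliser_def)
    ultimately show "pair_class a (Suc j) (h i) = pair_class a (Suc j) i" using pair_class_Suc by blast
  qed
  have s_class: "pair_class a (Suc j) (s i) = pair_class a (Suc j) i" if "a \<le> i" for i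
  proof -
    have "i = ?p \<or> i = ?q \<or> s i = i" by (auto simp: s_def transpose_def)
    then show ?thesis by (auto simp: s_def pair_class_def)
  qed
  have sub_s: "h \<circ> s \<in> pair_stabiliser a b (Suc j)" if h: "h \<in> pair_stabiliser a b (Suc j)" for h
  proof -
    have "pair_class a (Suc j) ((h \<circ> s) i) = pair_class a (Suc j) i" if "i \<in> ?I" for i
      using h s_class[of i] that permutes_in_image[OF s, of i] by (auto simp: pair_stabiliser_def)
    then show ?thesis using h permutes_compose[OF s] by (auto simp: pair_stabiliser_def)
  qed
  have down: "h \<in> pair_stabiliser a b j" if h: "h \<in> pair_stabiliser a b (Suc j)" "h ?p = ?p" for h
  proof -
    have p: "h permutes ?I" using h by (simp add: pair_stabiliser_def)
    have "pair_class a j (h i) = pair_class a j i" if i: "i \<in> ?I" for i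
    proof -
      have hi: "h i \<in> ?I" using permutes_in_image[OF p] i by blast
      have "{h i, i} \<noteq> {?p, ?q}"
      proof
        assume eq: "{h i, i} = {?p, ?q}"
        then have "h i = ?p \<and> i = ?q \<or> h i = ?q \<and> i = ?p" by (simp add: doubleton_eq_iff)
        then show False using h(2) permutes_inj[OF p] by (metis add_eq_self_zero injD one_neq_zero)
      qed
      then show ?thesis
        using h(1) i hi pair_class_Suc[of a "h i" i j] by (auto simp: pair_stabiliser_def)
    qed
    then show ?thesis using p by (auto simp: pair_stabiliser_def)
  qed
  have move: "h ?p = ?p \<or> h ?p = ?q" if h: "h \<in> pair_stabiliser a b (Suc j)" for h
  proof -
    have "pair_class a (Suc j) (h ?p) = pair_class a (Suc j) ?p" "h ?p \<in> ?I"
      using h assms(1) permutes_in_image[of h ?I ?p] by (auto simp: pair_stabiliser_def)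
    moreover have "pair_class a j ?p = ?p" by (simp add: pair_class_def)
    moreover have "pair_class a j (h ?p) = ?p \<Longrightarrow> h ?p = ?p"
      using \<open>h ?p \<in> ?I\<close> by (auto simp: pair_class_def split: if_splits; presburger)
    ultimately show ?thesis using pair_class_Suc[of a "h ?p" ?p j] by (auto simp: doubleton_eq_iff)
  qed
  show "pair_stabiliser a b (Suc j) = pair_stabiliser a b j \<union> (\<lambda>h. h \<circ> s) ` pair_stabiliser a b j"
  proof (intro equalityI subsetI)
    fix h assume h: "h \<in> pair_stabiliser a b (Suc j)"
    show "h \<in> pair_stabiliser a b j \<union> (\<lambda>h. h \<circ> s) ` pair_stabiliser a b j"
    proof (cases "h ?p = ?p")
      case True
      then show ?thesis using down h by blast
    next
      case False
      then have hp: "h ?p = ?q" using move[OF h] by blast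
      have "h ?q = ?p"
      proof -
        have inj: "inj h" using h permutes_inj by (auto simp: pair_stabiliser_def)
        have "h ?q \<in> ?I" "pair_class a (Suc j) (h ?q) = pair_class a (Suc j) ?q"
          using h assms(1) permutes_in_image[of h ?I ?q] by (auto simp: pair_stabiliser_def)
        moreover have "pair_class a j ?q = ?q" by (simp add: pair_class_def)
        moreover have "pair_class a j (h ?q) = ?q \<Longrightarrow> h ?q = ?q"
          using \<open>h ?q \<in> ?I\<close> by (auto simp: pair_class_def split: if_splits; presburger)
        ultimately have "h ?q = ?q \<or> h ?q = ?p"
          using pair_class_Suc[of a "h ?q" ?q j] by (auto simp: doubleton_eq_iff)
        then show ?thesis using hp inj by (metis add_eq_self_zero injD one_neq_zero)
      qed
      then have "(h \<circ> s) ?p = ?p" by (simp add: s_def)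
      then have "h \<circ> s \<in> pair_stabiliser a b j" using down sub_s[OF h] by blast
      then show ?thesis using ss[of h] by (metis UnI2 image_eqI)
    qed
  next
    fix h assume "h \<in> pair_stabiliser a b j \<union> (\<lambda>h. h \<circ> s) ` pair_stabiliser a b j"
    then show "h \<in> pair_stabiliser a b (Suc j)" using sub sub_s by blast
  qed
  show "pair_stabiliser a b j \<inter> (\<lambda>h. h \<circ> s) ` pair_stabiliser a b j = {}"
  proof (rule ccontr)
    assume "pair_stabiliser a b j \<inter> (\<lambda>h. h \<circ> s) ` pair_stabiliser a b j \<noteq> {}"
    then obtain h where h: "h \<in> pair_stabiliser a b j" "h \<circ> s \<in> pair_stabiliser a b j" by blast
    from pair_stabiliser_fixes[OF h(1), of ?q] pair_stabiliser_fixes[OF h(2), of ?p]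
    show False by (simp add: s_def)
  qed
qed

text \<open>Let \<open>A\<close> be \<open>f\<close> times the sum over the smaller group. That the
  larger sums vanish means that \<open>A\<close> is unchanged by \<open>s\<close> on the right, for
  \<open>f\<close> and for its translate by \<open>s'\<close> alike. With
  \<open>c = s \<circ> s'\<close> this gives \<open>A c = A s' = A (c \<circ> c)\<close>, and the
  relation for \<open>c\<close> leaves \<open>A id = 0\<close>.\<close>

lemma pair_sum_step:
  fixes L :: "nat set"
  assumes L: "closed_letters m L"
    and cyc: "\<And>f :: (nat \<Rightarrow> nat) \<Rightarrow> 'k. \<And>\<sigma>. kills m a b L f \<Longrightarrow> \<sigma> permutes {a..<b} \<Longrightarrow>
        f \<sigma> + f (\<sigma> \<circ> cyc (a + 2 * j)) + f (\<sigma> \<circ> (cyc (a + 2 * j) \<circ> cyc (a + 2 * j))) = 0"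
    and j: "a + 2 * j + 2 < b"
    and Z: "\<And>f :: (nat \<Rightarrow> nat) \<Rightarrow> 'k. kills m a b L f \<Longrightarrow> (\<Sum>h\<in>pair_stabiliser a b (Suc j). f h) = 0"
    and f: "kills m a b L (f :: (nat \<Rightarrow> nat) \<Rightarrow> 'k)"
  shows "(\<Sum>h\<in>pair_stabiliser a b j. f h) = 0"
proof -
  let ?H = "pair_stabiliser a b j" and ?I = "{a..<b}"
  define p where "p = a + 2 * j"
  define s where "s = transpose p (p + 1)"
  define s' where "s' = transpose (p + 1) (p + 2)"
  have perm: "s permutes ?I" "s' permutes ?I"
    unfolding s_def s'_def p_def using j by (auto intro: permutes_swap_id)
  have c: "cyc p = s \<circ> s'" by (simp add: cyc_def s_def s'_def)
  have H: "h permutes ?I" if "h \<in> ?H" for h using that by (simp add: pair_stabiliser_def)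
  have finH: "finite ?H" by (rule finite_subset[OF _ finite_permutations[of ?I]]) (auto simp: pair_stabiliser_def)
  \<comment> \<open>The smaller group fixes everything from \<open>p\<close> on; the third position
    \<open>p + 2\<close> lies outside the pairs.\<close>
  have comm: "h \<circ> s = s \<circ> h" "h \<circ> s' = s' \<circ> h" if "h \<in> ?H" for h
  proof -
    have fixes_p: "h i = i" if "p \<le> i" for i
      using pair_stabiliser_fixes[OF \<open>h \<in> ?H\<close>] that by (simp add: p_def)
    have neq: "h i \<noteq> p + l" if "i \<noteq> p + l" for i l
      using fixes_p[of "p + l"] that permutes_inj[OF H[OF \<open>h \<in> ?H\<close>]] by (metis injD le_add1)
    show "h \<circ> s = s \<circ> h" "h \<circ> s' = s' \<circ> h"
      using fixes_p[of p] fixes_p[of "p + 1"] fixes_p[of "p + 2"] neq[of _ 0] neq[of _ 1] neq[of _ 2]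
      by (auto simp: s_def s'_def fun_eq_iff transpose_def)
  qed
  define A where "A g \<sigma> = (\<Sum>h\<in>?H. g (\<sigma> \<circ> h))" for g :: "(nat \<Rightarrow> nat) \<Rightarrow> 'k" and \<sigma>
  have As: "A g (\<sigma> \<circ> s) = A g \<sigma>" if g: "kills m a b L g" and sig: "\<sigma> permutes ?I" for g \<sigma>
  proof -
    have "0 = (\<Sum>h\<in>pair_stabiliser a b (Suc j). g (\<sigma> \<circ> h))"
      using Z[OF kills_left[OF g sig L]] by simp
    also have "\<dots> = A g \<sigma> + (\<Sum>h\<in>(\<lambda>h. h \<circ> s) ` ?H. g (\<sigma> \<circ> h))"
      using pair_stabiliser_Suc[of a j b] j finH
      by (simp add: A_def s_def p_def sum.union_disjoint)
    also have "(\<Sum>h\<in>(\<lambda>h. h \<circ> s) ` ?H. g (\<sigma> \<circ> h)) = (\<Sum>h\<in>?H. g (\<sigma> \<circ> (h \<circ> s)))"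
    proof (rule sum.reindex_cong[OF _ refl refl])
      have ss: "h \<circ> s \<circ> s = h" for h :: "nat \<Rightarrow> nat" by (simp add: s_def comp_assoc)
      show "inj_on (\<lambda>h. h \<circ> s) ?H" by (rule inj_on_inverseI[where g="\<lambda>h. h \<circ> s"]) (rule ss)
    qed
    also have "\<dots> = A g (\<sigma> \<circ> s)"
      unfolding A_def by (intro sum.cong refl) (simp only: comm(1) comp_assoc)
    finally show ?thesis by (metis add_eq_0_iff_eq)
  qed
  have A': "A (\<lambda>\<tau>. g (\<tau> \<circ> s')) \<sigma> = A g (\<sigma> \<circ> s')" for g \<sigma>
    unfolding A_def by (intro sum.cong refl) (simp only: comm(2) comp_assoc)
  have "A f id = 0"
  proof -
    have kA: "kills m a b L (A f)"
      unfolding A_def by (intro kills_sum kills_right f H)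
    have ids: "id permutes ?I" by (rule permutes_id)
    have "A f (s' ) = A f (s \<circ> s')"
      using As[OF kills_right[OF f perm(2)] ids] unfolding A' by simp
    moreover have "A f (s') = A f (s' \<circ> s)" using As[OF f perm(2)] by simp
    moreover have "s \<circ> s' \<circ> (s \<circ> s') = s' \<circ> s"
      by (auto simp: s_def s'_def transpose_def fun_eq_iff)
    moreover have "A f id + A f (s \<circ> s') + A f (s \<circ> s' \<circ> (s \<circ> s')) = 0"
      using cyc[OF kA ids] unfolding p_def[symmetric] c by simp
    ultimately show ?thesis by (simp add: add.assoc)
  qed
  then show ?thesis by (simp add: A_def)
qed

text \<open>The disjunct \<open>b \<le> a\<close> admits the empty block, for which the other
  inequality would still ask for a letter.\<close>

theorem kills_eq_0:
  fixes f :: "(nat \<Rightarrow> nat) \<Rightarrow> 'k"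
  assumes "b - a \<le> m + 4 * n" "1 + (b - a) div 2 \<le> m + 2 * n \<or> b \<le> a"
    and "kills m a b {..<m + 2 * n} f" "\<sigma> permutes {a..<b}"
  shows "f \<sigma> = 0"
  using assms
proof (induction n arbitrary: a f \<sigma>)
  case (0 a f \<sigma>)
  \<comment> \<open>Without copies of P there are at least as many letters as positions, and a word
    without repetitions has trivial stabiliser.\<close>
  have "(\<Sum>h | h permutes {a..<b} \<and> (\<forall>i\<in>{a..<b}. id (h i) = id i). f (\<sigma> \<circ> h)) = 0"
    by (rule kills_stabiliser_sum[OF kills_left[OF 0(3,4)]]) (use 0(1) closed_letters_lessThan[of m 0] in auto)
  moreover have "{h. h permutes {a..<b} \<and> (\<forall>i\<in>{a..<b}. id (h i) = id i)} = {id}"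
  proof -
    have "h = id" if "h permutes {a..<b}" "\<forall>i\<in>{a..<b}. h i = i" for h
    proof
      fix i show "h i = id i" using that permutes_not_in[OF that(1), of i] by (cases "i \<in> {a..<b}") auto
    qed
    then show ?thesis by (auto simp: permutes_id)
  qed
  ultimately show ?case by simp
next
  case (Suc n a f \<sigma>)
  let ?L = "{..<m + 2 * Suc n}" and ?I = "{a..<b}"
  have L: "closed_letters m ?L" by (rule closed_letters_lessThan)
  have cyc: "g \<tau> + g (\<tau> \<circ> cyc p) + g (\<tau> \<circ> (cyc p \<circ> cyc p)) = 0"
    if g: "kills m a b ?L g" and t: "\<tau> permutes ?I" and p: "a \<le> p" "p + 2 < b" for g :: "(nat \<Rightarrow> nat) \<Rightarrow> 'k" and \<tau> p
  proof (rule kills_cyc[OF _ L p g t])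
    fix g :: "(nat \<Rightarrow> nat) \<Rightarrow> 'k" assume g: "kills m a b ?L g"
    show "g id + g (cyc a) + g (cyc a \<circ> cyc a) = 0"
    proof (rule kills_cyc_first[OF g])
      fix g :: "(nat \<Rightarrow> nat) \<Rightarrow> 'k" assume le: "a + 4 \<le> b" and g: "kills m (a + 4) b {..<m + 2 * n} g"
      show "g id = 0"
        by (rule Suc.IH[OF _ _ g permutes_id]) (use Suc.prems(1,2) le in auto)
    qed (use p in simp)
  qed
  \<comment> \<open>The largest number of pairs that leaves a position free. By
    \<open>card_pair_class\<close> the word then takes \<open>1 + (b - a) div 2\<close> letters,
    just what the second inequality provides; from there \<open>j\<close> is lowered to 0.\<close>
  define j0 where "j0 = (b - a - 1) div 2"
  have Z: "(\<Sum>h\<in>pair_stabiliser a b j. g h) = 0" if "j \<le> j0" "kills m a b ?L g" for j and g :: "(nat \<Rightarrow> nat) \<Rightarrow> 'k"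
    using that
  proof (induction "j0 - j" arbitrary: j g)
    case 0
    then have j: "j = j0" by simp
    have "card (pair_class a j ` ?I) \<le> m + 2 * Suc n"
    proof (cases "a < b")
      case True
      then show ?thesis using card_pair_class[of a j b] Suc.prems(2) unfolding j j0_def by linarith
    qed simp
    from kills_stabiliser_sum[OF 0(3) this] show ?case by (simp add: pair_stabiliser_def)
  next
    case (Suc k)
    show ?case
    proof (rule pair_sum_step[OF L _ _ _ Suc.prems(2)])
      show lt: "a + 2 * j + 2 < b" using Suc.hyps(2) unfolding j0_def by linarith
      show "g \<tau> + g (\<tau> \<circ> cyc (a + 2 * j)) + g (\<tau> \<circ> (cyc (a + 2 * j) \<circ> cyc (a + 2 * j))) = 0"
        if "kills m a b ?L g" "\<tau> permutes ?I" for g :: "(nat \<Rightarrow> nat) \<Rightarrow> 'k" and \<tau>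
        by (rule cyc[OF that]) (use lt in auto)
      show "(\<Sum>h\<in>pair_stabiliser a b (Suc j). g h) = 0" if "kills m a b ?L g" for g :: "(nat \<Rightarrow> nat) \<Rightarrow> 'k"
        by (rule Suc.hyps(1)[OF _ _ that]) (use Suc.hyps(2) in auto)
    qed
  qed
  have "pair_stabiliser a b 0 = {id}"
    using pair_stabiliser_fixes[of _ a b 0] permutes_not_in
    by (fastforce simp: pair_stabiliser_def permutes_id fun_eq_iff)
  moreover have "(\<Sum>h\<in>pair_stabiliser a b 0. f (\<sigma> \<circ> h)) = 0"
    by (rule Z[OF _ kills_left[OF Suc.prems(3,4) L]]) simp
  ultimately show ?case by simp
qed

end

section \<open>Expansion of tensors in basis words\<close>

text \<open>Words are infinite, so the values off \<open>I\<close> are pinned to those of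
  \<open>w\<close>; for finite \<open>I\<close> and \<open>L\<close> this leaves finitely many words
  to sum over.\<close>

definition words_on :: "nat set \<Rightarrow> nat set \<Rightarrow> (nat \<Rightarrow> nat) \<Rightarrow> (nat \<Rightarrow> nat) set" where
  "words_on I L w = {u. (\<forall>i\<in>I. u i \<in> L) \<and> (\<forall>i. i \<notin> I \<longrightarrow> u i = w i)}"

definition word_indicator :: "nat set \<Rightarrow> (nat \<Rightarrow> nat) \<Rightarrow> (nat \<Rightarrow> nat) \<Rightarrow> 'k::field" where
  "word_indicator I u v = (if \<forall>i\<in>I. v i = u i then 1 else 0)"

lemma finite_words_on:
  assumes "finite I" "finite L" shows "finite (words_on I L w)"
proof -
  have "words_on I L w \<subseteq> (\<lambda>f. override_on w f I) ` (PiE I (\<lambda>_. L))"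
  proof
    fix u assume u: "u \<in> words_on I L w"
    then have "u = override_on w (restrict u I) I"
      by (auto simp: words_on_def override_on_def fun_eq_iff)
    then show "u \<in> (\<lambda>f. override_on w f I) ` (PiE I (\<lambda>_. L))"
      using u by (intro image_eqI[of _ _ "restrict u I"]) (auto simp: words_on_def)
  qed
  then show ?thesis by (rule finite_subset) (intro finite_imageI finite_PiE assms)
qed

lemma tact_expand:
  fixes \<phi> :: "(nat \<Rightarrow> nat) \<Rightarrow> 'k::field"
  assumes s: "\<sigma> permutes {a..<b}" and L: "closed_letters m L" "finite L" and w: "\<forall>i\<in>{a..<b}. w i \<in> L"
  shows "tact m \<sigma> \<phi> w = (\<Sum>u\<in>words_on {a..<b} L w. \<phi> u * tact m \<sigma> (word_indicator {a..<b} u) w)"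
proof -
  let ?I = "{a..<b}" and ?U = "words_on {a..<b} L w"
  have fin: "finite ?U" using L(2) by (simp add: finite_words_on)
  have ww: "override_on w w ?I = w" by (simp add: override_on_def fun_eq_iff)
  have "tact m \<sigma> \<phi> w = tact m \<sigma> (\<lambda>v. \<phi> (override_on w v ?I)) w"
    using tact_override[OF s, of m \<phi> w w] ww by simp
  also have "\<dots> = tact m \<sigma> (\<lambda>v. \<Sum>u\<in>?U. \<phi> u * word_indicator ?I u v) w"
  proof (rule tact_local[OF s L(1) w])
    fix v assume v: "\<forall>i\<in>?I. v i \<in> L"
    let ?v = "override_on w v ?I"
    have "?v \<in> ?U" using v by (simp add: words_on_def override_on_def)
    have "(\<Sum>u\<in>?U. \<phi> u * word_indicator ?I u v) = (\<Sum>u\<in>?U. if u = ?v then \<phi> u else 0)"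
    proof (intro sum.cong refl)
      fix u assume "u \<in> ?U"
      then have "(\<forall>i\<in>?I. v i = u i) \<longleftrightarrow> u = ?v"
        by (auto simp: words_on_def override_on_def fun_eq_iff)
      then show "\<phi> u * word_indicator ?I u v = (if u = ?v then \<phi> u else 0)"
        by (simp only: word_indicator_def) simp
    qed
    then show "\<phi> ?v = (\<Sum>u\<in>?U. \<phi> u * word_indicator ?I u v)"
      using \<open>?v \<in> ?U\<close> fin by simp
  qed
  also have "\<dots> = (\<Sum>u\<in>?U. \<phi> u * tact m \<sigma> (word_indicator ?I u) w)"
    by (simp add: tact_sum[OF s fin] tact_scale[OF s])
  finally show ?thesis .
qed

text \<open>A variant of \<open>tact_leading\<close> for tensors whose vanishing in lower degree is
  known only at words over \<open>L\<close>, as happens inside inductions on the degree.\<close>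

lemma tact_leading_letters:
  fixes \<phi> :: "(nat \<Rightarrow> nat) \<Rightarrow> 'k::field"
  assumes s: "\<sigma> permutes {a..<b}" and L: "closed_letters m L" and w: "\<forall>i\<in>{a..<b}. w i \<in> L"
    and van: "\<And>v. \<forall>i\<in>{a..<b}. v i \<in> L \<Longrightarrow> delta_count m {a..<b} v < delta_count m {a..<b} w \<Longrightarrow> \<phi> v = 0"
  shows "tact m \<sigma> \<phi> w = \<phi> (w \<circ> \<sigma>)"
proof -
  let ?\<phi> = "\<lambda>w. if \<forall>i\<in>{a..<b}. w i \<in> L then \<phi> w else 0"
  have "tact m \<sigma> \<phi> w = tact m \<sigma> ?\<phi> w" by (rule tact_restrict[OF s L w, symmetric])
  also have "\<dots> = ?\<phi> (w \<circ> \<sigma>)"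
    by (rule tact_leading[OF s, of m "delta_count m {a..<b} w"]) (use van in \<open>auto simp: vanishes_below_def\<close>)
  also have "\<dots> = \<phi> (w \<circ> \<sigma>)"
  proof -
    have "\<forall>i\<in>{a..<b}. (w \<circ> \<sigma>) i \<in> L" using w permutes_in_image[OF s] by auto
    then show ?thesis by (simp only: if_P)
  qed
  finally show ?thesis .
qed

lemma twists_no_delta:
  assumes "finite S" "\<And>A. A \<in> S \<Longrightarrow> \<exists>i\<in>A. \<not> is_delta m (v i)"
  shows "twists m S \<phi> v = \<phi> v"
  using assms
proof (induction S)
  case (insert A S)
  then have "\<not> (\<forall>i\<in>A. is_delta m (v i))" "twists m S \<phi> v = \<phi> v" by blast+
  then show ?case by (simp only: twists_insert[OF insert.hyps] twist_def delta_at_def if_False add_0_right)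
qed simp

lemma inversions_adjacent: "inversions (transpose p (Suc p)) = {{p, Suc p}}"
proof -
  have "{i, j} = {p, Suc p}" if "i < j" "transpose p (Suc p) j < transpose p (Suc p) i" for i j
    using that by (auto simp: transpose_def split: if_splits)
  then have "inversions (transpose p (Suc p)) \<subseteq> {{p, Suc p}}" unfolding inversions_def by blast
  moreover have "{p, Suc p} \<in> inversions (transpose p (Suc p))"
    by (simp add: doubleton_in_inversions)
  ultimately show ?thesis by blast
qed

lemma tact_adjacent:
  "tact m (transpose p (Suc p)) \<phi> w =
    \<phi> (w \<circ> transpose p (Suc p)) + delta_at m {p, Suc p} \<phi> (w \<circ> transpose p (Suc p))"
  by (simp add: tact_def inversions_adjacent twists_insert[of "{}", simplified] twist_def)

text \<open>\<open>P\<close> selects one element from each pair \<open>x\<close>,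
  \<open>h x\<close>.\<close>

lemma sum_half:
  fixes f :: "'b \<Rightarrow> 'a::comm_monoid_add"
  assumes "finite S" "\<And>x. x \<in> S \<Longrightarrow> h x \<in> S" "\<And>x. x \<in> S \<Longrightarrow> h (h x) = x"
    "\<And>x. x \<in> S \<Longrightarrow> P (h x) \<longleftrightarrow> \<not> P x"
  shows "sum f S = (\<Sum>x | x \<in> S \<and> P x. f x + f (h x))"
proof -
  have "sum f S = sum f {x \<in> S. P x} + sum f {x \<in> S. \<not> P x}"
    using assms(1) by (subst sum.union_disjoint[symmetric]) (auto intro!: sum.cong)
  also have "sum f {x \<in> S. \<not> P x} = (\<Sum>x | x \<in> S \<and> P x. f (h x))"
    by (rule sum.reindex_bij_witness[where i=h and j=h]) (use assms in auto)
  finally show ?thesis by (simp add: sum.distrib)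
qed

lemma permutes_extend_injection:
  assumes "finite S" "inj_on f A" "A \<subseteq> S" "f ` A \<subseteq> S"
  obtains g where "g permutes S" "\<And>x. x \<in> A \<Longrightarrow> g x = f x"
proof -
  have "card (S - A) = card (S - f ` A)"
    using assms by (simp add: card_Diff_subset finite_subset card_image)
  then obtain h where h: "bij_betw h (S - A) (S - f ` A)"
    using assms(1) by (meson finite_Diff finite_same_card_bij)
  let ?g = "\<lambda>x. if x \<in> A then f x else if x \<in> S then h x else x"
  have "bij_betw (\<lambda>x. if x \<in> A then f x else h x) (A \<union> (S - A)) (f ` A \<union> (S - f ` A))"
    by (rule bij_betw_disjoint_Un) (use assms h in \<open>auto simp: bij_betw_def\<close>)
  then have "bij_betw (\<lambda>x. if x \<in> A then f x else h x) S S"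
    using assms by (simp add: Un_absorb1)
  then have "bij_betw ?g S S" by (rule bij_betw_cong[THEN iffD1, rotated]) auto
  then have "?g permutes S" by (rule bij_imp_permutes) (use assms(3) in auto)
  then show ?thesis by (rule that) simp
qed

text \<open>Brings the repeated letters of a word to the first positions.\<close>

lemma permutes_to_front:
  assumes "finite P" "P \<subseteq> {0..<d}" "l \<le> card P"
  obtains g where "g permutes {0..<d::nat}" "\<And>i. i < l \<Longrightarrow> g i \<in> P"
proof -
  have "card {..<l} \<le> card P" using assms by simp
  then obtain f where f: "f ` {..<l} \<subseteq> P" "inj_on f {..<l}"
    using card_le_inj[of "{..<l}" P] assms(1) by auto
  have "l \<le> d" using assms card_mono[OF _ assms(2)] by simp
  then have "{..<l} \<subseteq> {0..<d}" by auto
  then obtain g where "g permutes {0..<d}" "\<And>x. x \<in> {..<l} \<Longrightarrow> g x = f x"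
    by (rule permutes_extend_injection[OF finite_atLeastLessThan f(2)]) (use f(1) assms(2) in auto)
  then show ?thesis using f(1) that by force
qed

section \<open>The sum of all permutations beyond capacity\<close>

context char_two
begin

definition norm_tensor :: "nat \<Rightarrow> nat \<Rightarrow> ((nat \<Rightarrow> nat) \<Rightarrow> 'k) \<Rightarrow> (nat \<Rightarrow> nat) \<Rightarrow> 'k" where
  "norm_tensor m d \<phi> w = (\<Sum>\<sigma> | \<sigma> permutes {0..<d}. tact m \<sigma> \<phi> w)"

lemma norm_tensor_invariant:
  assumes g: "g permutes {0..<d}"
  shows "tact m g (norm_tensor m d \<phi>) = norm_tensor m d \<phi>"
proof
  fix w
  have "tact m g (norm_tensor m d \<phi>) w = (\<Sum>\<sigma> | \<sigma> permutes {0..<d}. tact m (g \<circ> \<sigma>) \<phi> w)"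
    unfolding norm_tensor_def tact_sum[OF g finite_permutations[OF finite_atLeastLessThan]]
    by (intro sum.cong refl) (simp add: tact_comp[OF g])
  also have "\<dots> = norm_tensor m d \<phi> w"
    unfolding norm_tensor_def by (rule setum_permutations_compose_left[OF g, symmetric])
  finally show "tact m g (norm_tensor m d \<phi>) w = norm_tensor m d \<phi> w" .
qed

text \<open>Swapping the first two positions fixes \<open>w\<close>, and the correction is zero
  because the letter is no \<delta>-image; so \<open>\<sigma>\<close> and its product with the swap
  contribute equally.\<close>

lemma norm_tensor_two_equal:
  assumes "2 \<le> d" "w 0 = w 1" "\<not> is_delta m (w 0)"
  shows "norm_tensor m d \<phi> w = 0"
  unfolding norm_tensor_def
proof (rule sum_involution_eq_0[where h="\<lambda>\<sigma>. transpose 0 (Suc 0) \<circ> \<sigma>"])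
  let ?s = "transpose 0 (Suc 0)"
  have s: "?s permutes {0..<d}" by (rule permutes_swap_id) (use assms in auto)
  fix \<sigma> assume "\<sigma> \<in> {\<sigma>. \<sigma> permutes {0..<d}}"
  then have p: "\<sigma> permutes {0..<d}" by simp
  show "?s \<circ> \<sigma> \<in> {\<sigma>. \<sigma> permutes {0..<d}}" using permutes_compose[OF p s] by simp
  show "?s \<circ> (?s \<circ> \<sigma>) = \<sigma>" by (simp add: comp_assoc[symmetric])
  show "?s \<circ> \<sigma> \<noteq> \<sigma>"
  proof
    assume "?s \<circ> \<sigma> = \<sigma>"
    then have "?s (\<sigma> (inv_into UNIV \<sigma> 0)) = \<sigma> (inv_into UNIV \<sigma> 0)" by (metis o_apply)
    then show False using permutes_inverses(1)[OF p] by simp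
  qed
  have "w \<circ> ?s = w" using assms(2) by (auto simp: fun_eq_iff transpose_def)
  then show "tact m (?s \<circ> \<sigma>) \<phi> w = tact m \<sigma> \<phi> w"
    using assms(3) by (simp add: tact_comp[OF s p] tact_adjacent delta_at_def)
qed (simp add: finite_permutations)

text \<open>For two equal \<delta>-letters the plain terms cancel, and the correction, which lowers
  both letters, remains.\<close>

lemma tact_adjacent_equal:
  fixes \<phi> :: "(nat \<Rightarrow> nat) \<Rightarrow> 'k"
  assumes "w p = w (Suc p)" "is_delta m (w p)"
  shows "\<phi> w + tact m (transpose p (Suc p)) \<phi> w = \<phi> (lower {p, Suc p} w)"
proof -
  have "w \<circ> transpose p (Suc p) = w" using assms(1) by (auto simp: fun_eq_iff transpose_def)
  then show ?thesis using assms by (simp add: tact_adjacent delta_at_def)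
qed

text \<open>Pairing by the swap of positions 0, 1 and then by that of 2, 3 lowers all four letters.
  The new letter is no \<delta>-image, so the double transposition \<open>u\<close> acts on the
  lowered word without corrections and pairs off the remaining terms.\<close>

lemma norm_tensor_four_equal:
  assumes d: "4 \<le> d" and eq: "w 1 = w 0" "w 2 = w 0" "w 3 = w 0" and delta: "is_delta m (w 0)"
  shows "norm_tensor m d \<phi> w = 0"
proof -
  let ?S = "{\<sigma>. \<sigma> permutes {0..<d}}"
  define s where "s = transpose 0 (Suc 0 :: nat)"
  define s' where "s' = transpose 2 (Suc 2 :: nat)"
  define u where "u = transpose 0 2 \<circ> transpose 1 (3 :: nat)"
  have perm: "s permutes {0..<d}" "s' permutes {0..<d}" "u permutes {0..<d}"
    unfolding s_def s'_def u_def using d by (auto intro!: permutes_compose permutes_swap_id)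
  have sq: "s \<circ> s = id" "s' \<circ> s' = id" "u \<circ> u = id"
    by (auto simp: s_def s'_def u_def fun_eq_iff transpose_def)
  \<comment> \<open>Chooses one permutation from each pair: \<open>P 0\<close> for \<open>s\<close>,
    \<open>P 2\<close> for \<open>s'\<close>. The involution \<open>u\<close> exchanges the two
    conditions, hence preserves their conjunction.\<close>
  define P where "P r \<sigma> \<longleftrightarrow> inv_into UNIV \<sigma> r < inv_into UNIV \<sigma> (Suc r)" for r :: nat and \<sigma> :: "nat \<Rightarrow> nat"
  have inv_comp: "inv_into UNIV (\<tau> \<circ> \<sigma>) i = inv_into UNIV \<sigma> (inv_into UNIV \<tau> i)"
    if "\<tau> permutes {0..<d}" "\<sigma> permutes {0..<d}" for \<tau> \<sigma> i
    using that by (simp add: o_inv_distrib permutes_bij)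
  have inv_self: "inv_into UNIV s = s" "inv_into UNIV s' = s'" "inv_into UNIV u = u"
    using sq by (metis inv_unique_comp)+
  have inv_neq: "inv_into UNIV \<sigma> i = inv_into UNIV \<sigma> j \<longleftrightarrow> i = j" if "\<sigma> permutes {0..<d}" for \<sigma> i j
    using that by (metis permutes_inverses(1))
  have Ps: "P 0 (s \<circ> \<sigma>) \<longleftrightarrow> \<not> P 0 \<sigma>" "P 2 (s' \<circ> \<sigma>) \<longleftrightarrow> \<not> P 2 \<sigma>" "P 0 (s' \<circ> \<sigma>) \<longleftrightarrow> P 0 \<sigma>"
      "P 0 (u \<circ> \<sigma>) \<longleftrightarrow> P 2 \<sigma>" "P 2 (u \<circ> \<sigma>) \<longleftrightarrow> P 0 \<sigma>" if p: "\<sigma> permutes {0..<d}" for \<sigma>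
    using inv_neq[OF p, of 0 1] inv_neq[OF p, of 2 3]
    unfolding P_def inv_comp[OF perm(1) p] inv_comp[OF perm(2) p] inv_comp[OF perm(3) p] inv_self
    by (auto simp: s_def s'_def u_def transpose_def)
  have pc: "\<tau> \<circ> \<sigma> \<in> ?S" if "\<tau> permutes {0..<d}" "\<sigma> \<in> ?S" for \<tau> \<sigma>
    using that permutes_compose by auto
  have cancel: "\<tau> \<circ> (\<tau> \<circ> \<sigma>) = \<sigma>" if "\<tau> \<circ> \<tau> = id" for \<tau> \<sigma> :: "nat \<Rightarrow> nat"
    using that by (simp only: comp_assoc[symmetric] id_comp)
  have fin: "finite ?S" by (simp add: finite_permutations)
  let ?w1 = "lower {0, Suc 0} w" and ?w2 = "lower {2, Suc 2} (lower {0, Suc 0} w)"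
  have "norm_tensor m d \<phi> w = (\<Sum>\<sigma> | \<sigma> \<in> ?S \<and> P 0 \<sigma>. tact m \<sigma> \<phi> w + tact m (s \<circ> \<sigma>) \<phi> w)"
    unfolding norm_tensor_def
    by (rule sum_half[where h="\<lambda>\<sigma>. s \<circ> \<sigma>", OF fin pc[OF perm(1)] cancel[OF sq(1)]]) (use Ps in auto)
  also have "\<dots> = (\<Sum>\<sigma> | \<sigma> \<in> ?S \<and> P 0 \<sigma>. tact m \<sigma> \<phi> ?w1)"
    by (intro sum.cong refl)
      (use eq delta in \<open>simp add: tact_comp[OF perm(1)], simp add: s_def tact_adjacent_equal\<close>)
  also have "\<dots> = (\<Sum>\<sigma> | \<sigma> \<in> {\<sigma>. \<sigma> \<in> ?S \<and> P 0 \<sigma>} \<and> P 2 \<sigma>. tact m \<sigma> \<phi> ?w1 + tact m (s' \<circ> \<sigma>) \<phi> ?w1)"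
    by (rule sum_half[where h="\<lambda>\<sigma>. s' \<circ> \<sigma>", OF _ _ cancel[OF sq(2)]]) (use Ps fin pc[OF perm(2)] in auto)
  also have "\<dots> = (\<Sum>\<sigma> | \<sigma> \<in> {\<sigma>. \<sigma> \<in> ?S \<and> P 0 \<sigma>} \<and> P 2 \<sigma>. tact m \<sigma> \<phi> ?w2)"
  proof (intro sum.cong refl)
    have "?w1 2 = ?w1 (Suc 2)" "is_delta m (?w1 2)"
      using eq delta by (simp_all add: lower_def numeral_3_eq_3 numeral_2_eq_2)
    moreover fix \<sigma> assume "\<sigma> \<in> {\<sigma> \<in> {\<sigma>. \<sigma> \<in> ?S \<and> P 0 \<sigma>}. P 2 \<sigma>}"
    then have p: "\<sigma> permutes {0..<d}" by simp
    ultimately show "tact m \<sigma> \<phi> ?w1 + tact m (s' \<circ> \<sigma>) \<phi> ?w1 = tact m \<sigma> \<phi> ?w2"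
      unfolding tact_comp[OF perm(2) p] unfolding s'_def by (intro tact_adjacent_equal)
  qed
  also have "\<dots> = 0"
  proof (rule sum_involution_eq_0[where h="\<lambda>\<sigma>. u \<circ> \<sigma>"])
    fix \<sigma> assume a: "\<sigma> \<in> {\<sigma> \<in> {\<sigma>. \<sigma> \<in> ?S \<and> P 0 \<sigma>}. P 2 \<sigma>}"
    then have p: "\<sigma> permutes {0..<d}" by simp
    show "u \<circ> \<sigma> \<in> {\<sigma> \<in> {\<sigma>. \<sigma> \<in> ?S \<and> P 0 \<sigma>}. P 2 \<sigma>}" using a Ps[OF p] pc[OF perm(3)] by auto
    show "u \<circ> (u \<circ> \<sigma>) = \<sigma>" by (rule cancel[OF sq(3)])
    show "u \<circ> \<sigma> \<noteq> \<sigma>"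
    proof
      assume "u \<circ> \<sigma> = \<sigma>"
      then have "u (\<sigma> (inv_into UNIV \<sigma> 0)) = \<sigma> (inv_into UNIV \<sigma> 0)" by (metis o_apply)
      then show False using permutes_inverses(1)[OF p] by (simp add: u_def transpose_def)
    qed
    have w2: "?w2 i = w 0 - 1" if "i < 4" for i
    proof -
      have "i = 0 \<or> i = 1 \<or> i = 2 \<or> i = 3" using that by auto
      then show ?thesis using eq by (auto simp: lower_def)
    qed
    have w2u: "?w2 \<circ> u = ?w2"
    proof
      fix i
      show "(?w2 \<circ> u) i = ?w2 i"
      proof (cases "i < 4")
        case True
        then have "u i < 4" by (auto simp: u_def transpose_def)
        then show ?thesis using w2 True by simp
      next
        case False
        then have "u i = i" by (auto simp: u_def transpose_def)
        then show ?thesis by simp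
      qed
    qed
    have u4: "u permutes {0..<4}" unfolding u_def by (auto intro!: permutes_compose permutes_swap_id)
    have "tact m u \<theta> ?w2 = \<theta> ?w2" for \<theta> :: "(nat \<Rightarrow> nat) \<Rightarrow> 'k"
      unfolding tact_def w2u
    proof (rule twists_no_delta[OF finite_inversions[OF u4]])
      fix A assume A: "A \<in> inversions u"
      then have "A \<subseteq> {0..<4}" "A \<noteq> {}" using inversions_subset[OF u4] empty_notin_inversions by auto
      then obtain i where "i \<in> A" "i < 4" by force
      then show "\<exists>i\<in>A. \<not> is_delta m (?w2 i)" using w2 is_delta_pred[OF delta] by metis
    qed
    then show "tact m (u \<circ> \<sigma>) \<phi> ?w2 = tact m \<sigma> \<phi> ?w2" by (simp add: tact_comp[OF perm(3) p])
  qed (use fin in auto)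
  finally show ?thesis .
qed

text \<open>Induction on the number of \<delta>-letters: if all words of lower degree give zero, the
  value at \<open>w\<close> does not change when its positions are permuted. By pigeonhole some
  letter exceeds its capacity, 1 or 3, and is moved to the front.\<close>

theorem norm_kills:
  assumes d: "m + 4 * n < d"
  shows "kills m 0 d {..<m + 2 * n} (\<lambda>\<sigma>. 1 :: 'k)"
proof -
  let ?I = "{0..<d}" and ?L = "{..<m + 2 * n}"
  have L: "closed_letters m ?L" by (rule closed_letters_lessThan)
  have "norm_tensor m d \<phi> w = 0" if "\<forall>i\<in>?I. w i \<in> ?L" for \<phi> w
    using that
  proof (induction "delta_count m ?I w" arbitrary: w rule: less_induct)
    case less
    have move: "norm_tensor m d \<phi> w = norm_tensor m d \<phi> (w \<circ> g)" if g: "g permutes ?I" for g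
    proof -
      have "norm_tensor m d \<phi> w = tact m g (norm_tensor m d \<phi>) w" by (simp add: norm_tensor_invariant[OF g])
      also have "\<dots> = norm_tensor m d \<phi> (w \<circ> g)"
        by (rule tact_leading_letters[OF g L less.prems]) (rule less.hyps)
      finally show ?thesis .
    qed
    define occ where "occ l = {i \<in> ?I. w i = l}" for l
    have "\<exists>l<m + 2 * n. (if is_delta m l then 3 else 1) < card (occ l)"
    proof (rule ccontr)
      assume "\<not> ?thesis"
      then have le: "card (occ l) \<le> (if is_delta m l then 3 else 1)" if "l < m + 2 * n" for l
        using that by (meson leI)
      have "?I = (\<Union>l\<in>?L. occ l)" using less.prems by (auto simp: occ_def)
      then have "d = card (\<Union>l\<in>?L. occ l)" by (metis card_atLeastLessThan diff_zero)
      also have "\<dots> \<le> (\<Sum>l\<in>?L. card (occ l))" by (rule card_UN_le) simp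
      also have "\<dots> \<le> (\<Sum>l\<in>?L. if is_delta m l then 3 else 1)" by (rule sum_mono) (use le in auto)
      \<comment> \<open>Each copy of P adds a capacity of 1 + 3.\<close>
      also have "(\<Sum>l<m + 2 * n. if is_delta m l then 3 else 1) = m + 4 * n"
      proof (induction n)
        case 0
        have "(\<Sum>l<m. if is_delta m l then 3 else 1) = (\<Sum>l<m. 1 :: nat)"
          by (intro sum.cong refl) (use is_delta_pos in force)
        then show ?case by simp
      next
        case (Suc n)
        have "\<not> is_delta m (m + 2 * n)" "is_delta m (Suc (m + 2 * n))" by (simp_all add: is_delta_def)
        then show ?case using Suc by simp
      qed
      finally show False using d by simp
    qed
    then obtain l where l: "l < m + 2 * n" "(if is_delta m l then 3 else 1) < card (occ l)" by blast
    have occ: "finite (occ l)" "occ l \<subseteq> ?I" by (auto simp: occ_def)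
    have cd: "card (occ l) \<le> d" using card_mono[OF _ occ(2)] by simp
    show ?case
    proof (cases "is_delta m l")
      case True
      then have "4 \<le> card (occ l)" using l(2) by simp
      from permutes_to_front[OF occ this] obtain g where g: "g permutes ?I" "\<And>i. i < 4 \<Longrightarrow> g i \<in> occ l" by blast
      have "(w \<circ> g) i = l" if "i < 4" for i using g(2)[OF that] by (simp add: occ_def)
      then have "norm_tensor m d \<phi> (w \<circ> g) = 0"
        using \<open>4 \<le> card (occ l)\<close> cd True by (intro norm_tensor_four_equal) auto
      then show ?thesis using move[OF g(1)] by simp
    next
      case False
      then have "2 \<le> card (occ l)" using l(2) by simp
      from permutes_to_front[OF occ this] obtain g where g: "g permutes ?I" "\<And>i. i < 2 \<Longrightarrow> g i \<in> occ l" by blast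
      have "(w \<circ> g) i = l" if "i < 2" for i using g(2)[OF that] by (simp add: occ_def)
      then have "norm_tensor m d \<phi> (w \<circ> g) = 0"
        using \<open>2 \<le> card (occ l)\<close> cd False by (intro norm_tensor_two_equal) auto
      then show ?thesis using move[OF g(1)] by simp
    qed
  qed
  then show ?thesis by (simp add: kills_def norm_tensor_def)
qed

text \<open>An element that is killed by \<open>1 + c + c\<^sup>2\<close> on both sides, for all \<open>3\<close>-cycles \<open>c\<close>, has
  no room to act when no letter is repeated three times, except on words using each letter twice.\<close>

context
  fixes n d :: nat and f :: "(nat \<Rightarrow> nat) \<Rightarrow> 'k"
  assumes d: "d = 4 * n"
    and left: "\<And>\<sigma> c. \<sigma> permutes {0..<d} \<Longrightarrow> c permutes {0..<d} \<Longrightarrow> c \<circ> c \<circ> c = id \<Longrightarrow>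
      \<exists>p q r. p \<noteq> q \<and> q \<noteq> r \<and> p \<noteq> r \<and> c = transpose p q \<circ> transpose q r \<Longrightarrow>
      f \<sigma> + f (c \<circ> \<sigma>) + f (c \<circ> c \<circ> \<sigma>) = 0"
    and right: "\<And>\<sigma> c. \<sigma> permutes {0..<d} \<Longrightarrow> c permutes {0..<d} \<Longrightarrow> c \<circ> c \<circ> c = id \<Longrightarrow>
      \<exists>p q r. p \<noteq> q \<and> q \<noteq> r \<and> p \<noteq> r \<and> c = transpose p q \<circ> transpose q r \<Longrightarrow>
      f \<sigma> + f (\<sigma> \<circ> c) + f (\<sigma> \<circ> (c \<circ> c)) = 0"
    and plain: "\<And>(\<phi> :: (nat \<Rightarrow> nat) \<Rightarrow> 'k) w. \<forall>i\<in>{0..<d}. w i < 2 * n \<Longrightarrow>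
      (\<Sum>\<sigma> | \<sigma> permutes {0..<d}. f \<sigma> * \<phi> (w \<circ> \<sigma>)) = 0"
begin

private definition F :: "((nat \<Rightarrow> nat) \<Rightarrow> 'k) \<Rightarrow> (nat \<Rightarrow> nat) \<Rightarrow> 'k" where
  "F \<phi> w = (\<Sum>\<sigma> | \<sigma> permutes {0..<d}. f \<sigma> * tact 0 \<sigma> \<phi> w)"

private abbreviation "I \<equiv> {0..<d}"
private abbreviation "L \<equiv> {..<2 * n}"

private lemma L: "closed_letters 0 L"
  using closed_letters_lessThan[of 0 n] by simp

private lemma fin: "finite {\<sigma>. \<sigma> permutes I}"
  by (simp add: finite_permutations)

private lemma F_add: "F (\<lambda>w. \<phi> w + \<psi> w) w = F \<phi> w + F \<psi> w"
  unfolding F_def sum.distrib[symmetric]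
  by (intro sum.cong refl) (simp add: tact_add distrib_left)

private lemma three_cycle:
  assumes "p \<in> I" "q \<in> I" "r \<in> I" "p \<noteq> q" "q \<noteq> r" "p \<noteq> r"
    and eq: "w p = w q" "w q = (w r :: nat)"
  obtains c where "c permutes I" "c \<circ> c \<circ> c = id"
    "\<exists>p q r. p \<noteq> q \<and> q \<noteq> r \<and> p \<noteq> r \<and> c = transpose p q \<circ> transpose q r"
    "w \<circ> c = w"
proof (rule that)
  let ?c = "transpose p q \<circ> transpose q r"
  show "?c permutes I" using assms by (intro permutes_compose permutes_swap_id)
  show "?c \<circ> ?c \<circ> ?c = id" using assms(4-6) by (auto simp: transpose_def fun_eq_iff)
  show "\<exists>p q r. p \<noteq> q \<and> q \<noteq> r \<and> p \<noteq> r \<and> ?c = transpose p q \<circ> transpose q r" using assms(4-6) by blast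
  have "w \<circ> transpose p q = w" "w \<circ> transpose q r = w"
    using eq by (auto simp: transpose_def fun_eq_iff)
  then show "w \<circ> ?c = w" by (simp only: comp_assoc[symmetric])
qed

text \<open>Translating the coefficients of \<open>f\<close> on the left amounts to acting on the
  image \<open>F \<phi>\<close>; in \<open>F_right\<close>, translating them on the right amounts to
  acting on the argument.\<close>

private lemma F_left:
  assumes c: "c permutes I" "c \<circ> c \<circ> c = id"
    "\<exists>p q r. p \<noteq> q \<and> q \<noteq> r \<and> p \<noteq> r \<and> c = transpose p q \<circ> transpose q r"
  shows "F \<phi> w + tact 0 c (F \<phi>) w + tact 0 (c \<circ> c) (F \<phi>) w = 0"
proof -
  have shift: "tact 0 g (F \<phi>) w = (\<Sum>\<sigma> | \<sigma> permutes I. f (h \<circ> \<sigma>) * tact 0 \<sigma> \<phi> w)"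
    if g: "g permutes I" and h: "h permutes I" and hg: "h \<circ> g = id" for g h
  proof -
    have "tact 0 g (F \<phi>) w = (\<Sum>\<sigma> | \<sigma> permutes I. f \<sigma> * tact 0 (g \<circ> \<sigma>) \<phi> w)"
      unfolding F_def tact_sum[OF g fin] tact_scale[OF g]
      by (intro sum.cong refl) (simp add: tact_comp[OF g])
    also have "\<dots> = (\<Sum>\<sigma> | \<sigma> permutes I. f ((h \<circ> g) \<circ> \<sigma>) * tact 0 (g \<circ> \<sigma>) \<phi> w)"
      by (simp only: hg id_comp)
    also have "\<dots> = (\<Sum>\<sigma> | \<sigma> permutes I. f (h \<circ> \<sigma>) * tact 0 \<sigma> \<phi> w)"
      unfolding comp_assoc by (rule setum_permutations_compose_left[OF g, symmetric])
    finally show ?thesis .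
  qed
  have cc: "c \<circ> c permutes I" using c(1) by (intro permutes_compose)
  have c3: "c \<circ> (c \<circ> c) = id" using c(2) by (simp only: comp_assoc)
  have "F \<phi> w + tact 0 (c \<circ> c) (F \<phi>) w + tact 0 c (F \<phi>) w
      = (\<Sum>\<sigma> | \<sigma> permutes I. (f \<sigma> + f (c \<circ> \<sigma>) + f (c \<circ> c \<circ> \<sigma>)) * tact 0 \<sigma> \<phi> w)"
    unfolding shift[OF cc c(1) c3] shift[OF c(1) cc c(2)]
    by (simp only: F_def sum.distrib distrib_right)
  also have "\<dots> = 0" by (rule sum.neutral) (use left[OF _ c] in simp)
  finally show ?thesis by (simp add: add_ac)
qed

private lemma F_right:
  assumes c: "c permutes I" "c \<circ> c \<circ> c = id"
    "\<exists>p q r. p \<noteq> q \<and> q \<noteq> r \<and> p \<noteq> r \<and> c = transpose p q \<circ> transpose q r"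
  shows "F \<phi> w + F (tact 0 c \<phi>) w + F (tact 0 (c \<circ> c) \<phi>) w = 0"
proof -
  have shift: "F (tact 0 g \<phi>) w = (\<Sum>\<sigma> | \<sigma> permutes I. f (\<sigma> \<circ> h) * tact 0 \<sigma> \<phi> w)"
    if g: "g permutes I" and h: "h permutes I" and gh: "g \<circ> h = id" for g h
  proof -
    have "F (tact 0 g \<phi>) w = (\<Sum>\<sigma> | \<sigma> permutes I. f (\<sigma> \<circ> (g \<circ> h)) * tact 0 (\<sigma> \<circ> g) \<phi> w)"
      unfolding F_def gh comp_id by (intro sum.cong refl) (simp add: tact_comp[OF _ g])
    also have "\<dots> = (\<Sum>\<sigma> | \<sigma> permutes I. f (\<sigma> \<circ> h) * tact 0 \<sigma> \<phi> w)"
      unfolding comp_assoc[symmetric] by (rule sum_permutations_compose_right[OF g, symmetric])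
    finally show ?thesis .
  qed
  have cc: "c \<circ> c permutes I" using c(1) by (intro permutes_compose)
  have c3: "c \<circ> (c \<circ> c) = id" using c(2) by (simp only: comp_assoc)
  have "F \<phi> w + F (tact 0 (c \<circ> c) \<phi>) w + F (tact 0 c \<phi>) w
      = (\<Sum>\<sigma> | \<sigma> permutes I. (f \<sigma> + f (\<sigma> \<circ> c) + f (\<sigma> \<circ> (c \<circ> c))) * tact 0 \<sigma> \<phi> w)"
    unfolding shift[OF cc c(1) c(2)] shift[OF c(1) cc c3]
    by (simp only: F_def sum.distrib distrib_right)
  also have "\<dots> = 0" by (rule sum.neutral) (use right[OF _ c] in simp)
  finally show ?thesis by (simp add: add_ac)
qed

text \<open>There are \<open>4n\<close> positions and \<open>2n\<close> letters. If no letter occurs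
  three times, each occurs exactly twice, and the \<open>n\<close> letters in the image of \<delta>
  fill \<open>2n\<close> positions.\<close>

private lemma count_or_three:
  assumes w: "\<forall>i\<in>I. w i \<in> L" and ne: "delta_count 0 I w \<noteq> 2 * n"
  obtains p q r where "p \<in> I" "q \<in> I" "r \<in> I" "p \<noteq> q" "q \<noteq> r" "p \<noteq> r" "w p = w q" "w q = w r"
proof -
  define occ where "occ l = {i \<in> I. w i = l}" for l
  have finocc: "finite (occ l)" for l by (simp add: occ_def)
  have "\<exists>l<2 * n. 2 < card (occ l)"
  proof (rule ccontr)
    assume "\<not> ?thesis"
    then have le: "card (occ l) \<le> 2" if "l < 2 * n" for l using that by (meson leI)
    have part: "card (\<Union>l\<in>M. occ l) = (\<Sum>l\<in>M. card (occ l))" if "finite M" for M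
      using that by (intro card_UN_disjoint) (auto simp: occ_def)
    have "I = (\<Union>l\<in>L. occ l)" using w by (auto simp: occ_def)
    then have "4 * n = (\<Sum>l\<in>L. card (occ l))" using part[of L] d by (metis card_atLeastLessThan diff_zero finite_lessThan)
    moreover have "(\<Sum>l\<in>L. 2 - card (occ l)) = (\<Sum>l\<in>L. 2) - (\<Sum>l\<in>L. card (occ l))"
      by (rule sum_subtractf_nat) (use le in auto)
    ultimately have "(\<Sum>l\<in>L. 2 - card (occ l)) = 0" by simp
    then have two: "card (occ l) = 2" if "l < 2 * n" for l
      using that le[OF that] by (simp add: antisym)
    have "{i \<in> I. is_delta 0 (w i)} = (\<Union>l\<in>(\<lambda>k. 2 * k + 1) ` {..<n}. occ l)"
    proof (intro equalityI subsetI)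
      fix i assume "i \<in> {i \<in> I. is_delta 0 (w i)}"
      then obtain k where k: "i \<in> I" "w i = 2 * k + 1" by (auto simp: is_delta_iff)
      moreover have "w i < 2 * n" using bspec[OF w k(1)] by simp
      ultimately have "k < n" "i \<in> occ (2 * k + 1)" by (simp_all add: occ_def)
      then show "i \<in> (\<Union>l\<in>(\<lambda>k. 2 * k + 1) ` {..<n}. occ l)" by blast
    qed (auto simp: occ_def is_delta_iff)
    then have "delta_count 0 I w = (\<Sum>l\<in>(\<lambda>k. 2 * k + 1) ` {..<n}. card (occ l))"
      using part[of "(\<lambda>k. 2 * k + 1) ` {..<n}"] by (simp add: delta_count_def)
    also have "\<dots> = (\<Sum>k<n. card (occ (2 * k + 1)))"
      by (rule sum.reindex_cong[of "\<lambda>k. 2 * k + 1"]) (auto simp: inj_on_def)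
    also have "\<dots> = 2 * n" using two by simp
    finally show False using ne by simp
  qed
  then obtain l where "2 < card (occ l)" by blast
  then obtain T where "T \<subseteq> occ l" "card T = 3" using obtain_subset_with_card_n[of 3 "occ l"] by auto
  then obtain p q r where "p \<in> occ l" "q \<in> occ l" "r \<in> occ l" "p \<noteq> q" "q \<noteq> r" "p \<noteq> r"
    by (auto simp: card_3_iff)
  then show ?thesis using that by (auto simp: occ_def)
qed

text \<open>A 3-cycle through three equal letters fixes \<open>w\<close>. As lower degrees vanish,
  it acts by place permutation, so the left relation reads \<open>3 F \<phi> w = 0\<close>, and 3 =
  1.\<close>

private lemma F_eq_0_step:
  assumes w: "\<forall>i\<in>I. w i \<in> L" and ne: "delta_count 0 I w \<noteq> 2 * n"
    and below: "\<And>v. \<forall>i\<in>I. v i \<in> L \<Longrightarrow> delta_count 0 I v < delta_count 0 I w \<Longrightarrow> F \<phi> v = 0"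
  shows "F \<phi> w = 0"
proof -
  obtain p q r where pqr: "p \<in> I" "q \<in> I" "r \<in> I" "p \<noteq> q" "q \<noteq> r" "p \<noteq> r" and eq: "w p = w q" "w q = w r"
    by (rule count_or_three[OF w ne])
  obtain c where c: "c permutes I" "c \<circ> c \<circ> c = id"
    "\<exists>p q r. p \<noteq> q \<and> q \<noteq> r \<and> p \<noteq> r \<and> c = transpose p q \<circ> transpose q r"
    and wcw: "w \<circ> c = w"
    by (rule three_cycle[OF pqr eq])
  have cc: "c \<circ> c permutes I" using c(1) by (intro permutes_compose)
  have "tact 0 c (F \<phi>) w = F \<phi> (w \<circ> c)" "tact 0 (c \<circ> c) (F \<phi>) w = F \<phi> (w \<circ> (c \<circ> c))"
    by (rule tact_leading_letters[OF c(1) L w below], assumption+)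
      (rule tact_leading_letters[OF cc L w below], assumption+)
  then have "F \<phi> w + F \<phi> w + F \<phi> w = 0"
    using F_left[OF c, of \<phi> w] by (simp only: comp_assoc[symmetric] wcw)
  then show ?thesis by simp
qed

text \<open>In degree \<open>2n\<close> the action is plain and the hypothesis on plain actions
  applies; a word of any other degree has a triple letter.\<close>

private lemma F_high:
  assumes van: "vanishes_below 0 I (2 * n) \<phi>" and "\<forall>i\<in>I. w i \<in> L"
  shows "F \<phi> w = 0"
  using assms(2)
proof (induction "delta_count 0 I w" arbitrary: w rule: less_induct)
  case less
  show ?case
  proof (cases "delta_count 0 I w = 2 * n")
    case True
    have "F \<phi> w = (\<Sum>\<sigma> | \<sigma> permutes I. f \<sigma> * \<phi> (w \<circ> \<sigma>))"
      unfolding F_def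
      by (intro sum.cong refl) (use tact_leading[OF _ van] True in auto)
    then show ?thesis using plain[of w \<phi>] less.prems by simp
  next
    case False
    then show ?thesis by (rule F_eq_0_step[OF less.prems]) (use less.hyps in auto)
  qed
qed

text \<open>The dual argument, descending in the lowest degree of the tensor: a basis tensor of
  degree below \<open>2n\<close> has a triple letter, its translates by \<open>c\<close> agree with
  it up to higher degree, and the right relation becomes \<open>3 F \<phi> w = 0\<close>.\<close>

private lemma F_eq_0:
  assumes "\<forall>i\<in>I. w i \<in> L" "vanishes_below 0 I r \<phi>"
  shows "F \<phi> w = 0"
  using assms
proof (induction "2 * n - r" arbitrary: r w \<phi>)
  case 0
  then have "vanishes_below 0 I (2 * n) \<phi>" by (auto simp: vanishes_below_def)
  then show ?case by (rule F_high[OF _ 0(2)])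
next
  case (Suc k)
  let ?U = "words_on I L w"
  have IH: "F \<psi> v = 0" if "\<forall>i\<in>I. v i \<in> L" "vanishes_below 0 I (Suc r) \<psi>" for v \<psi>
    by (rule Suc.hyps(1)[OF _ that]) (use Suc.hyps(2) in simp)
  have ind: "F (word_indicator I u) w = 0" if u: "u \<in> ?U" "r \<le> delta_count 0 I u" for u
  proof -
    have same: "delta_count 0 I v = delta_count 0 I u" if "\<forall>i\<in>I. v i = u i" for v
    proof -
      have "{i \<in> I. is_delta 0 (v i)} = {i \<in> I. is_delta 0 (u i)}" using that by auto
      then show ?thesis by (simp add: delta_count_def)
    qed
    have van: "vanishes_below 0 I (delta_count 0 I u) (word_indicator I u :: _ \<Rightarrow> 'k)"
      unfolding vanishes_below_def word_indicator_def using same by (metis less_irrefl)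
    show ?thesis
    proof (cases "delta_count 0 I u = r")
      case False
      then have "vanishes_below 0 I (Suc r) (word_indicator I u :: _ \<Rightarrow> 'k)"
        using van u(2) by (auto simp: vanishes_below_def)
      then show ?thesis by (rule IH[OF Suc.prems(1)])
    next
      case True
      have uL: "\<forall>i\<in>I. u i \<in> L" using u(1) by (simp add: words_on_def)
      obtain p q s where pqr: "p \<in> I" "q \<in> I" "s \<in> I" "p \<noteq> q" "q \<noteq> s" "p \<noteq> s" and eq: "u p = u q" "u q = u s"
        by (rule count_or_three[OF uL]) (use True Suc.hyps(2) in auto)
      obtain c where c: "c permutes I" "c \<circ> c \<circ> c = id"
        "\<exists>p q r. p \<noteq> q \<and> q \<noteq> r \<and> p \<noteq> r \<and> c = transpose p q \<circ> transpose q r"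
        and wc: "u \<circ> c = u"
        by (rule three_cycle[OF pqr eq])
      have cc: "c \<circ> c permutes I" using c(1) by (intro permutes_compose)
      let ?\<phi> = "word_indicator I u :: _ \<Rightarrow> 'k"
      have inv1: "?\<phi> (v \<circ> g) = ?\<phi> v" if g: "g permutes I" "u \<circ> g = u" for g v
      proof -
        have "(\<forall>i\<in>I. (v \<circ> g) i = u i) \<longleftrightarrow> (\<forall>i\<in>I. (v \<circ> g) i = (u \<circ> g) i)" by (simp only: g(2))
        also have "\<dots> \<longleftrightarrow> (\<forall>i\<in>g ` I. v i = u i)" by simp
        finally show ?thesis by (simp only: word_indicator_def permutes_image[OF g(1)])
      qed
      have uc: "u \<circ> c = u" "u \<circ> (c \<circ> c) = u" using wc by (simp_all only: comp_assoc[symmetric])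
      have hi: "vanishes_below 0 I (Suc r) (\<lambda>v. ?\<phi> v + tact 0 g ?\<phi> v)" if g: "g permutes I" "u \<circ> g = u" for g
        unfolding vanishes_below_def
      proof (intro allI impI)
        fix v assume "delta_count 0 I v < Suc r"
        then have "tact 0 g ?\<phi> v = ?\<phi> v"
          using tact_leading[OF g(1) van, of v] True inv1[OF g] by simp
        then show "?\<phi> v + tact 0 g ?\<phi> v = 0" by simp
      qed
      have "F ?\<phi> w + F (tact 0 c ?\<phi>) w = 0" "F ?\<phi> w + F (tact 0 (c \<circ> c) ?\<phi>) w = 0"
        using IH[OF Suc.prems(1) hi[OF c(1) uc(1)]] IH[OF Suc.prems(1) hi[OF cc uc(2)]]
        by (simp_all only: F_add)
      then have "F (tact 0 c ?\<phi>) w = F ?\<phi> w" "F (tact 0 (c \<circ> c) ?\<phi>) w = F ?\<phi> w"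
        unfolding add_eq_0_iff_eq by simp_all
      then show ?thesis using F_right[OF c, of ?\<phi> w] by simp
    qed
  qed
  have "F \<phi> w = (\<Sum>\<sigma> | \<sigma> permutes I. \<Sum>u\<in>?U. \<phi> u * (f \<sigma> * tact 0 \<sigma> (word_indicator I u) w))"
    unfolding F_def
    by (intro sum.cong refl)
      (simp add: tact_expand[OF _ L finite_lessThan Suc.prems(1), of _ \<phi>] sum_distrib_left mult.left_commute)
  also have "\<dots> = (\<Sum>u\<in>?U. \<phi> u * F (word_indicator I u) w)"
    by (subst sum.swap) (simp only: F_def sum_distrib_left)
  also have "\<dots> = 0"
  proof (rule sum.neutral, rule ballI)
    fix u assume u: "u \<in> ?U"
    show "\<phi> u * F (word_indicator I u) w = 0"
    proof (cases "r \<le> delta_count 0 I u")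
      case True
      then show ?thesis using ind[OF u] by simp
    next
      case False
      then show ?thesis using Suc.prems(2) by (simp add: vanishes_below_def)
    qed
  qed
  finally show ?case .
qed

theorem three_cycle_annihilator_kills: "kills 0 0 d {..<2 * n} f"
  unfolding kills_def
proof (intro allI impI)
  fix \<phi> :: "(nat \<Rightarrow> nat) \<Rightarrow> 'k" and w assume "\<forall>i\<in>I. w i \<in> L"
  moreover have "vanishes_below 0 I 0 \<phi>" by (simp add: vanishes_below_def)
  ultimately show "(\<Sum>\<sigma> | \<sigma> permutes I. f \<sigma> * tact 0 \<sigma> \<phi> w) = 0"
    using F_eq_0 by (simp add: F_def)
qed

end

end

section \<open>The representation on tensor powers\<close>

lemma dim_mnP: "dim_row (mnP m n :: 'k::field mat) = m + 2 * n" "dim_col (mnP m n :: 'k mat) = m + 2 * n"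
  by (simp_all add: mnP_def dim_diag_block_mat unit_obj_def P_obj_def sum_list_replicate)

lemma mnP_carrier: "(mnP m n :: 'k::field mat) \<in> carrier_mat (m + 2 * n) (m + 2 * n)"
  by (intro carrier_matI dim_mnP)

lemma mnP_index:
  assumes "i < m + 2 * n" "j < m + 2 * n"
  shows "(mnP m n :: 'k::field mat) $$ (i, j) = (if is_delta m i \<and> j = i - 1 then 1 else 0)"
  using assms
proof (induction m arbitrary: i j)
  case 0
  then show ?case
  proof (induction n arbitrary: i j)
    case (Suc n)
    have dims: "dim_row (diag_block_mat (replicate n (P_obj :: 'k mat))) = 2 * n"
        "dim_col (diag_block_mat (replicate n (P_obj :: 'k mat))) = 2 * n"
      using dim_mnP[where 'k='k, of 0 n] by (simp_all add: mnP_def)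
    have P: "dim_row (P_obj :: 'k mat) = 2" "dim_col (P_obj :: 'k mat) = 2" by (simp_all add: P_obj_def)
    have IH: "mnP 0 n $$ (i - 2, j - 2) = (if is_delta 0 (i - 2) \<and> j - 2 = i - 2 - 1 then 1 else 0 :: 'k)"
      if "2 \<le> i" "2 \<le> j"
      by (rule Suc.IH) (use Suc.prems that in auto)
    have rest: "mnP 0 (Suc n) $$ (i, j) = (if i < 2 then if j < 2 then P_obj $$ (i, j) else 0
        else if j < 2 then 0 else mnP 0 n $$ (i - 2, j - 2) :: 'k)"
      using Suc.prems by (simp add: mnP_def Let_def dims P)
    consider "i < 2" "j < 2" | "i < 2" "2 \<le> j" | "2 \<le> i" "j < 2" | "2 \<le> i" "2 \<le> j" by linarith
    then show ?case
    proof cases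
      case 1
      then have "(i = 0 \<or> i = 1) \<and> (j = 0 \<or> j = 1)" by auto
      then show ?thesis unfolding rest by (auto simp: P_obj_def is_delta_def)
    next
      case 2
      then have "i = 0 \<or> i = 1" by auto
      then show ?thesis using 2 unfolding rest by (auto simp: is_delta_def)
    next
      case 3
      have "\<not> (is_delta 0 i \<and> j = i - 1)"
      proof
        assume a: "is_delta 0 i \<and> j = i - 1"
        then have "i = 2" using 3 by auto
        then show False using a by (simp add: is_delta_def)
      qed
      then show ?thesis using 3 unfolding rest by simp
    next
      case 4
      have "is_delta 0 (i - 2) \<longleftrightarrow> is_delta 0 i" using 4 by (simp add: is_delta_def)
      moreover have "j - 2 = i - 2 - 1 \<longleftrightarrow> j = i - 1" if "is_delta 0 i"
      proof -
        have "i \<noteq> 2" using that by (auto simp: is_delta_def)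
        then show ?thesis using 4 by auto
      qed
      ultimately show ?thesis using 4 IH unfolding rest by auto
    qed
  qed simp
next
  case (Suc m)
  have dims: "dim_row (diag_block_mat (replicate m (unit_obj :: 'k mat) @ replicate n P_obj)) = m + 2 * n"
      "dim_col (diag_block_mat (replicate m (unit_obj :: 'k mat) @ replicate n P_obj)) = m + 2 * n"
    using dim_mnP[where 'k='k, of m n] by (simp_all add: mnP_def)
  have U: "dim_row (unit_obj :: 'k mat) = 1" "dim_col (unit_obj :: 'k mat) = 1" by (simp_all add: unit_obj_def)
  have IH: "mnP m n $$ (i - 1, j - 1) = (if is_delta m (i - 1) \<and> j - 1 = i - 1 - 1 then 1 else 0 :: 'k)"
    if "1 \<le> i" "1 \<le> j"
    by (rule Suc.IH) (use Suc.prems that in auto)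
  have rest: "mnP (Suc m) n $$ (i, j) = (if i < 1 then if j < 1 then unit_obj $$ (i, j) else 0
      else if j < 1 then 0 else mnP m n $$ (i - 1, j - 1) :: 'k)"
    using Suc.prems by (simp add: mnP_def Let_def dims U)
  have delta: "is_delta (Suc m) i \<longleftrightarrow> is_delta m (i - 1) \<and> 1 < i"
    by (cases i) (auto simp: is_delta_def intro: gr0I)
  show ?case
  proof (cases "i < 1 \<or> j < 1")
    case True
    then show ?thesis unfolding rest delta by (auto simp: unit_obj_def)
  next
    case False
    then have "is_delta m (i - 1) \<Longrightarrow> 1 < i \<and> (j - 1 = i - 1 - 1 \<longleftrightarrow> j = i - 1)"
      using is_delta_pos[of m "i - 1"] by auto
    then show ?thesis using False IH unfolding rest delta by auto
  qed
qed

lemma mnP_Ver4p: "(mnP m n :: 'k::field mat) \<in> Ver4p"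
proof -
  let ?D = "m + 2 * n"
  have "mnP m n * mnP m n = (0\<^sub>m ?D ?D :: 'k mat)"
  proof (rule eq_matI)
    fix i j assume "i < dim_row (0\<^sub>m ?D ?D :: 'k mat)" "j < dim_col (0\<^sub>m ?D ?D :: 'k mat)"
    then have ij: "i < ?D" "j < ?D" by auto
    have "(mnP m n * mnP m n :: 'k mat) $$ (i, j) = (\<Sum>l<?D. mnP m n $$ (i, l) * mnP m n $$ (l, j))"
      using ij by (simp add: scalar_prod_def dim_mnP lessThan_atLeast0)
    also have "\<dots> = 0"
    proof (rule sum.neutral, rule ballI)
      fix l assume "l \<in> {..<?D}"
      then show "(mnP m n $$ (i, l) * mnP m n $$ (l, j) :: 'k) = 0"
        using ij is_delta_pred[of m i] by (auto simp: mnP_index)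
    qed
    finally show "(mnP m n * mnP m n) $$ (i, j) = (0\<^sub>m ?D ?D :: 'k mat) $$ (i, j)" using ij by simp
  qed (simp_all add: dim_mnP)
  then show ?thesis by (simp add: Ver4p_def dim_mnP)
qed

section \<open>Tensor indices as words\<close>

text \<open>Most significant digit first, as \<open>kron\<close> numbers basis vectors; letters past
  \<open>d\<close> are 0, so that words and indices correspond bijectively.\<close>

definition digits :: "nat \<Rightarrow> nat \<Rightarrow> nat \<Rightarrow> nat \<Rightarrow> nat" where
  "digits D d r = (\<lambda>i. if i < d then (r div D ^ (d - 1 - i)) mod D else 0)"

lemma mod_power_eq_iff:
  "(r :: nat) mod D ^ e = s mod D ^ e \<longleftrightarrow> (\<forall>k<e. (r div D ^ k) mod D = (s div D ^ k) mod D)"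
proof (induction e)
  case (Suc e)
  have split: "x mod D ^ Suc e = D ^ e * (x div D ^ e mod D) + x mod D ^ e" for x :: nat
    by (simp add: mod_mult2_eq mult.commute[of D])
  have "r mod D ^ Suc e = s mod D ^ Suc e \<longleftrightarrow>
      (r div D ^ e) mod D = (s div D ^ e) mod D \<and> r mod D ^ e = s mod D ^ e"
  proof
    assume eq: "r mod D ^ Suc e = s mod D ^ Suc e"
    have "x mod D ^ Suc e mod D ^ e = x mod D ^ e" for x :: nat
      by (simp add: mod_mod_cancel)
    then have 1: "r mod D ^ e = s mod D ^ e" using eq by metis
    show "(r div D ^ e) mod D = (s div D ^ e) mod D \<and> r mod D ^ e = s mod D ^ e"
    proof (cases "D = 0")
      case True
      then show ?thesis using eq 1 by (cases e) simp_all
    next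
      case False
      then show ?thesis using eq 1 unfolding split by simp
    qed
  qed (simp only: split)
  then show ?case using Suc by (auto simp: less_Suc_eq)
qed simp

lemma div_power_eq_iff:
  assumes "r < D ^ (e + p)" "s < D ^ (e + p)"
  shows "(r :: nat) div D ^ p = s div D ^ p \<longleftrightarrow> (\<forall>k<e. (r div D ^ (p + k)) mod D = (s div D ^ (p + k)) mod D)"
proof -
  have "r div D ^ p < D ^ e" "s div D ^ p < D ^ e"
    using assms by (simp_all add: power_add less_mult_imp_div_less)
  then have "r div D ^ p = s div D ^ p \<longleftrightarrow> (r div D ^ p) mod D ^ e = (s div D ^ p) mod D ^ e" by simp
  then show ?thesis unfolding mod_power_eq_iff by (simp add: div_mult2_eq power_add)
qed

text \<open>Remainders see the last tensor factors and quotients (\<open>div_power_digits\<close>)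
  the first ones; this is how a Kronecker index splits around the braided positions.\<close>

lemma mod_power_digits:
  assumes "e \<le> d"
  shows "r mod D ^ e = s mod D ^ e \<longleftrightarrow> (\<forall>i<d. d - e \<le> i \<longrightarrow> digits D d r i = digits D d s i)"
proof -
  have "(\<forall>k<e. (r div D ^ k) mod D = (s div D ^ k) mod D) \<longleftrightarrow>
      (\<forall>i<d. d - e \<le> i \<longrightarrow> digits D d r i = digits D d s i)" (is "?L \<longleftrightarrow> ?R")
  proof
    assume L: ?L
    show ?R
    proof (intro allI impI)
      fix i assume i: "i < d" "d - e \<le> i"
      then have "d - 1 - i < e" using assms by linarith
      with L i show "digits D d r i = digits D d s i" by (simp add: digits_def)
    qed
  next
    assume R: ?R
    show ?L
    proof (intro allI impI)
      fix k assume k: "k < e"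
      then have "d - 1 - k < d" "d - e \<le> d - 1 - k" "d - 1 - (d - 1 - k) = k" using assms by linarith+
      with R[rule_format, of "d - 1 - k"] show "(r div D ^ k) mod D = (s div D ^ k) mod D"
        by (simp add: digits_def)
    qed
  qed
  then show ?thesis by (simp only: mod_power_eq_iff)
qed

lemma div_power_digits:
  assumes "r < D ^ d" "s < D ^ d" "p \<le> d"
  shows "r div D ^ p = s div D ^ p \<longleftrightarrow> (\<forall>i<d - p. digits D d r i = digits D d s i)"
proof -
  have "(\<forall>k<d - p. (r div D ^ (p + k)) mod D = (s div D ^ (p + k)) mod D) \<longleftrightarrow>
      (\<forall>i<d - p. digits D d r i = digits D d s i)" (is "?L \<longleftrightarrow> ?R")
  proof
    assume L: ?L
    show ?R
    proof (intro allI impI)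
      fix i assume i: "i < d - p"
      then have "d - p - 1 - i < d - p" "p + (d - p - 1 - i) = d - 1 - i" by linarith+
      with L[rule_format, of "d - p - 1 - i"] i show "digits D d r i = digits D d s i"
        by (simp add: digits_def)
    qed
  next
    assume R: ?R
    show ?L
    proof (intro allI impI)
      fix k assume k: "k < d - p"
      then have "d - p - 1 - k < d - p" "d - 1 - (d - p - 1 - k) = p + k" by linarith+
      with R[rule_format, of "d - p - 1 - k"] k show "(r div D ^ (p + k)) mod D = (s div D ^ (p + k)) mod D"
        by (simp add: digits_def)
    qed
  qed
  then show ?thesis using div_power_eq_iff[of r D "d - p" p s] assms by simp
qed

text \<open>Comparing all digits gives injectivity, and counting words then gives
  surjectivity.\<close>

lemma digits_bij: "bij_betw (digits D d) {..<D ^ d} (words_on {0..<d} {..<D} (\<lambda>_. 0))"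
proof -
  let ?W = "words_on {0..<d} {..<D} (\<lambda>_. 0)"
  have fin: "finite ?W" by (rule finite_words_on) auto
  have inj: "inj_on (digits D d) {..<D ^ d}"
  proof (rule inj_onI)
    fix r s assume "r \<in> {..<D ^ d}" "s \<in> {..<D ^ d}" "digits D d r = digits D d s"
    then show "r = s" using mod_power_digits[of d d r D s] by simp
  qed
  have sub: "digits D d ` {..<D ^ d} \<subseteq> ?W"
  proof
    fix u assume "u \<in> digits D d ` {..<D ^ d}"
    then obtain r where r: "r < D ^ d" "u = digits D d r" by auto
    have "D \<noteq> 0" if "0 < d" using r that by (auto intro!: gr0I simp: power_0_left)
    then show "u \<in> ?W" by (auto simp: r(2) words_on_def digits_def)
  qed
  have "card ?W \<le> card (PiE {0..<d} (\<lambda>_. {..<D}))"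
  proof (rule card_inj_on_le)
    show "inj_on (\<lambda>u. restrict u {0..<d}) ?W"
    proof (rule inj_onI)
      fix u v assume uv: "u \<in> ?W" "v \<in> ?W" "restrict u {0..<d} = restrict v {0..<d}"
      show "u = v"
      proof
        fix i show "u i = v i"
        proof (cases "i \<in> {0..<d}")
          case True
          then show ?thesis using fun_cong[OF uv(3), of i] by simp
        next
          case False
          then show ?thesis using uv(1,2) by (simp add: words_on_def)
        qed
      qed
    qed
  qed (auto simp: words_on_def intro: finite_PiE)
  also have "\<dots> = D ^ d" by (simp add: card_PiE)
  finally have "card ?W \<le> D ^ d" .
  moreover have "card (digits D d ` {..<D ^ d}) = D ^ d" using inj by (simp add: card_image)
  ultimately have "digits D d ` {..<D ^ d} = ?W"
    using sub fin card_mono[OF fin sub] by (intro card_subset_eq) auto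
  then show ?thesis using inj by (simp add: bij_betw_def)
qed

lemma dim_kron [simp]:
  "dim_row (kron A B) = dim_row A * dim_row B" "dim_col (kron A B) = dim_col A * dim_col B"
  by (simp_all add: kron_def)

lemma kron_index:
  "i < dim_row A * dim_row B \<Longrightarrow> j < dim_col A * dim_col B \<Longrightarrow>
    kron A B $$ (i, j) = A $$ (i div dim_row B, j div dim_col B) * B $$ (i mod dim_row B, j mod dim_col B)"
  by (simp add: kron_def)

lemma div_mod_lt:
  assumes "(x :: nat) < D * D" shows "x div D < D" "x mod D < D"
proof -
  have "0 < D" using assms by (cases D) auto
  then show "x div D < D" "x mod D < D" using assms by (simp_all add: less_mult_imp_div_less)
qed

lemma braiding_index:
  fixes X :: "'k::field mat"
  assumes X: "X \<in> carrier_mat D D" and x: "x < D * D" and y: "y < D * D"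
  shows "braiding X $$ (x, y) = (if y div D = x mod D \<and> y mod D = x div D then 1 else 0)
    + X $$ (x mod D, y div D) * X $$ (x div D, y mod D)"
proof -
  let ?k = "(x mod D) * D + x div D"
  note lt = div_mod_lt[OF x] div_mod_lt[OF y]
  have D: "0 < D" using x by (cases D) auto
  have dX: "dim_row X = D" "dim_col X = D" using X by auto
  have k: "?k < D * D" "?k div D = x mod D" "?k mod D = x div D"
  proof -
    have "?k < (x mod D) * D + D" using lt by simp
    also have "\<dots> = (x mod D + 1) * D" by simp
    also have "\<dots> \<le> D * D" using lt(2) by (intro mult_right_mono) auto
    finally show "?k < D * D" .
  qed (use lt D in auto)
  have flip: "(flip_mat D :: 'k mat) $$ (x, l) = (if l = ?k then 1 else 0)" if "l < D * D" for l
  proof -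
    have "x div D = l mod D \<and> x mod D = l div D \<longleftrightarrow> l = ?k"
      using k(2,3) by (metis div_mult_mod_eq)
    then show ?thesis using that x by (simp add: flip_mat_def)
  qed
  have "braiding X $$ (x, y) = (\<Sum>l<D * D. flip_mat D $$ (x, l) * (1\<^sub>m (D * D) + kron X X) $$ (l, y))"
    using x y by (simp add: braiding_def dX scalar_prod_def flip_mat_def lessThan_atLeast0)
  also have "\<dots> = (\<Sum>l<D * D. if l = ?k then (1\<^sub>m (D * D) + kron X X) $$ (l, y) else 0)"
    by (intro sum.cong refl) (simp add: flip)
  also have "\<dots> = (1\<^sub>m (D * D) + kron X X) $$ (?k, y)"
    using k(1) by simp
  also have "\<dots> = (if ?k = y then 1 else 0) + X $$ (x mod D, y div D) * X $$ (x div D, y mod D)"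
    using k y by (simp add: kron_index dX)
  also have "?k = y \<longleftrightarrow> y div D = x mod D \<and> y mod D = x div D"
    using k(2,3) by (metis div_mult_mod_eq)
  finally show ?thesis .
qed

lemma dim_braid_at:
  fixes X :: "'k::field mat"
  assumes X: "X \<in> carrier_mat D D" and i: "Suc i < d"
  shows "dim_row (braid_at d X i) = D ^ d" "dim_col (braid_at d X i) = D ^ d"
proof -
  have e: "D ^ i * (D * D) * D ^ (d - 2 - i) = D ^ d"
  proof -
    have "i + 2 + (d - 2 - i) = d" using i by simp
    then show ?thesis by (metis power_add power2_eq_square)
  qed
  show "dim_row (braid_at d X i) = D ^ d" "dim_col (braid_at d X i) = D ^ d"
    using X e by (simp_all add: braid_at_def braiding_def flip_mat_def)
qed

text \<open>The link between Kronecker products and words: the outer identity factors force equality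
  off the positions \<open>i\<close> and \<open>i + 1\<close>, and the two summands of the braiding
  are the plain and the corrected term of an adjacent transposition.\<close>

lemma braid_at_index:
  fixes m n d i :: nat
  defines "D \<equiv> m + 2 * n"
  assumes i: "Suc i < d" and r: "r < D ^ d" and s: "s < D ^ d"
  shows "(braid_at d (mnP m n) i :: 'k::field mat) $$ (r, s) =
    tact m (transpose i (Suc i)) (word_indicator {0..<d} (digits D d s)) (digits D d r)"
proof -
  let ?X = "mnP m n :: 'k mat" and ?e = "d - 2 - i" and ?I = "{0..<d}"
  let ?R = "digits D d r" and ?S = "digits D d s"
  have X: "?X \<in> carrier_mat D D" unfolding D_def by (rule mnP_carrier)
  have dX: "dim_row ?X = D" "dim_col ?X = D" using X by auto
  have d: "d = i + 2 + ?e" using i by simp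
  have Dd: "D ^ i * (D * D) * D ^ ?e = D ^ d"
    using d by (metis power_add power2_eq_square)
  have D0: "0 < D" using r i by (auto intro!: gr0I simp: power_0_left)
  have dB: "dim_row (braiding ?X) = D * D" "dim_col (braiding ?X) = D * D"
    by (simp_all add: braiding_def flip_mat_def dX)
  have lt: "x div D ^ ?e < D ^ i * (D * D)" "x mod D ^ ?e < D ^ ?e" "x div D ^ ?e div (D * D) < D ^ i"
      "x div D ^ ?e mod (D * D) < D * D"
    if "x < D ^ d" for x
  proof -
    show "x div D ^ ?e < D ^ i * (D * D)" using that Dd by (metis less_mult_imp_div_less)
    then show "x div D ^ ?e div (D * D) < D ^ i" by (rule less_mult_imp_div_less)
  qed (use D0 in auto)
  let ?A = "r div D ^ ?e div (D * D) = s div D ^ ?e div (D * D)" and ?B = "r mod D ^ ?e = s mod D ^ ?e"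
  have entry: "(braid_at d ?X i) $$ (r, s) =
      (if ?A then 1 else 0) * braiding ?X $$ (r div D ^ ?e mod (D * D), s div D ^ ?e mod (D * D)) * (if ?B then 1 else 0)"
    using lt[OF r] lt[OF s] r s Dd
    by (simp add: braid_at_def kron_index dX dB)
  have dig: "x div D ^ ?e mod (D * D) div D = digits D d x i" "x div D ^ ?e mod (D * D) mod D = digits D d x (Suc i)" for x
  proof -
    have "d - 1 - i = Suc ?e" "d - 1 - Suc i = ?e" using i by auto
    then show "x div D ^ ?e mod (D * D) div D = digits D d x i" "x div D ^ ?e mod (D * D) mod D = digits D d x (Suc i)"
      using i D0 by (simp_all add: digits_def mod_mult2_eq div_mult2_eq power_Suc2 del: power_Suc)
  qed
  have AB: "?A \<longleftrightarrow> (\<forall>j<i. ?R j = ?S j)" "?B \<longleftrightarrow> (\<forall>j<d. Suc i < j \<longrightarrow> ?R j = ?S j)"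
  proof -
    have "D ^ ?e * (D * D) = D ^ (?e + 2)" by (simp add: power_add power2_eq_square)
    then have "x div D ^ ?e div (D * D) = x div D ^ (?e + 2)" for x by (simp only: div_mult2_eq[symmetric])
    moreover have "d - (?e + 2) = i" "?e + 2 \<le> d" using i by auto
    ultimately show "?A \<longleftrightarrow> (\<forall>j<i. ?R j = ?S j)"
      using div_power_digits[OF r s, of "?e + 2"] by simp
    have "d - ?e \<le> j \<longleftrightarrow> Suc i < j" for j using i by auto
    then show "?B \<longleftrightarrow> (\<forall>j<d. Suc i < j \<longrightarrow> ?R j = ?S j)"
      using mod_power_digits[of ?e d r D s] by simp
  qed
  have ltD: "digits D d x j < D" for x j using D0 by (simp add: digits_def)
  have B: "braiding ?X $$ (r div D ^ ?e mod (D * D), s div D ^ ?e mod (D * D)) =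
      (if ?S i = ?R (Suc i) \<and> ?S (Suc i) = ?R i then 1 else 0) +
      (if is_delta m (?R (Suc i)) \<and> ?S i = ?R (Suc i) - 1 then 1 else 0) *
      (if is_delta m (?R i) \<and> ?S (Suc i) = ?R i - 1 then 1 else 0)"
    unfolding braiding_index[OF X lt(4)[OF r] lt(4)[OF s]] dig
    using ltD by (simp add: mnP_index D_def)
  let ?rest = "(\<forall>j<i. ?R j = ?S j) \<and> (\<forall>j<d. Suc i < j \<longrightarrow> ?R j = ?S j)"
  let ?t = "transpose i (Suc i)"
  have t: "?t i = Suc i" "?t (Suc i) = i" "j \<noteq> i \<Longrightarrow> j \<noteq> Suc i \<Longrightarrow> ?t j = j" for j
    by (simp_all add: transpose_def)
  have all: "(\<forall>j\<in>?I. P j) \<longleftrightarrow> P i \<and> P (Suc i) \<and> (\<forall>j<i. P j) \<and> (\<forall>j<d. Suc i < j \<longrightarrow> P j)" for P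
  proof -
    have "?I = insert i (insert (Suc i) ({j. j < i} \<union> {j. j < d \<and> Suc i < j}))" using i by auto
    then show ?thesis by auto
  qed
  have fixes_low: "?t j = j" if "j < i" for j using that by (simp add: transpose_def)
  have fixes_high: "?t j = j" if "Suc i < j" for j using that by (simp add: transpose_def)
  have low: "lower {i, Suc i} v j = v j" if "j \<noteq> i" "j \<noteq> Suc i" for v j using that by (simp add: lower_def)
  have "(\<forall>j\<in>?I. (?R \<circ> ?t) j = ?S j) \<longleftrightarrow> ?rest \<and> ?S i = ?R (Suc i) \<and> ?S (Suc i) = ?R i"
  proof -
    have "(\<forall>j<i. (?R \<circ> ?t) j = ?S j) \<longleftrightarrow> (\<forall>j<i. ?R j = ?S j)"
      "(\<forall>j<d. Suc i < j \<longrightarrow> (?R \<circ> ?t) j = ?S j) \<longleftrightarrow> (\<forall>j<d. Suc i < j \<longrightarrow> ?R j = ?S j)"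
      using fixes_low fixes_high by simp_all
    moreover have "(?R \<circ> ?t) i = ?R (Suc i)" "(?R \<circ> ?t) (Suc i) = ?R i" by (simp_all add: t)
    ultimately show ?thesis unfolding all by (auto simp del: o_apply)
  qed
  then have w1: "word_indicator ?I ?S (?R \<circ> ?t) = (if ?rest \<and> ?S i = ?R (Suc i) \<and> ?S (Suc i) = ?R i then 1 else 0 :: 'k)"
    by (simp only: word_indicator_def)
  let ?w = "lower {i, Suc i} (?R \<circ> ?t)"
  have "(\<forall>j\<in>?I. ?w j = ?S j) \<longleftrightarrow> ?rest \<and> ?S i = ?R (Suc i) - 1 \<and> ?S (Suc i) = ?R i - 1"
  proof -
    have "(\<forall>j<i. ?w j = ?S j) \<longleftrightarrow> (\<forall>j<i. ?R j = ?S j)"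
      "(\<forall>j<d. Suc i < j \<longrightarrow> ?w j = ?S j) \<longleftrightarrow> (\<forall>j<d. Suc i < j \<longrightarrow> ?R j = ?S j)"
      using fixes_low fixes_high low by simp_all
    moreover have "?w i = ?R (Suc i) - 1" "?w (Suc i) = ?R i - 1" by (simp_all add: t lower_def)
    ultimately show ?thesis unfolding all by auto
  qed
  moreover have "(\<forall>j\<in>{i, Suc i}. is_delta m ((?R \<circ> ?t) j)) \<longleftrightarrow> is_delta m (?R (Suc i)) \<and> is_delta m (?R i)"
    by (simp add: t)
  ultimately have w2: "delta_at m {i, Suc i} (word_indicator ?I ?S) (?R \<circ> ?t) =
      (if ?rest \<and> (is_delta m (?R (Suc i)) \<and> ?S i = ?R (Suc i) - 1) \<and>
        (is_delta m (?R i) \<and> ?S (Suc i) = ?R i - 1) then 1 else 0 :: 'k)"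
    unfolding delta_at_def word_indicator_def by auto
  have bool: "(if a then 1 else 0) * ((if p then 1 else 0) + (if q then 1 else 0) * (if r then 1 else 0)) * (if b then 1 else 0)
      = (if (a \<and> b) \<and> p then 1 else 0) + (if (a \<and> b) \<and> q \<and> r then 1 else 0 :: 'k)" for a b p q r by simp
  show ?thesis
    unfolding entry B AB tact_adjacent w1 w2 by (rule bool)
qed

context char_two
begin

definition tact_mat :: "nat \<Rightarrow> nat \<Rightarrow> nat \<Rightarrow> (nat \<Rightarrow> nat) \<Rightarrow> 'k mat" where
  "tact_mat m n d \<sigma> = mat ((m + 2 * n) ^ d) ((m + 2 * n) ^ d) (\<lambda>(r, s).
     tact m \<sigma> (word_indicator {0..<d} (digits (m + 2 * n) d s)) (digits (m + 2 * n) d r))"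

lemma tact_mat_carrier [simp]: "tact_mat m n d \<sigma> \<in> carrier_mat ((m + 2 * n) ^ d) ((m + 2 * n) ^ d)"
  by (simp add: tact_mat_def)

lemma dim_tact_mat [simp]:
  "dim_row (tact_mat m n d \<sigma>) = (m + 2 * n) ^ d" "dim_col (tact_mat m n d \<sigma>) = (m + 2 * n) ^ d"
  by (simp_all add: tact_mat_def)

lemma digits_words_on:
  "r < D ^ d \<Longrightarrow> digits D d r \<in> words_on {0..<d} {..<D} (\<lambda>_. 0)"
  using bij_betwE[OF digits_bij] by blast

lemma tact_expand_digits:
  fixes \<phi> :: "(nat \<Rightarrow> nat) \<Rightarrow> 'k" and m n d :: nat
  defines "D \<equiv> m + 2 * n"
  assumes s: "\<sigma> permutes {0..<d}" and r: "r < D ^ d"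
  shows "tact m \<sigma> \<phi> (digits D d r) =
    (\<Sum>t<D ^ d. tact m \<sigma> (word_indicator {0..<d} (digits D d t)) (digits D d r) * \<phi> (digits D d t))"
proof -
  let ?I = "{0..<d}" and ?w = "digits D d r"
  have w: "?w \<in> words_on ?I {..<D} (\<lambda>_. 0)" by (rule digits_words_on[OF r])
  then have "words_on ?I {..<D} ?w = words_on ?I {..<D} (\<lambda>_. 0)" by (auto simp: words_on_def)
  moreover have "tact m \<sigma> \<phi> ?w = (\<Sum>u\<in>words_on ?I {..<D} ?w. \<phi> u * tact m \<sigma> (word_indicator ?I u) ?w)"
    by (rule tact_expand[OF s]) (use w closed_letters_lessThan[of m n] in \<open>auto simp: words_on_def D_def\<close>)
  ultimately have "tact m \<sigma> \<phi> ?w = (\<Sum>u\<in>words_on ?I {..<D} (\<lambda>_. 0). \<phi> u * tact m \<sigma> (word_indicator ?I u) ?w)"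
    by simp
  also have "\<dots> = (\<Sum>t<D ^ d. \<phi> (digits D d t) * tact m \<sigma> (word_indicator ?I (digits D d t)) ?w)"
    by (rule sum.reindex_bij_betw[OF digits_bij, symmetric])
  finally show ?thesis by (simp add: mult.commute)
qed

lemma word_indicator_digits:
  assumes "r < D ^ d" "s < D ^ d"
  shows "word_indicator {0..<d} (digits D d s) (digits D d r) = (if r = s then 1 else 0 :: 'k)"
proof -
  have "(\<forall>i\<in>{0..<d}. digits D d r i = digits D d s i) \<longleftrightarrow> digits D d r = digits D d s"
    by (auto simp: digits_def fun_eq_iff)
  also have "\<dots> \<longleftrightarrow> r = s"
    using bij_betw_imp_inj_on[OF digits_bij[of D d]] assms by (auto simp: inj_on_eq_iff)
  finally show ?thesis by (simp only: word_indicator_def)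
qed

lemma tact_mat_mult:
  assumes s: "\<sigma> permutes {0..<d}" and t: "\<tau> permutes {0..<d}"
  shows "tact_mat m n d (\<sigma> \<circ> \<tau>) = tact_mat m n d \<sigma> * tact_mat m n d \<tau>"
proof (rule eq_matI)
  let ?D = "m + 2 * n"
  fix r q assume "r < dim_row (tact_mat m n d \<sigma> * tact_mat m n d \<tau>)" "q < dim_col (tact_mat m n d \<sigma> * tact_mat m n d \<tau>)"
  then have rq: "r < ?D ^ d" "q < ?D ^ d" by auto
  show "tact_mat m n d (\<sigma> \<circ> \<tau>) $$ (r, q) = (tact_mat m n d \<sigma> * tact_mat m n d \<tau>) $$ (r, q)"
    using rq
    by (simp add: tact_mat_def tact_comp[OF s t] scalar_prod_def lessThan_atLeast0[symmetric]
        tact_expand_digits[OF s, of r m n, OF rq(1), of "tact m \<tau> \<psi>" for \<psi>])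
qed auto

lemma tact_mat_id: "tact_mat m n d id = 1\<^sub>m ((m + 2 * n) ^ d)"
  by (rule eq_matI) (simp_all add: tact_mat_def word_indicator_digits)

lemma braid_at_eq: "Suc i < d \<Longrightarrow> braid_at d (mnP m n) i = tact_mat m n d (transpose i (Suc i))"
proof (rule eq_matI)
  assume i: "Suc i < d"
  note dim = dim_braid_at[OF mnP_carrier[where 'k='k, of m n] i]
  show "dim_row (braid_at d (mnP m n :: 'k mat) i) = dim_row (tact_mat m n d (transpose i (Suc i)))"
    "dim_col (braid_at d (mnP m n :: 'k mat) i) = dim_col (tact_mat m n d (transpose i (Suc i)))"
    using dim by simp_all
  fix r s assume "r < dim_row (tact_mat m n d (transpose i (Suc i)))" "s < dim_col (tact_mat m n d (transpose i (Suc i)))"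
  then show "braid_at d (mnP m n) i $$ (r, s) = tact_mat m n d (transpose i (Suc i)) $$ (r, s)"
    using braid_at_index[OF i, of r m n s, where 'k='k] by (simp add: tact_mat_def)
qed

lemma word_perm_permutes: "\<forall>i\<in>set w. Suc i < d \<Longrightarrow> word_perm w permutes {0..<d}"
  by (induction w) (auto simp: word_perm_def permutes_id intro!: permutes_compose permutes_swap_id)

lemma word_mat_eq: "\<forall>i\<in>set w. Suc i < d \<Longrightarrow> word_mat d (mnP m n) w = tact_mat m n d (word_perm w)"
proof (induction w)
  case Nil
  have "word_perm [] = id" by (simp add: word_perm_def)
  moreover have "word_mat d (mnP m n) [] = (1\<^sub>m ((m + 2 * n) ^ d) :: 'k mat)" by (simp add: word_mat_def dim_mnP)
  ultimately show ?case by (simp only: tact_mat_id)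
next
  case (Cons i w)
  have "word_mat d (mnP m n) (i # w) = braid_at d (mnP m n) i * word_mat d (mnP m n :: 'k mat) w"
    by (simp add: word_mat_def)
  also have "\<dots> = tact_mat m n d (transpose i (Suc i)) * tact_mat m n d (word_perm w)"
    using Cons by (simp add: braid_at_eq)
  also have "\<dots> = tact_mat m n d (transpose i (Suc i) \<circ> word_perm w)"
    by (rule tact_mat_mult[symmetric]) (use Cons.prems in \<open>auto intro: permutes_swap_id word_perm_permutes\<close>)
  also have "transpose i (Suc i) \<circ> word_perm w = word_perm (i # w)"
    by (simp add: word_perm_def fun_eq_iff)
  finally show ?case .
qed

end

lemma word_perm_append: "word_perm (v @ w) = word_perm v \<circ> word_perm w"
  by (induction v) (simp_all add: word_perm_def comp_assoc)

text \<open>Conjugation by the transposition of \<open>j\<close> and \<open>j + 1\<close> moves the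
  larger endpoint one step.\<close>

lemma transposition_word:
  assumes "i < j" "j < d"
  shows "\<exists>w. (\<forall>i\<in>set w. Suc i < d) \<and> word_perm w = transpose i j"
  using assms
proof (induction j)
  case (Suc j)
  show ?case
  proof (cases "i = j")
    case True
    then show ?thesis using Suc.prems by (intro exI[of _ "[j]"]) (simp add: word_perm_def)
  next
    case False
    then obtain w where w: "\<forall>i\<in>set w. Suc i < d" "word_perm w = transpose i j" using Suc by auto
    have "transpose j (Suc j) \<circ> (transpose i j \<circ> transpose j (Suc j)) = transpose i (Suc j)"
      using False Suc.prems by (auto simp: transpose_def fun_eq_iff)
    then have "word_perm ([j] @ w @ [j]) = transpose i (Suc j)"
      by (simp only: word_perm_append w(2)) (simp add: word_perm_def)
    then show ?thesis using w Suc.prems by (intro exI[of _ "[j] @ w @ [j]"]) auto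
  qed
qed simp

lemma permutation_word:
  assumes "\<sigma> permutes {0..<d}"
  shows "\<exists>w. (\<forall>i\<in>set w. Suc i < d) \<and> word_perm w = \<sigma>"
  using assms finite_atLeastLessThan
proof (induction rule: permutes_induct)
  case id
  show ?case by (intro exI[of _ "[]"]) (simp add: word_perm_def)
next
  case (swap a b p)
  obtain v where v: "\<forall>i\<in>set v. Suc i < d" "word_perm v = transpose a b"
  proof (cases a b rule: linorder_cases)
    case less
    then show ?thesis using transposition_word[of a b d] swap that by auto
  next
    case equal
    then show ?thesis using swap by simp
  next
    case greater
    then show ?thesis using transposition_word[of b a d] swap that by (auto simp: transpose_commute)
  qed
  obtain w where "\<forall>i\<in>set w. Suc i < d" "word_perm w = p" using swap by blast
  then show ?case using v by (intro exI[of _ "v @ w"]) (auto simp: word_perm_append)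
qed

lemma Sym_eq: "Sym d = {\<sigma>. \<sigma> permutes {0..<d}}"
  by (simp add: Sym_def lessThan_atLeast0)

context char_two
begin

text \<open>By \<open>tact_mat_mult\<close> every word for \<open>\<sigma>\<close> yields the same
  matrix, so the definite description has exactly one candidate.\<close>

lemma tensor_rep_mnP:
  assumes s: "\<sigma> \<in> Sym d" shows "tensor_rep d (mnP m n) \<sigma> = tact_mat m n d \<sigma>"
  unfolding tensor_rep_def
proof (rule the_equality)
  show "\<exists>w. (\<forall>i\<in>set w. Suc i < d) \<and> word_perm w = \<sigma> \<and> tact_mat m n d \<sigma> = word_mat d (mnP m n) w"
    using permutation_word[of \<sigma> d] s word_mat_eq by (metis Sym_eq mem_Collect_eq)
qed (use word_mat_eq in auto)

lemma tensor_rep_is_rep: "is_rep d (tensor_rep d (mnP m n :: 'k mat))"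
  and rdim_tensor_rep: "rdim (tensor_rep d (mnP m n :: 'k mat)) = (m + 2 * n) ^ d"
proof -
  have id: "id \<in> Sym d" by (simp add: Sym_def permutes_id)
  show dim: "rdim (tensor_rep d (mnP m n :: 'k mat)) = (m + 2 * n) ^ d"
    by (simp add: rdim_def tensor_rep_mnP[OF id])
  show "is_rep d (tensor_rep d (mnP m n :: 'k mat))"
    unfolding is_rep_def dim
  proof (intro conjI ballI)
    show "tensor_rep d (mnP m n :: 'k mat) id = 1\<^sub>m ((m + 2 * n) ^ d)"
      by (simp only: tensor_rep_mnP[OF id] tact_mat_id)
  next
    fix \<sigma> assume "\<sigma> \<in> Sym d"
    then show "tensor_rep d (mnP m n :: 'k mat) \<sigma> \<in> carrier_mat ((m + 2 * n) ^ d) ((m + 2 * n) ^ d)"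
      by (simp add: tensor_rep_mnP)
  next
    fix \<sigma> \<tau> assume st: "\<sigma> \<in> Sym d" "\<tau> \<in> Sym d"
    then have "\<sigma> \<circ> \<tau> \<in> Sym d" by (simp add: Sym_def permutes_compose)
    then show "tensor_rep d (mnP m n :: 'k mat) (\<sigma> \<circ> \<tau>) = tensor_rep d (mnP m n) \<sigma> * tensor_rep d (mnP m n) \<tau>"
      using st tact_mat_mult[of \<sigma> d \<tau>] by (simp only: tensor_rep_mnP Sym_eq mem_Collect_eq)
  qed
qed

lemma braid_hom_eq_0_iff:
  fixes f :: "(nat \<Rightarrow> nat) \<Rightarrow> 'k" and m n d :: nat
  defines "D \<equiv> m + 2 * n"
  shows "braid_hom d (mnP m n) f = 0\<^sub>m (D ^ d) (D ^ d) \<longleftrightarrow> kills m 0 d {..<D} f"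
proof -
  let ?I = "{0..<d}"
  have entry: "braid_hom d (mnP m n) f $$ (r, s) =
      (\<Sum>\<sigma> | \<sigma> permutes ?I. f \<sigma> * tact m \<sigma> (word_indicator ?I (digits D d s)) (digits D d r))"
    if "r < D ^ d" "s < D ^ d" for r s
  proof -
    have "braid_hom d (mnP m n) f $$ (r, s) = (\<Sum>\<sigma>\<in>Sym d. f \<sigma> * tensor_rep d (mnP m n) \<sigma> $$ (r, s))"
      using that by (simp add: braid_hom_def dim_mnP D_def)
    also have "\<dots> = (\<Sum>\<sigma>\<in>Sym d. f \<sigma> * tact m \<sigma> (word_indicator ?I (digits D d s)) (digits D d r))"
      using that by (intro sum.cong refl) (simp add: tensor_rep_mnP tact_mat_def D_def)
    finally show ?thesis by (simp only: Sym_eq)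
  qed
  have dims: "dim_row (braid_hom d (mnP m n) f) = D ^ d" "dim_col (braid_hom d (mnP m n) f) = D ^ d"
    by (simp_all add: braid_hom_def dim_mnP D_def)
  show ?thesis
  proof
    assume k: "kills m 0 d {..<D} f"
    show "braid_hom d (mnP m n) f = 0\<^sub>m (D ^ d) (D ^ d)"
    proof (rule eq_matI)
      fix r s assume "r < dim_row (0\<^sub>m (D ^ d) (D ^ d) :: 'k mat)" "s < dim_col (0\<^sub>m (D ^ d) (D ^ d) :: 'k mat)"
      then have rs: "r < D ^ d" "s < D ^ d" by auto
      then show "braid_hom d (mnP m n) f $$ (r, s) = 0\<^sub>m (D ^ d) (D ^ d) $$ (r, s)"
        using killsD[OF k, of "digits D d r"] digits_words_on[OF rs(1)] by (simp add: entry words_on_def)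
    qed (simp_all add: dims)
  next
    assume z: "braid_hom d (mnP m n) f = 0\<^sub>m (D ^ d) (D ^ d)"
    show "kills m 0 d {..<D} f"
      unfolding kills_def
    proof (intro allI impI)
      fix \<phi> :: "(nat \<Rightarrow> nat) \<Rightarrow> 'k" and w assume w: "\<forall>i\<in>?I. w i \<in> {..<D}"
      \<comment> \<open>Zeros past position \<open>d\<close> bring the word into the range of
        \<open>digits\<close>; \<open>?\<phi>\<close> puts the original letters back.\<close>
      define w0 where "w0 = override_on (\<lambda>_. 0) w ?I"
      have "w0 \<in> words_on ?I {..<D} (\<lambda>_. 0)" using w by (simp add: w0_def words_on_def)
      then have "w0 \<in> digits D d ` {..<D ^ d}" by (simp only: bij_betw_imp_surj_on[OF digits_bij])
      then obtain r where r: "r < D ^ d" "digits D d r = w0" by blast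
      have ow: "override_on w w0 ?I = w" by (auto simp: w0_def override_on_def fun_eq_iff)
      let ?\<phi> = "\<lambda>v. \<phi> (override_on w v ?I)"
      have "(\<Sum>\<sigma> | \<sigma> permutes ?I. f \<sigma> * tact m \<sigma> \<phi> w)
          = (\<Sum>\<sigma> | \<sigma> permutes ?I. \<Sum>t<D ^ d. f \<sigma> * tact m \<sigma> (word_indicator ?I (digits D d t)) w0 * ?\<phi> (digits D d t))"
      proof (intro sum.cong refl)
        fix \<sigma> assume "\<sigma> \<in> {\<sigma>. \<sigma> permutes ?I}"
        then have s: "\<sigma> permutes ?I" by simp
        have "tact m \<sigma> \<phi> w = tact m \<sigma> ?\<phi> w0"
          using tact_override[OF s, of m \<phi> w w0] by (simp only: ow)
        also have "\<dots> = (\<Sum>t<D ^ d. tact m \<sigma> (word_indicator ?I (digits D d t)) w0 * ?\<phi> (digits D d t))"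
          using tact_expand_digits[OF s, of r m n ?\<phi>] r by (simp add: D_def)
        finally show "f \<sigma> * tact m \<sigma> \<phi> w = (\<Sum>t<D ^ d. f \<sigma> * tact m \<sigma> (word_indicator ?I (digits D d t)) w0 * ?\<phi> (digits D d t))"
          by (simp only: sum_distrib_left mult.assoc)
      qed
      also have "\<dots> = (\<Sum>t<D ^ d. braid_hom d (mnP m n) f $$ (r, t) * ?\<phi> (digits D d t))"
        by (subst sum.swap) (simp add: entry r sum_distrib_right)
      also have "\<dots> = 0" using r(1) by (simp add: z)
      finally show "(\<Sum>\<sigma> | \<sigma> permutes ?I. f \<sigma> * tact m \<sigma> \<phi> w) = 0" .
    qed
  qed
qed

lemma faithful_obj_mnP:
  "faithful_obj d (mnP m n :: 'k mat) \<longleftrightarrow>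
    (\<forall>f :: (nat \<Rightarrow> nat) \<Rightarrow> 'k. kills m 0 d {..<m + 2 * n} f \<longrightarrow> (\<forall>\<sigma>. \<sigma> permutes {0..<d} \<longrightarrow> f \<sigma> = 0))"
proof -
  let ?D = "m + 2 * n" and ?h = "braid_hom d (mnP m n :: 'k mat)"
  have add: "?h (\<lambda>\<sigma>. f \<sigma> + g \<sigma>) = 0\<^sub>m (?D ^ d) (?D ^ d) \<longleftrightarrow> ?h f = ?h g" for f g :: "(nat \<Rightarrow> nat) \<Rightarrow> 'k"
  proof -
    have "?h (\<lambda>\<sigma>. f \<sigma> + g \<sigma>) $$ (r, s) = ?h f $$ (r, s) + ?h g $$ (r, s)" if "r < ?D ^ d" "s < ?D ^ d" for r s
      using that by (simp add: braid_hom_def dim_mnP distrib_right sum.distrib)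
    moreover have "dim_row (?h f) = ?D ^ d" "dim_col (?h f) = ?D ^ d" for f
      by (simp_all add: braid_hom_def dim_mnP)
    ultimately show ?thesis by (auto simp: mat_eq_iff add_eq_0_iff_eq)
  qed
  show ?thesis
  proof
    assume inj: "faithful_obj d (mnP m n :: 'k mat)"
    show "\<forall>f :: (nat \<Rightarrow> nat) \<Rightarrow> 'k. kills m 0 d {..<m + 2 * n} f \<longrightarrow> (\<forall>\<sigma>. \<sigma> permutes {0..<d} \<longrightarrow> f \<sigma> = 0)"
    proof (intro allI impI)
      fix f :: "(nat \<Rightarrow> nat) \<Rightarrow> 'k" and \<sigma> assume k: "kills m 0 d {..<m + 2 * n} f" and s: "\<sigma> permutes {0..<d}"
      \<comment> \<open>\<open>kills\<close> sees \<open>f\<close> only on \<open>S\<^sub>d\<close>;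
        cutting it off there makes it an element of \<open>group_algebra\<close>.\<close>
      define g where "g \<tau> = (if \<tau> permutes {0..<d} then f \<tau> else 0)" for \<tau>
      have "kills m 0 d {..<m + 2 * n} g"
        unfolding kills_def
      proof (intro allI impI)
        fix \<phi> :: "(nat \<Rightarrow> nat) \<Rightarrow> 'k" and w assume w: "\<forall>i\<in>{0..<d}. w i \<in> {..<m + 2 * n}"
        have "(\<Sum>\<sigma> | \<sigma> permutes {0..<d}. g \<sigma> * tact m \<sigma> \<phi> w) = (\<Sum>\<sigma> | \<sigma> permutes {0..<d}. f \<sigma> * tact m \<sigma> \<phi> w)"
          by (intro sum.cong refl) (simp add: g_def)
        then show "(\<Sum>\<sigma> | \<sigma> permutes {0..<d}. g \<sigma> * tact m \<sigma> \<phi> w) = 0" using killsD[OF k w] by simp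
      qed
      then have "?h g = 0\<^sub>m (?D ^ d) (?D ^ d)" by (simp add: braid_hom_eq_0_iff)
      then have "?h (\<lambda>\<sigma>. g \<sigma> + 0) = 0\<^sub>m (?D ^ d) (?D ^ d)" by simp
      then have "?h g = ?h (\<lambda>\<sigma>. 0)" unfolding add .
      moreover have "g \<in> group_algebra d" "(\<lambda>\<sigma>. 0) \<in> group_algebra d"
        by (auto simp: group_algebra_def g_def Sym_eq)
      ultimately have "g = (\<lambda>\<sigma>. 0)" using inj unfolding faithful_obj_def by (metis inj_onD)
      then have "g \<sigma> = 0" by (rule fun_cong)
      then show "f \<sigma> = 0" using s by (simp add: g_def)
    qed
  next
    assume z: "\<forall>f :: (nat \<Rightarrow> nat) \<Rightarrow> 'k. kills m 0 d {..<m + 2 * n} f \<longrightarrow> (\<forall>\<sigma>. \<sigma> permutes {0..<d} \<longrightarrow> f \<sigma> = 0)"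
    show "faithful_obj d (mnP m n :: 'k mat)"
      unfolding faithful_obj_def
    proof (rule inj_onI)
      fix f g :: "(nat \<Rightarrow> nat) \<Rightarrow> 'k"
      assume fg: "f \<in> group_algebra d" "g \<in> group_algebra d" "?h f = ?h g"
      then have "kills m 0 d {..<m + 2 * n} (\<lambda>\<sigma>. f \<sigma> + g \<sigma>)" using add by (simp add: braid_hom_eq_0_iff)
      then have eq: "f \<sigma> = g \<sigma>" if "\<sigma> permutes {0..<d}" for \<sigma> using z[rule_format, OF _ that] by (metis add_eq_0_iff_eq)
      show "f = g"
      proof
        fix \<sigma> show "f \<sigma> = g \<sigma>"
          using eq[of \<sigma>] fg(1,2) by (cases "\<sigma> \<in> Sym d") (auto simp: group_algebra_def Sym_eq)
      qed
    qed
  qed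
qed

end

section \<open>Splitting idempotents and Fitting's lemma\<close>

lemma mat_assoc:
  "dim_col A = dim_row B \<Longrightarrow> dim_col B = dim_row C \<Longrightarrow> A * B * C = A * (B * C :: 'k::semiring_0 mat)"
  by (rule assoc_mult_mat[of A "dim_row A" "dim_col A" B "dim_col B" C "dim_col C"]) auto

lemma mat_distrib:
  "dim_row B = dim_row C \<Longrightarrow> dim_col B = dim_col C \<Longrightarrow> dim_col A = dim_row B \<Longrightarrow>
    A * (B + C) = A * B + A * (C :: 'k::semiring_0 mat)"
  "dim_row B = dim_row C \<Longrightarrow> dim_col B = dim_col C \<Longrightarrow> dim_row A = dim_col B \<Longrightarrow>
    (B + C) * A = B * A + C * A"
  by (rule mult_add_distrib_mat[of _ "dim_row A" "dim_row B"]; auto)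
    (rule add_mult_distrib_mat[of _ "dim_row B" "dim_col B"]; auto)

text \<open>A kernel vector \<open>v\<close> with \<open>v $ j\<close> nonzero expresses column
  \<open>j\<close> of \<open>B\<close> through the others: \<open>C\<close> drops this column and
  \<open>D\<close> restores it. The map \<open>skip\<close> enumerates the remaining
  indices.\<close>

lemma singular_factor:
  fixes B :: "'k::field mat"
  assumes B: "B \<in> carrier_mat r r" and sing: "det B = 0"
  shows "0 < r \<and> (\<exists>C \<in> carrier_mat r (r - 1). \<exists>D \<in> carrier_mat (r - 1) r. B = C * D)"
proof -
  obtain v where v: "v \<in> carrier_vec r" "v \<noteq> 0\<^sub>v r" "B *\<^sub>v v = 0\<^sub>v r"
    using det_0_iff_vec_prod_zero_field[OF B] sing by blast
  then obtain j where j: "j < r" "v $ j \<noteq> 0"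
    by (metis carrier_vecD eq_vecI index_zero_vec)
  define skip where "skip b = (if b < j then b else Suc b)" for b
  have bij: "bij_betw skip {..<r - 1} ({..<r} - {j})"
  proof (rule bij_betwI[where g="\<lambda>x. if x < j then x else x - 1"])
    show "skip \<in> {..<r - 1} \<rightarrow> {..<r} - {j}" unfolding skip_def using j(1) by (auto split: if_splits)
    show "(\<lambda>x. if x < j then x else x - 1) \<in> {..<r} - {j} \<rightarrow> {..<r - 1}" using j(1) by (auto split: if_splits)
    show "(if skip x < j then skip x else skip x - 1) = x" for x by (simp add: skip_def)
    show "skip (if x < j then x else x - 1) = x" if "x \<in> {..<r} - {j}" for x
      using that unfolding skip_def by (cases "x < j") auto
  qed
  define C where "C = mat r (r - 1) (\<lambda>(a, b). B $$ (a, skip b))"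
  define D where "D = mat (r - 1) r (\<lambda>(b, l). if l = j then - (v $ skip b / v $ j) else if l = skip b then 1 else 0)"
  have "C * D = B"
  proof (rule eq_matI)
    fix a l assume "a < dim_row B" "l < dim_col B"
    then have al: "a < r" "l < r" using B by auto
    let ?g = "\<lambda>x. B $$ (a, x) * (if l = j then - (v $ x / v $ j) else if l = x then 1 else 0)"
    have "(C * D) $$ (a, l) = (\<Sum>b<r - 1. ?g (skip b))"
      using al by (simp add: C_def D_def scalar_prod_def lessThan_atLeast0)
    also have "\<dots> = (\<Sum>x\<in>{..<r} - {j}. ?g x)"
      by (rule sum.reindex_bij_betw[OF bij])
    also have "\<dots> = B $$ (a, l)"
    proof (cases "l = j")
      case True
      have "0 = (B *\<^sub>v v) $ a" using v(3) al by simp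
      also have "\<dots> = (\<Sum>x<r. B $$ (a, x) * v $ x)"
        using B v(1) al by (simp add: scalar_prod_def lessThan_atLeast0)
      also have "\<dots> = B $$ (a, j) * v $ j + (\<Sum>x\<in>{..<r} - {j}. B $$ (a, x) * v $ x)"
        using j(1) by (subst sum.remove[of _ j]) auto
      finally have "(\<Sum>x\<in>{..<r} - {j}. B $$ (a, x) * v $ x) = - (B $$ (a, j) * v $ j)"
        by (metis add_eq_0_iff)
      moreover have "(\<Sum>x\<in>{..<r} - {j}. ?g x) = - (\<Sum>x\<in>{..<r} - {j}. B $$ (a, x) * v $ x) / v $ j"
        using True by (simp add: sum_negf[symmetric] sum_divide_distrib)
      ultimately show ?thesis using True j(2) by simp
    next
      case False
      have "(\<Sum>x\<in>{..<r} - {j}. ?g x) = (\<Sum>x\<in>{..<r} - {j}. if l = x then B $$ (a, x) else 0)"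
        using False by (intro sum.cong) auto
      then show ?thesis using False al by simp
    qed
    finally show "(C * D) $$ (a, l) = B $$ (a, l)" .
  qed (use B in \<open>auto simp: C_def D_def\<close>)
  then show ?thesis
    using j(1) by (intro conjI bexI[of _ C] bexI[of _ D]) (auto simp: C_def D_def)
qed

text \<open>A product through a smaller dimension is singular; here \<open>A\<close> and \<open>B\<close> are padded by zeros.\<close>

lemma mult_eq_one_imp_le:
  fixes A :: "'k::field mat"
  assumes A: "A \<in> carrier_mat n r" and B: "B \<in> carrier_mat r n" and AB: "A * B = 1\<^sub>m n"
  shows "n \<le> r"
proof (rule ccontr)
  assume "\<not> n \<le> r"
  then have lt: "r < n" by simp
  define A' where "A' = mat n n (\<lambda>(i, j). if j < r then A $$ (i, j) else 0)"
  define B' where "B' = mat n n (\<lambda>(i, j). if i < r then B $$ (i, j) else 0)"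
  have c: "A' \<in> carrier_mat n n" "B' \<in> carrier_mat n n" by (simp_all add: A'_def B'_def)
  have "A' * B' = 1\<^sub>m n"
  proof (rule eq_matI)
    fix i j assume "i < dim_row (1\<^sub>m n :: 'k mat)" "j < dim_col (1\<^sub>m n :: 'k mat)"
    then have ij: "i < n" "j < n" by auto
    have "(A' * B') $$ (i, j) = (\<Sum>l<n. if l < r then A $$ (i, l) * B $$ (l, j) else 0)"
      using ij unfolding A'_def B'_def
      by (simp add: scalar_prod_def lessThan_atLeast0) (intro sum.cong refl, simp)
    also have "\<dots> = (\<Sum>l<r. A $$ (i, l) * B $$ (l, j))"
      by (rule sum.mono_neutral_cong_right) (use lt in auto)
    also have "\<dots> = (A * B) $$ (i, j)"
      using ij A B by (simp add: scalar_prod_def lessThan_atLeast0)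
    finally show "(A' * B') $$ (i, j) = 1\<^sub>m n $$ (i, j)" by (simp only: AB)
  qed (simp_all add: A'_def B'_def)
  then have "B' * A' = 1\<^sub>m n" by (rule mat_mult_left_right_inverse[OF c])
  then have "(B' * A') $$ (r, r) = 1" using lt by simp
  moreover have "(B' * A') $$ (r, r) = 0"
    using lt by (simp add: A'_def B'_def scalar_prod_def)
  ultimately show False by simp
qed

lemma mat_inverse_square:
  fixes A :: "'k::field mat"
  assumes "A \<in> carrier_mat n r" "B \<in> carrier_mat r n" "A * B = 1\<^sub>m n" "B * A = 1\<^sub>m r"
  shows "n = r"
  using mult_eq_one_imp_le[OF assms(1,2,3)] mult_eq_one_imp_le[OF assms(2,1,4)] by simp

lemma nonsingular_inverse:
  fixes B :: "'k::field mat"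
  assumes B: "B \<in> carrier_mat r r" and "det B \<noteq> 0"
  obtains B' where "B' \<in> carrier_mat r r" "B * B' = 1\<^sub>m r" "B' * B = 1\<^sub>m r"
proof -
  have "B \<in> Units (ring_mat TYPE('k) r ())" by (rule det_non_zero_imp_unit) fact+
  then show ?thesis using that by (auto simp: Units_def ring_mat_simps)
qed

text \<open>In a factorisation of least inner dimension \<open>p * i\<close> is invertible, since a
  singular one would factor through a smaller dimension. Idempotency gives
  \<open>B\<^sup>3 = B\<^sup>2\<close> for \<open>B = p * i\<close>, so \<open>B\<close> is the
  identity.\<close>

lemma split_idempotent:
  fixes e :: "'k::field mat"
  assumes e: "e \<in> carrier_mat n n" and ee: "e * e = e"
  shows "\<exists>r i p. i \<in> carrier_mat n r \<and> p \<in> carrier_mat r n \<and> p * i = 1\<^sub>m r \<and> i * p = e"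
proof -
  let ?P = "\<lambda>r. \<exists>i p. i \<in> carrier_mat n r \<and> p \<in> carrier_mat r n \<and> i * p = e"
  have "?P n" by (intro exI[of _ e] exI[of _ "1\<^sub>m n"]) (use e in auto)
  define r where "r = (LEAST r. ?P r)"
  have "?P r" unfolding r_def by (rule LeastI) fact
  then obtain i p where i: "i \<in> carrier_mat n r" and p: "p \<in> carrier_mat r n" and ip: "i * p = e" by blast
  note dims = carrier_matD[OF i] carrier_matD[OF p]
  let ?B = "p * i"
  have B: "?B \<in> carrier_mat r r" using i p by auto
  have eB: "i * (?B * p) = e"
    using ee unfolding ip[symmetric] by (simp add: mat_assoc dims)
  have "det ?B \<noteq> 0"
  proof
    assume "det ?B = 0"
    then obtain C D where r: "0 < r" and C: "C \<in> carrier_mat r (r - 1)" and D: "D \<in> carrier_mat (r - 1) r" and CD: "?B = C * D"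
      using singular_factor[OF B] by blast
    note dimsCD = carrier_matD[OF C] carrier_matD[OF D]
    have "(i * C) * (D * p) = i * (C * D * p)" by (simp add: mat_assoc dims dimsCD)
    then have "(i * C) * (D * p) = e" using eB unfolding CD by simp
    moreover have "i * C \<in> carrier_mat n (r - 1)" "D * p \<in> carrier_mat (r - 1) n" using i p C D by auto
    ultimately have "?P (r - 1)" by blast
    then have "r \<le> r - 1" unfolding r_def by (rule Least_le)
    then show False using r by simp
  qed
  then obtain B' where B': "B' \<in> carrier_mat r r" "?B * B' = 1\<^sub>m r" "B' * ?B = 1\<^sub>m r"
    by (rule nonsingular_inverse[OF B])
  note dimsB = carrier_matD[OF B'(1)] carrier_matD[OF B]
  have "p * (i * (?B * p)) * i = p * e * i" by (simp only: eB)
  then have "p * (i * (?B * p)) * i = p * (i * p) * i" by (simp only: ip)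
  then have "?B * (?B * ?B) = ?B * ?B" by (simp add: mat_assoc dims)
  then have "B' * (?B * (?B * ?B)) = B' * (?B * ?B)" by (simp only:)
  then have "B' * ?B * (?B * ?B) = B' * ?B * ?B" using dimsB by (simp add: mat_assoc dims)
  then have BB: "?B * ?B = ?B"
    unfolding B'(3) using left_mult_one_mat[OF B] left_mult_one_mat[OF mult_carrier_mat[OF B B]] by simp
  then have "B' * (?B * ?B) = B' * ?B" by (simp only:)
  then have "B' * ?B * ?B = B' * ?B" using dimsB by (simp add: mat_assoc dims)
  then have "?B = 1\<^sub>m r" unfolding B'(3) using left_mult_one_mat[OF B] by simp
  then show ?thesis using i p ip by blast
qed

section \<open>Homomorphisms, direct sums and summands\<close>

lemma is_repD:
  assumes "is_rep d M"
  shows "\<sigma> \<in> Sym d \<Longrightarrow> M \<sigma> \<in> carrier_mat (rdim M) (rdim M)" "M id = 1\<^sub>m (rdim M)"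
    "\<sigma> \<in> Sym d \<Longrightarrow> \<tau> \<in> Sym d \<Longrightarrow> M (\<sigma> \<circ> \<tau>) = M \<sigma> * M \<tau>"
    "\<sigma> \<in> Sym d \<Longrightarrow> dim_row (M \<sigma>) = rdim M" "\<sigma> \<in> Sym d \<Longrightarrow> dim_col (M \<sigma>) = rdim M"
  using assms by (auto simp: is_rep_def)

lemma HomsD:
  assumes "f \<in> Homs d M N"
  shows "f \<in> carrier_mat (rdim N) (rdim M)" "dim_row f = rdim N" "dim_col f = rdim M"
    "\<sigma> \<in> Sym d \<Longrightarrow> f * M \<sigma> = N \<sigma> * f"
  using assms by (auto simp: Homs_def)

lemma HomsI:
  "f \<in> carrier_mat (rdim N) (rdim M) \<Longrightarrow> (\<And>\<sigma>. \<sigma> \<in> Sym d \<Longrightarrow> f * M \<sigma> = N \<sigma> * f) \<Longrightarrow> f \<in> Homs d M N"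
  by (simp add: Homs_def)

lemma Homs_id: "is_rep d M \<Longrightarrow> 1\<^sub>m (rdim M) \<in> Homs d M M"
  by (rule HomsI) (auto simp: is_repD)

lemma Homs_comp:
  assumes "is_rep d L" "is_rep d M" "is_rep d N" "f \<in> Homs d L M" "g \<in> Homs d M N"
  shows "g * f \<in> Homs d L N"
proof (rule HomsI)
  show "g * f \<in> carrier_mat (rdim N) (rdim L)" using HomsD[OF assms(4)] HomsD[OF assms(5)] by auto
  fix \<sigma> assume s: "\<sigma> \<in> Sym d"
  note dims = HomsD(2,3)[OF assms(4)] HomsD(2,3)[OF assms(5)] is_repD(4,5)[OF assms(1) s]
    is_repD(4,5)[OF assms(2) s] is_repD(4,5)[OF assms(3) s]
  have "g * f * L \<sigma> = g * (M \<sigma> * f)" by (simp add: mat_assoc dims HomsD(4)[OF assms(4) s])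
  also have "\<dots> = N \<sigma> * (g * f)"
    using HomsD(4)[OF assms(5) s] by (simp add: mat_assoc[symmetric] dims)
  finally show "g * f * L \<sigma> = N \<sigma> * (g * f)" .
qed

lemma Homs_add:
  assumes "is_rep d M" "is_rep d N" "f \<in> Homs d M N" "g \<in> Homs d M N"
  shows "f + g \<in> Homs d M N"
proof (rule HomsI)
  show "f + g \<in> carrier_mat (rdim N) (rdim M)" using HomsD[OF assms(3)] HomsD[OF assms(4)] by auto
  fix \<sigma> assume s: "\<sigma> \<in> Sym d"
  show "(f + g) * M \<sigma> = N \<sigma> * (f + g)"
    using HomsD[OF assms(3)] HomsD[OF assms(4)] is_repD[OF assms(1)] is_repD[OF assms(2)] s
    by (simp add: mat_distrib)
qed

lemma Homs_smult:
  assumes "is_rep d M" "is_rep d N" "f \<in> Homs d M N"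
  shows "c \<cdot>\<^sub>m f \<in> Homs d M N"
proof (rule HomsI)
  show "c \<cdot>\<^sub>m f \<in> carrier_mat (rdim N) (rdim M)" using HomsD[OF assms(3)] by auto
  fix \<sigma> assume s: "\<sigma> \<in> Sym d"
  have "c \<cdot>\<^sub>m f * M \<sigma> = c \<cdot>\<^sub>m (f * M \<sigma>)"
    by (rule mult_smult_assoc_mat[OF HomsD(1)[OF assms(3)] is_repD(1)[OF assms(1) s]])
  moreover have "N \<sigma> * (c \<cdot>\<^sub>m f) = c \<cdot>\<^sub>m (N \<sigma> * f)"
    by (rule mult_smult_distrib[OF is_repD(1)[OF assms(2) s] HomsD(1)[OF assms(3)]])
  ultimately show "c \<cdot>\<^sub>m f * M \<sigma> = N \<sigma> * (c \<cdot>\<^sub>m f)" by (simp add: HomsD(4)[OF assms(3) s])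
qed

lemma Homs_zero:
  assumes "is_rep d M" "is_rep d N" shows "0\<^sub>m (rdim N) (rdim M) \<in> Homs d M N"
  by (rule HomsI) (use assms in \<open>auto simp: is_repD\<close>)

section \<open>Binary direct sums and their complements\<close>

definition incl1 :: "nat \<Rightarrow> nat \<Rightarrow> 'k::field mat" where
  "incl1 a b = mat (a + b) a (\<lambda>(x, y). if x = y then 1 else 0)"

definition incl2 :: "nat \<Rightarrow> nat \<Rightarrow> 'k::field mat" where
  "incl2 a b = mat (a + b) b (\<lambda>(x, y). if x = a + y then 1 else 0)"

definition proj1 :: "nat \<Rightarrow> nat \<Rightarrow> 'k::field mat" where
  "proj1 a b = mat a (a + b) (\<lambda>(x, y). if x = y then 1 else 0)"

definition proj2 :: "nat \<Rightarrow> nat \<Rightarrow> 'k::field mat" where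
  "proj2 a b = mat b (a + b) (\<lambda>(x, y). if a + x = y then 1 else 0)"

lemma dim_incl_proj [simp]:
  "dim_row (incl1 a b) = a + b" "dim_col (incl1 a b) = a" "dim_row (incl2 a b) = a + b" "dim_col (incl2 a b) = b"
  "dim_row (proj1 a b) = a" "dim_col (proj1 a b) = a + b" "dim_row (proj2 a b) = b" "dim_col (proj2 a b) = a + b"
  by (simp_all add: incl1_def incl2_def proj1_def proj2_def)

lemma incl_proj_mult:
  "proj1 a b * incl1 a b = (1\<^sub>m a :: 'k::field mat)" "proj2 a b * incl2 a b = (1\<^sub>m b :: 'k mat)"
  "proj1 a b * incl2 a b = (0\<^sub>m a b :: 'k mat)" "proj2 a b * incl1 a b = (0\<^sub>m b a :: 'k mat)"
  "incl1 a b * proj1 a b + incl2 a b * proj2 a b = (1\<^sub>m (a + b) :: 'k mat)"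
proof -
  have if_mult: "(if P then 1 else 0) * (if Q then 1 else 0 :: 'k) = (if P then if Q then 1 else 0 else 0)" for P Q
    by simp
  show "proj1 a b * incl1 a b = (1\<^sub>m a :: 'k mat)"
    by (rule eq_matI) (simp_all add: proj1_def incl1_def scalar_prod_def if_mult)
  show "proj2 a b * incl2 a b = (1\<^sub>m b :: 'k mat)"
    by (rule eq_matI) (simp_all add: proj2_def incl2_def scalar_prod_def if_mult)
  show "proj1 a b * incl2 a b = (0\<^sub>m a b :: 'k mat)"
    by (rule eq_matI) (simp_all add: proj1_def incl2_def scalar_prod_def if_mult)
  show "proj2 a b * incl1 a b = (0\<^sub>m b a :: 'k mat)"
    by (rule eq_matI) (simp_all add: proj2_def incl1_def scalar_prod_def if_mult)
  show "incl1 a b * proj1 a b + incl2 a b * proj2 a b = (1\<^sub>m (a + b) :: 'k mat)"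
  proof (rule eq_matI)
    fix i j assume "i < dim_row (1\<^sub>m (a + b) :: 'k mat)" "j < dim_col (1\<^sub>m (a + b) :: 'k mat)"
    then have ij: "i < a + b" "j < a + b" by auto
    have "(\<Sum>y<b. if i = a + y then if a + y = j then 1 else 0 else 0) = (if a \<le> i \<and> i = j then 1 else 0 :: 'k)"
    proof (cases "a \<le> i")
      case True
      then obtain z where "i = a + z" using le_Suc_ex by blast
      then show ?thesis using ij by simp
    qed simp
    moreover have "(\<Sum>y<a. if i = y then if y = j then 1 else 0 else 0) = (if i < a \<and> i = j then 1 else 0 :: 'k)"
      by simp
    ultimately show "(incl1 a b * proj1 a b + incl2 a b * proj2 a b) $$ (i, j) = (1\<^sub>m (a + b) :: 'k mat) $$ (i, j)"
      using ij by (simp add: incl1_def incl2_def proj1_def proj2_def scalar_prod_def if_mult lessThan_atLeast0)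
  qed auto
qed

text \<open>A constant for the two-fold sum shields later proofs from the recursion of
  \<open>diag_block_mat\<close>; they work with inclusions and projections.\<close>

definition rep_pair :: "'k::field srep \<Rightarrow> 'k srep \<Rightarrow> 'k srep" where
  "rep_pair A B = direct_sum [A, B]"

lemma rep_pair_eq:
  "rep_pair A B \<sigma> = four_block_mat (A \<sigma>) (0\<^sub>m (dim_row (A \<sigma>)) (dim_col (B \<sigma>)))
     (0\<^sub>m (dim_row (B \<sigma>)) (dim_col (A \<sigma>))) (B \<sigma>)"
  by (simp add: rep_pair_def direct_sum_def Let_def diag_block_mat.simps(2)[of _ "[_]"]
      diag_block_mat_singleton del: diag_block_mat.simps)

lemma rdim_rep_pair: "rdim (rep_pair A B) = rdim A + rdim B"
  by (simp add: rdim_def rep_pair_eq)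

lemma id_in_Sym: "id \<in> Sym d"
  by (simp add: Sym_def permutes_id)

lemma Sym_comp: "\<sigma> \<in> Sym d \<Longrightarrow> \<tau> \<in> Sym d \<Longrightarrow> \<sigma> \<circ> \<tau> \<in> Sym d"
  by (simp add: Sym_def permutes_compose)

lemma four_block_incl_proj:
  fixes P Q :: "'k::field mat"
  assumes P: "P \<in> carrier_mat a a" and Q: "Q \<in> carrier_mat b b"
  defines "F \<equiv> four_block_mat P (0\<^sub>m a b) (0\<^sub>m b a) Q"
  shows "F * incl1 a b = incl1 a b * P" "F * incl2 a b = incl2 a b * Q"
    "proj1 a b * F = P * proj1 a b" "proj2 a b * F = Q * proj2 a b"
proof -
  have dims: "dim_row P = a" "dim_col P = a" "dim_row Q = b" "dim_col Q = b" using P Q by auto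
  have ind: "x * (if c then 1 else 0) = (if c then x else 0)" "(if c then 1 else 0) * x = (if c then x else 0)"
    for x :: 'k and c by simp_all
  have shift: "(\<Sum>y = 0..<b. if i = a + y then g y else 0) = (if a \<le> i \<and> i < a + b then g (i - a) else 0)"
      "(\<Sum>y = 0..<b. if a + y = i then g y else 0) = (if a \<le> i \<and> i < a + b then g (i - a) else 0)"
    for i and g :: "nat \<Rightarrow> 'k"
  proof -
    have "(\<Sum>y = 0..<b. if a + y = i then g y else 0) = (\<Sum>y = 0..<b. if y = i - a then if a \<le> i then g y else 0 else 0)"
      by (intro sum.cong) auto
    then show "(\<Sum>y = 0..<b. if a + y = i then g y else 0) = (if a \<le> i \<and> i < a + b then g (i - a) else 0)"
      by auto
    then show "(\<Sum>y = 0..<b. if i = a + y then g y else 0) = (if a \<le> i \<and> i < a + b then g (i - a) else 0)"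
      by (simp only: eq_commute[of i])
  qed
  show "F * incl1 a b = incl1 a b * P"
    by (rule eq_matI) (auto simp: F_def incl1_def scalar_prod_def dims ind)
  show "F * incl2 a b = incl2 a b * Q"
    by (rule eq_matI) (auto simp: F_def incl2_def scalar_prod_def dims ind shift)
  show "proj1 a b * F = P * proj1 a b"
    by (rule eq_matI) (auto simp: F_def proj1_def scalar_prod_def dims ind)
  show "proj2 a b * F = Q * proj2 a b"
    by (rule eq_matI) (auto simp: F_def proj2_def scalar_prod_def dims ind shift)
qed

lemma rep_pair_is_rep:
  assumes A: "is_rep d A" and B: "is_rep d B" shows "is_rep d (rep_pair A B)"
  unfolding is_rep_def rdim_rep_pair
proof (intro conjI ballI)
  show "rep_pair A B id = 1\<^sub>m (rdim A + rdim B)"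
    unfolding rep_pair_eq is_repD(2)[OF A] is_repD(2)[OF B] by (rule eq_matI) auto
next
  fix \<sigma> assume s: "\<sigma> \<in> Sym d"
  show "rep_pair A B \<sigma> \<in> carrier_mat (rdim A + rdim B) (rdim A + rdim B)"
    unfolding rep_pair_eq using is_repD(1)[OF A s] is_repD(1)[OF B s] by auto
next
  fix \<sigma> \<tau> assume s: "\<sigma> \<in> Sym d" and t: "\<tau> \<in> Sym d"
  show "rep_pair A B (\<sigma> \<circ> \<tau>) = rep_pair A B \<sigma> * rep_pair A B \<tau>"
    unfolding rep_pair_eq is_repD(3)[OF A s t] is_repD(3)[OF B s t]
    using mult_four_block_mat[OF is_repD(1)[OF A s] zero_carrier_mat zero_carrier_mat is_repD(1)[OF B s]
        is_repD(1)[OF A t] zero_carrier_mat zero_carrier_mat is_repD(1)[OF B t]]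
      is_repD(1)[OF A s] is_repD(1)[OF B s] is_repD(1)[OF A t] is_repD(1)[OF B t]
    by simp
qed

lemma rep_pair_Homs:
  assumes A: "is_rep d A" and B: "is_rep d B"
  shows "incl1 (rdim A) (rdim B) \<in> Homs d A (rep_pair A B)" "incl2 (rdim A) (rdim B) \<in> Homs d B (rep_pair A B)"
    "proj1 (rdim A) (rdim B) \<in> Homs d (rep_pair A B) A" "proj2 (rdim A) (rdim B) \<in> Homs d (rep_pair A B) B"
proof -
  have eq: "rep_pair A B \<sigma> = four_block_mat (A \<sigma>) (0\<^sub>m (rdim A) (rdim B)) (0\<^sub>m (rdim B) (rdim A)) (B \<sigma>)"
    if "\<sigma> \<in> Sym d" for \<sigma>
    using is_repD(4,5)[OF A that] is_repD(4,5)[OF B that] by (simp add: rep_pair_eq)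
  show "incl1 (rdim A) (rdim B) \<in> Homs d A (rep_pair A B)"
    by (rule HomsI) (auto simp: rdim_rep_pair eq four_block_incl_proj[OF is_repD(1)[OF A] is_repD(1)[OF B]])
  show "incl2 (rdim A) (rdim B) \<in> Homs d B (rep_pair A B)"
    by (rule HomsI) (auto simp: rdim_rep_pair eq four_block_incl_proj[OF is_repD(1)[OF A] is_repD(1)[OF B]])
  show "proj1 (rdim A) (rdim B) \<in> Homs d (rep_pair A B) A"
    by (rule HomsI) (auto simp: rdim_rep_pair eq four_block_incl_proj[OF is_repD(1)[OF A] is_repD(1)[OF B]])
  show "proj2 (rdim A) (rdim B) \<in> Homs d (rep_pair A B) B"
    by (rule HomsI) (auto simp: rdim_rep_pair eq four_block_incl_proj[OF is_repD(1)[OF A] is_repD(1)[OF B]])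
qed

text \<open>On the image, \<open>\<sigma>\<close> acts as \<open>p * (M \<sigma> * i)\<close>;
  \<open>i\<close> and \<open>p\<close> intertwine because \<open>M \<sigma>\<close> commutes with
  \<open>i * p = e\<close>.\<close>

lemma image_of_idempotent:
  assumes M: "is_rep d M" and e: "e \<in> Homs d M M" and ee: "e * e = e"
  obtains A i p where "is_rep d A" "i \<in> Homs d A M" "p \<in> Homs d M A" "p * i = 1\<^sub>m (rdim A)" "i * p = e"
proof -
  let ?n = "rdim M"
  obtain r i p where i: "i \<in> carrier_mat ?n r" and p: "p \<in> carrier_mat r ?n" and pi: "p * i = 1\<^sub>m r" and ip: "i * p = e"
    using split_idempotent[OF HomsD(1)[OF e] ee] by blast
  define A where "A \<sigma> = p * (M \<sigma> * i)" for \<sigma>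
  note dims = carrier_matD[OF i] carrier_matD[OF p]
  have A_id: "A id = 1\<^sub>m r" using left_mult_one_mat[OF i] by (simp add: A_def is_repD(2)[OF M] pi)
  then have rA: "rdim A = r" by (simp add: rdim_def)
  have iA: "i * A \<sigma> = M \<sigma> * i" if s: "\<sigma> \<in> Sym d" for \<sigma>
  proof -
    note dM = is_repD(4,5)[OF M s]
    have "i * A \<sigma> = e * M \<sigma> * i" by (simp add: A_def ip[symmetric] mat_assoc dims dM)
    also have "\<dots> = M \<sigma> * (i * (p * i))"
      unfolding HomsD(4)[OF e s] by (simp add: ip[symmetric] mat_assoc dims dM)
    finally show ?thesis using right_mult_one_mat[OF i] by (simp add: pi)
  qed
  have Ap: "A \<sigma> * p = p * M \<sigma>" if s: "\<sigma> \<in> Sym d" for \<sigma>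
  proof -
    note dM = is_repD(4,5)[OF M s]
    have "A \<sigma> * p = p * (M \<sigma> * e)" by (simp add: A_def ip[symmetric] mat_assoc dims dM)
    also have "\<dots> = (p * i) * (p * M \<sigma>)"
      unfolding HomsD(4)[OF e s, symmetric] by (simp add: ip[symmetric] mat_assoc dims dM)
    also have "\<dots> = p * M \<sigma>"
      unfolding pi using left_mult_one_mat[OF mult_carrier_mat[OF p is_repD(1)[OF M s]]] .
    finally show ?thesis .
  qed
  have "is_rep d A"
    unfolding is_rep_def rA
  proof (intro conjI ballI A_id)
    fix \<sigma> assume "\<sigma> \<in> Sym d"
    then show "A \<sigma> \<in> carrier_mat r r" using i p is_repD(1)[OF M] by (auto simp: A_def)
  next
    fix \<sigma> \<tau> assume s: "\<sigma> \<in> Sym d" and t: "\<tau> \<in> Sym d"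
    note dM = is_repD(4,5)[OF M s] is_repD(4,5)[OF M t]
    have "A (\<sigma> \<circ> \<tau>) = p * M \<sigma> * (M \<tau> * i)"
      by (simp add: A_def is_repD(3)[OF M s t] mat_assoc dims dM)
    also have "\<dots> = A \<sigma> * (p * (M \<tau> * i))"
      unfolding Ap[OF s, symmetric] by (rule mat_assoc) (simp_all add: A_def dims dM)
    finally show "A (\<sigma> \<circ> \<tau>) = A \<sigma> * A \<tau>" by (simp add: A_def)
  qed
  moreover have "i \<in> Homs d A M" by (rule HomsI) (simp_all add: rA i iA)
  moreover have "p \<in> Homs d M A" by (rule HomsI) (simp_all add: rA p Ap)
  ultimately show ?thesis using that pi ip rA by blast
qed

lemma one_minus_idempotent:
  fixes e :: "'k::field mat"
  assumes e: "e \<in> carrier_mat n n" and ee: "e * e = e"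
  shows "(1\<^sub>m n - e) * (1\<^sub>m n - e) = 1\<^sub>m n - e" "e + (1\<^sub>m n - e) = 1\<^sub>m n"
    "e * (1\<^sub>m n - e) = 0\<^sub>m n n" "(1\<^sub>m n - e) * e = 0\<^sub>m n n"
proof -
  have 1: "e * (1\<^sub>m n - e) = 0\<^sub>m n n"
    using e ee by (simp add: mult_minus_distrib_mat[OF e one_carrier_mat e] minus_r_inv_mat[OF e])
  have 2: "(1\<^sub>m n - e) * e = 0\<^sub>m n n"
    using e ee by (simp add: minus_mult_distrib_mat[OF one_carrier_mat e e] minus_r_inv_mat[OF e])
  show "e * (1\<^sub>m n - e) = 0\<^sub>m n n" "(1\<^sub>m n - e) * e = 0\<^sub>m n n" by fact+
  have c: "1\<^sub>m n - e \<in> carrier_mat n n" using e by auto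
  show "(1\<^sub>m n - e) * (1\<^sub>m n - e) = 1\<^sub>m n - e"
    unfolding minus_mult_distrib_mat[OF one_carrier_mat e c] 1 left_mult_one_mat[OF c]
    by (rule eq_matI) (use e in auto)
  show "e + (1\<^sub>m n - e) = 1\<^sub>m n" by (rule eq_matI) (use e in auto)
qed

lemma Homs_minus_id:
  assumes M: "is_rep d M" and e: "e \<in> Homs d M M"
  shows "1\<^sub>m (rdim M) - e \<in> Homs d M M"
proof (rule HomsI)
  let ?n = "rdim M"
  show "1\<^sub>m ?n - e \<in> carrier_mat ?n ?n" using HomsD[OF e] by auto
  fix \<sigma> assume s: "\<sigma> \<in> Sym d"
  note c = HomsD(1)[OF e] is_repD(1)[OF M s]
  show "(1\<^sub>m ?n - e) * M \<sigma> = M \<sigma> * (1\<^sub>m ?n - e)"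
    using c by (simp add: minus_mult_distrib_mat[OF one_carrier_mat c(1) c(2)]
      mult_minus_distrib_mat[OF c(2) one_carrier_mat c(1)] HomsD(4)[OF e s])
qed

lemma rep_iso_pair:
  assumes M: "is_rep d M" and A: "is_rep d A" and B: "is_rep d B"
    and i: "i \<in> Homs d A M" and p: "p \<in> Homs d M A" and pi: "p * i = 1\<^sub>m (rdim A)"
    and i': "i' \<in> Homs d B M" and p': "p' \<in> Homs d M B" and pi': "p' * i' = 1\<^sub>m (rdim B)"
    and pi0: "p * i' = 0\<^sub>m (rdim A) (rdim B)" "p' * i = 0\<^sub>m (rdim B) (rdim A)"
    and sum: "i * p + i' * p' = 1\<^sub>m (rdim M)"
  shows "rep_iso d (rep_pair A B) M"
proof -
  let ?a = "rdim A" and ?b = "rdim B" and ?n = "rdim M"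
  note P = rep_pair_is_rep[OF A B] and H = rep_pair_Homs[OF A B]
  let ?f = "i * proj1 ?a ?b + i' * proj2 ?a ?b" and ?g = "incl1 ?a ?b * p + incl2 ?a ?b * p'"
  note dims = HomsD(2,3)[OF i] HomsD(2,3)[OF p] HomsD(2,3)[OF i'] HomsD(2,3)[OF p']
  have f: "?f \<in> Homs d (rep_pair A B) M"
    by (intro Homs_add[OF P M] Homs_comp[OF P A M H(3) i] Homs_comp[OF P B M H(4) i'])
  have ac: "x * y * (z * w) = x * (y * z) * w" if "dim_col x = dim_row y" "dim_col y = dim_row z" "dim_col z = dim_row w"
    for x y z w :: "'a mat"
    using that by (simp add: mat_assoc)
  have fg: "?f * ?g = 1\<^sub>m ?n"
  proof -
    have "?f * ?g = (i * proj1 ?a ?b * (incl1 ?a ?b * p) + i' * proj2 ?a ?b * (incl1 ?a ?b * p))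
        + (i * proj1 ?a ?b * (incl2 ?a ?b * p') + i' * proj2 ?a ?b * (incl2 ?a ?b * p'))"
      by (simp add: mat_distrib dims)
    also have "\<dots> = i * p + i' * p'"
      using HomsD(1)[OF i] HomsD(1)[OF p] HomsD(1)[OF i'] HomsD(1)[OF p']
      by (simp add: ac dims incl_proj_mult)
    finally show ?thesis using sum by simp
  qed
  have gf: "?g * ?f = 1\<^sub>m (?a + ?b)"
  proof -
    have "?g * ?f = (incl1 ?a ?b * p * (i * proj1 ?a ?b) + incl2 ?a ?b * p' * (i * proj1 ?a ?b))
        + (incl1 ?a ?b * p * (i' * proj2 ?a ?b) + incl2 ?a ?b * p' * (i' * proj2 ?a ?b))"
      by (simp add: mat_distrib dims)
    also have "\<dots> = incl1 ?a ?b * proj1 ?a ?b + incl2 ?a ?b * proj2 ?a ?b"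
      using HomsD(1)[OF H(1)] HomsD(1)[OF H(2)] HomsD(1)[OF H(3)] HomsD(1)[OF H(4)]
      by (simp add: ac dims pi pi' pi0 rdim_rep_pair)
    finally show ?thesis by (simp add: incl_proj_mult)
  qed
  have "?n = ?a + ?b"
  proof -
    have "?f \<in> carrier_mat ?n (?a + ?b)" "?g \<in> carrier_mat (?a + ?b) ?n"
      using dims by auto
    then show ?thesis using fg gf by (rule mat_inverse_square)
  qed
  then have "invertible_mat ?f"
    unfolding invertible_mat_def inverts_mat_def using fg gf dims by (intro conjI exI[of _ ?g]) auto
  then show ?thesis unfolding rep_iso_def using f by blast
qed

text \<open>The complement is the image of the idempotent \<open>1 - f * g\<close>.\<close>

lemma is_summand_of_split:
  assumes Y: "is_rep d Y" and M: "is_rep d M"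
    and f: "f \<in> Homs d Y M" and g: "g \<in> Homs d M Y" and gf: "g * f = 1\<^sub>m (rdim Y)"
  shows "is_summand d Y M"
proof -
  let ?n = "rdim M"
  note dims = HomsD(2,3)[OF f] HomsD(2,3)[OF g]
  note fc = HomsD(1)[OF f] and gc = HomsD(1)[OF g]
  let ?e = "f * g"
  have e: "?e \<in> Homs d M M" by (rule Homs_comp[OF M Y M g f])
  have ee: "?e * ?e = ?e"
  proof -
    have "?e * ?e = f * (g * f) * g" by (simp add: mat_assoc dims)
    then show ?thesis using right_mult_one_mat[OF fc] by (simp add: gf)
  qed
  note om = one_minus_idempotent[OF HomsD(1)[OF e] ee]
  obtain B i p where B: "is_rep d B" and i: "i \<in> Homs d B M" and p: "p \<in> Homs d M B"
    and pi: "p * i = 1\<^sub>m (rdim B)" and ip: "i * p = 1\<^sub>m ?n - ?e"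
    by (rule image_of_idempotent[OF M Homs_minus_id[OF M e] om(1)])
  note dimsB = HomsD(2,3)[OF i] HomsD(2,3)[OF p]
  have "g * i = 0\<^sub>m (rdim Y) (rdim B)"
  proof -
    have "g * i = (g * f) * (g * i) * (p * i)"
      using left_mult_one_mat[OF mult_carrier_mat[OF gc HomsD(1)[OF i]]]
        right_mult_one_mat[OF mult_carrier_mat[OF gc HomsD(1)[OF i]]]
      by (simp add: gf pi)
    also have "\<dots> = g * (?e * (i * p)) * i" by (simp add: mat_assoc dims dimsB)
    also have "\<dots> = 0\<^sub>m (rdim Y) (rdim B)"
      unfolding ip om(3) using gc HomsD(1)[OF i] by simp
    finally show ?thesis .
  qed
  moreover have "p * f = 0\<^sub>m (rdim B) (rdim Y)"
  proof -
    have "p * f = (p * i) * (p * f) * (g * f)"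
      using left_mult_one_mat[OF mult_carrier_mat[OF HomsD(1)[OF p] fc]]
        right_mult_one_mat[OF mult_carrier_mat[OF HomsD(1)[OF p] fc]]
      by (simp add: gf pi)
    also have "\<dots> = p * ((i * p) * ?e) * f" by (simp add: mat_assoc dims dimsB)
    also have "\<dots> = 0\<^sub>m (rdim B) (rdim Y)"
      unfolding ip om(4) using HomsD(1)[OF p] fc by simp
    finally show ?thesis .
  qed
  moreover have "f * g + i * p = 1\<^sub>m ?n" unfolding ip by (rule om(2))
  ultimately have "rep_iso d (rep_pair Y B) M"
    by (intro rep_iso_pair[OF M Y B f g gf i p pi])
  then show ?thesis
    unfolding is_summand_def using Y B by (auto simp: rep_pair_def)
qed

lemma is_summand_refl: "is_rep d M \<Longrightarrow> is_summand d M M"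
  by (rule is_summand_of_split[OF _ _ Homs_id Homs_id]) (auto simp: right_mult_one_mat')

lemma Homs_inverse:
  assumes M: "is_rep d M" and N: "is_rep d N" and f: "f \<in> Homs d M N"
    and g: "g \<in> carrier_mat (rdim M) (rdim N)" and fg: "f * g = 1\<^sub>m (rdim N)" and gf: "g * f = 1\<^sub>m (rdim M)"
  shows "g \<in> Homs d N M"
proof (rule HomsI[OF g])
  fix \<sigma> assume s: "\<sigma> \<in> Sym d"
  note dims = HomsD(2,3)[OF f] carrier_matD[OF g] is_repD(4,5)[OF M s] is_repD(4,5)[OF N s]
  have "g * N \<sigma> = g * N \<sigma> * (f * g)"
    unfolding fg using right_mult_one_mat[OF mult_carrier_mat[OF g is_repD(1)[OF N s]]] by simp
  also have "\<dots> = g * (N \<sigma> * f) * g" by (simp add: mat_assoc dims)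
  also have "\<dots> = (g * f) * (M \<sigma> * g)"
    unfolding HomsD(4)[OF f s, symmetric] by (simp add: mat_assoc dims)
  also have "\<dots> = M \<sigma> * g"
    unfolding gf by (rule left_mult_one_mat[OF mult_carrier_mat[OF is_repD(1)[OF M s] g]])
  finally show "g * N \<sigma> = M \<sigma> * g" .
qed

lemma rep_iso_inverse:
  assumes M: "is_rep d M" and N: "is_rep d N" and iso: "rep_iso d M N"
  obtains f g where "f \<in> Homs d M N" "g \<in> Homs d N M" "f * g = 1\<^sub>m (rdim N)" "g * f = 1\<^sub>m (rdim M)"
proof -
  obtain f where f: "f \<in> Homs d M N" and "invertible_mat f" using iso by (auto simp: rep_iso_def)
  then obtain g where sq: "dim_row f = dim_col f" and fg: "f * g = 1\<^sub>m (dim_row f)" and gf: "g * f = 1\<^sub>m (dim_row g)"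
    by (auto simp: invertible_mat_def inverts_mat_def)
  have "dim_row g = dim_col f" using arg_cong[OF gf, of dim_col] by simp
  moreover have "dim_col g = dim_row f" using arg_cong[OF fg, of dim_col] by simp
  ultimately have dims: "dim_row g = rdim M" "dim_col g = rdim N"
    using HomsD(2,3)[OF f] by (simp_all only:)
  then have g: "g \<in> carrier_mat (rdim M) (rdim N)" by (intro carrier_matI)
  moreover have "f * g = 1\<^sub>m (rdim N)" "g * f = 1\<^sub>m (rdim M)"
    using fg gf unfolding HomsD(2)[OF f] dims by (simp_all only:)
  ultimately show ?thesis using that[OF f Homs_inverse[OF M N f g]] by blast
qed

text \<open>Splitting \<open>e\<close> and \<open>1 - e\<close> decomposes \<open>Y\<close>, so one
  of the two images is zero.\<close>

lemma indecomposable_idempotent: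
  assumes ind: "indecomposable d Y" and e: "e \<in> Homs d Y Y" and ee: "e * e = e"
  shows "e = 0\<^sub>m (rdim Y) (rdim Y) \<or> e = 1\<^sub>m (rdim Y)"
proof -
  let ?n = "rdim Y"
  have Y: "is_rep d Y" using ind by (simp add: indecomposable_def)
  note om = one_minus_idempotent[OF HomsD(1)[OF e] ee]
  obtain A i p where A: "is_rep d A" and i: "i \<in> Homs d A Y" and p: "p \<in> Homs d Y A"
    and pi: "p * i = 1\<^sub>m (rdim A)" and ip: "i * p = e"
    by (rule image_of_idempotent[OF Y e ee])
  obtain B i' p' where B: "is_rep d B" and i': "i' \<in> Homs d B Y" and p': "p' \<in> Homs d Y B"
    and pi': "p' * i' = 1\<^sub>m (rdim B)" and ip': "i' * p' = 1\<^sub>m ?n - e"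
    by (rule image_of_idempotent[OF Y Homs_minus_id[OF Y e] om(1)])
  note dims = HomsD(2,3)[OF i] HomsD(2,3)[OF p] HomsD(2,3)[OF i'] HomsD(2,3)[OF p']
  have 1: "p * i' = 0\<^sub>m (rdim A) (rdim B)"
  proof -
    have "p * i' = (p * i) * (p * i') * (p' * i')"
      using left_mult_one_mat[OF mult_carrier_mat[OF HomsD(1)[OF p] HomsD(1)[OF i']]]
        right_mult_one_mat[OF mult_carrier_mat[OF HomsD(1)[OF p] HomsD(1)[OF i']]]
      by (simp add: pi pi')
    also have "\<dots> = p * ((i * p) * (i' * p')) * i'" by (simp add: mat_assoc dims)
    also have "\<dots> = 0\<^sub>m (rdim A) (rdim B)"
      unfolding ip ip' om(3) using HomsD(1)[OF p] HomsD(1)[OF i'] by simp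
    finally show ?thesis .
  qed
  have 2: "p' * i = 0\<^sub>m (rdim B) (rdim A)"
  proof -
    have "p' * i = (p' * i') * (p' * i) * (p * i)"
      using left_mult_one_mat[OF mult_carrier_mat[OF HomsD(1)[OF p'] HomsD(1)[OF i]]]
        right_mult_one_mat[OF mult_carrier_mat[OF HomsD(1)[OF p'] HomsD(1)[OF i]]]
      by (simp add: pi pi')
    also have "\<dots> = p' * ((i' * p') * (i * p)) * i" by (simp add: mat_assoc dims)
    also have "\<dots> = 0\<^sub>m (rdim B) (rdim A)"
      unfolding ip ip' om(4) using HomsD(1)[OF p'] HomsD(1)[OF i] by simp
    finally show ?thesis .
  qed
  have "i * p + i' * p' = 1\<^sub>m ?n" unfolding ip ip' by (rule om(2))
  then have "rep_iso d (rep_pair A B) Y"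
    by (intro rep_iso_pair[OF Y A B i p pi i' p' pi' 1 2])
  then have "rdim A = 0 \<or> rdim B = 0"
    using ind A B by (auto simp: indecomposable_def rep_pair_def)
  then show ?thesis
  proof
    assume "rdim A = 0"
    then have "i * p = 0\<^sub>m ?n ?n" by (intro eq_matI) (auto simp: dims scalar_prod_def)
    then show ?thesis by (simp add: ip)
  next
    assume "rdim B = 0"
    then have "i' * p' = 0\<^sub>m ?n ?n" by (intro eq_matI) (auto simp: dims scalar_prod_def)
    then have "1\<^sub>m ?n - e = 0\<^sub>m ?n ?n" by (simp add: ip')
    then have "e = 1\<^sub>m ?n" using om(2) HomsD(1)[OF e] by simp
    then show ?thesis by simp
  qed
qed

lemma pow_mat_add: "A \<in> carrier_mat n n \<Longrightarrow> A ^\<^sub>m (k + l) = A ^\<^sub>m k * (A ^\<^sub>m l :: 'k::semiring_1 mat)"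
proof (induction l)
  case (Suc l)
  then show ?case
    using assoc_mult_mat[OF pow_carrier_mat[OF Suc.prems, of k] pow_carrier_mat[OF Suc.prems, of l] Suc.prems] by simp
qed simp

lemma Homs_pow: "is_rep d M \<Longrightarrow> f \<in> Homs d M M \<Longrightarrow> f ^\<^sub>m k \<in> Homs d M M"
proof (induction k)
  case 0
  then show ?case using HomsD(2)[OF 0(2)] by (simp add: Homs_id)
next
  case (Suc k)
  then show ?case using Homs_comp[of d M M M f "f ^\<^sub>m k"] by simp
qed

text \<open>A factorisation \<open>h\<^sup>N = i p\<close> of minimal inner dimension makes \<open>p i\<close> invertible, so
  \<open>i (p i)\<^sup>-\<^sup>1 p\<close> is the Fitting idempotent of \<open>h\<close>.\<close>

lemma indecomposable_unit:
  assumes ind: "indecomposable d Y" and h: "h \<in> Homs d Y Y"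
    and nil: "\<And>N. h ^\<^sub>m N \<noteq> 0\<^sub>m (rdim Y) (rdim Y)"
  obtains g where "g \<in> Homs d Y Y" "g * h = 1\<^sub>m (rdim Y)"
proof -
  let ?n = "rdim Y"
  have Y: "is_rep d Y" using ind by (simp add: indecomposable_def)
  have hc: "h \<in> carrier_mat ?n ?n" by (rule HomsD(1)[OF h])
  \<comment> \<open>The dimension is minimised over all positive powers of \<open>h\<close> at once;
    a singular \<open>p * i\<close> would factor the power \<open>2N\<close> through a smaller
    dimension.\<close>
  let ?P = "\<lambda>r. \<exists>N i p. 0 < N \<and> i \<in> carrier_mat ?n r \<and> p \<in> carrier_mat r ?n \<and> h ^\<^sub>m N = i * p"
  have "?P ?n"
    by (intro exI[of _ 1] exI[of _ h] exI[of _ "1\<^sub>m ?n"]) (use hc in auto)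
  define r where "r = (LEAST r. ?P r)"
  have "?P r" unfolding r_def by (rule LeastI) fact
  then obtain N i p where N: "0 < N" and i: "i \<in> carrier_mat ?n r" and p: "p \<in> carrier_mat r ?n" and ip: "h ^\<^sub>m N = i * p"
    by blast
  note dims = carrier_matD[OF i] carrier_matD[OF p]
  let ?B = "p * i"
  have B: "?B \<in> carrier_mat r r" using i p by auto
  have "det ?B \<noteq> 0"
  proof
    assume "det ?B = 0"
    then obtain C D where r: "0 < r" and C: "C \<in> carrier_mat r (r - 1)" and D: "D \<in> carrier_mat (r - 1) r" and CD: "?B = C * D"
      using singular_factor[OF B] by blast
    note dimsCD = carrier_matD[OF C] carrier_matD[OF D]
    have "h ^\<^sub>m (N + N) = i * ?B * p" unfolding pow_mat_add[OF hc] ip by (simp add: mat_assoc dims)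
    also have "\<dots> = (i * C) * (D * p)" unfolding CD by (simp add: mat_assoc dims dimsCD)
    finally have "?P (r - 1)" using N i p C D by (intro exI[of _ "N + N"] exI[of _ "i * C"] exI[of _ "D * p"]) auto
    then have "r \<le> r - 1" unfolding r_def by (rule Least_le[of ?P])
    then show False using r by simp
  qed
  then obtain B' where B': "B' \<in> carrier_mat r r" "?B * B' = 1\<^sub>m r" "B' * ?B = 1\<^sub>m r"
    by (rule nonsingular_inverse[OF B])
  note dimsB = carrier_matD[OF B'(1)]
  have cancel: "p * (i * (B' * Z)) = Z" "B' * (p * (i * Z)) = Z" if "Z \<in> carrier_mat r c" for Z c
  proof -
    have dZ: "dim_row Z = r" "dim_col Z = c" using that by auto
    have "p * (i * (B' * Z)) = ?B * B' * Z" "B' * (p * (i * Z)) = B' * ?B * Z"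
      by (simp_all add: mat_assoc dims dimsB dZ)
    then show "p * (i * (B' * Z)) = Z" "B' * (p * (i * Z)) = Z"
      unfolding B'(2,3) using left_mult_one_mat[OF that] by simp_all
  qed
  let ?e = "i * (B' * p)"
  have ec: "?e \<in> carrier_mat ?n ?n" using i p B'(1) by auto
  have ee: "?e * ?e = ?e"
    using cancel(1)[OF p] by (simp add: mat_assoc dims dimsB)
  have e: "?e \<in> Homs d Y Y"
  proof (rule HomsI[OF ec])
    fix \<sigma> assume s: "\<sigma> \<in> Sym d"
    note dY = is_repD(4,5)[OF Y s] and Yc = is_repD(1)[OF Y s]
    have hN: "h ^\<^sub>m N * Y \<sigma> = Y \<sigma> * h ^\<^sub>m N" by (rule HomsD(4)[OF Homs_pow[OF Y h] s])
    \<comment> \<open>\<open>?X\<close> inverts \<open>?H\<close> on the image of \<open>?e\<close>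
      from both sides; this turns commutation with \<open>?H\<close> into commutation with
      \<open>?e\<close>.\<close>
    let ?H = "h ^\<^sub>m N" and ?X = "i * (B' * (B' * p))"
    have Hc: "?H \<in> carrier_mat ?n ?n" and Xc: "?X \<in> carrier_mat ?n ?n" using hc i p B'(1) by auto
    note dd = carrier_matD[OF Hc] carrier_matD[OF Xc] carrier_matD[OF ec] dY
    have HX: "?H * ?X = ?e"
      unfolding ip using cancel(1)[of "B' * p" ?n] B'(1) p by (simp add: mat_assoc dims dimsB)
    have XH: "?X * ?H = ?e"
      unfolding ip using cancel(2)[OF p] by (simp add: mat_assoc dims dimsB)
    have He: "?H * ?e = ?H"
      unfolding ip using cancel(1)[OF p] by (simp add: mat_assoc dims dimsB)
    have eH: "?e * ?H = ?H"
      unfolding ip using cancel(2)[OF p] by (simp add: mat_assoc dims dimsB)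
    have "?e * Y \<sigma> = ?X * (?H * Y \<sigma>)" unfolding XH[symmetric] by (rule mat_assoc) (simp_all only: dd)
    also have "\<dots> = ?X * (Y \<sigma> * (?H * ?e))" by (simp only: hN He)
    also have "\<dots> = ?X * (Y \<sigma> * ?H * ?e)"
      using mat_assoc[of "Y \<sigma>" ?H ?e] by (simp only: dd)
    also have "\<dots> = ?X * (?H * Y \<sigma>) * ?e"
      unfolding hN[symmetric] using mat_assoc[of ?X "?H * Y \<sigma>" ?e] by (simp only: dd dims index_mult_mat)
    also have "\<dots> = ?e * Y \<sigma> * ?e"
      unfolding XH[symmetric] using mat_assoc[of ?X ?H "Y \<sigma>"] by (simp only: dd)
    finally have 1: "?e * Y \<sigma> = ?e * Y \<sigma> * ?e" .
    have "Y \<sigma> * ?e = Y \<sigma> * ?H * ?X" unfolding HX[symmetric] using mat_assoc[of "Y \<sigma>" ?H ?X] by (simp only: dd)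
    also have "\<dots> = ?e * ?H * Y \<sigma> * ?X" by (simp only: hN[symmetric] eH)
    also have "\<dots> = ?e * (?H * Y \<sigma> * ?X)"
      using mat_assoc[of ?e ?H "Y \<sigma>"] mat_assoc[of ?e "?H * Y \<sigma>" ?X] by (simp only: dd dims index_mult_mat)
    also have "\<dots> = ?e * (Y \<sigma> * ?e)"
      unfolding hN HX[symmetric] using mat_assoc[of "Y \<sigma>" ?H ?X] by (simp only: dd)
    also have "\<dots> = ?e * Y \<sigma> * ?e" using mat_assoc[of ?e "Y \<sigma>" ?e] by (simp only: dd)
    finally show "?e * Y \<sigma> = Y \<sigma> * ?e" using 1 by (simp only:)
  qed
  have "?e \<noteq> 0\<^sub>m ?n ?n"
  proof
    assume z: "?e = 0\<^sub>m ?n ?n"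
    have "h ^\<^sub>m N = ?e * (i * p)"
      unfolding ip using cancel(2)[OF p] by (simp add: mat_assoc dims dimsB)
    then have "h ^\<^sub>m N = 0\<^sub>m ?n ?n" unfolding z using i p by auto
    then show False using nil by blast
  qed
  then have e1: "?e = 1\<^sub>m ?n" using indecomposable_idempotent[OF ind e ee] by blast
  let ?X = "i * (B' * (B' * p))"
  have Xc: "?X \<in> carrier_mat ?n ?n" using i p B'(1) by auto
  have "?X * h ^\<^sub>m N = ?e"
    unfolding ip using cancel(2)[OF p] by (simp add: mat_assoc dims dimsB)
  moreover have "h ^\<^sub>m N = h ^\<^sub>m (N - 1) * h" using N by (cases N) auto
  ultimately have gh: "(?X * h ^\<^sub>m (N - 1)) * h = 1\<^sub>m ?n"
    unfolding e1 using assoc_mult_mat[OF Xc pow_carrier_mat[OF hc, of "N - 1"] hc] by (simp only:)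
  let ?g = "?X * h ^\<^sub>m (N - 1)"
  have gc: "?g \<in> carrier_mat ?n ?n" using Xc pow_carrier_mat[OF hc, of "N - 1"] by auto
  have hg: "h * ?g = 1\<^sub>m ?n" by (rule mat_mult_left_right_inverse[OF gc hc gh])
  show ?thesis using that[OF Homs_inverse[OF Y Y h gc hg gh] gh] .
qed

section \<open>The simple functor of an indecomposable object\<close>

text \<open>The radical of \<open>Hom(Y,-)\<close> when the endomorphism ring of \<open>Y\<close> is
  local: the maps out of \<open>Y\<close> that are not split injections.\<close>

definition nonsplit_homs :: "nat \<Rightarrow> 'k::field srep \<Rightarrow> 'k srep \<Rightarrow> 'k mat set" where
  "nonsplit_homs d Y M = {f \<in> hom_functor d Y M. \<not> (\<exists>g \<in> Homs d M Y. g * f = 1\<^sub>m (rdim Y))}"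

lemma in_B_is_rep: "in_B d M \<Longrightarrow> is_rep d M"
  by (simp add: in_B_def)

lemma in_BI:
  assumes X: "X \<in> Ver4p" and Y: "is_summand d Y (tensor_rep d X)"
  shows "in_B d Y"
proof -
  have rep: "is_rep d Y" using Y by (simp add: is_summand_def)
  have one: "direct_sum [Y] \<sigma> = Y \<sigma>" for \<sigma>
    by (simp add: direct_sum_def diag_block_mat_singleton del: diag_block_mat.simps)
  then have "rdim (direct_sum [Y]) = rdim Y" by (simp add: rdim_def)
  then have "1\<^sub>m (rdim Y) \<in> Homs d (direct_sum [Y]) Y"
    using Homs_id[OF rep] by (simp add: Homs_def one)
  moreover have "invertible_mat (1\<^sub>m (rdim Y) :: 'a mat)"
    unfolding invertible_mat_def inverts_mat_def by (intro conjI exI[of _ "1\<^sub>m (rdim Y)"]) auto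
  ultimately have "rep_iso d (direct_sum [Y]) Y" unfolding rep_iso_def by blast
  then show ?thesis unfolding in_B_def using rep X Y by (intro conjI exI[of _ "[Y]"]) auto
qed

context
  fixes d :: nat and Y :: "'k::field srep"
  assumes Y: "in_B d Y" and dim: "rdim Y \<noteq> 0"
    and local: "\<And>f g. f \<in> Homs d Y Y \<Longrightarrow> g \<in> Homs d Y Y \<Longrightarrow> f + g = 1\<^sub>m (rdim Y) \<Longrightarrow>
      \<exists>h \<in> Homs d Y Y. h * f = 1\<^sub>m (rdim Y) \<or> h * g = 1\<^sub>m (rdim Y)"
begin

text \<open>Locality enters in closure under addition: a left inverse of \<open>f + g\<close> gives
  two endomorphisms of \<open>Y\<close> with sum 1, one of which has a left inverse.\<close>

lemma nonsplit_is_subfunctor: "is_subfunctor d Y (nonsplit_homs d Y)"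
  unfolding is_subfunctor_def
proof (intro conjI allI impI ballI)
  note YR = in_B_is_rep[OF Y]
  show "nonsplit_homs d Y \<le> hom_functor d Y" by (auto simp: le_fun_def nonsplit_homs_def)
  {
    fix M :: "'k srep" assume B: "in_B d M"
    note M = in_B_is_rep[OF B]
    have mem: "f \<in> nonsplit_homs d Y M \<longleftrightarrow> f \<in> Homs d Y M \<and> \<not> (\<exists>g \<in> Homs d M Y. g * f = 1\<^sub>m (rdim Y))" for f
      using B by (simp add: nonsplit_homs_def hom_functor_def)
    show "0\<^sub>m (rdim M) (rdim Y) \<in> nonsplit_homs d Y M"
      unfolding mem
    proof (intro conjI notI Homs_zero[OF YR M])
      assume "\<exists>g \<in> Homs d M Y. g * 0\<^sub>m (rdim M) (rdim Y) = 1\<^sub>m (rdim Y)"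
      then obtain g where "g \<in> Homs d M Y" and eq: "g * 0\<^sub>m (rdim M) (rdim Y) = 1\<^sub>m (rdim Y)" by blast
      then have "(0\<^sub>m (rdim Y) (rdim Y) :: 'k mat) = 1\<^sub>m (rdim Y)" using HomsD(1)[of g d M Y] by simp
      then have "(0\<^sub>m (rdim Y) (rdim Y) :: 'k mat) $$ (0, 0) = 1\<^sub>m (rdim Y) $$ (0, 0)" by simp
      then show False using dim by simp
    qed
    {
      fix f g assume "f \<in> nonsplit_homs d Y M" "g \<in> nonsplit_homs d Y M"
      then have f: "f \<in> Homs d Y M" "\<not> (\<exists>h \<in> Homs d M Y. h * f = 1\<^sub>m (rdim Y))"
        and g: "g \<in> Homs d Y M" "\<not> (\<exists>h \<in> Homs d M Y. h * g = 1\<^sub>m (rdim Y))" by (simp_all add: mem)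
      show "f + g \<in> nonsplit_homs d Y M"
        unfolding mem
      proof (intro conjI notI Homs_add[OF YR M f(1) g(1)])
        assume "\<exists>h \<in> Homs d M Y. h * (f + g) = 1\<^sub>m (rdim Y)"
        then obtain h where h: "h \<in> Homs d M Y" "h * (f + g) = 1\<^sub>m (rdim Y)" by blast
        note dims = HomsD(2,3)[OF h(1)] HomsD(2,3)[OF f(1)] HomsD(2,3)[OF g(1)]
        have "h * f + h * g = 1\<^sub>m (rdim Y)" using h(2) by (simp add: mat_distrib dims)
        then obtain k where k: "k \<in> Homs d Y Y" "k * (h * f) = 1\<^sub>m (rdim Y) \<or> k * (h * g) = 1\<^sub>m (rdim Y)"
          using local[OF Homs_comp[OF YR M YR f(1) h(1)] Homs_comp[OF YR M YR g(1) h(1)]] by blast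
        have "k * h * f = 1\<^sub>m (rdim Y) \<or> k * h * g = 1\<^sub>m (rdim Y)"
          using k(2) by (simp add: mat_assoc dims HomsD(2,3)[OF k(1)])
        then show False using f(2) g(2) Homs_comp[OF M YR YR h(1) k(1)] by blast
      qed
    }
    {
      fix c :: 'k and f assume "f \<in> nonsplit_homs d Y M"
      then have f: "f \<in> Homs d Y M" "\<not> (\<exists>h \<in> Homs d M Y. h * f = 1\<^sub>m (rdim Y))" by (simp_all add: mem)
      show "c \<cdot>\<^sub>m f \<in> nonsplit_homs d Y M"
        unfolding mem
      proof (intro conjI notI Homs_smult[OF YR M f(1)])
        assume "\<exists>h \<in> Homs d M Y. h * (c \<cdot>\<^sub>m f) = 1\<^sub>m (rdim Y)"
        then obtain h where h: "h \<in> Homs d M Y" "h * (c \<cdot>\<^sub>m f) = 1\<^sub>m (rdim Y)" by blast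
        have "(c \<cdot>\<^sub>m h) * f = h * (c \<cdot>\<^sub>m f)"
          using mult_smult_assoc_mat[OF HomsD(1)[OF h(1)] HomsD(1)[OF f(1)]]
            mult_smult_distrib[OF HomsD(1)[OF h(1)] HomsD(1)[OF f(1)]] by simp
        then show False using h f(2) Homs_smult[OF M YR h(1)] by metis
      qed
    }
  }
  fix M N :: "'k srep" and f g
  assume MN: "in_B d M \<and> in_B d N" and f: "f \<in> nonsplit_homs d Y M" and g: "g \<in> Homs d M N"
  note M = in_B_is_rep[OF conjunct1[OF MN]] and N = in_B_is_rep[OF conjunct2[OF MN]]
  have f': "f \<in> Homs d Y M" "\<not> (\<exists>h \<in> Homs d M Y. h * f = 1\<^sub>m (rdim Y))"
    using f MN by (simp_all add: nonsplit_homs_def hom_functor_def)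
  have "\<not> (\<exists>h \<in> Homs d N Y. h * (g * f) = 1\<^sub>m (rdim Y))"
  proof
    assume "\<exists>h \<in> Homs d N Y. h * (g * f) = 1\<^sub>m (rdim Y)"
    then obtain h where h: "h \<in> Homs d N Y" "h * (g * f) = 1\<^sub>m (rdim Y)" by blast
    have "h * g * f = 1\<^sub>m (rdim Y)"
      using h(2) HomsD(2,3)[OF h(1)] HomsD(2,3)[OF g] HomsD(2,3)[OF f'(1)] by (simp add: mat_assoc)
    then show False using f'(2) Homs_comp[OF M N YR g h(1)] by blast
  qed
  then show "g * f \<in> nonsplit_homs d Y N"
    using Homs_comp[OF YR M N f'(1) g] MN by (simp add: nonsplit_homs_def hom_functor_def)
qed

text \<open>A split map and its retraction put the identity of \<open>Y\<close> into the subfunctor,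
  and by Yoneda the identity generates everything.\<close>

lemma subfunctor_with_split:
  assumes T: "is_subfunctor d Y T" and "\<not> T \<le> nonsplit_homs d Y"
  shows "T = hom_functor d Y"
proof -
  note YR = in_B_is_rep[OF Y]
  have le: "T M \<subseteq> hom_functor d Y M" for M using T by (simp add: is_subfunctor_def le_fun_def)
  obtain M f where f: "f \<in> T M" "f \<notin> nonsplit_homs d Y M" using assms(2) by (auto simp: le_fun_def)
  then have fh: "f \<in> hom_functor d Y M" using le by blast
  then have B: "in_B d M" by (auto simp: hom_functor_def split: if_splits)
  obtain g where g: "g \<in> Homs d M Y" "g * f = 1\<^sub>m (rdim Y)"
    using f fh by (auto simp: nonsplit_homs_def)
  have one: "1\<^sub>m (rdim Y) \<in> T Y"
    using T f(1) g B Y unfolding is_subfunctor_def by metis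
  have "h \<in> T N" if h: "h \<in> hom_functor d Y N" for N h
  proof -
    have N: "in_B d N" and h': "h \<in> Homs d Y N" using h by (auto simp: hom_functor_def split: if_splits)
    have "h * 1\<^sub>m (rdim Y) \<in> T N"
      using T one h' N Y unfolding is_subfunctor_def by blast
    then show ?thesis using right_mult_one_mat[OF HomsD(1)[OF h']] by simp
  qed
  then show ?thesis using le by (intro ext equalityI subsetI) auto
qed

lemma nonsplit_ne: "nonsplit_homs d Y \<noteq> hom_functor d Y"
proof
  assume eq: "nonsplit_homs d Y = hom_functor d Y"
  note YR = in_B_is_rep[OF Y]
  have "1\<^sub>m (rdim Y) \<in> hom_functor d Y Y" using Y by (simp add: hom_functor_def Homs_id[OF YR])
  then have "1\<^sub>m (rdim Y) \<in> nonsplit_homs d Y Y" by (simp add: eq)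
  moreover have "1\<^sub>m (rdim Y) * 1\<^sub>m (rdim Y) = (1\<^sub>m (rdim Y) :: 'k mat)" by simp
  ultimately show False using Homs_id[OF YR] by (auto simp: nonsplit_homs_def)
qed

lemma rad_functor_eq: "rad_functor d Y = nonsplit_homs d Y"
  unfolding rad_functor_def
proof (rule the_equality)
  show "is_maximal_subfunctor d Y (nonsplit_homs d Y)"
    unfolding is_maximal_subfunctor_def
  proof (intro conjI allI impI nonsplit_is_subfunctor nonsplit_ne)
    fix T assume "is_subfunctor d Y T \<and> nonsplit_homs d Y \<le> T"
    then show "T = nonsplit_homs d Y \<or> T = hom_functor d Y"
      using subfunctor_with_split[of T] by (metis antisym)
  qed
  fix S assume S: "is_maximal_subfunctor d Y S"
  then have "S \<le> nonsplit_homs d Y"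
    using subfunctor_with_split[of S] by (auto simp: is_maximal_subfunctor_def)
  then show "S = nonsplit_homs d Y"
    using S nonsplit_is_subfunctor nonsplit_ne by (metis is_maximal_subfunctor_def)
qed

text \<open>The quotient by the radical has a single coset at \<open>M\<close> exactly when all maps
  from \<open>Y\<close> to \<open>M\<close> are radical, that is, when \<open>Y\<close> is not a
  summand of \<open>M\<close>.\<close>

lemma simple_functor_singleton_iff:
  assumes M: "in_B d M"
  shows "is_singleton (simple_functor d Y M) \<longleftrightarrow>
    \<not> (\<exists>f \<in> Homs d Y M. \<exists>g \<in> Homs d M Y. g * f = 1\<^sub>m (rdim Y))"
proof -
  note YR = in_B_is_rep[OF Y] and MR = in_B_is_rep[OF M]
  let ?R = "nonsplit_homs d Y M" and ?H = "Homs d Y M"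
  have H: "hom_functor d Y M = ?H" using M by (simp add: hom_functor_def)
  have R: "f \<in> ?R \<longleftrightarrow> f \<in> ?H \<and> \<not> (\<exists>g \<in> Homs d M Y. g * f = 1\<^sub>m (rdim Y))" for f
    by (simp add: nonsplit_homs_def H)
  have sf: "simple_functor d Y M = (\<lambda>f. (\<lambda>r. f + r) ` ?R) ` ?H"
    unfolding simple_functor_def rad_functor_eq H by (auto simp: image_def)
  have zero: "0\<^sub>m (rdim M) (rdim Y) \<in> ?R"
    using nonsplit_is_subfunctor M by (simp add: is_subfunctor_def)
  have zH: "0\<^sub>m (rdim M) (rdim Y) \<in> ?H" by (rule Homs_zero[OF YR MR])
  have coset0: "(\<lambda>r. 0\<^sub>m (rdim M) (rdim Y) + r) ` ?R = ?R"
  proof -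
    have "0\<^sub>m (rdim M) (rdim Y) + r = r" if "r \<in> ?R" for r
      using that HomsD(1)[of r d Y M] by (simp add: R)
    then show ?thesis by simp
  qed
  show ?thesis
  proof
    assume "is_singleton (simple_functor d Y M)"
    then have all: "(\<lambda>r. f + r) ` ?R = ?R" if "f \<in> ?H" for f
      unfolding sf using coset0 zH that by (metis (no_types, lifting) image_eqI is_singleton_the_elem singletonD)
    show "\<not> (\<exists>f \<in> ?H. \<exists>g \<in> Homs d M Y. g * f = 1\<^sub>m (rdim Y))"
    proof
      assume "\<exists>f \<in> ?H. \<exists>g \<in> Homs d M Y. g * f = 1\<^sub>m (rdim Y)"
      then obtain f where f: "f \<in> ?H" "\<exists>g \<in> Homs d M Y. g * f = 1\<^sub>m (rdim Y)" by blast
      have "f + 0\<^sub>m (rdim M) (rdim Y) \<in> ?R" using all[OF f(1)] zero by blast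
      then have "f \<in> ?R" using HomsD(1)[OF f(1)] by simp
      then show False using f by (simp add: R)
    qed
  next
    assume "\<not> (\<exists>f \<in> ?H. \<exists>g \<in> Homs d M Y. g * f = 1\<^sub>m (rdim Y))"
    then have RH: "?R = ?H" using R by blast
    have "(\<lambda>r. f + r) ` ?H = ?H" if f: "f \<in> ?H" for f
    proof (intro equalityI subsetI)
      fix h assume h: "h \<in> ?H"
      have "f + (h + (-1) \<cdot>\<^sub>m f) = h"
        by (rule eq_matI) (use HomsD(1)[OF f] HomsD(1)[OF h] in auto)
      moreover have "h + (-1) \<cdot>\<^sub>m f \<in> ?H" by (intro Homs_add[OF YR MR h] Homs_smult[OF YR MR f])
      ultimately show "h \<in> (\<lambda>r. f + r) ` ?H" by (metis image_eqI)
    qed (use Homs_add[OF YR MR f] in auto)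
    then have "simple_functor d Y M = {?H}" unfolding sf RH using zH by auto
    then show "is_singleton (simple_functor d Y M)" by (simp add: is_singleton_def)
  qed
qed

end

section \<open>Permutation modules\<close>

lemma Sym_inv: "\<sigma> \<in> Sym d \<Longrightarrow> inv_into UNIV \<sigma> \<in> Sym d"
  by (simp add: Sym_def permutes_inv)

lemma Sym_lt: "\<sigma> \<in> Sym d \<Longrightarrow> x < d \<Longrightarrow> \<sigma> x < d"
  using permutes_in_image[of \<sigma> "{..<d}" x] by (simp add: Sym_def)

lemma Sym_inverses: "\<sigma> \<in> Sym d \<Longrightarrow> \<sigma> (inv_into UNIV \<sigma> x) = x" "\<sigma> \<in> Sym d \<Longrightarrow> inv_into UNIV \<sigma> (\<sigma> x) = x"
  using permutes_inverses by (auto simp: Sym_def)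

lemma finite_Sym [simp]: "finite (Sym d)"
  by (simp add: Sym_def finite_permutations)

lemma sum_Sym: "\<sigma> \<in> Sym d \<Longrightarrow> (\<Sum>x<d. f (\<sigma> x)) = (\<Sum>x<d. f x)"
  by (rule sum.permute[of \<sigma> "{..<d}" f, symmetric, unfolded o_def]) (simp add: Sym_def)

lemma count_list_card: "count_list w i = card {x. x < length w \<and> w ! x = i}"
  by (simp add: count_list_eq_length_filter length_filter_conv_card eq_commute)

lemma set_tabloids:
  "w \<in> set (tabloids d l) \<longleftrightarrow> length w = d \<and> (\<forall>x<d. w ! x < length l) \<and>
    (\<forall>i<length l. card {x. x < d \<and> w ! x = i} = l ! i)"
  by (auto simp: tabloids_def set_n_lists count_list_card in_set_conv_nth subset_iff)

lemma distinct_tabloids: "distinct (tabloids d l)"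
  unfolding tabloids_def by (intro distinct_filter distinct_n_lists distinct_upt)

lemma tabloid_index:
  assumes "w \<in> set (tabloids d l)"
  obtains a where "a < length (tabloids d l)" "tabloids d l ! a = w"
  using assms by (auto simp: in_set_conv_nth)

lemma length_perm_word [simp]: "length (perm_word d \<sigma> w) = d"
  by (simp add: perm_word_def)

lemma perm_word_nth: "y < d \<Longrightarrow> perm_word d \<sigma> w ! y = w ! inv_into UNIV \<sigma> y"
  by (simp add: perm_word_def)

lemma perm_word_id: "length w = d \<Longrightarrow> perm_word d id w = w"
  by (rule nth_equalityI) (simp_all add: perm_word_nth inv_id)

lemma perm_word_comp:
  assumes "\<sigma> \<in> Sym d" "\<tau> \<in> Sym d"
  shows "perm_word d (\<sigma> \<circ> \<tau>) w = perm_word d \<sigma> (perm_word d \<tau> w)"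
proof (rule nth_equalityI)
  fix y assume "y < length (perm_word d (\<sigma> \<circ> \<tau>) w)"
  then have y: "y < d" by simp
  have "inv_into UNIV (\<sigma> \<circ> \<tau>) y = inv_into UNIV \<tau> (inv_into UNIV \<sigma> y)"
    using assms by (simp add: Sym_def o_inv_distrib permutes_bij)
  then show "perm_word d (\<sigma> \<circ> \<tau>) w ! y = perm_word d \<sigma> (perm_word d \<tau> w) ! y"
    using y Sym_lt[OF Sym_inv[OF assms(1)] y] by (simp add: perm_word_nth)
qed simp

lemma perm_word_tabloids:
  assumes s: "\<sigma> \<in> Sym d" and w: "w \<in> set (tabloids d l)"
  shows "perm_word d \<sigma> w \<in> set (tabloids d l)"
proof -
  have lt: "inv_into UNIV \<sigma> x < d" if "x < d" for x by (rule Sym_lt[OF Sym_inv[OF s] that])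
  have "card {x. x < d \<and> perm_word d \<sigma> w ! x = i} = card {x. x < d \<and> w ! x = i}" for i
  proof (rule bij_betw_same_card[of "inv_into UNIV \<sigma>"], rule bij_betw_byWitness[where f'=\<sigma>])
  qed (use lt Sym_lt[OF s] Sym_inverses[OF s] in \<open>auto simp: perm_word_nth\<close>)
  then show ?thesis using w lt by (auto simp: set_tabloids perm_word_nth)
qed

lemma perm_word_cancel:
  assumes "\<sigma> \<in> Sym d" "length w = d"
  shows "perm_word d \<sigma> (perm_word d (inv_into UNIV \<sigma>) w) = w" "perm_word d (inv_into UNIV \<sigma>) (perm_word d \<sigma> w) = w"
proof -
  have "\<sigma> \<circ> inv_into UNIV \<sigma> = id" "inv_into UNIV \<sigma> \<circ> \<sigma> = id"
    using assms(1) permutes_inv_o by (auto simp: Sym_def)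
  then show "perm_word d \<sigma> (perm_word d (inv_into UNIV \<sigma>) w) = w" "perm_word d (inv_into UNIV \<sigma>) (perm_word d \<sigma> w) = w"
    using perm_word_comp[OF assms(1) Sym_inv[OF assms(1)], of w] perm_word_comp[OF Sym_inv[OF assms(1)] assms(1), of w]
      perm_word_id[OF assms(2)] by (simp_all only:)
qed

definition tvec :: "nat \<Rightarrow> nat list \<Rightarrow> nat list \<Rightarrow> 'k::field vec" where
  "tvec d l w = vec (length (tabloids d l)) (\<lambda>a. if tabloids d l ! a = w then 1 else 0)"

lemma tvec_carrier [simp]: "tvec d l w \<in> carrier_vec (length (tabloids d l))"
  by (simp add: tvec_def)

lemma rdim_perm_module: "rdim (perm_module d l :: 'k::field srep) = length (tabloids d l)"
  by (simp add: rdim_def perm_module_def)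

lemma perm_module_tvec:
  assumes s: "\<sigma> \<in> Sym d" and w: "w \<in> set (tabloids d l)"
  shows "perm_module d l \<sigma> *\<^sub>v tvec d l w = (tvec d l (perm_word d \<sigma> w) :: 'k::field vec)"
proof (rule eq_vecI)
  obtain b where b: "b < length (tabloids d l)" "tabloids d l ! b = w" by (rule tabloid_index[OF w])
  fix a assume "a < dim_vec (tvec d l (perm_word d \<sigma> w) :: 'k vec)"
  then have a: "a < length (tabloids d l)" by (simp add: tvec_def)
  have "(perm_module d l \<sigma> *\<^sub>v tvec d l w) $ a = (\<Sum>c<length (tabloids d l). (perm_module d l \<sigma> :: 'k mat) $$ (a, c) *
      (if c = b then 1 else 0))"
    using a b distinct_tabloids[of d l]
    by (auto simp: scalar_prod_def perm_module_def tvec_def lessThan_atLeast0 nth_eq_iff_index_eq intro!: sum.cong)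
  also have "\<dots> = (\<Sum>c<length (tabloids d l). if c = b then (perm_module d l \<sigma> :: 'k mat) $$ (a, c) else 0)"
    by (intro sum.cong refl) simp
  finally show "(perm_module d l \<sigma> *\<^sub>v tvec d l w) $ a = (tvec d l (perm_word d \<sigma> w) :: 'k vec) $ a"
    using a b by (simp add: perm_module_def tvec_def)
qed (simp add: perm_module_def tvec_def)

lemma perm_module_is_rep: "is_rep d (perm_module d l :: 'k::field srep)"
  unfolding is_rep_def rdim_perm_module
proof (intro conjI ballI)
  let ?T = "tabloids d l" and ?M = "perm_module d l :: 'k srep"
  have T: "?T ! a \<in> set ?T" if "a < length ?T" for a using that by simp
  show "?M id = 1\<^sub>m (length ?T)"
  proof (rule eq_matI)
    fix a b assume "a < dim_row (1\<^sub>m (length ?T) :: 'k mat)" "b < dim_col (1\<^sub>m (length ?T) :: 'k mat)"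
    then have ab: "a < length ?T" "b < length ?T" by auto
    have "perm_word d id (?T ! b) = ?T ! b" using T[OF ab(2)] by (intro perm_word_id) (simp add: set_tabloids)
    then show "?M id $$ (a, b) = 1\<^sub>m (length ?T) $$ (a, b)"
      using ab distinct_tabloids[of d l] by (simp add: perm_module_def nth_eq_iff_index_eq)
  qed (simp_all add: perm_module_def)
  fix \<sigma> assume s: "\<sigma> \<in> Sym d"
  show "?M \<sigma> \<in> carrier_mat (length ?T) (length ?T)" by (simp add: perm_module_def)
  fix \<tau> assume t: "\<tau> \<in> Sym d"
  show "?M (\<sigma> \<circ> \<tau>) = ?M \<sigma> * ?M \<tau>"
  proof (rule eq_matI)
    fix a b assume "a < dim_row (?M \<sigma> * ?M \<tau>)" "b < dim_col (?M \<sigma> * ?M \<tau>)"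
    then have ab: "a < length ?T" "b < length ?T" by (simp_all add: perm_module_def)
    have col: "col (?M \<tau>) b = tvec d l (perm_word d \<tau> (?T ! b))"
      using ab by (intro eq_vecI) (simp_all add: perm_module_def tvec_def)
    have "(?M \<sigma> * ?M \<tau>) $$ (a, b) = (?M \<sigma> *\<^sub>v col (?M \<tau>) b) $ a"
      using ab by (simp add: perm_module_def)
    also have "\<dots> = tvec d l (perm_word d \<sigma> (perm_word d \<tau> (?T ! b))) $ a"
      unfolding col using perm_module_tvec[OF s perm_word_tabloids[OF t T[OF ab(2)]], where 'k='k] by simp
    finally show "?M (\<sigma> \<circ> \<tau>) $$ (a, b) = (?M \<sigma> * ?M \<tau>) $$ (a, b)"
      using ab by (simp add: perm_module_def tvec_def perm_word_comp[OF s t])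
  qed (simp_all add: perm_module_def)
qed

text \<open>The dimension is a parameter and the sum is entrywise, because matrices of all sizes
  share one type.\<close>

definition mat_sum :: "nat \<Rightarrow> 'b set \<Rightarrow> ('b \<Rightarrow> 'k::field mat) \<Rightarrow> 'k mat" where
  "mat_sum n S F = mat n n (\<lambda>(i, j). \<Sum>x\<in>S. F x $$ (i, j))"

lemma mat_sum_carrier [simp]: "mat_sum n S F \<in> carrier_mat n n"
  by (simp add: mat_sum_def)

lemma dim_mat_sum [simp]: "dim_row (mat_sum n S F) = n" "dim_col (mat_sum n S F) = n"
  by (simp_all add: mat_sum_def)

lemma mat_sum_intertwine:
  assumes f: "f \<in> carrier_mat n k" and F: "\<And>x. x \<in> S \<Longrightarrow> F x \<in> carrier_mat k k" and G: "\<And>x. x \<in> S \<Longrightarrow> G x \<in> carrier_mat n n"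
    and eq: "\<And>x. x \<in> S \<Longrightarrow> f * F x = G x * f"
  shows "f * mat_sum k S F = mat_sum n S G * f"
proof (rule eq_matI)
  fix i j assume "i < dim_row (mat_sum n S G * f)" "j < dim_col (mat_sum n S G * f)"
  then have ij: "i < n" "j < k" using f by auto
  have "(f * mat_sum k S F) $$ (i, j) = (\<Sum>c<k. f $$ (i, c) * (\<Sum>x\<in>S. F x $$ (c, j)))"
    using ij f by (simp add: scalar_prod_def mat_sum_def lessThan_atLeast0)
  also have "\<dots> = (\<Sum>x\<in>S. \<Sum>c<k. f $$ (i, c) * F x $$ (c, j))"
    unfolding sum_distrib_left by (rule sum.swap)
  also have "\<dots> = (\<Sum>x\<in>S. (f * F x) $$ (i, j))"
    using ij f carrier_matD[OF F] by (intro sum.cong refl) (simp add: scalar_prod_def lessThan_atLeast0)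
  also have "\<dots> = (\<Sum>x\<in>S. (G x * f) $$ (i, j))" by (intro sum.cong refl) (simp only: eq)
  also have "\<dots> = (\<Sum>x\<in>S. \<Sum>c<n. G x $$ (i, c) * f $$ (c, j))"
    using ij f carrier_matD[OF G] by (intro sum.cong refl) (simp add: scalar_prod_def lessThan_atLeast0)
  also have "\<dots> = (\<Sum>c<n. (\<Sum>x\<in>S. G x $$ (i, c)) * f $$ (c, j))"
    unfolding sum_distrib_right by (rule sum.swap)
  also have "\<dots> = (mat_sum n S G * f) $$ (i, j)"
    using ij f by (simp add: scalar_prod_def mat_sum_def lessThan_atLeast0)
  finally show "(f * mat_sum k S F) $$ (i, j) = (mat_sum n S G * f) $$ (i, j)" .
qed (use f in auto)

lemma mat_sum_mult:
  assumes F: "\<And>x. x \<in> S \<Longrightarrow> F x \<in> carrier_mat n n" and G: "\<And>y. y \<in> R \<Longrightarrow> G y \<in> carrier_mat n n"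
  shows "mat_sum n S F * mat_sum n R G = mat_sum n (S \<times> R) (\<lambda>(x, y). F x * G y)"
proof (rule eq_matI)
  fix i j assume "i < dim_row (mat_sum n (S \<times> R) (\<lambda>(x, y). F x * G y))" "j < dim_col (mat_sum n (S \<times> R) (\<lambda>(x, y). F x * G y))"
  then have ij: "i < n" "j < n" by auto
  have "(mat_sum n S F * mat_sum n R G) $$ (i, j) = (\<Sum>c<n. \<Sum>x\<in>S. \<Sum>y\<in>R. F x $$ (i, c) * G y $$ (c, j))"
    using ij by (simp add: scalar_prod_def mat_sum_def lessThan_atLeast0 sum_product)
  also have "\<dots> = (\<Sum>x\<in>S. \<Sum>y\<in>R. \<Sum>c<n. F x $$ (i, c) * G y $$ (c, j))"
    by (subst sum.swap) (intro sum.cong refl sum.swap)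
  also have "\<dots> = (\<Sum>x\<in>S. \<Sum>y\<in>R. (F x * G y) $$ (i, j))"
    using ij carrier_matD[OF F] carrier_matD[OF G] by (intro sum.cong refl) (simp add: scalar_prod_def lessThan_atLeast0)
  finally show "(mat_sum n S F * mat_sum n R G) $$ (i, j) = mat_sum n (S \<times> R) (\<lambda>(x, y). F x * G y) $$ (i, j)"
    using ij by (simp add: mat_sum_def sum.cartesian_product case_prod_unfold del: index_mult_mat)
qed auto

lemma mat_sum_vec:
  assumes F: "\<And>x. x \<in> S \<Longrightarrow> F x \<in> carrier_mat n n" and v: "v \<in> carrier_vec n" and i: "i < n"
  shows "(mat_sum n S F *\<^sub>v v) $ i = (\<Sum>x\<in>S. (F x *\<^sub>v v) $ i)"
proof -
  have "(mat_sum n S F *\<^sub>v v) $ i = (\<Sum>c<n. (\<Sum>x\<in>S. F x $$ (i, c)) * v $ c)"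
    using i v by (simp add: scalar_prod_def mat_sum_def lessThan_atLeast0)
  also have "\<dots> = (\<Sum>x\<in>S. \<Sum>c<n. F x $$ (i, c) * v $ c)"
    unfolding sum_distrib_right by (rule sum.swap)
  also have "\<dots> = (\<Sum>x\<in>S. (F x *\<^sub>v v) $ i)"
    using i v carrier_matD[OF F] by (intro sum.cong refl) (simp add: scalar_prod_def lessThan_atLeast0)
  finally show ?thesis .
qed

abbreviation rep_sum :: "nat \<Rightarrow> 'k::field srep \<Rightarrow> (nat \<Rightarrow> nat) set \<Rightarrow> 'k mat" where
  "rep_sum d M S \<equiv> mat_sum (rdim M) S M"

lemma Homs_rep_sum:
  assumes "is_rep d M" "is_rep d N" "f \<in> Homs d M N" "S \<subseteq> Sym d"
  shows "f * rep_sum d M S = rep_sum d N S * f"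
  by (rule mat_sum_intertwine[OF HomsD(1)[OF assms(3)]])
    (use assms is_repD(1) HomsD(4)[OF assms(3)] in \<open>auto simp: subset_iff\<close>)

lemma rep_sum_tvec:
  assumes S: "S \<subseteq> Sym d" and w: "w \<in> set (tabloids d l)" and a: "a < length (tabloids d l)"
  shows "(rep_sum d (perm_module d l) S *\<^sub>v tvec d l w) $ a =
    (\<Sum>\<sigma>\<in>S. if tabloids d l ! a = perm_word d \<sigma> w then 1 else 0 :: 'k::field)"
proof -
  have "(rep_sum d (perm_module d l) S *\<^sub>v tvec d l w) $ a = (\<Sum>\<sigma>\<in>S. (perm_module d l \<sigma> *\<^sub>v tvec d l w) $ a :: 'k)"
    by (rule mat_sum_vec) (use S a in \<open>auto simp: rdim_perm_module perm_module_def\<close>)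
  also have "\<dots> = (\<Sum>\<sigma>\<in>S. if tabloids d l ! a = perm_word d \<sigma> w then 1 else 0 :: 'k)"
  proof (intro sum.cong refl)
    fix \<sigma> assume "\<sigma> \<in> S"
    then have "\<sigma> \<in> Sym d" using S by blast
    then show "(perm_module d l \<sigma> *\<^sub>v tvec d l w) $ a = (if tabloids d l ! a = perm_word d \<sigma> w then 1 else 0 :: 'k)"
      unfolding perm_module_tvec[OF \<open>\<sigma> \<in> Sym d\<close> w] using a by (simp add: tvec_def)
  qed
  finally show ?thesis .
qed

section \<open>Tableaux and polytabloids\<close>

text \<open>The parts of the conjugate partition.\<close>

definition col_len :: "nat list \<Rightarrow> nat \<Rightarrow> nat" where
  "col_len l j = card {i. i < length l \<and> j < l ! i}"

lemma partition_nth_mono: "is_partition d l \<Longrightarrow> i \<le> i' \<Longrightarrow> i' < length l \<Longrightarrow> l ! i' \<le> l ! i"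
  unfolding is_partition_def by (cases "i = i'") (auto simp: sorted_wrt_iff_nth_less)

lemma cell_iff:
  assumes "is_partition d l" shows "i < length l \<and> j < l ! i \<longleftrightarrow> i < col_len l j"
proof -
  let ?A = "{i. i < length l \<and> j < l ! i}"
  have down: "i' \<in> ?A" if "i \<in> ?A" "i' \<le> i" for i i'
    using that partition_nth_mono[OF assms, of i' i] by auto
  have fin: "finite ?A" by simp
  have "i \<in> ?A \<longleftrightarrow> i < card ?A"
  proof
    assume "i \<in> ?A"
    then have "{..i} \<subseteq> ?A" using down by auto
    then have "card {..i} \<le> card ?A" by (rule card_mono[OF fin])
    then show "i < card ?A" by simp
  next
    assume lt: "i < card ?A"
    show "i \<in> ?A"
    proof (rule ccontr)
      assume "i \<notin> ?A"
      then have "?A \<subseteq> {..<i}" using down by (meson lessThan_iff not_le subsetI)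
      then have "card ?A \<le> i" by (metis card_lessThan card_mono finite_lessThan)
      then show False using lt by simp
    qed
  qed
  then show ?thesis by (simp add: col_len_def)
qed

text \<open>Row lengths descend to 0 in steps of at most one, so no value is skipped; the witness is
  the last row longer than \<open>j\<close>.\<close>

lemma two_restricted_attains:
  assumes l: "is_partition d l" and tr: "two_restricted l" and j: "j < row_len l 0"
  shows "\<exists>i<length l. l ! i = Suc j"
proof -
  have ex: "\<exists>i. row_len l i \<le> j" by (intro exI[of _ "length l"]) (simp add: row_len_def)
  define i where "i = (LEAST i. row_len l i \<le> j)"
  have i: "row_len l i \<le> j" unfolding i_def using ex by (rule LeastI_ex)
  have "i \<noteq> 0" using i j by (metis not_le)
  then obtain i' where i': "i = Suc i'" by (cases i) auto
  have "\<not> row_len l i' \<le> j" using not_less_Least[of i'] i' unfolding i_def by (metis lessI)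
  moreover have "row_len l i' - row_len l (Suc i') \<le> 1" using tr by (simp add: two_restricted_def)
  ultimately have "row_len l i' = Suc j" using i unfolding i' by linarith
  then show ?thesis by (intro exI[of _ i']) (auto simp: row_len_def split: if_splits)
qed

text \<open>A row of length exactly \<open>j + 1\<close> meets column \<open>j\<close> but no later
  one.\<close>

lemma col_len_strict:
  assumes l: "is_partition d l" and tr: "two_restricted l" and j: "j < j'" and ne: "0 < col_len l j'"
  shows "col_len l j' < col_len l j"
proof -
  have 0: "0 < length l \<and> j' < l ! 0" using ne cell_iff[OF l, of 0 j'] by simp
  then have "j < row_len l 0" using j by (simp add: row_len_def)
  then obtain i where i: "i < length l" "l ! i = Suc j" using two_restricted_attains[OF l tr] by blast
  have "{i. i < length l \<and> j' < l ! i} \<subset> {i. i < length l \<and> j < l ! i}"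
  proof
    show "{i. i < length l \<and> j' < l ! i} \<subseteq> {i. i < length l \<and> j < l ! i}" using j by auto
    have "i \<in> {i. i < length l \<and> j < l ! i}" "i \<notin> {i. i < length l \<and> j' < l ! i}" using i j by auto
    then show "{i. i < length l \<and> j' < l ! i} \<noteq> {i. i < length l \<and> j < l ! i}" by blast
  qed
  then show ?thesis unfolding col_len_def by (intro psubset_card_mono) auto
qed

lemma sum_lessThan_le: "finite (A :: nat set) \<Longrightarrow> \<Sum>{..<card A} \<le> \<Sum>A"
proof (induction "card A" arbitrary: A)
  case (Suc n)
  then have ne: "A \<noteq> {}" by auto
  let ?M = "Max A"
  have M: "?M \<in> A" using Suc.prems ne by (rule Max_in)
  have c: "card (A - {?M}) = n" using Suc M by simp
  have "A \<subseteq> {..?M}" using Suc.prems by auto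
  then have "card A \<le> Suc ?M" by (metis card_atMost card_mono finite_atMost)
  then have "n \<le> ?M" using Suc.hyps(2) by simp
  moreover have "\<Sum>{..<n} \<le> \<Sum>(A - {?M})" using Suc.hyps(1)[of "A - {?M}"] c Suc.prems by simp
  moreover have "\<Sum>A = ?M + \<Sum>(A - {?M})" using Suc.prems M by (simp add: sum.remove)
  ultimately show ?case by (simp add: Suc.hyps(2)[symmetric])
qed simp

text \<open>Among sets of one size only the initial segment attains the least sum; this will bound
  the letters in each column.\<close>

lemma sum_le_lessThan_subset:
  assumes fin: "finite (A :: nat set)" and le: "\<Sum>A \<le> \<Sum>{..<card A}"
  shows "A \<subseteq> {..<card A}"
proof (cases "A = {}")
  case False
  let ?M = "Max A"
  have M: "?M \<in> A" using fin False by (rule Max_in)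
  have c: "card A = Suc (card (A - {?M}))" using fin M by (metis card_Suc_Diff1)
  have "\<Sum>{..<card (A - {?M})} \<le> \<Sum>(A - {?M})" by (rule sum_lessThan_le) (use fin in simp)
  moreover have "\<Sum>A = ?M + \<Sum>(A - {?M})" using fin M by (simp add: sum.remove)
  ultimately have "?M \<le> card (A - {?M})" using le c by simp
  then show ?thesis using fin c by (auto dest!: Max_ge[OF fin])
qed simp

section \<open>Row and column groups of a 2-restricted tableau\<close>

definition row_stabilizer :: "nat \<Rightarrow> (nat \<Rightarrow> nat \<times> nat) \<Rightarrow> (nat \<Rightarrow> nat) set" where
  "row_stabilizer d t = {\<rho> \<in> Sym d. \<forall>x<d. fst (t (\<rho> x)) = fst (t x)}"

definition row_word :: "nat \<Rightarrow> (nat \<Rightarrow> nat \<times> nat) \<Rightarrow> nat list" where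
  "row_word d t = map (fst \<circ> t) [0..<d]"

lemma row_word_nth: "x < d \<Longrightarrow> row_word d t ! x = fst (t x)" and length_row_word: "length (row_word d t) = d"
  by (simp_all add: row_word_def)

locale restricted_tableau =
  fixes d :: nat and l :: "nat list" and t :: "nat \<Rightarrow> nat \<times> nat"
  assumes part: "is_partition d l" and restr: "two_restricted l" and tab: "is_tableau d l t"
begin

abbreviation "C \<equiv> column_stabilizer d t"
abbreviation "R \<equiv> row_stabilizer d t"
abbreviation "r \<equiv> row_word d t"
abbreviation "clen x \<equiv> col_len l (snd (t x))"

lemma t_cell: assumes x: "x < d" shows "fst (t x) < clen x"
proof -
  have "t x \<in> {(i, j). i < length l \<and> j < l ! i}"
    using bij_betwE[OF tab[unfolded is_tableau_def], rule_format, of x] x by (simp only: lessThan_iff)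
  then show ?thesis
    using cell_iff[OF part, of "fst (t x)" "snd (t x)"] by (simp add: case_prod_unfold)
qed

lemma t_inj: "x < d \<Longrightarrow> y < d \<Longrightarrow> fst (t x) = fst (t y) \<Longrightarrow> snd (t x) = snd (t y) \<Longrightarrow> x = y"
  using tab by (auto simp: is_tableau_def bij_betw_def inj_on_def prod_eq_iff)

definition place :: "nat \<Rightarrow> nat \<Rightarrow> nat" where
  "place i j = inv_into {..<d} t (i, j)"

lemma place:
  assumes "i < col_len l j" shows "place i j < d" "t (place i j) = (i, j)"
proof -
  have "(i, j) \<in> t ` {..<d}"
    using tab assms cell_iff[OF part, of i j] by (auto simp: is_tableau_def bij_betw_def)
  then show "place i j < d" "t (place i j) = (i, j)"
    unfolding place_def using inv_into_into[of "(i, j)" t "{..<d}"] f_inv_into_f[of "(i, j)" t "{..<d}"] by auto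
qed

lemma clen_inj:
  assumes "x < d" "y < d" "clen x = clen y" shows "snd (t x) = snd (t y)"
proof (cases "snd (t x)" "snd (t y)" rule: linorder_cases)
  case less
  then show ?thesis using col_len_strict[OF part restr less] t_cell[OF assms(2)] assms(3) by simp
next
  case greater
  then show ?thesis using col_len_strict[OF part restr greater] t_cell[OF assms(1)] assms(3) by simp
qed

lemma C_Sym: "C \<subseteq> Sym d" and R_Sym: "R \<subseteq> Sym d"
  by (auto simp: column_stabilizer_def row_stabilizer_def)

lemma finite_CR: "finite C" "finite R"
  using C_Sym R_Sym finite_subset[OF _ finite_Sym] by blast+

lemma C_snd: "\<gamma> \<in> C \<Longrightarrow> x < d \<Longrightarrow> snd (t (\<gamma> x)) = snd (t x)"
  by (simp add: column_stabilizer_def)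

lemma R_fst: "\<rho> \<in> R \<Longrightarrow> x < d \<Longrightarrow> fst (t (\<rho> x)) = fst (t x)"
  by (simp add: row_stabilizer_def)

lemma C_inv: "\<gamma> \<in> C \<Longrightarrow> inv_into UNIV \<gamma> \<in> C"
proof -
  assume g: "\<gamma> \<in> C"
  then have S: "\<gamma> \<in> Sym d" using C_Sym by blast
  have "snd (t (inv_into UNIV \<gamma> x)) = snd (t x)" if "x < d" for x
    using C_snd[OF g Sym_lt[OF Sym_inv[OF S] that]] Sym_inverses(1)[OF S] by simp
  then show "inv_into UNIV \<gamma> \<in> C" using Sym_inv[OF S] by (simp add: column_stabilizer_def)
qed

lemma R_inv: "\<rho> \<in> R \<Longrightarrow> inv_into UNIV \<rho> \<in> R"
proof -
  assume g: "\<rho> \<in> R"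
  then have S: "\<rho> \<in> Sym d" using R_Sym by blast
  have "fst (t (inv_into UNIV \<rho> x)) = fst (t x)" if "x < d" for x
    using R_fst[OF g Sym_lt[OF Sym_inv[OF S] that]] Sym_inverses(1)[OF S] by simp
  then show "inv_into UNIV \<rho> \<in> R" using Sym_inv[OF S] by (simp add: row_stabilizer_def)
qed

lemma C_comp: "\<gamma> \<in> C \<Longrightarrow> \<gamma>' \<in> C \<Longrightarrow> \<gamma> \<circ> \<gamma>' \<in> C"
  by (auto simp: column_stabilizer_def Sym_comp Sym_lt)

lemma id_CR: "id \<in> C" "id \<in> R"
  by (auto simp: column_stabilizer_def row_stabilizer_def id_in_Sym)

lemma row_word_tabloid: "r \<in> set (tabloids d l)"
proof -
  have "card {x. x < d \<and> fst (t x) = i} = l ! i" if i: "i < length l" for i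
  proof -
    have "bij_betw t {x. x < d \<and> fst (t x) = i} ({i} \<times> {..<l ! i})"
    proof (rule bij_betw_byWitness[where f'="\<lambda>(i, j). place i j"])
      show "\<forall>x\<in>{x. x < d \<and> fst (t x) = i}. (case t x of (i, j) \<Rightarrow> place i j) = x"
      proof
        fix x assume "x \<in> {x. x < d \<and> fst (t x) = i}"
        then have x: "x < d" by simp
        have "place (fst (t x)) (snd (t x)) = x"
          using t_inj[OF place(1)[OF t_cell[OF x]] x] place(2)[OF t_cell[OF x]] by simp
        then show "(case t x of (i, j) \<Rightarrow> place i j) = x" by (simp add: case_prod_unfold)
      qed
      show "\<forall>a'\<in>{i} \<times> {..<l ! i}. t (case a' of (i, j) \<Rightarrow> place i j) = a'"
        using place(2) cell_iff[OF part] i by auto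
      show "t ` {x. x < d \<and> fst (t x) = i} \<subseteq> {i} \<times> {..<l ! i}"
      proof
        fix c assume "c \<in> t ` {x. x < d \<and> fst (t x) = i}"
        then obtain x where x: "x < d" "fst (t x) = i" "c = t x" by blast
        then show "c \<in> {i} \<times> {..<l ! i}"
          using t_cell[OF x(1)] cell_iff[OF part, of i "snd (t x)"] by (cases "t x") auto
      qed
      show "(\<lambda>(i, j). place i j) ` ({i} \<times> {..<l ! i}) \<subseteq> {x. x < d \<and> fst (t x) = i}"
      proof
        fix x assume "x \<in> (\<lambda>(i, j). place i j) ` ({i} \<times> {..<l ! i})"
        then obtain j where j: "j < l ! i" "x = place i j" by auto
        then have "i < col_len l j" using cell_iff[OF part, of i j] i by simp
        then show "x \<in> {x. x < d \<and> fst (t x) = i}" unfolding j(2) using place[of i j] by simp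
      qed
    qed
    then show ?thesis by (simp add: bij_betw_same_card)
  qed
  moreover have "fst (t x) < length l" if "x < d" for x
    using t_cell[OF that] cell_iff[OF part, of "fst (t x)" "snd (t x)"] by simp
  moreover have "{x. x < d \<and> r ! x = i} = {x. x < d \<and> fst (t x) = i}" for i
    by (auto simp: row_word_nth)
  ultimately show ?thesis by (simp add: set_tabloids length_row_word row_word_nth)
qed

text \<open>The column reversal; as the columns have distinct lengths, its rows have distinct letters.\<close>

definition rev_col :: "nat \<Rightarrow> nat" where
  "rev_col x = (if x < d then place (clen x - 1 - fst (t x)) (snd (t x)) else x)"

lemma rev_col:
  assumes "x < d"
  shows "rev_col x < d" "fst (t (rev_col x)) = clen x - 1 - fst (t x)" "snd (t (rev_col x)) = snd (t x)"
proof -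
  have "clen x - 1 - fst (t x) < clen x" using t_cell[OF assms] by simp
  from place[OF this] show "rev_col x < d" "fst (t (rev_col x)) = clen x - 1 - fst (t x)" "snd (t (rev_col x)) = snd (t x)"
    using assms by (simp_all add: rev_col_def)
qed

lemma rev_col_invol: "rev_col (rev_col x) = x"
proof (cases "x < d")
  case True
  show ?thesis
    using t_inj[OF rev_col(1)[OF rev_col(1)[OF True]] True] rev_col(2,3)[OF rev_col(1)[OF True]] rev_col(2,3)[OF True] t_cell[OF True]
    by simp
qed (simp add: rev_col_def)

lemma rev_col_C: "rev_col \<in> C"
proof -
  have "bij_betw rev_col {..<d} {..<d}"
    by (rule bij_betw_byWitness[where f'=rev_col]) (auto simp: rev_col_invol rev_col(1))
  then have "rev_col permutes {..<d}" by (rule bij_imp_permutes) (simp add: rev_col_def)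
  then show ?thesis by (simp add: column_stabilizer_def Sym_def rev_col(3))
qed

lemma inv_rev_col: "inv_into UNIV rev_col = rev_col"
  by (rule inv_unique_comp) (simp_all add: fun_eq_iff rev_col_invol)

abbreviation "m \<equiv> perm_word d rev_col r"

lemma m_nth: "x < d \<Longrightarrow> m ! x = clen x - 1 - fst (t x)"
  using rev_col(1,2) by (simp add: perm_word_nth inv_rev_col row_word_nth)

lemma m_tabloid: "m \<in> set (tabloids d l)"
  by (rule perm_word_tabloids[OF _ row_word_tabloid]) (use rev_col_C C_Sym in blast)

text \<open>Let \<open>rr\<close> be the row, \<open>LL\<close> the column length minus one, and
  \<open>mm = LL - rr\<close> the letter after reversal. The equation turns
  \<open>mm (\<rho>' x)\<close> into \<open>rr (\<gamma> x)\<close>. When the sum of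
  \<open>(mm (\<rho>' x) + rr x - LL x)\<^sup>2\<close> is expanded, reindexing along the column
  permutation \<open>\<gamma>\<close> or the row permutation \<open>\<rho>'\<close> gives each term
  its value for \<open>\<rho>' = id\<close>, so the sum is 0. Hence \<open>\<rho>'\<close> preserves
  \<open>LL\<close>, therefore columns, as these have distinct lengths; it also preserves rows, so
  it is the identity.\<close>

lemma unique_pair:
  assumes g: "\<gamma> \<in> C" and h: "\<rho> \<in> R" and eq: "perm_word d \<gamma> (perm_word d \<rho> m) = r"
  shows "\<gamma> = rev_col \<and> \<rho> = id"
proof -
  define \<rho>' where "\<rho>' = inv_into UNIV \<rho>"
  have h': "\<rho>' \<in> R" unfolding \<rho>'_def by (rule R_inv[OF h])
  have gS: "\<gamma> \<in> Sym d" and hS: "\<rho>' \<in> Sym d" using g h' C_Sym R_Sym by blast+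
  define rr LL mm where "rr x = int (fst (t x))" and "LL x = int (clen x) - 1" and "mm x = int (m ! x)" for x
  have mm: "mm x = LL x - rr x" if "x < d" for x
    using t_cell[OF that] by (simp add: mm_def LL_def rr_def m_nth[OF that])
  have mm_rev: "mm x = rr (rev_col x)" if "x < d" for x
    using that by (simp add: mm_def rr_def m_nth rev_col)
  have U: "mm (\<rho>' x) = rr (\<gamma> x)" if x: "x < d" for x
  proof -
    have "perm_word d \<gamma> (perm_word d \<rho> m) ! \<gamma> x = r ! \<gamma> x" by (simp only: eq)
    then show ?thesis
      using x Sym_lt[OF gS x] Sym_inverses(2)[OF gS]
      by (simp add: perm_word_nth row_word_nth mm_def rr_def \<rho>'_def)
  qed
  have rhs_g: "LL (\<gamma> x) = LL x" if "x < d" for x using C_snd[OF g that] by (simp add: LL_def)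
  have rhs_b: "LL (rev_col x) = LL x" if "x < d" for x using rev_col(3)[OF that] by (simp add: LL_def)
  have rr_h: "rr (\<rho>' x) = rr x" if "x < d" for x using R_fst[OF h' that] by (simp add: rr_def)
  have bS: "rev_col \<in> Sym d" using rev_col_C C_Sym by blast
  let ?S = "\<lambda>x. rr x - LL x"
  have expand: "(\<Sum>x<d. (f x + ?S x)\<^sup>2) = (\<Sum>x<d. (f x)\<^sup>2) + (\<Sum>x<d. (?S x)\<^sup>2) + 2 * (\<Sum>x<d. f x * rr x) - 2 * (\<Sum>x<d. f x * LL x)"
    for f :: "nat \<Rightarrow> int"
    by (simp add: sum.distrib[symmetric] sum_distrib_left sum_subtractf[symmetric] power2_eq_square algebra_simps)
  have "(\<Sum>x<d. (mm (\<rho>' x))\<^sup>2) = (\<Sum>x<d. (rr x)\<^sup>2)"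
    using sum_Sym[OF gS, of "\<lambda>x. (rr x)\<^sup>2"] U by simp
  moreover have "(\<Sum>x<d. mm (\<rho>' x) * LL x) = (\<Sum>x<d. rr x * LL x)"
    using sum_Sym[OF gS, of "\<lambda>x. rr x * LL x"] U rhs_g by simp
  moreover have "(\<Sum>x<d. mm (\<rho>' x) * rr x) = (\<Sum>x<d. mm x * rr x)"
    using sum_Sym[OF hS, of "\<lambda>x. mm x * rr x"] rr_h by simp
  moreover have "(\<Sum>x<d. (mm x)\<^sup>2) = (\<Sum>x<d. (rr x)\<^sup>2)"
    using sum_Sym[OF bS, of "\<lambda>x. (rr x)\<^sup>2"] mm_rev by simp
  moreover have "(\<Sum>x<d. mm x * LL x) = (\<Sum>x<d. rr x * LL x)"
    using sum_Sym[OF bS, of "\<lambda>x. rr x * LL x"] mm_rev rhs_b by simp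
  ultimately have "(\<Sum>x<d. (mm (\<rho>' x) + ?S x)\<^sup>2) = (\<Sum>x<d. (mm x + ?S x)\<^sup>2)"
    unfolding expand by simp
  also have "\<dots> = 0" using mm by simp
  finally have U0: "(\<Sum>x<d. (mm (\<rho>' x) + ?S x)\<^sup>2) = 0" .
  have U_eq: "mm (\<rho>' x) = mm x" if "x < d" for x
  proof -
    have "(mm (\<rho>' x) + ?S x)\<^sup>2 = 0"
      using U0 that sum_nonneg_eq_0_iff[of "{..<d}" "\<lambda>x. (mm (\<rho>' x) + ?S x)\<^sup>2"] by simp
    then show ?thesis using mm[OF that] by simp
  qed
  have "\<rho>' x = x" for x
  proof (cases "x < d")
    case True
    have lt: "\<rho>' x < d" by (rule Sym_lt[OF hS True])
    have "LL (\<rho>' x) = LL x" using U_eq[OF True] mm[OF True] mm[OF lt] rr_h[OF True] by simp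
    then have "snd (t (\<rho>' x)) = snd (t x)" by (intro clen_inj[OF lt True]) (simp add: LL_def)
    then show ?thesis by (intro t_inj[OF lt True] R_fst[OF h' True])
  next
    case False
    then show ?thesis using hS permutes_not_in[of \<rho>' "{..<d}" x] by (simp add: Sym_def)
  qed
  then have "\<rho>' = id" by auto
  then have "\<rho> = id"
    unfolding \<rho>'_def using h R_Sym Sym_inverses(1)[of \<rho> d] by (metis eq_id_iff subsetD)
  moreover have "\<gamma> x = rev_col x" for x
  proof (cases "x < d")
    case True
    have "rr (\<gamma> x) = rr (rev_col x)" using U[OF True] U_eq[OF True] mm_rev[OF True] by simp
    then show ?thesis
      using t_inj[OF Sym_lt[OF gS True] rev_col(1)[OF True]] C_snd[OF g True] rev_col(3)[OF True] by (simp add: rr_def)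
  next
    case False
    then show ?thesis using gS permutes_not_in[of \<gamma> "{..<d}" x] by (simp add: Sym_def rev_col_def)
  qed
  ultimately show ?thesis by auto
qed

lemma rev_pair: "perm_word d rev_col (perm_word d id m) = r"
  using perm_word_cancel(2)[of rev_col d r] rev_col_C C_Sym
  by (auto simp: perm_word_id inv_rev_col length_row_word)

text \<open>A word that is injective on columns has the same letter sum as \<open>r\<close>, whose columns have
  the least possible letters.\<close>

lemma column_injective_word:
  assumes w: "w \<in> set (tabloids d l)"
    and inj: "\<And>x y. x < d \<Longrightarrow> y < d \<Longrightarrow> snd (t x) = snd (t y) \<Longrightarrow> w ! x = w ! y \<Longrightarrow> x = y"
  obtains \<gamma> where "\<gamma> \<in> C" "perm_word d \<gamma> r = w"
proof -
  \<comment> \<open>The letter sum of a tabloid depends on the shape only.\<close>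
  have total: "(\<Sum>x<d. v ! x) = (\<Sum>i<length l. i * l ! i)" if v: "v \<in> set (tabloids d l)" for v
  proof -
    have "(\<Sum>x<d. v ! x) = (\<Sum>i\<in>{..<length l}. \<Sum>x\<in>{x \<in> {..<d}. v ! x = i}. v ! x)"
      using v by (intro sum.group[symmetric]) (auto simp: set_tabloids)
    also have "\<dots> = (\<Sum>i<length l. i * l ! i)"
      using v by (intro sum.cong refl) (simp add: set_tabloids mult.commute)
    finally show ?thesis .
  qed
  define J where "J = (\<lambda>x. snd (t x)) ` {..<d}"
  define X where "X j = {x \<in> {..<d}. snd (t x) = j}" for j
  have cols: "(\<Sum>x<d. v ! x) = (\<Sum>j\<in>J. \<Sum>x\<in>X j. v ! x)" for v :: "nat list"
    unfolding X_def J_def by (rule sum.group[symmetric]) auto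
  have finX: "finite (X j)" for j by (simp add: X_def)
  have Xr: "bij_betw (\<lambda>x. r ! x) (X j) {..<col_len l j}" for j
  proof (rule bij_betw_byWitness[where f'="\<lambda>i. place i j"])
    show "\<forall>x\<in>X j. place (r ! x) j = x"
    proof
      fix x assume "x \<in> X j"
      then have x: "x < d" "snd (t x) = j" by (auto simp: X_def)
      show "place (r ! x) j = x"
        using t_inj[OF place(1)[OF t_cell[OF x(1)]] x(1)] place(2)[OF t_cell[OF x(1)]] x by (simp add: row_word_nth)
    qed
  qed (use place t_cell in \<open>auto simp: X_def row_word_nth\<close>)
  have cX: "card (X j) = col_len l j" for j using bij_betw_same_card[OF Xr] by simp
  have injX: "inj_on (\<lambda>x. w ! x) (X j)" for j
    unfolding X_def by (rule inj_onI) (use inj in auto)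
  have sumr: "(\<Sum>x\<in>X j. r ! x) = \<Sum>{..<col_len l j}" for j
    by (rule sum.reindex_bij_betw[OF Xr, of "\<lambda>i. i"])
  have sumw: "(\<Sum>x\<in>X j. w ! x) = \<Sum>((\<lambda>x. w ! x) ` X j)" for j
    using sum.reindex[OF injX, of "\<lambda>i. i"] by simp
  have cw: "card ((\<lambda>x. w ! x) ` X j) = col_len l j" for j using card_image[OF injX] cX by simp
  have le: "(\<Sum>x\<in>X j. r ! x) \<le> (\<Sum>x\<in>X j. w ! x)" for j
    unfolding sumr sumw using sum_lessThan_le[of "(\<lambda>x. w ! x) ` X j"] cw finX by simp
  have eqJ: "(\<Sum>j\<in>J. \<Sum>x\<in>X j. r ! x) = (\<Sum>j\<in>J. \<Sum>x\<in>X j. w ! x)"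
    using cols[of r] cols[of w] total[OF w] total[OF row_word_tabloid] by simp
  have eqX: "(\<Sum>x\<in>X j. r ! x) = (\<Sum>x\<in>X j. w ! x)" if "j \<in> J" for j
    using sum_mono_inv[OF eqJ le that] by (simp add: J_def)
  have w_lt: "w ! x < clen x" if x: "x < d" for x
  proof -
    have j: "snd (t x) \<in> J" "x \<in> X (snd (t x))" using x by (auto simp: J_def X_def)
    have "(\<lambda>x. w ! x) ` X (snd (t x)) \<subseteq> {..<card ((\<lambda>x. w ! x) ` X (snd (t x)))}"
      by (rule sum_le_lessThan_subset) (use eqX[OF j(1)] finX in \<open>simp_all add: sumr sumw cw\<close>)
    then show ?thesis using j(2) cw by auto
  qed
  \<comment> \<open>Sends \<open>x\<close> to the cell of its own column in row
    \<open>w ! x\<close>; the required column permutation is the inverse.\<close>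
  define g where "g x = (if x < d then place (w ! x) (snd (t x)) else x)" for x
  have g: "g x < d" "fst (t (g x)) = w ! x" "snd (t (g x)) = snd (t x)" if "x < d" for x
    using place[OF w_lt[OF that]] that by (simp_all add: g_def)
  have "inj_on g {..<d}"
  proof (rule inj_onI)
    fix x y assume xy: "x \<in> {..<d}" "y \<in> {..<d}" "g x = g y"
    then have lt: "x < d" "y < d" by simp_all
    have "snd (t x) = snd (t y)" using arg_cong[OF xy(3), of "\<lambda>z. snd (t z)"] unfolding g(3)[OF lt(1)] g(3)[OF lt(2)] .
    moreover have "w ! x = w ! y" using arg_cong[OF xy(3), of "\<lambda>z. fst (t z)"] unfolding g(2)[OF lt(1)] g(2)[OF lt(2)] .
    ultimately show "x = y" by (rule inj[OF lt])
  qed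
  moreover from this have "g ` {..<d} = {..<d}" by (intro endo_inj_surj) (use g(1) in auto)
  ultimately have "bij_betw g {..<d} {..<d}" by (simp add: bij_betw_def)
  then have "g permutes {..<d}" by (rule bij_imp_permutes) (simp add: g_def)
  then have gS: "g \<in> Sym d" and gC: "g \<in> C" by (simp_all add: Sym_def column_stabilizer_def g(3))
  have "perm_word d (inv_into UNIV g) r = w"
  proof (rule nth_equalityI)
    show "length (perm_word d (inv_into UNIV g) r) = length w" using w by (simp add: set_tabloids)
    fix x assume "x < length (perm_word d (inv_into UNIV g) r)"
    then have x: "x < d" by simp
    have "inv_into UNIV (inv_into UNIV g) = g" using gS by (simp add: Sym_def permutes_inv_inv)
    then show "perm_word d (inv_into UNIV g) r ! x = w ! x"
      using x g[OF x] by (simp add: perm_word_nth row_word_nth)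
  qed
  then show ?thesis using that C_inv[OF gC] by blast
qed

end

section \<open>Young modules of 2-restricted partitions\<close>

lemma mat_vec_assoc:
  "dim_col A = dim_row B \<Longrightarrow> dim_col B = dim_vec v \<Longrightarrow> (A * B) *\<^sub>v v = A *\<^sub>v (B *\<^sub>v v :: 'k::semiring_0 vec)"
  by (rule assoc_mult_mat_vec[of A "dim_row A" "dim_col A" B "dim_col B"]) (auto intro: carrier_vecI)

lemma mat_vec_smult:
  "dim_col A = dim_vec v \<Longrightarrow> A *\<^sub>v (c \<cdot>\<^sub>v v) = c \<cdot>\<^sub>v (A *\<^sub>v v :: 'k::field vec)"
  by (rule mult_mat_vec[of A "dim_row A" "dim_col A"]) (auto intro: carrier_vecI)

lemma mat_vec_nth:
  "i < dim_row A \<Longrightarrow> dim_col A = n \<Longrightarrow> dim_vec v = n \<Longrightarrow> (A *\<^sub>v v) $ i = (\<Sum>c<n. A $$ (i, c) * v $ c :: 'k::semiring_0)"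
  by (auto simp: scalar_prod_def lessThan_atLeast0 intro!: sum.cong)

text \<open>The average over \<open>S\<^sub>d\<close> of the elementary matrix with entry \<open>1\<close> at \<open>(x, a)\<close>.\<close>

definition avg :: "nat \<Rightarrow> 'k::field srep \<Rightarrow> 'k srep \<Rightarrow> nat \<Rightarrow> nat \<Rightarrow> 'k mat" where
  "avg d M N a x = mat (rdim N) (rdim M) (\<lambda>(i, j). \<Sum>g\<in>Sym d. N g $$ (i, x) * M (inv_into UNIV g) $$ (a, j))"

lemma rep_entry:
  assumes M: "is_rep d M" and s: "\<sigma> \<in> Sym d" and t: "\<tau> \<in> Sym d" and ij: "i < rdim M" "j < rdim M"
  shows "M (\<sigma> \<circ> \<tau>) $$ (i, j) = (\<Sum>c<rdim M. M \<sigma> $$ (i, c) * M \<tau> $$ (c, j))"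
  using is_repD(4,5)[OF M s] is_repD(4,5)[OF M t] ij
  by (simp add: is_repD(3)[OF M s t] scalar_prod_def lessThan_atLeast0)

lemma sum_Sym_left:
  assumes s: "\<sigma> \<in> Sym d"
  shows "(\<Sum>g\<in>Sym d. f (\<sigma> \<circ> g)) = (\<Sum>g\<in>Sym d. f g)"
proof (rule sum.reindex_bij_witness[where i="\<lambda>g. inv_into UNIV \<sigma> \<circ> g" and j="\<lambda>g. \<sigma> \<circ> g"])
  have io: "inv_into UNIV \<sigma> \<circ> \<sigma> = id" "\<sigma> \<circ> inv_into UNIV \<sigma> = id"
    using s permutes_inv_o by (auto simp: Sym_def)
  show "inv_into UNIV \<sigma> \<circ> (\<sigma> \<circ> g) = g" "\<sigma> \<circ> (inv_into UNIV \<sigma> \<circ> g) = g" for g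
    unfolding comp_assoc[symmetric] io by simp_all
qed (use s in \<open>auto intro: Sym_comp Sym_inv\<close>)

lemma inv_comp_Sym: "\<sigma> \<in> Sym d \<Longrightarrow> \<tau> \<in> Sym d \<Longrightarrow> inv_into UNIV (\<sigma> \<circ> \<tau>) = inv_into UNIV \<tau> \<circ> inv_into UNIV \<sigma>"
  by (simp add: Sym_def o_inv_distrib permutes_bij)

lemma inv_o_Sym: "\<sigma> \<in> Sym d \<Longrightarrow> inv_into UNIV \<sigma> \<circ> \<sigma> = id" "\<sigma> \<in> Sym d \<Longrightarrow> \<sigma> \<circ> inv_into UNIV \<sigma> = id"
  using permutes_inv_o by (auto simp: Sym_def)

lemma avg_Homs:
  assumes M: "is_rep d M" and N: "is_rep d N" and a: "a < rdim M" and x: "x < rdim N"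
  shows "avg d M N a x \<in> Homs d M N"
proof (rule HomsI)
  show "avg d M N a x \<in> carrier_mat (rdim N) (rdim M)" by (simp add: avg_def)
  fix \<sigma> assume s: "\<sigma> \<in> Sym d"
  show "avg d M N a x * M \<sigma> = N \<sigma> * avg d M N a x"
  proof (rule eq_matI)
    fix i j assume "i < dim_row (N \<sigma> * avg d M N a x)" "j < dim_col (N \<sigma> * avg d M N a x)"
    then have ij: "i < rdim N" "j < rdim M" using is_repD(4)[OF N s] by (simp_all add: avg_def)
    let ?i = "\<lambda>g. inv_into UNIV g"
    have "(avg d M N a x * M \<sigma>) $$ (i, j) = (\<Sum>c<rdim M. (\<Sum>g\<in>Sym d. N g $$ (i, x) * M (?i g) $$ (a, c)) * M \<sigma> $$ (c, j))"
      using ij is_repD(4,5)[OF M s] by (simp add: avg_def scalar_prod_def lessThan_atLeast0)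
    also have "\<dots> = (\<Sum>g\<in>Sym d. \<Sum>c<rdim M. N g $$ (i, x) * (M (?i g) $$ (a, c) * M \<sigma> $$ (c, j)))"
      unfolding sum_distrib_right mult.assoc by (rule sum.swap)
    also have "\<dots> = (\<Sum>g\<in>Sym d. N g $$ (i, x) * M (?i g \<circ> \<sigma>) $$ (a, j))"
      unfolding sum_distrib_left[symmetric] by (intro sum.cong refl) (simp add: rep_entry[OF M Sym_inv s a ij(2)])
    also have "\<dots> = (\<Sum>g\<in>Sym d. N (\<sigma> \<circ> g) $$ (i, x) * M (?i (\<sigma> \<circ> g) \<circ> \<sigma>) $$ (a, j))"
      by (rule sum_Sym_left[OF s, symmetric, where f="\<lambda>g. N g $$ (i, x) * M (?i g \<circ> \<sigma>) $$ (a, j)"])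
    also have "\<dots> = (\<Sum>g\<in>Sym d. N (\<sigma> \<circ> g) $$ (i, x) * M (?i g) $$ (a, j))"
    proof (intro sum.cong refl)
      fix g assume g: "g \<in> Sym d"
      have "?i (\<sigma> \<circ> g) \<circ> \<sigma> = ?i g"
        unfolding inv_comp_Sym[OF s g] comp_assoc inv_o_Sym(1)[OF s] by simp
      then show "N (\<sigma> \<circ> g) $$ (i, x) * M (?i (\<sigma> \<circ> g) \<circ> \<sigma>) $$ (a, j) = N (\<sigma> \<circ> g) $$ (i, x) * M (?i g) $$ (a, j)"
        by (simp only:)
    qed
    also have "\<dots> = (\<Sum>g\<in>Sym d. \<Sum>c<rdim N. N \<sigma> $$ (i, c) * (N g $$ (c, x) * M (?i g) $$ (a, j)))"
      unfolding mult.assoc[symmetric] sum_distrib_right[symmetric]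
      by (intro sum.cong refl) (simp only: rep_entry[OF N s _ ij(1) x])
    also have "\<dots> = (\<Sum>c<rdim N. N \<sigma> $$ (i, c) * (\<Sum>g\<in>Sym d. N g $$ (c, x) * M (?i g) $$ (a, j)))"
      unfolding sum_distrib_left by (rule sum.swap)
    also have "\<dots> = (N \<sigma> * avg d M N a x) $$ (i, j)"
      using ij is_repD(4,5)[OF N s] by (simp add: avg_def scalar_prod_def lessThan_atLeast0)
    finally show "(avg d M N a x * M \<sigma>) $$ (i, j) = (N \<sigma> * avg d M N a x) $$ (i, j)" .
  qed (use is_repD(4,5)[OF M s] is_repD(4,5)[OF N s] in \<open>simp_all add: avg_def\<close>)
qed

lemma avg_vec:
  assumes M: "is_rep d M" and v: "v \<in> carrier_vec (rdim M)" and a: "a < rdim M" and i: "i < rdim N"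
  shows "(avg d M N a x *\<^sub>v v) $ i = (\<Sum>g\<in>Sym d. N g $$ (i, x) * (M (inv_into UNIV g) *\<^sub>v v) $ a)"
proof -
  have "(avg d M N a x *\<^sub>v v) $ i = (\<Sum>c<rdim M. (\<Sum>g\<in>Sym d. N g $$ (i, x) * M (inv_into UNIV g) $$ (a, c)) * v $ c)"
    using i v by (simp add: avg_def scalar_prod_def lessThan_atLeast0)
  also have "\<dots> = (\<Sum>g\<in>Sym d. \<Sum>c<rdim M. N g $$ (i, x) * (M (inv_into UNIV g) $$ (a, c) * v $ c))"
    unfolding sum_distrib_right mult.assoc by (rule sum.swap)
  also have "\<dots> = (\<Sum>g\<in>Sym d. N g $$ (i, x) * (M (inv_into UNIV g) *\<^sub>v v) $ a)"
  proof (intro sum.cong refl)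
    fix g assume "g \<in> Sym d"
    then have "dim_row (M (inv_into UNIV g)) = rdim M" "dim_col (M (inv_into UNIV g)) = rdim M"
      using is_repD(4,5)[OF M Sym_inv] by blast+
    then show "(\<Sum>c<rdim M. N g $$ (i, x) * (M (inv_into UNIV g) $$ (a, c) * v $ c)) = N g $$ (i, x) * (M (inv_into UNIV g) *\<^sub>v v) $ a"
      using v a by (simp add: scalar_prod_def lessThan_atLeast0 sum_distrib_left)
  qed
  finally show ?thesis .
qed

text \<open>A composite of two averaged maps through \<open>V\<close> becomes a combination of the
  entries \<open>V k $$ (y, x)\<close> with coefficients that depend on \<open>M\<close> only. For
  varying \<open>x\<close> and \<open>y\<close> these are the entries of one group algebra element
  acting on \<open>V\<close>.\<close>

lemma avg_avg_vec:
  assumes M: "is_rep d M" and V: "is_rep d V" and v: "v \<in> carrier_vec (rdim M)"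
    and a: "a < rdim M" and b: "b < rdim M" and xy: "x < rdim V" "y < rdim V"
  shows "(avg d V M y b *\<^sub>v (avg d M V a x *\<^sub>v v)) $ a =
    (\<Sum>k\<in>Sym d. (\<Sum>g\<in>Sym d. M g $$ (a, b) * (M (inv_into UNIV (g \<circ> k)) *\<^sub>v v) $ a) * V k $$ (y, x))"
proof -
  let ?F = "avg d M V a x" and ?i = "\<lambda>g. inv_into UNIV g"
  have Fv: "?F *\<^sub>v v \<in> carrier_vec (rdim V)" by (auto simp: avg_def intro!: carrier_vecI)
  have "(avg d V M y b *\<^sub>v (?F *\<^sub>v v)) $ a = (\<Sum>g\<in>Sym d. M g $$ (a, b) * (V (?i g) *\<^sub>v (?F *\<^sub>v v)) $ y)"
    by (rule avg_vec[OF V Fv xy(2) a])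
  also have "\<dots> = (\<Sum>g\<in>Sym d. \<Sum>k\<in>Sym d. M g $$ (a, b) * ((M (?i (g \<circ> k)) *\<^sub>v v) $ a * V k $$ (y, x)))"
  proof (intro sum.cong refl)
    fix g assume g: "g \<in> Sym d"
    note dims = is_repD(4,5)[OF V Sym_inv[OF g]]
    have "(V (?i g) *\<^sub>v (?F *\<^sub>v v)) $ y = (\<Sum>c<rdim V. V (?i g) $$ (y, c) * (?F *\<^sub>v v) $ c)"
      by (rule mat_vec_nth) (use dims xy in \<open>simp_all add: avg_def\<close>)
    also have "\<dots> = (\<Sum>c<rdim V. \<Sum>h\<in>Sym d. V (?i g) $$ (y, c) * (V h $$ (c, x) * (M (?i h) *\<^sub>v v) $ a))"
      unfolding sum_distrib_left[symmetric] by (intro sum.cong refl) (simp add: avg_vec[OF M v a])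
    also have "\<dots> = (\<Sum>h\<in>Sym d. \<Sum>c<rdim V. V (?i g) $$ (y, c) * V h $$ (c, x) * (M (?i h) *\<^sub>v v) $ a)"
      unfolding mult.assoc by (rule sum.swap)
    also have "\<dots> = (\<Sum>h\<in>Sym d. V (?i g \<circ> h) $$ (y, x) * (M (?i h) *\<^sub>v v) $ a)"
      unfolding sum_distrib_right[symmetric] by (intro sum.cong refl) (simp only: rep_entry[OF V Sym_inv[OF g] _ xy(2,1)])
    also have "\<dots> = (\<Sum>k\<in>Sym d. V (?i g \<circ> (g \<circ> k)) $$ (y, x) * (M (?i (g \<circ> k)) *\<^sub>v v) $ a)"
      by (rule sum_Sym_left[OF g, symmetric, where f="\<lambda>h. V (?i g \<circ> h) $$ (y, x) * (M (?i h) *\<^sub>v v) $ a"])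
    also have "\<dots> = (\<Sum>k\<in>Sym d. (M (?i (g \<circ> k)) *\<^sub>v v) $ a * V k $$ (y, x))"
      unfolding comp_assoc[symmetric, of "?i g" g] inv_o_Sym(1)[OF g] by (simp add: mult.commute)
    finally show "M g $$ (a, b) * (V (?i g) *\<^sub>v (?F *\<^sub>v v)) $ y =
        (\<Sum>k\<in>Sym d. M g $$ (a, b) * ((M (?i (g \<circ> k)) *\<^sub>v v) $ a * V k $$ (y, x)))"
      by (simp add: sum_distrib_left)
  qed
  also have "\<dots> = (\<Sum>k\<in>Sym d. \<Sum>g\<in>Sym d. M g $$ (a, b) * ((M (?i (g \<circ> k)) *\<^sub>v v) $ a * V k $$ (y, x)))"
    by (rule sum.swap)
  finally show ?thesis by (simp add: sum_distrib_right mult.assoc)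
qed

lemma sum_of_bool_unique:
  assumes "finite S" "a \<in> S" "\<And>x. x \<in> S \<Longrightarrow> P x \<longleftrightarrow> x = a"
  shows "(\<Sum>x\<in>S. if P x then 1 else 0 :: 'k::field) = 1"
proof -
  have "(\<Sum>x\<in>S. if P x then 1 else 0 :: 'k) = (\<Sum>x\<in>S. if x = a then 1 else 0)"
    by (intro sum.cong refl) (simp add: assms(3))
  then show ?thesis using assms(1,2) by simp
qed

locale young_tableau = restricted_tableau d l t + char_two K
  for d l t and K :: "'k::field itself"
begin

abbreviation M :: "'k srep" where "M \<equiv> perm_module d l"
abbreviation "nT \<equiv> length (tabloids d l)"
abbreviation "tv w \<equiv> (tvec d l w :: 'k vec)"
text \<open>Column and row sums; the signs of the polytabloid disappear in characteristic
  two.\<close>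

abbreviation "\<kappa> \<equiv> mat_sum nT C M"
abbreviation "\<rho>\<rho> \<equiv> mat_sum nT R M"
abbreviation "e \<equiv> \<kappa> *\<^sub>v tv r"

lemmas MR = perm_module_is_rep[of d l, where 'k='k]

lemmas sum_tvec = rep_sum_tvec[where l=l and d=d and 'k='k, unfolded rdim_perm_module]

lemma dim_e: "dim_vec e = nT"
  by simp

lemma e_carrier: "e \<in> carrier_vec nT"
  by (rule carrier_vecI) (rule dim_e)

lemma polytabloid_eq: "polytabloid d l t = e"
proof (rule eq_vecI)
  fix a assume "a < dim_vec e"
  then have a: "a < nT" by (simp add: dim_e)
  have "of_int (sign \<tau>) = (1 :: 'k)" for \<tau> :: "nat \<Rightarrow> nat"
    by (simp add: sign_def uminus_eq)
  then show "polytabloid d l t $ a = e $ a"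
    using a unfolding sum_tvec[OF C_Sym row_word_tabloid a] by (simp add: polytabloid_def row_word_def cong: if_cong)
qed (simp add: polytabloid_def rdim_perm_module)

lemma kappa_column_word:
  assumes g: "\<gamma> \<in> C"
  shows "\<kappa> *\<^sub>v tv (perm_word d \<gamma> r) = e"
proof (rule eq_vecI)
  fix a assume "a < dim_vec e"
  then have a: "a < nT" by (simp add: dim_e)
  have gS: "\<gamma> \<in> Sym d" using g C_Sym by blast
  have tab: "perm_word d \<gamma> r \<in> set (tabloids d l)" by (rule perm_word_tabloids[OF gS row_word_tabloid])
  have "(\<Sum>\<sigma>\<in>C. if tabloids d l ! a = perm_word d \<sigma> (perm_word d \<gamma> r) then 1 else 0 :: 'k) =
      (\<Sum>\<sigma>\<in>C. if tabloids d l ! a = perm_word d (\<sigma> \<circ> \<gamma>) r then 1 else 0)"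
    using C_Sym gS by (intro sum.cong refl) (auto simp: perm_word_comp subset_iff)
  also have "\<dots> = (\<Sum>\<sigma>\<in>C. if tabloids d l ! a = perm_word d \<sigma> r then 1 else 0)"
  proof (rule sum.reindex_bij_witness[where i="\<lambda>\<sigma>. \<sigma> \<circ> inv_into UNIV \<gamma>" and j="\<lambda>\<sigma>. \<sigma> \<circ> \<gamma>"])
    show "\<sigma> \<circ> \<gamma> \<circ> inv_into UNIV \<gamma> = \<sigma>" "\<sigma> \<circ> inv_into UNIV \<gamma> \<circ> \<gamma> = \<sigma>" for \<sigma>
      unfolding comp_assoc inv_o_Sym[OF gS] by simp_all
    show "\<sigma> \<circ> inv_into UNIV \<gamma> \<in> C" "\<sigma> \<circ> \<gamma> \<in> C" if "\<sigma> \<in> C" for \<sigma>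
      by (rule C_comp[OF that C_inv[OF g]], rule C_comp[OF that g])
  qed simp
  finally show "(\<kappa> *\<^sub>v tv (perm_word d \<gamma> r)) $ a = e $ a"
    unfolding sum_tvec[OF C_Sym tab a] sum_tvec[OF C_Sym row_word_tabloid a] .
qed (simp add: rdim_perm_module)

lemma transpose_C:
  assumes "x < d" "y < d" "snd (t x) = snd (t y)" shows "transpose x y \<in> C"
  using assms by (auto simp: column_stabilizer_def Sym_def transpose_def intro: permutes_swap_id)

text \<open>The transposition of \<open>x\<close> and \<open>y\<close> is a column permutation
  fixing \<open>w\<close>, so the terms cancel in pairs.\<close>

lemma kappa_repeated_word:
  assumes w: "w \<in> set (tabloids d l)" and xy: "x < d" "y < d" "snd (t x) = snd (t y)" "x \<noteq> y" and eq: "w ! x = w ! y"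
  shows "\<kappa> *\<^sub>v tv w = 0\<^sub>v nT"
proof (rule eq_vecI)
  fix a assume "a < dim_vec (0\<^sub>v nT :: 'k vec)"
  then have a: "a < nT" by simp
  define s where "s = transpose x y"
  have sC: "s \<in> C" unfolding s_def by (rule transpose_C[OF xy(1-3)])
  then have sS: "s \<in> Sym d" using C_Sym by blast
  have ss: "s \<circ> s = id" by (simp add: s_def)
  have "perm_word d s w = w"
  proof (rule nth_equalityI)
    fix z assume "z < length (perm_word d s w)"
    then have z: "z < d" by simp
    have "inv_into UNIV s = s" unfolding s_def by simp
    then show "perm_word d s w ! z = w ! z" using z eq by (auto simp: perm_word_nth s_def transpose_def)
  qed (use w in \<open>simp add: set_tabloids\<close>)
  then have inv: "perm_word d (\<sigma> \<circ> s) w = perm_word d \<sigma> w" if "\<sigma> \<in> C" for \<sigma>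
    using that C_Sym sS by (auto simp: perm_word_comp subset_iff)
  have "(\<Sum>\<sigma>\<in>C. if tabloids d l ! a = perm_word d \<sigma> w then 1 else 0 :: 'k) = 0"
  proof (rule sum_involution_eq_0[where h="\<lambda>\<sigma>. \<sigma> \<circ> s"])
    show "finite C" by (rule finite_CR(1))
    fix \<sigma> assume \<sigma>: "\<sigma> \<in> C"
    show "\<sigma> \<circ> s \<in> C" by (rule C_comp[OF \<sigma> sC])
    show "\<sigma> \<circ> s \<circ> s = \<sigma>" unfolding comp_assoc ss by simp
    show "(if tabloids d l ! a = perm_word d (\<sigma> \<circ> s) w then 1 else 0 :: 'k) = (if tabloids d l ! a = perm_word d \<sigma> w then 1 else 0)"
      by (simp only: inv[OF \<sigma>])
    show "\<sigma> \<circ> s \<noteq> \<sigma>"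
    proof
      assume "\<sigma> \<circ> s = \<sigma>"
      then have "\<sigma> (s x) = \<sigma> x" by (metis comp_apply)
      then have "s x = x" using \<sigma> C_Sym Sym_inverses(2)[of \<sigma> d] by (metis subsetD)
      then show False using xy(4) by (simp add: s_def)
    qed
  qed
  then show "(\<kappa> *\<^sub>v tv w) $ a = 0\<^sub>v nT $ a"
    unfolding sum_tvec[OF C_Sym w a] using a by simp
qed (simp add: rdim_perm_module)

text \<open>Either two equal letters share a column, and the sum is 0, or the word is a column
  permutation of \<open>r\<close>, and the sum is \<open>e\<close>.\<close>

lemma kappa_tabloid:
  assumes w: "w \<in> set (tabloids d l)"
  shows "\<exists>c. \<kappa> *\<^sub>v tv w = c \<cdot>\<^sub>v e"
proof (cases "\<exists>x y. x < d \<and> y < d \<and> snd (t x) = snd (t y) \<and> x \<noteq> y \<and> w ! x = w ! y")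
  case True
  then have "\<kappa> *\<^sub>v tv w = 0\<^sub>v nT" using kappa_repeated_word[OF w] by blast
  also have "\<dots> = 0 \<cdot>\<^sub>v e" by (rule eq_vecI) (simp_all add: dim_e del: dim_mult_mat_vec)
  finally show ?thesis by blast
next
  case False
  then obtain \<gamma> where "\<gamma> \<in> C" "perm_word d \<gamma> r = w" using column_injective_word[OF w] by blast
  then have "\<kappa> *\<^sub>v tv w = 1 \<cdot>\<^sub>v e" using kappa_column_word by force
  then show ?thesis by blast
qed

lemma kappa_vec:
  assumes v: "v \<in> carrier_vec nT"
  shows "\<exists>c. \<kappa> *\<^sub>v v = c \<cdot>\<^sub>v e"
proof -
  have "\<forall>b. \<exists>c. b < nT \<longrightarrow> \<kappa> *\<^sub>v tv (tabloids d l ! b) = c \<cdot>\<^sub>v e" using kappa_tabloid by auto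
  then obtain c where c: "\<And>b. b < nT \<Longrightarrow> \<kappa> *\<^sub>v tv (tabloids d l ! b) = c b \<cdot>\<^sub>v e" by metis
  have dimk: "dim_row \<kappa> = nT" "dim_col \<kappa> = nT" by (simp_all add: rdim_perm_module)
  have ent: "\<kappa> $$ (a, b) = c b * e $ a" if ab: "a < nT" "b < nT" for a b
  proof -
    have "\<kappa> $$ (a, b) = (\<Sum>x<nT. if x = b then \<kappa> $$ (a, x) else 0)" using ab by simp
    also have "\<dots> = (\<Sum>x<nT. \<kappa> $$ (a, x) * (if x = b then 1 else 0))" by (intro sum.cong refl) simp
    also have "\<dots> = (\<kappa> *\<^sub>v tv (tabloids d l ! b)) $ a"
      using ab distinct_tabloids[of d l]
      by (subst mat_vec_nth[of _ _ nT]) (auto simp: tvec_def nth_eq_iff_index_eq intro!: sum.cong)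
    also have "\<dots> = c b * e $ a" unfolding c[OF ab(2)] by (rule index_smult_vec(1)) (use ab dim_e in simp)
    finally show ?thesis .
  qed
  have "\<kappa> *\<^sub>v v = (\<Sum>b<nT. c b * v $ b) \<cdot>\<^sub>v e"
  proof (rule eq_vecI)
    fix a assume "a < dim_vec ((\<Sum>b<nT. c b * v $ b) \<cdot>\<^sub>v e)"
    then have a: "a < nT" using dim_e by simp
    have "(\<kappa> *\<^sub>v v) $ a = (\<Sum>b<nT. \<kappa> $$ (a, b) * v $ b)"
      by (rule mat_vec_nth) (use a v in auto)
    also have "\<dots> = (\<Sum>b<nT. c b * v $ b) * e $ a"
      unfolding sum_distrib_right by (intro sum.cong refl) (simp only: ent[OF a] lessThan_iff mult_ac)
    finally show "(\<kappa> *\<^sub>v v) $ a = ((\<Sum>b<nT. c b * v $ b) \<cdot>\<^sub>v e) $ a" using a dim_e by simp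
  qed (simp add: dimk)
  then show ?thesis by blast
qed

text \<open>\<open>e\<close> is the column sum applied to \<open>r\<close>, \<open>\<theta>\<close>
  commutes with the column sum, and the latter maps everything to multiples of
  \<open>e\<close>.\<close>

lemma endo_scalar:
  assumes th: "\<theta> \<in> Homs d M M"
  shows "\<exists>c. \<theta> *\<^sub>v e = c \<cdot>\<^sub>v e"
proof -
  note dims = HomsD(2,3)[OF th] rdim_perm_module[of d l, where 'k='k]
  have "\<theta> *\<^sub>v e = (\<theta> * \<kappa>) *\<^sub>v tv r" by (rule mat_vec_assoc[symmetric]) (simp_all add: dims tvec_def)
  also have "\<theta> * \<kappa> = \<kappa> * \<theta>" by (rule Homs_rep_sum[OF MR MR th C_Sym, unfolded rdim_perm_module])
  also have "(\<kappa> * \<theta>) *\<^sub>v tv r = \<kappa> *\<^sub>v (\<theta> *\<^sub>v tv r)" by (rule mat_vec_assoc) (simp_all add: dims tvec_def)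
  finally have eq: "\<theta> *\<^sub>v e = \<kappa> *\<^sub>v (\<theta> *\<^sub>v tv r)" .
  have "\<theta> *\<^sub>v tv r \<in> carrier_vec nT" by (rule carrier_vecI) (simp add: dims)
  then show ?thesis unfolding eq by (rule kappa_vec)
qed

definition "ar = (SOME a. a < nT \<and> tabloids d l ! a = r)"
definition "am = (SOME a. a < nT \<and> tabloids d l ! a = m)"

lemma ar: "ar < nT" "tabloids d l ! ar = r" and am: "am < nT" "tabloids d l ! am = m"
proof -
  have "ar < nT \<and> tabloids d l ! ar = r"
    unfolding ar_def by (rule someI_ex) (meson tabloid_index[OF row_word_tabloid])
  then show "ar < nT" "tabloids d l ! ar = r" by auto
  have "am < nT \<and> tabloids d l ! am = m"
    unfolding am_def by (rule someI_ex) (meson tabloid_index[OF m_tabloid])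
  then show "am < nT" "tabloids d l ! am = m" by auto
qed

text \<open>Rewriting \<open>e\<close> as the column sum of \<open>m\<close> makes
  \<open>unique_pair\<close> applicable with trivial row part.\<close>

lemma e_ar: "e $ ar = 1"
proof -
  have bC: "rev_col \<in> C" by (rule rev_col_C)
  have "e $ ar = (\<kappa> *\<^sub>v tv m) $ ar" by (simp only: kappa_column_word[OF bC])
  also have "\<dots> = (\<Sum>\<gamma>\<in>C. if tabloids d l ! ar = perm_word d \<gamma> m then 1 else 0)"
    by (rule sum_tvec[OF C_Sym m_tabloid ar(1)])
  also have "\<dots> = 1"
  proof (rule sum_of_bool_unique[OF finite_CR(1) bC])
    fix \<gamma> assume g: "\<gamma> \<in> C"
    have "perm_word d id m = m" by (rule perm_word_id) simp
    then show "tabloids d l ! ar = perm_word d \<gamma> m \<longleftrightarrow> \<gamma> = rev_col"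
      using unique_pair[OF g id_CR(2)] rev_pair ar(2) by metis
  qed
  finally show ?thesis .
qed

lemma two_sums_tvec:
  assumes S: "S \<subseteq> Sym d" and S': "S' \<subseteq> Sym d" and w: "w \<in> set (tabloids d l)" and a: "a < nT"
  shows "(mat_sum nT S M *\<^sub>v (mat_sum nT S' M *\<^sub>v tv w)) $ a =
    (\<Sum>(\<sigma>, \<tau>)\<in>S \<times> S'. if tabloids d l ! a = perm_word d \<sigma> (perm_word d \<tau> w) then 1 else 0)"
proof -
  have cM: "M \<sigma> \<in> carrier_mat nT nT" for \<sigma> by (simp add: perm_module_def)
  have "mat_sum nT S M *\<^sub>v (mat_sum nT S' M *\<^sub>v tv w) = (mat_sum nT S M * mat_sum nT S' M) *\<^sub>v tv w"
    by (rule mat_vec_assoc[symmetric]) (simp_all add: rdim_perm_module tvec_def)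
  also have "mat_sum nT S M * mat_sum nT S' M = mat_sum nT (S \<times> S') (\<lambda>(\<sigma>, \<tau>). M \<sigma> * M \<tau>)"
    by (rule mat_sum_mult) (use cM in blast)+
  also have "(\<dots> *\<^sub>v tv w) $ a = (\<Sum>p\<in>S \<times> S'. ((case p of (\<sigma>, \<tau>) \<Rightarrow> M \<sigma> * M \<tau>) *\<^sub>v tv w) $ a)"
  proof (rule mat_sum_vec)
    show "tv w \<in> carrier_vec nT" "a < nT" using a by simp_all
    fix p assume "p \<in> S \<times> S'"
    then obtain \<sigma> \<tau> where p: "p = (\<sigma>, \<tau>)" "\<sigma> \<in> Sym d" "\<tau> \<in> Sym d" using S S' by blast
    show "(case p of (\<sigma>, \<tau>) \<Rightarrow> M \<sigma> * M \<tau>) \<in> carrier_mat nT nT"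
      unfolding p(1) using mult_carrier_mat[OF cM cM] by simp
  qed
  also have "\<dots> = (\<Sum>(\<sigma>, \<tau>)\<in>S \<times> S'. if tabloids d l ! a = perm_word d \<sigma> (perm_word d \<tau> w) then 1 else 0)"
  proof (intro sum.cong refl)
    fix p assume "p \<in> S \<times> S'"
    then obtain \<sigma> \<tau> where p: "p = (\<sigma>, \<tau>)" "\<sigma> \<in> Sym d" "\<tau> \<in> Sym d" using S S' by blast
    have "M \<sigma> * M \<tau> *\<^sub>v tv w = M \<sigma> *\<^sub>v (M \<tau> *\<^sub>v tv w)"
      by (rule mat_vec_assoc) (simp_all add: is_repD(4,5)[OF MR p(2)] is_repD(4,5)[OF MR p(3)] rdim_perm_module tvec_def)
    also have "\<dots> = tv (perm_word d \<sigma> (perm_word d \<tau> w))"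
      by (simp only: perm_module_tvec[OF p(3) w] perm_module_tvec[OF p(2) perm_word_tabloids[OF p(3) w]])
    finally show "((case p of (\<sigma>, \<tau>) \<Rightarrow> M \<sigma> * M \<tau>) *\<^sub>v tv w) $ a =
        (case p of (\<sigma>, \<tau>) \<Rightarrow> if tabloids d l ! a = perm_word d \<sigma> (perm_word d \<tau> w) then 1 else 0)"
      unfolding p(1) using a by (simp add: tvec_def)
  qed
  finally show ?thesis .
qed

text \<open>The left side is a multiple of \<open>e\<close>, and by \<open>unique_pair\<close> a
  single pair of permutations contributes to its coefficient at \<open>r\<close>.\<close>

lemma kappa_rho_m: "\<kappa> *\<^sub>v (\<rho>\<rho> *\<^sub>v tv m) = e"
proof -
  have "(\<kappa> *\<^sub>v (\<rho>\<rho> *\<^sub>v tv m)) $ ar = (\<Sum>(\<gamma>, \<rho>)\<in>C \<times> R. if tabloids d l ! ar = perm_word d \<gamma> (perm_word d \<rho> m) then 1 else 0)"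
    by (rule two_sums_tvec[OF C_Sym R_Sym m_tabloid ar(1)])
  also have "\<dots> = 1"
    unfolding case_prod_unfold
  proof (rule sum_of_bool_unique[where a="(rev_col, id)"])
    show "finite (C \<times> R)" using finite_CR by simp
    show "(rev_col, id) \<in> C \<times> R" using rev_col_C id_CR by simp
    fix p assume "p \<in> C \<times> R"
    then obtain \<gamma> \<rho> where p: "p = (\<gamma>, \<rho>)" "\<gamma> \<in> C" "\<rho> \<in> R" by blast
    show "tabloids d l ! ar = perm_word d (fst p) (perm_word d (snd p) m) \<longleftrightarrow> p = (rev_col, id)"
      unfolding p(1) fst_conv snd_conv ar(2) using unique_pair[OF p(2,3)] rev_pair by auto
  qed
  finally have 1: "(\<kappa> *\<^sub>v (\<rho>\<rho> *\<^sub>v tv m)) $ ar = 1" .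
  have "\<rho>\<rho> *\<^sub>v tv m \<in> carrier_vec nT" by (intro carrier_vecI) (simp add: rdim_perm_module)
  then obtain c where c: "\<kappa> *\<^sub>v (\<rho>\<rho> *\<^sub>v tv m) = c \<cdot>\<^sub>v e" using kappa_vec by blast
  then have "c = 1" using 1 e_ar ar(1) dim_e by simp
  then show ?thesis unfolding c by (simp only: one_smult_vec)
qed

text \<open>The coefficient at \<open>m\<close> counts inverses of the pairs in
  \<open>unique_pair\<close>, hence is 1.\<close>

lemma rho_e_ne: "\<rho>\<rho> *\<^sub>v e \<noteq> 0\<^sub>v nT"
proof -
  have "(\<rho>\<rho> *\<^sub>v (\<kappa> *\<^sub>v tv r)) $ am = (\<Sum>(\<rho>, \<gamma>)\<in>R \<times> C. if tabloids d l ! am = perm_word d \<rho> (perm_word d \<gamma> r) then 1 else 0)"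
    by (rule two_sums_tvec[OF R_Sym C_Sym row_word_tabloid am(1)])
  also have "\<dots> = 1"
    unfolding case_prod_unfold
  proof (rule sum_of_bool_unique[where a="(id, rev_col)"])
    show "finite (R \<times> C)" using finite_CR by simp
    show "(id, rev_col) \<in> R \<times> C" using rev_col_C id_CR by simp
    fix p assume "p \<in> R \<times> C"
    then obtain \<gamma> \<rho> where p: "p = (\<rho>, \<gamma>)" "\<gamma> \<in> C" "\<rho> \<in> R" by blast
    have gS: "\<gamma> \<in> Sym d" and hS: "\<rho> \<in> Sym d" using p C_Sym R_Sym by blast+
    have inv2: "inv_into UNIV (inv_into UNIV \<gamma>) = \<gamma>" "inv_into UNIV (inv_into UNIV \<rho>) = \<rho>"
      using gS hS by (simp_all add: Sym_def permutes_inv_inv)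
    have "m = perm_word d \<rho> (perm_word d \<gamma> r) \<Longrightarrow> \<rho> = id \<and> \<gamma> = rev_col"
    proof -
      assume m: "m = perm_word d \<rho> (perm_word d \<gamma> r)"
      have "perm_word d (inv_into UNIV \<gamma>) (perm_word d (inv_into UNIV \<rho>) m) = r"
        unfolding m using perm_word_cancel(2)[OF hS, of "perm_word d \<gamma> r"] perm_word_cancel(2)[OF gS length_row_word[of d t]] by simp
      then have "inv_into UNIV \<gamma> = rev_col" "inv_into UNIV \<rho> = id"
        using unique_pair[OF C_inv[OF p(2)] R_inv[OF p(3)]] by auto
      then show ?thesis using inv2 inv_rev_col inv_id by metis
    qed
    moreover have "perm_word d id m = m" by (rule perm_word_id) simp
    ultimately show "tabloids d l ! am = perm_word d (fst p) (perm_word d (snd p) r) \<longleftrightarrow> p = (id, rev_col)"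
      unfolding p(1) fst_conv snd_conv am(2) by auto
  qed
  finally have "(\<rho>\<rho> *\<^sub>v e) $ am = 1" .
  then show ?thesis using am(1) by (metis index_zero_vec(1) zero_neq_one)
qed

lemma row_stabilizer_iff:
  assumes "\<sigma> \<in> Sym d" "perm_word d \<sigma> r = r" shows "\<sigma> \<in> R"
proof -
  have "fst (t (\<sigma> x)) = fst (t x)" if x: "x < d" for x
  proof -
    have "perm_word d \<sigma> r ! \<sigma> x = r ! \<sigma> x" by (simp only: assms(2))
    then show ?thesis
      using x Sym_lt[OF assms(1) x] Sym_inverses(2)[OF assms(1)] by (simp add: perm_word_nth row_word_nth)
  qed
  then show ?thesis using assms(1) by (simp add: row_stabilizer_def)
qed

text \<open>The coefficient at the identity in \<open>avg_avg_vec\<close>. If \<open>g\<close> maps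
  \<open>m\<close> to \<open>r\<close> and \<open>r\<close> occurs in the inverse of
  \<open>g\<close> applied to \<open>e\<close>, then \<open>g\<close> is a column times a row
  permutation, and \<open>unique_pair\<close> leaves only \<open>rev_col\<close>.\<close>

lemma avg_coefficient_id: "(\<Sum>g\<in>Sym d. M g $$ (ar, am) * (M (inv_into UNIV g) *\<^sub>v e) $ ar) = 1"
proof -
  have "(\<Sum>g\<in>Sym d. M g $$ (ar, am) * (M (inv_into UNIV g) *\<^sub>v e) $ ar) =
      (\<Sum>g\<in>Sym d. if g = rev_col then 1 else 0)"
  proof (intro sum.cong refl)
    fix g assume g: "g \<in> Sym d"
    have "M g $$ (ar, am) = (if r = perm_word d g m then 1 else 0)"
      using ar am by (simp add: perm_module_def)
    moreover have "(M (inv_into UNIV g) *\<^sub>v e) $ ar = (if g = rev_col then 1 else 0)" if r: "r = perm_word d g m"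
    proof -
      have gi: "inv_into UNIV g \<in> Sym d" by (rule Sym_inv[OF g])
      have s1: "mat_sum nT {inv_into UNIV g} M = M (inv_into UNIV g)"
        by (rule eq_matI) (use is_repD(4,5)[OF MR gi, unfolded rdim_perm_module] in \<open>simp_all add: mat_sum_def\<close>)
      have "(mat_sum nT {inv_into UNIV g} M *\<^sub>v e) $ ar =
          (\<Sum>(\<sigma>, \<gamma>)\<in>{inv_into UNIV g} \<times> C. if tabloids d l ! ar = perm_word d \<sigma> (perm_word d \<gamma> r) then 1 else 0)"
        by (rule two_sums_tvec[OF _ C_Sym row_word_tabloid ar(1)]) (use gi in simp)
      also have "\<dots> = (\<Sum>\<gamma>\<in>C. if r = perm_word d (inv_into UNIV g) (perm_word d \<gamma> r) then 1 else 0)"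
        unfolding ar(2) sum.cartesian_product[symmetric] by simp
      also have "\<dots> = (\<Sum>\<gamma>\<in>C. if \<gamma> = rev_col \<and> g = rev_col then 1 else 0)"
      proof (intro sum.cong refl if_cong)
        fix \<gamma> assume c: "\<gamma> \<in> C"
        have cS: "\<gamma> \<in> Sym d" using c C_Sym by blast
        show "r = perm_word d (inv_into UNIV g) (perm_word d \<gamma> r) \<longleftrightarrow> \<gamma> = rev_col \<and> g = rev_col"
        proof
          assume "r = perm_word d (inv_into UNIV g) (perm_word d \<gamma> r)"
          then have gr: "perm_word d g r = perm_word d \<gamma> r"
            using perm_word_cancel(1)[OF g, of "perm_word d \<gamma> r"] by simp
          define \<rho> where "\<rho> = inv_into UNIV \<gamma> \<circ> g"
          have rS: "\<rho> \<in> Sym d" unfolding \<rho>_def by (rule Sym_comp[OF Sym_inv[OF cS] g])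
          have "perm_word d \<rho> r = r"
            unfolding \<rho>_def perm_word_comp[OF Sym_inv[OF cS] g] gr by (rule perm_word_cancel(2)[OF cS length_row_word])
          then have rR: "\<rho> \<in> R" by (rule row_stabilizer_iff[OF rS])
          have g': "g = \<gamma> \<circ> \<rho>" unfolding \<rho>_def comp_assoc[symmetric] inv_o_Sym[OF cS] by simp
          have "perm_word d \<gamma> (perm_word d \<rho> m) = r" using r unfolding g' perm_word_comp[OF cS rS] by simp
          then have "\<gamma> = rev_col \<and> \<rho> = id" by (rule unique_pair[OF c rR])
          then show "\<gamma> = rev_col \<and> g = rev_col" using g' by simp
        next
          assume "\<gamma> = rev_col \<and> g = rev_col"
          then show "r = perm_word d (inv_into UNIV g) (perm_word d \<gamma> r)"
            using perm_word_cancel(2)[OF g length_row_word[of d t]] by simp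
        qed
      qed
      also have "\<dots> = (if g = rev_col then 1 else 0)"
        using finite_CR(1) rev_col_C by (cases "g = rev_col") simp_all
      finally show ?thesis by (simp only: s1)
    qed
    moreover have "r = perm_word d rev_col m" using rev_pair by (simp add: perm_word_id)
    ultimately show "M g $$ (ar, am) * (M (inv_into UNIV g) *\<^sub>v e) $ ar = (if g = rev_col then 1 else 0)"
      by auto
  qed
  also have "\<dots> = 1" using rev_col_C C_Sym by auto
  finally show ?thesis .
qed

end

lemma zero_mat_vec: "dim_vec v = n \<Longrightarrow> 0\<^sub>m r n *\<^sub>v v = (0\<^sub>v r :: 'k::semiring_0 vec)"
  by (rule eq_vecI) (auto simp: scalar_prod_def)

lemma zero_smult_vec: "dim_vec v = n \<Longrightarrow> 0 \<cdot>\<^sub>v v = (0\<^sub>v n :: 'k::semiring_0 vec)"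
  by (rule eq_vecI) auto

context young_tableau
begin

lemma mat_sum_singleton: "mat_sum nT {\<sigma>} M = M \<sigma>"
  by (rule eq_matI) (simp_all add: mat_sum_def perm_module_def)

text \<open>Two tableaux of one shape differ by a permutation of the entries, which conjugates their
  column groups.\<close>

lemma polytabloid_translate:
  assumes t': "is_tableau d l t'"
  obtains \<sigma> where "\<sigma> \<in> Sym d" "polytabloid d l t' = M \<sigma> *\<^sub>v e"
proof -
  interpret T: young_tableau d l t' K by unfold_locales (rule part restr t')+
  define \<sigma> where "\<sigma> y = (if y < d then T.place (fst (t y)) (snd (t y)) else y)" for y
  have s: "\<sigma> y < d" "t' (\<sigma> y) = t y" if "y < d" for y
    using T.place[OF t_cell[OF that]] that by (simp_all add: \<sigma>_def)
  have "inj_on \<sigma> {..<d}"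
  proof (rule inj_onI)
    fix x y assume "x \<in> {..<d}" "y \<in> {..<d}" "\<sigma> x = \<sigma> y"
    then have lt: "x < d" "y < d" and "t' (\<sigma> x) = t' (\<sigma> y)" by simp_all
    then have "t x = t y" by (simp only: s(2))
    then show "x = y" using t_inj[OF lt] by simp
  qed
  moreover from this have "\<sigma> ` {..<d} = {..<d}" by (intro endo_inj_surj) (use s(1) in auto)
  ultimately have "bij_betw \<sigma> {..<d} {..<d}" by (simp add: bij_betw_def)
  then have "\<sigma> permutes {..<d}" by (rule bij_imp_permutes) (simp add: \<sigma>_def)
  then have sS: "\<sigma> \<in> Sym d" by (simp add: Sym_def)
  let ?i = "inv_into UNIV \<sigma>"
  have iS: "?i \<in> Sym d" by (rule Sym_inv[OF sS])
  have ti: "t (?i y) = t' y" if "y < d" for y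
    using s(2)[OF Sym_lt[OF iS that]] Sym_inverses(1)[OF sS] by simp
  have r': "T.r = perm_word d \<sigma> r"
    by (rule nth_equalityI) (use ti Sym_lt[OF iS] in \<open>simp_all add: length_row_word perm_word_nth row_word_nth\<close>)
  have conj: "\<sigma> \<circ> \<gamma> \<circ> ?i \<in> T.C" if "\<gamma> \<in> C" for \<gamma>
  proof -
    have gS: "\<gamma> \<in> Sym d" using that C_Sym by blast
    have "snd (t' (\<sigma> (\<gamma> (?i x)))) = snd (t' x)" if x: "x < d" for x
      using s(2)[OF Sym_lt[OF gS Sym_lt[OF iS x]]] C_snd[OF \<open>\<gamma> \<in> C\<close> Sym_lt[OF iS x]] ti[OF x] by simp
    then show ?thesis
      unfolding column_stabilizer_def using Sym_comp[OF Sym_comp[OF sS gS] iS] by simp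
  qed
  have conj': "?i \<circ> \<gamma> \<circ> \<sigma> \<in> C" if "\<gamma> \<in> T.C" for \<gamma>
  proof -
    have gS: "\<gamma> \<in> Sym d" using that T.C_Sym by blast
    have "snd (t (?i (\<gamma> (\<sigma> x)))) = snd (t x)" if x: "x < d" for x
      using ti[OF Sym_lt[OF gS s(1)[OF x]]] T.C_snd[OF \<open>\<gamma> \<in> T.C\<close> s(1)[OF x]] s(2)[OF x] by simp
    then show ?thesis
      unfolding column_stabilizer_def using Sym_comp[OF Sym_comp[OF iS gS] sS] by simp
  qed
  have "T.e = M \<sigma> *\<^sub>v e"
  proof (rule eq_vecI)
    fix a assume "a < dim_vec (M \<sigma> *\<^sub>v e)"
    then have a: "a < nT" by (simp add: perm_module_def)
    have "(M \<sigma> *\<^sub>v e) $ a = (\<Sum>(s, \<gamma>)\<in>{\<sigma>} \<times> C. if tabloids d l ! a = perm_word d s (perm_word d \<gamma> r) then 1 else 0)"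
      using two_sums_tvec[of "{\<sigma>}", OF _ C_Sym row_word_tabloid a] sS by (simp only: mat_sum_singleton) simp
    also have "\<dots> = (\<Sum>\<gamma>\<in>C. if tabloids d l ! a = perm_word d \<sigma> (perm_word d \<gamma> r) then 1 else 0)"
      unfolding sum.cartesian_product[symmetric] by simp
    also have "\<dots> = (\<Sum>\<gamma>\<in>C. if tabloids d l ! a = perm_word d (\<sigma> \<circ> \<gamma>) r then 1 else 0)"
    proof (intro sum.cong refl)
      fix \<gamma> assume "\<gamma> \<in> C"
      then have "\<gamma> \<in> Sym d" using C_Sym by blast
      then show "(if tabloids d l ! a = perm_word d \<sigma> (perm_word d \<gamma> r) then 1 else 0) =
          (if tabloids d l ! a = perm_word d (\<sigma> \<circ> \<gamma>) r then 1 else 0 :: 'k)"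
        by (simp only: perm_word_comp[OF sS])
    qed
    also have "\<dots> = (\<Sum>\<gamma>\<in>T.C. if tabloids d l ! a = perm_word d \<gamma> T.r then 1 else 0)"
    proof (rule sum.reindex_bij_witness[where i="\<lambda>\<gamma>. ?i \<circ> \<gamma> \<circ> \<sigma>" and j="\<lambda>\<gamma>. \<sigma> \<circ> \<gamma> \<circ> ?i"])
      fix \<gamma> assume g: "\<gamma> \<in> C"
      then have gS: "\<gamma> \<in> Sym d" using C_Sym by blast
      show "?i \<circ> (\<sigma> \<circ> \<gamma> \<circ> ?i) \<circ> \<sigma> = \<gamma>"
        by (rule ext) (simp add: Sym_inverses[OF sS])
      show "\<sigma> \<circ> \<gamma> \<circ> ?i \<in> T.C" by (rule conj[OF g])
      have "perm_word d (\<sigma> \<circ> \<gamma> \<circ> ?i) T.r = perm_word d (\<sigma> \<circ> \<gamma>) r"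
        unfolding r' perm_word_comp[OF Sym_comp[OF sS gS] iS] perm_word_cancel(2)[OF sS length_row_word] ..
      then show "(if tabloids d l ! a = perm_word d (\<sigma> \<circ> \<gamma> \<circ> ?i) T.r then 1 else 0) =
          (if tabloids d l ! a = perm_word d (\<sigma> \<circ> \<gamma>) r then 1 else 0 :: 'k)" by (simp only:)
    next
      fix \<gamma> assume g: "\<gamma> \<in> T.C"
      show "\<sigma> \<circ> (?i \<circ> \<gamma> \<circ> \<sigma>) \<circ> ?i = \<gamma>"
        by (rule ext) (simp add: Sym_inverses[OF sS])
      show "?i \<circ> \<gamma> \<circ> \<sigma> \<in> C" by (rule conj'[OF g])
    qed
    also have "\<dots> = T.e $ a" by (rule sum_tvec[OF T.C_Sym T.row_word_tabloid a, symmetric])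
    finally show "T.e $ a = (M \<sigma> *\<^sub>v e) $ a" by (rule sym)
  qed (simp add: perm_module_def)
  then show ?thesis using that[OF sS] T.polytabloid_eq by simp
qed

section \<open>Young modules as minimal summands containing the polytabloid\<close>

text \<open>\<open>i\<close> and \<open>p\<close> present \<open>Y\<close> as a summand of the
  permutation module that contains the polytabloid \<open>e\<close>.\<close>

definition carries :: "'k srep \<Rightarrow> 'k mat \<Rightarrow> 'k mat \<Rightarrow> bool" where
  "carries Y i p \<longleftrightarrow> is_rep d Y \<and> i \<in> Homs d Y M \<and> p \<in> Homs d M Y \<and> p * i = 1\<^sub>m (rdim Y) \<and> (i * p) *\<^sub>v e = e"

lemma carriesD:
  assumes "carries Y i p"
  shows "is_rep d Y" "i \<in> Homs d Y M" "p \<in> Homs d M Y" "p * i = 1\<^sub>m (rdim Y)" "(i * p) *\<^sub>v e = e"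
    "dim_row i = nT" "dim_col i = rdim Y" "dim_row p = rdim Y" "dim_col p = nT"
  using assms HomsD(2,3)[of i d Y M] HomsD(2,3)[of p d M Y] by (auto simp: carries_def rdim_perm_module)

lemma carries_vec:
  assumes c: "carries Y i p"
  shows "i *\<^sub>v (p *\<^sub>v e) = e"
proof -
  note D = carriesD[OF c]
  have "i *\<^sub>v (p *\<^sub>v e) = (i * p) *\<^sub>v e" by (rule mat_vec_assoc[symmetric]) (simp_all only: D dim_e)
  then show ?thesis by (simp only: D(5))
qed

lemma e_nonzero: "e \<noteq> 0\<^sub>v nT"
  using e_ar ar(1) by (metis index_zero_vec(1) zero_neq_one)

text \<open>Composing \<open>h\<close> with \<open>i\<close> and \<open>p\<close> gives an
  endomorphism of the permutation module, to which \<open>endo_scalar\<close> applies.\<close>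

lemma carries_endo:
  assumes c: "carries Y i p" and h: "h \<in> Homs d Y Y"
  obtains a where "h *\<^sub>v (p *\<^sub>v e) = a \<cdot>\<^sub>v (p *\<^sub>v e)"
proof -
  note D = carriesD[OF c] and dh = HomsD(2,3)[OF h]
  have hp: "h * p \<in> Homs d M Y" by (rule Homs_comp[OF MR D(1) D(1) D(3) h])
  obtain a where a: "(i * (h * p)) *\<^sub>v e = a \<cdot>\<^sub>v e"
    using endo_scalar[OF Homs_comp[OF MR D(1) MR hp D(2)]] by blast
  have "h *\<^sub>v (p *\<^sub>v e) = (p * i * (h * p)) *\<^sub>v e"
    unfolding D(4) using left_mult_one_mat[OF HomsD(1)[OF hp]]
    by (simp only:) (rule mat_vec_assoc[symmetric]; simp only: D dim_e dh)
  also have "\<dots> = (p * (i * (h * p))) *\<^sub>v e"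
    by (subst mat_assoc) (simp_all only: D dim_e dh index_mult_mat)
  also have "\<dots> = p *\<^sub>v (a \<cdot>\<^sub>v e)"
    unfolding a[symmetric] by (rule mat_vec_assoc) (simp_all only: D dim_e dh index_mult_mat)
  also have "\<dots> = a \<cdot>\<^sub>v (p *\<^sub>v e)" by (rule mat_vec_smult) (simp_all only: D dim_e)
  finally show ?thesis by (rule that)
qed

lemma carries_ne:
  assumes c: "carries Y i p" shows "p *\<^sub>v e \<noteq> 0\<^sub>v (rdim Y)" "rdim Y \<noteq> 0"
proof -
  note D = carriesD[OF c]
  show 1: "p *\<^sub>v e \<noteq> 0\<^sub>v (rdim Y)"
  proof
    assume "p *\<^sub>v e = 0\<^sub>v (rdim Y)"
    then have "e = i *\<^sub>v 0\<^sub>v (rdim Y)" using carries_vec[OF c] by simp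
    also have "\<dots> = 0\<^sub>v nT" by (rule eq_vecI) (simp_all add: D scalar_prod_def)
    finally show False using e_nonzero by blast
  qed
  show "rdim Y \<noteq> 0"
  proof
    assume "rdim Y = 0"
    then have "p *\<^sub>v e = 0\<^sub>v (rdim Y)" by (intro eq_vecI) (simp_all add: D)
    then show False using 1 by blast
  qed
qed

lemma carries_summand:
  assumes c: "carries Y i p" and A: "is_rep d A" and f: "f \<in> Homs d A Y" and g: "g \<in> Homs d Y A"
    and gf: "g * f = 1\<^sub>m (rdim A)" and fge: "(f * g) *\<^sub>v (p *\<^sub>v e) = p *\<^sub>v e"
  shows "carries A (i * f) (g * p)"
proof -
  note D = carriesD[OF c] and df = HomsD(2,3)[OF f] HomsD(2,3)[OF g]
  have "g * p * (i * f) = g * (p * i * f)" by (simp add: mat_assoc D(6-) df)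
  also have "\<dots> = 1\<^sub>m (rdim A)" unfolding D(4) left_mult_one_mat[OF HomsD(1)[OF f]] by (rule gf)
  finally have 1: "g * p * (i * f) = 1\<^sub>m (rdim A)" .
  have "(i * f * (g * p)) *\<^sub>v e = (i * (f * g * p)) *\<^sub>v e" by (simp add: mat_assoc D(6-) df)
  also have "\<dots> = i *\<^sub>v ((f * g) *\<^sub>v (p *\<^sub>v e))"
    by (subst mat_vec_assoc, simp add: D(6-) df, simp add: D(6-) df)
      (subst mat_vec_assoc, simp add: D(6-) df, simp add: D(6-) df, rule refl)
  also have "\<dots> = e" unfolding fge by (rule carries_vec[OF c])
  finally show ?thesis
    unfolding carries_def using A Homs_comp[OF A D(1) MR f D(2)] Homs_comp[OF MR D(1) A D(3) g] 1 by blast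
qed

lemma smult_cancel_vec:
  fixes v :: "'k vec"
  assumes "a \<cdot>\<^sub>v v = b \<cdot>\<^sub>v v" "v \<noteq> 0\<^sub>v n" "dim_vec v = n" shows "a = b"
proof -
  obtain i where i: "i < n" "v $ i \<noteq> 0" using assms(2,3) by (metis eq_vecI index_zero_vec)
  have "(a \<cdot>\<^sub>v v) $ i = (b \<cdot>\<^sub>v v) $ i" by (simp only: assms(1))
  then show ?thesis using i assms(3) by simp
qed

text \<open>The two idempotents of a decomposition act on \<open>p *\<^sub>v e\<close> by idempotent
  scalars, 0 or 1. They sum to the identity, so one of them fixes the vector and its summand still
  carries \<open>e\<close>; minimality makes the other summand zero.\<close>

lemma minimal_indecomposable:
  assumes c: "carries Y i p" and min: "\<And>A j q. carries A j q \<Longrightarrow> rdim Y \<le> rdim A"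
  shows "indecomposable d Y"
  unfolding indecomposable_def
proof (intro conjI allI impI)
  note D = carriesD[OF c]
  let ?y = "p *\<^sub>v e"
  have dimy: "dim_vec ?y = rdim Y" by (simp add: D)
  show "is_rep d Y" "rdim Y \<noteq> 0" by (rule D(1), rule carries_ne(2)[OF c])
  fix A B :: "'k srep" assume "is_rep d A \<and> is_rep d B \<and> rep_iso d (direct_sum [A, B]) Y"
  then have A: "is_rep d A" and B: "is_rep d B" and iso: "rep_iso d (rep_pair A B) Y" by (simp_all add: rep_pair_def)
  have P: "is_rep d (rep_pair A B)" by (rule rep_pair_is_rep[OF A B])
  obtain f g where f: "f \<in> Homs d (rep_pair A B) Y" and g: "g \<in> Homs d Y (rep_pair A B)"
    and fg: "f * g = 1\<^sub>m (rdim Y)" and gf: "g * f = 1\<^sub>m (rdim (rep_pair A B))"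
    by (rule rep_iso_inverse[OF P D(1) iso])
  have dim: "rdim Y = rdim A + rdim B"
    using mat_inverse_square[OF HomsD(1)[OF f] HomsD(1)[OF g] fg gf] by (simp add: rdim_rep_pair)
  note df = HomsD(2,3)[OF f] HomsD(2,3)[OF g] rdim_rep_pair[of A B]
  let ?a = "rdim A" and ?b = "rdim B"
  note H = rep_pair_Homs[OF A B] and m = incl_proj_mult[of ?a ?b, where 'k='k]
  have part: "carries Z (i * (f * u)) (w * g * p) \<or> (f * u * (w * g)) *\<^sub>v ?y = 0 \<cdot>\<^sub>v ?y"
    if Z: "is_rep d Z" and u: "u \<in> Homs d Z (rep_pair A B)" and w: "w \<in> Homs d (rep_pair A B) Z" and wu: "w * u = 1\<^sub>m (rdim Z)" for Z u w
  proof -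
    note du = HomsD(2,3)[OF u] HomsD(2,3)[OF w]
    have fu: "f * u \<in> Homs d Z Y" and wg: "w * g \<in> Homs d Y Z"
      by (rule Homs_comp[OF Z P D(1) u f], rule Homs_comp[OF D(1) P Z g w])
    note dfu = HomsD(2,3)[OF fu] HomsD(2,3)[OF wg]
    have "w * g * (f * u) = w * (g * f * u)" by (simp add: mat_assoc df du)
    also have "\<dots> = 1\<^sub>m (rdim Z)" unfolding gf left_mult_one_mat[OF HomsD(1)[OF u]] by (rule wu)
    finally have 1: "w * g * (f * u) = 1\<^sub>m (rdim Z)" .
    let ?h = "f * u * (w * g)"
    have h: "?h \<in> Homs d Y Y" by (rule Homs_comp[OF D(1) Z D(1) wg fu])
    obtain x where x: "?h *\<^sub>v ?y = x \<cdot>\<^sub>v ?y" by (rule carries_endo[OF c h])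
    have "?h * ?h = f * u * (w * g * (f * u) * (w * g))" using dfu by (simp add: mat_assoc)
    also have "\<dots> = ?h" unfolding 1 left_mult_one_mat[OF HomsD(1)[OF wg]] ..
    finally have hh: "?h * ?h = ?h" .
    have "x \<cdot>\<^sub>v ?y = (?h * ?h) *\<^sub>v ?y" unfolding hh by (rule x[symmetric])
    also have "\<dots> = ?h *\<^sub>v (?h *\<^sub>v ?y)" by (rule mat_vec_assoc) (simp_all only: HomsD(2,3)[OF h] dimy)
    also have "\<dots> = x \<cdot>\<^sub>v (x \<cdot>\<^sub>v ?y)"
      unfolding x by (subst mat_vec_smult) (simp_all only: x HomsD(3)[OF h] dimy)
    also have "\<dots> = (x * x) \<cdot>\<^sub>v ?y" by (rule smult_smult_assoc)
    finally have "x = x * x" by (rule smult_cancel_vec[OF _ carries_ne(1)[OF c] dimy])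
    then have "x = 0 \<or> x = 1" by (metis mult_cancel_right1)
    then show ?thesis
    proof
      assume "x = 1"
      then have "?h *\<^sub>v ?y = ?y" using x by (simp only: one_smult_vec)
      then show ?thesis using carries_summand[OF c Z fu wg 1] by blast
    qed (use x in simp)
  qed
  let ?hA = "f * incl1 ?a ?b * (proj1 ?a ?b * g)" and ?hB = "f * incl2 ?a ?b * (proj2 ?a ?b * g)"
  have sum1: "?hA + ?hB = 1\<^sub>m (rdim Y)"
  proof -
    have "?hA + ?hB = f * ((incl1 ?a ?b * proj1 ?a ?b + incl2 ?a ?b * proj2 ?a ?b) * g)"
      by (simp add: mat_assoc mat_distrib df)
    also have "\<dots> = 1\<^sub>m (rdim Y)" unfolding m(5) using left_mult_one_mat[OF HomsD(1)[OF g]] fg by (simp add: df)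
    finally show ?thesis .
  qed
  show "?a = 0 \<or> ?b = 0"
  proof (rule ccontr)
    assume n: "\<not> (?a = 0 \<or> ?b = 0)"
    have "(?hA *\<^sub>v ?y) = 0 \<cdot>\<^sub>v ?y" using part[OF A H(1,3) m(1)] min n dim by fastforce
    moreover have "(?hB *\<^sub>v ?y) = 0 \<cdot>\<^sub>v ?y" using part[OF B H(2,4) m(2)] min n dim by fastforce
    moreover have "(?hA + ?hB) *\<^sub>v ?y = ?hA *\<^sub>v ?y + ?hB *\<^sub>v ?y"
      by (rule add_mult_distrib_mat_vec[of _ "rdim Y" "rdim Y"]) (auto simp: df D intro!: carrier_matI carrier_vecI)
    moreover have "1\<^sub>m (rdim Y) *\<^sub>v ?y = ?y" by (rule one_mult_mat_vec) (simp add: carrier_vecI D)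
    ultimately have "?y = 0 \<cdot>\<^sub>v ?y + 0 \<cdot>\<^sub>v ?y" by (simp only: sum1)
    also have "\<dots> = 0\<^sub>v (rdim Y)" by (rule eq_vecI) (simp_all add: D)
    finally show False using carries_ne(1)[OF c] by blast
  qed
qed

text \<open>The vectors fixed by \<open>i * p\<close> form a subspace stable under
  \<open>S\<^sub>d\<close>, and every polytabloid is a translate of \<open>e\<close>.\<close>

lemma specht_subset_image:
  assumes c: "carries Y i p"
  shows "specht d l \<subseteq> (\<lambda>v. i *\<^sub>v v) ` carrier_vec (rdim Y)"
proof -
  note D = carriesD[OF c]
  interpret vec_space "TYPE('k)" nT .
  let ?N = "{v \<in> carrier_vec nT. (i * p) *\<^sub>v v = v}"
  have ip: "i * p \<in> carrier_mat nT nT" by (rule carrier_matI) (simp_all add: D)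
  have sub: "submodule class_ring ?N V"
  proof (unfold_locales)
    show "?N \<subseteq> carrier V" by auto
    show "v \<oplus>\<^bsub>V\<^esub> w \<in> ?N" if "v \<in> ?N" "w \<in> ?N" for v w
      using that mult_add_distrib_mat_vec[OF ip] by (simp add: module_vec_simps)
    show "\<zero>\<^bsub>V\<^esub> \<in> ?N"
      using ip by (auto simp: module_vec_simps scalar_prod_def intro!: eq_vecI)
    show "x \<odot>\<^bsub>V\<^esub> v \<in> ?N" if "v \<in> ?N" for x v
      using that mult_mat_vec[OF ip] by (simp add: module_vec_simps)
  qed
  have "{polytabloid d l t' |t'. is_tableau d l t'} \<subseteq> ?N"
  proof
    fix v :: "'k vec" assume "v \<in> {polytabloid d l t' |t'. is_tableau d l t'}"
    then obtain t' where t': "is_tableau d l t'" "v = polytabloid d l t'" by blast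
    then obtain \<sigma> where s: "\<sigma> \<in> Sym d" "v = M \<sigma> *\<^sub>v e" using polytabloid_translate by metis
    have Ms: "M \<sigma> \<in> carrier_mat nT nT" by (simp add: perm_module_def)
    have vc: "v \<in> carrier_vec nT" unfolding s(2) by (rule mult_mat_vec_carrier[OF Ms e_carrier])
    have "(i * p) *\<^sub>v v = (i * p * M \<sigma>) *\<^sub>v e"
      unfolding s(2) by (rule assoc_mult_mat_vec[OF ip Ms e_carrier, symmetric])
    also have "i * p * M \<sigma> = M \<sigma> * (i * p)"
      by (rule HomsD(4)[OF Homs_comp[OF MR D(1) MR D(3) D(2)] s(1)])
    also have "(M \<sigma> * (i * p)) *\<^sub>v e = v"
      unfolding s(2) assoc_mult_mat_vec[OF Ms ip e_carrier] D(5) ..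
    finally show "v \<in> ?N" using vc by simp
  qed
  then have "specht d l \<subseteq> ?N" unfolding specht_def by (rule span_is_subset[OF _ sub])
  moreover have "v \<in> (\<lambda>v. i *\<^sub>v v) ` carrier_vec (rdim Y)" if "v \<in> ?N" for v
  proof (rule image_eqI)
    have "dim_vec v = nT" using that by simp
    then have "i *\<^sub>v (p *\<^sub>v v) = (i * p) *\<^sub>v v" by (intro mat_vec_assoc[symmetric]) (simp_all only: D(6-))
    then show "v = i *\<^sub>v (p *\<^sub>v v)" using that by simp
    show "p *\<^sub>v v \<in> carrier_vec (rdim Y)" by (rule carrier_vecI) (simp add: D)
  qed
  ultimately show ?thesis by blast
qed

lemma e_in_specht: "e \<in> specht d l"
proof -
  interpret vec_space "TYPE('k)" nT .
  let ?P = "{polytabloid d l t' |t'. is_tableau d l t'} :: 'k vec set"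
  have "?P \<subseteq> carrier_vec nT"
    by (auto simp: polytabloid_def)
  then have "?P \<subseteq> (specht d l :: 'k vec set)"
    unfolding specht_def by (rule in_own_span)
  moreover have "e \<in> ?P" using tab polytabloid_eq[symmetric] by blast
  ultimately show ?thesis by blast
qed

text \<open>Among the summands carrying \<open>e\<close>, one of least dimension qualifies.\<close>

lemma young_module_exists: "is_young_module d l (young_module d l :: 'k srep)"
proof -
  have "carries M (1\<^sub>m nT) (1\<^sub>m nT)"
  proof -
    have "1\<^sub>m nT \<in> Homs d M M" using Homs_id[OF MR] by (simp add: rdim_perm_module)
    moreover have "(1\<^sub>m nT * 1\<^sub>m nT) *\<^sub>v e = e" using e_carrier by simp
    ultimately show ?thesis using MR by (simp add: carries_def rdim_perm_module)
  qed
  then have ex: "\<exists>n Y i p. carries Y i p \<and> rdim Y = n" by blast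
  define n where "n = (LEAST n. \<exists>Y i p. carries Y i p \<and> rdim Y = n)"
  obtain Y i p where Y: "carries Y i p" "rdim Y = n"
    using LeastI_ex[OF ex] unfolding n_def by blast
  have "indecomposable d Y"
    by (rule minimal_indecomposable[OF Y(1)]) (unfold Y(2) n_def, rule Least_le, blast)
  then have "is_young_module d l Y"
    unfolding is_young_module_def using carriesD[OF Y(1)] specht_subset_image[OF Y(1)] by blast
  then show ?thesis using someI[of "is_young_module d l" Y] by (simp add: young_module_def)
qed

lemma young_module_carries:
  assumes Y: "is_young_module d l Y"
  obtains i p where "carries Y i p"
proof -
  obtain i p where ip: "i \<in> Homs d Y M" "p \<in> Homs d M Y" "p * i = 1\<^sub>m (rdim Y)" "specht d l \<subseteq> (\<lambda>v. i *\<^sub>v v) ` carrier_vec (rdim Y)"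
    and R: "is_rep d Y"
    using Y by (auto simp: is_young_module_def indecomposable_def)
  obtain v where v: "v \<in> carrier_vec (rdim Y)" "e = i *\<^sub>v v" using ip(4) e_in_specht by blast
  note di = HomsD(2,3)[OF ip(1)] HomsD(2,3)[OF ip(2)]
  have dv: "dim_vec v = rdim Y" using v(1) by simp
  have "(i * p) *\<^sub>v e = i *\<^sub>v ((p * i) *\<^sub>v v)"
    unfolding v(2) using dv di by (simp add: mat_vec_assoc)
  also have "\<dots> = e" unfolding ip(3) v(2) using v(1) by simp
  finally show ?thesis using that ip(1-3) R unfolding carries_def by blast
qed

context
  fixes Y :: "'k srep" and i p :: "'k mat"
  assumes Y: "is_young_module d l Y" and c: "carries Y i p"
begin

text \<open>Powers of \<open>h\<close> scale \<open>p *\<^sub>v e\<close> by powers of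
  \<open>a\<close>, so \<open>h\<close> is not nilpotent and Fitting's lemma makes it a
  unit.\<close>

lemma young_unit:
  assumes h: "h \<in> Homs d Y Y" and hy: "h *\<^sub>v (p *\<^sub>v e) = a \<cdot>\<^sub>v (p *\<^sub>v e)" and a: "a \<noteq> 0"
  shows "\<exists>g\<in>Homs d Y Y. g * h = 1\<^sub>m (rdim Y)"
proof -
  note D = carriesD[OF c]
  let ?y = "p *\<^sub>v e"
  have y: "?y \<in> carrier_vec (rdim Y)" by (rule carrier_vecI) (simp add: D)
  have pow: "(h ^\<^sub>m N) *\<^sub>v ?y = (a ^ N) \<cdot>\<^sub>v ?y" for N
  proof (induction N)
    case 0
    then show ?case using y HomsD(2)[OF h] by simp
  next
    case (Suc N)
    have "(h ^\<^sub>m Suc N) *\<^sub>v ?y = h ^\<^sub>m N *\<^sub>v (h *\<^sub>v ?y)"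
      using assoc_mult_mat_vec[OF pow_carrier_mat[OF HomsD(1)[OF h]] HomsD(1)[OF h] y] by simp
    also have "\<dots> = a \<cdot>\<^sub>v (h ^\<^sub>m N *\<^sub>v ?y)"
      unfolding hy by (rule mult_mat_vec[OF pow_carrier_mat[OF HomsD(1)[OF h]] y])
    also have "\<dots> = (a ^ Suc N) \<cdot>\<^sub>v ?y" unfolding Suc by (simp add: smult_smult_assoc)
    finally show ?case .
  qed
  have "h ^\<^sub>m N \<noteq> 0\<^sub>m (rdim Y) (rdim Y)" for N
  proof
    assume "h ^\<^sub>m N = 0\<^sub>m (rdim Y) (rdim Y)"
    then have "(a ^ N) \<cdot>\<^sub>v ?y = 0\<^sub>m (rdim Y) (rdim Y) *\<^sub>v ?y" using pow[of N] by simp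
    also have "\<dots> = 0 \<cdot>\<^sub>v ?y"
      by (simp only: zero_mat_vec[OF carrier_vecD[OF y]] zero_smult_vec[OF carrier_vecD[OF y]])
    finally have "a ^ N = 0" by (rule smult_cancel_vec[OF _ carries_ne(1)[OF c] carrier_vecD[OF y]])
    then show False using a by simp
  qed
  moreover have "indecomposable d Y" using Y by (simp add: is_young_module_def)
  ultimately show ?thesis using indecomposable_unit[OF _ h] by blast
qed

text \<open>The two scalars on \<open>p *\<^sub>v e\<close> cannot both be zero.\<close>

lemma young_local:
  assumes f: "f \<in> Homs d Y Y" and g: "g \<in> Homs d Y Y" and fg: "f + g = 1\<^sub>m (rdim Y)"
  shows "\<exists>h \<in> Homs d Y Y. h * f = 1\<^sub>m (rdim Y) \<or> h * g = 1\<^sub>m (rdim Y)"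
proof -
  note D = carriesD[OF c]
  let ?y = "p *\<^sub>v e"
  have y: "?y \<in> carrier_vec (rdim Y)" by (rule carrier_vecI) (simp add: D)
  obtain a where a: "f *\<^sub>v ?y = a \<cdot>\<^sub>v ?y" by (rule carries_endo[OF c f])
  obtain b where b: "g *\<^sub>v ?y = b \<cdot>\<^sub>v ?y" by (rule carries_endo[OF c g])
  have "?y = (f + g) *\<^sub>v ?y" unfolding fg using y by simp
  also have "\<dots> = a \<cdot>\<^sub>v ?y + b \<cdot>\<^sub>v ?y"
    unfolding a[symmetric] b[symmetric] by (rule add_mult_distrib_mat_vec[OF HomsD(1)[OF f] HomsD(1)[OF g] y])
  finally have "?y = a \<cdot>\<^sub>v ?y + b \<cdot>\<^sub>v ?y" .
  then have "\<not> (a = 0 \<and> b = 0)"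
    using carries_ne(1)[OF c] zero_smult_vec[OF carrier_vecD[OF y]] by auto
  then show ?thesis using young_unit[OF f a] young_unit[OF g b] by blast
qed

text \<open>A composite through \<open>V\<close> that scales \<open>e\<close> by a nonzero factor
  induces a unit in the endomorphism ring of \<open>Y\<close>.\<close>

lemma split_of_nonzero:
  assumes V: "is_rep d V" and F: "F \<in> Homs d M V" and G: "G \<in> Homs d V M" and ne: "(G *\<^sub>v (F *\<^sub>v e)) $ ar \<noteq> 0"
  shows "\<exists>f \<in> Homs d Y V. \<exists>g \<in> Homs d V Y. g * f = 1\<^sub>m (rdim Y)"
proof -
  note D = carriesD[OF c]
  note dF = HomsD(2,3)[OF F, unfolded rdim_perm_module] HomsD(2,3)[OF G, unfolded rdim_perm_module]
  obtain a where a: "(G * F) *\<^sub>v e = a \<cdot>\<^sub>v e" using endo_scalar[OF Homs_comp[OF MR V MR F G]] by blast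
  have GF: "G *\<^sub>v (F *\<^sub>v e) = a \<cdot>\<^sub>v e" unfolding a[symmetric] by (rule mat_vec_assoc[symmetric]) (simp_all add: dF)
  have a0: "a \<noteq> 0"
  proof
    assume "a = 0"
    then have "(G *\<^sub>v (F *\<^sub>v e)) $ ar = 0" unfolding GF using ar(1) by simp
    then show False using ne by blast
  qed
  have Fi: "F * i \<in> Homs d Y V" and pG: "p * G \<in> Homs d V Y"
    by (rule Homs_comp[OF D(1) MR V D(2) F], rule Homs_comp[OF V MR D(1) G D(3)])
  note dFi = HomsD(2,3)[OF Fi] HomsD(2,3)[OF pG]
  have "(p * G * (F * i)) *\<^sub>v (p *\<^sub>v e) = (p * G) *\<^sub>v ((F * i) *\<^sub>v (p *\<^sub>v e))"
    by (rule mat_vec_assoc) (simp_all add: dF D)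
  also have "(F * i) *\<^sub>v (p *\<^sub>v e) = F *\<^sub>v e"
    using mat_vec_assoc[of F i "p *\<^sub>v e"] carries_vec[OF c] by (simp add: dF D)
  also have "(p * G) *\<^sub>v (F *\<^sub>v e) = p *\<^sub>v (a \<cdot>\<^sub>v e)"
    unfolding GF[symmetric] by (rule mat_vec_assoc) (simp_all add: dF D)
  also have "\<dots> = a \<cdot>\<^sub>v (p *\<^sub>v e)" by (rule mat_vec_smult) (simp add: D)
  finally obtain h where h: "h \<in> Homs d Y Y" "h * (p * G * (F * i)) = 1\<^sub>m (rdim Y)"
    using young_unit[OF Homs_comp[OF D(1) V D(1) Fi pG] _ a0] by blast
  have "h * (p * G) * (F * i) = 1\<^sub>m (rdim Y)"
    using h(2) mat_assoc[of h "p * G" "F * i"] dFi HomsD(2,3)[OF h(1)] by (simp only:)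
  then show ?thesis using Fi Homs_comp[OF V D(1) D(1) pG h(1)] by blast
qed

text \<open>If \<open>Y\<close> did not split off, all averaged composites would vanish on
  \<open>e\<close> at \<open>r\<close>, and by \<open>avg_avg_vec\<close> the element
  \<open>b\<close> would act by zero. Faithfulness gives \<open>b = 0\<close>, against
  \<open>b id = 1\<close>.\<close>

lemma split_of_faithful:
  assumes V: "is_rep d (tensor_rep d X)" and dim: "rdim (tensor_rep d X) = dim_row X ^ d" and faith: "faithful_obj d X"
  shows "\<exists>f \<in> Homs d Y (tensor_rep d X). \<exists>g \<in> Homs d (tensor_rep d X) Y. g * f = 1\<^sub>m (rdim Y)"
proof (rule ccontr)
  assume no: "\<not> ?thesis"
  let ?V = "tensor_rep d X"
  define b where "b k = (if k \<in> Sym d then \<Sum>g\<in>Sym d. M g $$ (ar, am) * (M (inv_into UNIV (g \<circ> k)) *\<^sub>v e) $ ar else 0)" for k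
  have arm: "ar < rdim M" "am < rdim M" using ar am by (simp_all add: rdim_perm_module)
  have ec: "e \<in> carrier_vec (rdim M)" using e_carrier by (simp add: rdim_perm_module)
  have "(\<Sum>k\<in>Sym d. b k * ?V k $$ (y, x)) = 0" if "x < rdim ?V" "y < rdim ?V" for x y
  proof -
    have "(avg d ?V M y am *\<^sub>v (avg d M ?V ar x *\<^sub>v e)) $ ar = 0"
      using split_of_nonzero[OF V avg_Homs[OF MR V arm(1) that(1)] avg_Homs[OF V MR that(2) arm(2)]] no by blast
    then show ?thesis
      unfolding avg_avg_vec[OF MR V ec arm that] by (simp add: b_def cong: sum.cong)
  qed
  then have "braid_hom d X b = braid_hom d X (\<lambda>_. 0)"
    unfolding braid_hom_def by (intro eq_matI) (simp_all add: dim)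
  moreover have "b \<in> group_algebra d" "(\<lambda>_. 0) \<in> group_algebra d" by (simp_all add: group_algebra_def b_def)
  ultimately have "b = (\<lambda>_. 0)" by (rule inj_onD[OF faith[unfolded faithful_obj_def]])
  moreover have "b id = 1" using avg_coefficient_id id_in_Sym by (simp add: b_def)
  ultimately show False by simp
qed

text \<open>If \<open>Y\<close> split off, the product of row, column and row sums would vanish
  after the idempotent \<open>i * p\<close>. Commuting the idempotent past the two inner sums and
  applying the result to \<open>m\<close> gives row sum of \<open>e\<close> equal to 0, against
  \<open>rho_e_ne\<close>.\<close>

lemma no_split:
  assumes V: "is_rep d V" and zero: "rep_sum d V R * (rep_sum d V C * rep_sum d V R) = 0\<^sub>m (rdim V) (rdim V)"
  shows "\<not> (\<exists>f \<in> Homs d Y V. \<exists>g \<in> Homs d V Y. g * f = 1\<^sub>m (rdim Y))"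
proof
  assume "\<exists>f \<in> Homs d Y V. \<exists>g \<in> Homs d V Y. g * f = 1\<^sub>m (rdim Y)"
  then obtain f g where f: "f \<in> Homs d Y V" and g: "g \<in> Homs d V Y" and gf: "g * f = 1\<^sub>m (rdim Y)" by blast
  note D = carriesD[OF c]
  have ig: "i * g \<in> Homs d V M" and fp: "f * p \<in> Homs d M V"
    by (rule Homs_comp[OF V D(1) MR g D(2)], rule Homs_comp[OF MR D(1) V D(3) f])
  note dims = HomsD(2,3)[OF f] HomsD(2,3)[OF g] HomsD(2,3)[OF ig, unfolded rdim_perm_module] HomsD(2,3)[OF fp, unfolded rdim_perm_module]
  have "(i * g) * (f * p) = i * ((g * f) * p)" by (simp add: mat_assoc dims D(6-))
  also have "\<dots> = i * p" unfolding gf left_mult_one_mat[OF HomsD(1)[OF D(3)]] ..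
  finally have igfp: "(i * g) * (f * p) = i * p" .
  have sw: "(i * g) * rep_sum d V S = mat_sum nT S M * (i * g)" if "S \<subseteq> Sym d" for S
    using Homs_rep_sum[OF V MR ig that] by (simp only: rdim_perm_module)
  let ?ig = "i * g" and ?fp = "f * p"
  have "0\<^sub>m nT nT = ?ig * (rep_sum d V R * (rep_sum d V C * rep_sum d V R)) * ?fp"
    unfolding zero by (rule eq_matI) (simp_all add: dims D(6-))
  also have "\<dots> = ?ig * rep_sum d V R * rep_sum d V C * rep_sum d V R * ?fp"
    by (simp add: mat_assoc dims D(6-))
  also have "\<dots> = \<rho>\<rho> * ?ig * rep_sum d V C * rep_sum d V R * ?fp" by (simp only: sw[OF R_Sym])
  also have "\<dots> = \<rho>\<rho> * (?ig * rep_sum d V C) * rep_sum d V R * ?fp" by (simp add: mat_assoc dims D(6-))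
  also have "\<dots> = \<rho>\<rho> * (\<kappa> * ?ig) * rep_sum d V R * ?fp" by (simp only: sw[OF C_Sym])
  also have "\<dots> = \<rho>\<rho> * (\<kappa> * (?ig * rep_sum d V R * ?fp))" by (simp add: mat_assoc dims D(6-))
  also have "\<dots> = \<rho>\<rho> * (\<kappa> * (\<rho>\<rho> * ?ig * ?fp))" by (simp only: sw[OF R_Sym])
  also have "\<dots> = \<rho>\<rho> * (\<kappa> * (\<rho>\<rho> * (?ig * ?fp)))" by (simp add: mat_assoc dims D(6-))
  also have "\<dots> = \<rho>\<rho> * (\<kappa> * (\<rho>\<rho> * (i * p)))" by (simp only: igfp)
  finally have z: "0\<^sub>m nT nT = \<rho>\<rho> * (\<kappa> * (\<rho>\<rho> * (i * p)))" .
  have ip: "i * p \<in> Homs d M M" by (rule Homs_comp[OF MR D(1) MR D(3) D(2)])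
  have com: "mat_sum nT S M * (i * p) = (i * p) * mat_sum nT S M" if "S \<subseteq> Sym d" for S
    using Homs_rep_sum[OF MR MR ip that] by (simp only: rdim_perm_module)
  have "\<rho>\<rho> * (\<kappa> * (\<rho>\<rho> * (i * p))) = \<rho>\<rho> * ((\<kappa> * (i * p)) * \<rho>\<rho>)"
    unfolding com[OF R_Sym] by (simp add: mat_assoc D(6-))
  also have "\<dots> = \<rho>\<rho> * ((i * p) * (\<kappa> * \<rho>\<rho>))"
    unfolding com[OF C_Sym] by (simp add: mat_assoc D(6-))
  finally have "0\<^sub>m nT nT *\<^sub>v tv m = (\<rho>\<rho> * ((i * p) * (\<kappa> * \<rho>\<rho>))) *\<^sub>v tv m" unfolding z by simp
  also have "\<dots> = \<rho>\<rho> *\<^sub>v ((i * p) *\<^sub>v (\<kappa> *\<^sub>v (\<rho>\<rho> *\<^sub>v tv m)))"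
  proof -
    have dt: "dim_vec (tv m) = nT" by (simp add: tvec_def)
    show ?thesis by (simp add: mat_vec_assoc D(6-) dt)
  qed
  also have "\<dots> = \<rho>\<rho> *\<^sub>v e" unfolding kappa_rho_m D(5) ..
  finally have "\<rho>\<rho> *\<^sub>v e = 0\<^sub>v nT" by (simp add: zero_mat_vec tvec_def)
  then show False using rho_e_ne by blast
qed

end

end

lemma tableau_exists:
  assumes "is_partition d l" obtains t where "is_tableau d l t"
proof -
  let ?cells = "{(i, j). i < length l \<and> j < l ! i}"
  have eq: "?cells = (SIGMA i:{..<length l}. {..<l ! i})" by auto
  have "card ?cells = (\<Sum>i<length l. l ! i)" unfolding eq by (subst card_SigmaI) auto
  also have "\<dots> = d" using assms by (simp add: is_partition_def sum_list_sum_nth lessThan_atLeast0)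
  finally have c: "card ?cells = d" .
  have "finite ?cells" unfolding eq by auto
  then obtain h where "bij_betw h {0..<card ?cells} ?cells" using ex_bij_betw_nat_finite by blast
  then have "is_tableau d l h" unfolding c is_tableau_def lessThan_atLeast0 .
  then show ?thesis by (rule that)
qed

section \<open>The shape \<open>(2\<^bsup>2n-1\<^esup>, 1, 1)\<close>\<close>

lemma odd_card_sym_diff:
  assumes "finite A" "finite B"
  shows "odd (card ((A - B) \<union> (B - A))) \<longleftrightarrow> odd (card A) \<noteq> odd (card B)"
proof -
  have "card ((A - B) \<union> (B - A)) = card (A - B) + card (B - A)"
    by (rule card_Un_disjoint) (use assms in auto)
  moreover have "card A = card (A - B) + card (A \<inter> B)"
    using card_Int_Diff[OF assms(1), of B] by simp
  moreover have "card B = card (B - A) + card (A \<inter> B)"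
    using card_Int_Diff[OF assms(2), of A] by (simp add: Int_commute)
  ultimately show ?thesis by auto
qed

lemma card_Int_insert:
  "p \<notin> Q \<Longrightarrow> finite Q \<Longrightarrow> card (V \<inter> insert p Q) = of_bool (p \<in> V) + card (V \<inter> Q)"
  by (simp add: Int_insert_right)

lemma ball_Plus: "(\<forall>x\<in>A <+> B. P x) \<longleftrightarrow> (\<forall>a\<in>A. P (Inl a)) \<and> (\<forall>b\<in>B. P (Inr b))"
  unfolding Plus_def by blast

lemma odd_card_insert:
  assumes "p \<notin> Q" "finite Q"
  shows "odd (card (V \<inter> insert p Q)) \<longleftrightarrow> (p \<in> V) \<noteq> odd (card (V \<inter> Q))"
  using assms by (simp add: Int_insert_right)

text \<open>Fewer affine parity conditions than elements: by pigeonhole a nonempty set can be added to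
  every solution.\<close>

lemma (in char_two) even_solutions:
  assumes S: "finite S" and J: "finite J" "card J < card S"
  shows "(\<Sum>T | T \<subseteq> S \<and> (\<forall>k\<in>J. odd (card (T \<inter> Z k)) \<longleftrightarrow> \<epsilon> k). 1 :: 'k) = 0"
proof -
  let ?par = "\<lambda>T. {k \<in> J. odd (card (T \<inter> Z k))}"
  have "\<not> inj_on ?par (Pow S)"
  proof
    assume "inj_on ?par (Pow S)"
    then have "card (Pow S) \<le> card (Pow J)" by (rule card_inj_on_le) (use J in auto)
    then show False using S J by (simp add: card_Pow)
  qed
  then obtain A B where AB: "A \<subseteq> S" "B \<subseteq> S" "A \<noteq> B" "?par A = ?par B" by (auto simp: inj_on_def)
  define D where "D = (A - B) \<union> (B - A)"
  have D: "D \<subseteq> S" "D \<noteq> {}" using AB(1-3) by (auto simp: D_def)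
  have fin: "finite T" if "T \<subseteq> S" for T using that S by (rule finite_subset)
  have sd: "odd (card (((T - U) \<union> (U - T)) \<inter> Z k)) \<longleftrightarrow> odd (card (T \<inter> Z k)) \<noteq> odd (card (U \<inter> Z k))"
    if "T \<subseteq> S" "U \<subseteq> S" for T U k
  proof -
    have "((T - U) \<union> (U - T)) \<inter> Z k = (T \<inter> Z k - U \<inter> Z k) \<union> (U \<inter> Z k - T \<inter> Z k)" by auto
    then show ?thesis using odd_card_sym_diff[of "T \<inter> Z k" "U \<inter> Z k"] fin that by simp
  qed
  have even: "even (card (D \<inter> Z k))" if "k \<in> J" for k
    unfolding D_def using sd[OF AB(1,2), of k] AB(4) that by blast
  show ?thesis
  proof (rule sum_involution_eq_0[where h="\<lambda>T. (T - D) \<union> (D - T)"])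
    show "finite {T. T \<subseteq> S \<and> (\<forall>k\<in>J. odd (card (T \<inter> Z k)) \<longleftrightarrow> \<epsilon> k)}" using S by simp
    fix T assume "T \<in> {T. T \<subseteq> S \<and> (\<forall>k\<in>J. odd (card (T \<inter> Z k)) \<longleftrightarrow> \<epsilon> k)}"
    then have T: "T \<subseteq> S" "\<And>k. k \<in> J \<Longrightarrow> odd (card (T \<inter> Z k)) \<longleftrightarrow> \<epsilon> k" by auto
    show "(T - D) \<union> (D - T) \<in> {T. T \<subseteq> S \<and> (\<forall>k\<in>J. odd (card (T \<inter> Z k)) \<longleftrightarrow> \<epsilon> k)}"
      using T D(1) sd[OF T(1) D(1)] even by auto
    show "((T - D) \<union> (D - T) - D) \<union> (D - ((T - D) \<union> (D - T))) = T" by auto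
    show "(T - D) \<union> (D - T) \<noteq> T" using D(2) by auto
  qed simp
qed

lemma Sym_inj: "\<sigma> \<in> Sym d \<Longrightarrow> inj \<sigma>"
  by (simp add: Sym_def permutes_inj)

lemma Sym_image: "\<sigma> \<in> Sym d \<Longrightarrow> T \<subseteq> {..<d} \<Longrightarrow> \<sigma> ` T \<subseteq> {..<d}"
  using Sym_lt by blast

locale double_tableau = young_tableau d l t K for d l t and K :: "'k::field itself" +
  fixes n :: nat
  assumes n: "0 < n" and l_eq: "l = replicate (2 * n - 1) 2 @ [1, 1]"
begin

abbreviation "N \<equiv> 2 * n + 1"

lemma length_l: "length l = N"
  using n by (simp add: l_eq)

lemma l_nth: "i < N \<Longrightarrow> l ! i = (if i < 2 * n - 1 then 2 else 1)"
  using n by (auto simp: l_eq nth_append nth_Cons split: nat.split)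

lemma d_eq: "d = 4 * n"
proof -
  have "sum_list l = d" using part by (simp add: is_partition_def)
  then show ?thesis using n by (simp add: l_eq sum_list_replicate)
qed

lemma cell: "x < d \<Longrightarrow> fst (t x) < N" "x < d \<Longrightarrow> snd (t x) < l ! fst (t x)"
  using t_cell[of x] cell_iff[OF part, of "fst (t x)" "snd (t x)"] by (auto simp: length_l)

lemma snd_01: "x < d \<Longrightarrow> snd (t x) = 0 \<or> snd (t x) = 1"
  using cell(2)[of x] l_nth[OF cell(1), of x] by (auto split: if_splits)

definition trow :: "nat \<Rightarrow> nat set" where
  "trow i = {x \<in> {..<d}. fst (t x) = i}"

definition "B = {x \<in> {..<d}. snd (t x) = 1}"

text \<open>Transversals of the two-element rows that avoid the one-element rows. Phrased by one
  parity per row they form an affine system over the field with two elements, as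
  \<open>even_solutions\<close> requires.\<close>

definition "Tr = {T. T \<subseteq> {..<d} \<and> (\<forall>i<N. odd (card (T \<inter> trow i)) \<longleftrightarrow> l ! i = 2)}"

lemma finite_trow: "finite (trow i)"
  by (simp add: trow_def)

lemma card_trow: "i < N \<Longrightarrow> card (trow i) = l ! i"
proof -
  assume "i < N"
  moreover have "trow i = {x. x < d \<and> r ! x = i}" by (auto simp: trow_def row_word_nth)
  ultimately show ?thesis using row_word_tabloid by (simp add: set_tabloids length_l)
qed

lemma finite_Tr: "finite Tr"
  by (rule finite_subset[of _ "Pow {..<d}"]) (auto simp: Tr_def)

lemma card_Int_row:
  assumes "i < N" "odd (card (T \<inter> trow i)) \<longleftrightarrow> l ! i = 2"
  shows "card (T \<inter> trow i) = l ! i - 1"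
proof -
  have "card (T \<inter> trow i) \<le> l ! i" using card_mono[OF finite_trow, of "T \<inter> trow i" i] card_trow[OF assms(1)] by simp
  moreover have "l ! i = 1 \<or> l ! i = 2" using l_nth[OF assms(1)] by (simp split: if_splits)
  ultimately show ?thesis using assms(2) by (elim disjE) (auto simp: le_Suc_eq numeral_2_eq_2)
qed

lemma TrD: "T \<in> Tr \<Longrightarrow> T \<subseteq> {..<d}" "T \<in> Tr \<Longrightarrow> i < N \<Longrightarrow> card (T \<inter> trow i) = l ! i - 1"
  using card_Int_row by (auto simp: Tr_def)

lemma card_by_rows:
  assumes "U \<subseteq> {..<d}" shows "card U = (\<Sum>i<N. card (U \<inter> trow i))"
proof -
  have fin: "finite U" using assms by (rule finite_subset) simp
  have "card U = (\<Sum>i\<in>{..<N}. \<Sum>x\<in>{x \<in> U. fst (t x) = i}. 1)"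
    by (subst sum.group) (use fin assms cell(1) in auto)
  also have "\<dots> = (\<Sum>i<N. card (U \<inter> trow i))"
  proof (intro sum.cong refl)
    fix i
    have "{x \<in> U. fst (t x) = i} = U \<inter> trow i" using assms by (auto simp: trow_def)
    then show "(\<Sum>x\<in>{x \<in> U. fst (t x) = i}. 1) = card (U \<inter> trow i)" by simp
  qed
  finally show ?thesis .
qed

lemma card_Tr: "T \<in> Tr \<Longrightarrow> card T = (\<Sum>i<N. l ! i - 1)"
  using card_by_rows[OF TrD(1)] TrD(2) by simp

lemma row_perm_Int: "\<rho> \<in> R \<Longrightarrow> T \<subseteq> {..<d} \<Longrightarrow> \<rho> ` T \<inter> trow i = \<rho> ` (T \<inter> trow i)"
  using R_fst Sym_lt[of \<rho> d] R_Sym by (auto simp: trow_def)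

lemma Tr_row_perm:
  assumes h: "\<rho> \<in> R" and T: "T \<in> Tr" shows "\<rho> ` T \<in> Tr"
proof -
  have S: "\<rho> \<in> Sym d" using h R_Sym by blast
  have "card (\<rho> ` T \<inter> trow i) = card (T \<inter> trow i)" for i
    unfolding row_perm_Int[OF h TrD(1)[OF T]] by (rule card_image) (use Sym_inj[OF S] inj_on_subset in blast)
  then show ?thesis using T Sym_image[OF S TrD(1)[OF T]] by (simp add: Tr_def)
qed

lemma B_Tr: "B \<in> Tr"
  unfolding Tr_def
proof (intro CollectI conjI allI impI)
  show "B \<subseteq> {..<d}" by (auto simp: B_def)
  fix i assume i: "i < N"
  show "odd (card (B \<inter> trow i)) \<longleftrightarrow> l ! i = 2"
  proof (cases "l ! i = 2")
    case True
    then have c: "i < col_len l 1" using cell_iff[OF part, of i 1] i by (simp add: length_l)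
    have "B \<inter> trow i = {place i 1}"
    proof (intro equalityI subsetI)
      fix x assume "x \<in> B \<inter> trow i"
      then have "x < d" "t x = (i, 1)" by (auto simp: B_def trow_def prod_eq_iff)
      then have "x = place i 1" using t_inj[OF _ place(1)[OF c]] place(2)[OF c] by simp
      then show "x \<in> {place i 1}" by simp
    qed (use place[OF c] in \<open>simp add: B_def trow_def\<close>)
    then show ?thesis using True by simp
  next
    case False
    then have "l ! i = 1" using l_nth[OF i] by (simp split: if_splits)
    then have "B \<inter> trow i = {}" using cell(2) by (fastforce simp: B_def trow_def)
    then show ?thesis using False by simp
  qed
qed

text \<open>The tableau has two columns, \<open>B\<close> and its complement.\<close>

lemma C_iff: "\<gamma> \<in> C \<longleftrightarrow> \<gamma> \<in> Sym d \<and> \<gamma> ` B = B"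
proof
  assume g: "\<gamma> \<in> C"
  then have S: "\<gamma> \<in> Sym d" using C_Sym by blast
  have sub: "\<gamma>' ` B \<subseteq> B" if "\<gamma>' \<in> C" for \<gamma>'
    using C_snd[OF that] Sym_lt[of \<gamma>' d] that C_Sym by (auto simp: B_def)
  have "B \<subseteq> \<gamma> ` B"
  proof
    fix x assume "x \<in> B"
    then have "inv_into UNIV \<gamma> x \<in> B" using sub[OF C_inv[OF g]] by blast
    then show "x \<in> \<gamma> ` B" using Sym_inverses(1)[OF S, of x] by (metis image_eqI)
  qed
  then show "\<gamma> \<in> Sym d \<and> \<gamma> ` B = B" using S sub[OF g] by blast
next
  assume g: "\<gamma> \<in> Sym d \<and> \<gamma> ` B = B"
  then have inj: "inj \<gamma>" using Sym_inj by blast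
  have "snd (t (\<gamma> x)) = snd (t x)" if x: "x < d" for x
  proof -
    have "\<gamma> x \<in> B \<longleftrightarrow> x \<in> B" using g inj by (metis inj_image_mem_iff)
    then show ?thesis using snd_01[OF x] snd_01[OF Sym_lt[OF conjunct1[OF g] x]] x Sym_lt[OF conjunct1[OF g] x] by (auto simp: B_def)
  qed
  then show "\<gamma> \<in> C" using g by (simp add: column_stabilizer_def)
qed

text \<open>The unique row permutation that carries the transversal \<open>T\<close> to the second
  column \<open>B\<close>.\<close>

definition straighten :: "nat set \<Rightarrow> nat \<Rightarrow> nat" where
  "straighten T x = (if x < d then place (fst (t x)) (if x \<in> T then 1 else 0) else x)"

lemma straighten:
  assumes T: "T \<in> Tr" and x: "x < d"
  shows "straighten T x < d" "t (straighten T x) = (fst (t x), if x \<in> T then 1 else 0)"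
proof -
  have i: "fst (t x) < N" by (rule cell(1)[OF x])
  have "(if x \<in> T then 1 else 0) < l ! fst (t x)"
  proof (cases "x \<in> T")
    case True
    then have "T \<inter> trow (fst (t x)) \<noteq> {}" using x by (auto simp: trow_def)
    then have "0 < card (T \<inter> trow (fst (t x)))" using finite_trow by (simp add: card_gt_0_iff)
    then show ?thesis using TrD(2)[OF T i] True by simp
  qed (use cell(2)[OF x] in simp)
  then have "fst (t x) < col_len l (if x \<in> T then 1 else 0)"
    using cell_iff[OF part, of "fst (t x)" "if x \<in> T then 1 else 0"] i by (simp add: length_l)
  from place[OF this] show "straighten T x < d" "t (straighten T x) = (fst (t x), if x \<in> T then 1 else 0)"
    using x by (simp_all add: straighten_def)
qed

lemma straighten_R:
  assumes T: "T \<in> Tr" shows "straighten T \<in> R"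
proof -
  have "inj_on (straighten T) {..<d}"
  proof (rule inj_onI)
    fix x y assume "x \<in> {..<d}" "y \<in> {..<d}" and eq: "straighten T x = straighten T y"
    then have xy: "x < d" "y < d" by auto
    have "(fst (t x), if x \<in> T then 1 else 0 :: nat) = (fst (t y), if y \<in> T then 1 else 0)"
      using straighten(2)[OF T xy(1)] straighten(2)[OF T xy(2)] eq by simp
    then have row: "fst (t x) = fst (t y)" and mem: "x \<in> T \<longleftrightarrow> y \<in> T" by (auto split: if_splits)
    let ?i = "fst (t x)"
    have i: "?i < N" by (rule cell(1)[OF xy(1)])
    have sub: "{x, y} \<subseteq> trow ?i" using xy row by (auto simp: trow_def)
    show "x = y"
    proof (rule ccontr)
      assume ne: "x \<noteq> y"
      then have "2 \<le> card (trow ?i)" using card_mono[OF finite_trow sub] by simp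
      then have l2: "l ! ?i = 2" using card_trow[OF i] l_nth[OF i] by (simp split: if_splits)
      then have "trow ?i = {x, y}" using card_subset_eq[OF finite_trow sub] card_trow[OF i] ne by simp
      then have "card (T \<inter> {x, y}) = 1" using TrD(2)[OF T i] l2 by simp
      then show False using mem ne by (cases "x \<in> T") (simp_all add: Int_insert_right)
    qed
  qed
  moreover from this have "straighten T ` {..<d} = {..<d}" by (intro endo_inj_surj) (use straighten(1)[OF T] in auto)
  ultimately have "bij_betw (straighten T) {..<d} {..<d}" by (simp add: bij_betw_def)
  then have "straighten T permutes {..<d}" by (rule bij_imp_permutes) (simp add: straighten_def)
  then show ?thesis using straighten(2)[OF T] by (simp add: row_stabilizer_def Sym_def)
qed

lemma straighten_image:
  assumes T: "T \<in> Tr" shows "straighten T ` T = B"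
proof -
  have S: "straighten T \<in> Sym d" using straighten_R[OF T] R_Sym by blast
  have "straighten T x \<in> B \<longleftrightarrow> x \<in> T" if "x < d" for x
    using straighten[OF T that] by (simp add: B_def)
  moreover have "\<exists>x<d. y = straighten T x" if "y \<in> B" for y
    using that Sym_lt[OF Sym_inv[OF S], of y] Sym_inverses(1)[OF S, of y] by (auto simp: B_def intro!: exI[of _ "inv_into UNIV (straighten T) y"])
  ultimately show ?thesis using TrD(1)[OF T] by blast
qed

lemma straighten_unique:
  assumes T: "T \<in> Tr" and h: "\<rho> \<in> R" and im: "\<rho> ` T = B"
  shows "straighten T = \<rho>"
proof
  fix x
  have S: "\<rho> \<in> Sym d" using h R_Sym by blast
  show "straighten T x = \<rho> x"
  proof (cases "x < d")
    case True
    have "\<rho> x \<in> B \<longleftrightarrow> x \<in> T" unfolding im[symmetric] using Sym_inj[OF S] by (rule inj_image_mem_iff)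
    then have "snd (t (\<rho> x)) = (if x \<in> T then 1 else 0)"
      using snd_01[OF Sym_lt[OF S True]] Sym_lt[OF S True] by (auto simp: B_def)
    then show ?thesis
      using straighten[OF T True] R_fst[OF h True] by (intro t_inj[OF straighten(1)[OF T True] Sym_lt[OF S True]]) simp_all
  next
    case False
    then show ?thesis using S permutes_not_in[of \<rho> "{..<d}" x] by (simp add: straighten_def Sym_def)
  qed
qed

text \<open>The coefficient of \<open>g\<close> in the product of row, column and row sums, by
  \<open>sum_RCR\<close>.\<close>

definition tcount :: "(nat \<Rightarrow> nat) \<Rightarrow> 'k" where
  "tcount g = (\<Sum>T\<in>Tr. if g ` T \<in> Tr then 1 else 0)"

text \<open>The row group permutes the transversals simply transitively and \<open>C\<close> is the stabilizer of
  the transversal \<open>B\<close>.\<close>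

lemma sum_RCR:
  "(\<Sum>(\<rho>, \<gamma>, \<rho>')\<in>R \<times> C \<times> R. F (\<rho> \<circ> (\<gamma> \<circ> \<rho>')) :: 'k) = (\<Sum>g\<in>Sym d. tcount g * F g)"
proof -
  let ?P = "SIGMA g:Sym d. {T \<in> Tr. g ` T \<in> Tr}" and ?i = "\<lambda>g. inv_into UNIV g"
  have cancel: "\<sigma> \<circ> (?i \<sigma> \<circ> h) = h" "?i \<sigma> \<circ> (\<sigma> \<circ> h) = h" if "\<sigma> \<in> Sym d" for \<sigma> h
    unfolding comp_assoc[symmetric] inv_o_Sym[OF that] by simp_all
  \<comment> \<open>A product is recorded together with the transversal that \<open>\<rho>'\<close>
    carries to \<open>B\<close>; \<open>straighten\<close> recovers both row factors from this
    pair.\<close>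
  have "(\<Sum>(\<rho>, \<gamma>, \<rho>')\<in>R \<times> C \<times> R. F (\<rho> \<circ> (\<gamma> \<circ> \<rho>'))) = (\<Sum>(g, T)\<in>?P. F g)"
  proof (rule sum.reindex_bij_witness[where
        j="\<lambda>(\<rho>, \<gamma>, \<rho>'). (\<rho> \<circ> (\<gamma> \<circ> \<rho>'), ?i \<rho>' ` B)" and
        i="\<lambda>(g, T). (?i (straighten (g ` T)), straighten (g ` T) \<circ> (g \<circ> ?i (straighten T)), straighten T)"])
    fix a assume "a \<in> R \<times> C \<times> R"
    then obtain \<rho> \<gamma> \<rho>' where a: "a = (\<rho>, \<gamma>, \<rho>')" and h: "\<rho> \<in> R" "\<gamma> \<in> C" "\<rho>' \<in> R" by auto
    have S: "\<rho> \<in> Sym d" "\<gamma> \<in> Sym d" "\<rho>' \<in> Sym d" using h R_Sym C_Sym by blast+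
    let ?g = "\<rho> \<circ> (\<gamma> \<circ> \<rho>')" and ?T = "?i \<rho>' ` B"
    have T: "?T \<in> Tr" by (rule Tr_row_perm[OF R_inv[OF h(3)] B_Tr])
    have T_B: "\<rho>' ` ?T = B" unfolding image_comp inv_o_Sym(2)[OF S(3)] by simp
    have gT: "?g ` ?T = \<rho> ` B"
      using T_B h(2) by (simp only: image_comp[symmetric] C_iff)
    have gTr: "?g ` ?T \<in> Tr" unfolding gT by (rule Tr_row_perm[OF h(1) B_Tr])
    have s1: "straighten ?T = \<rho>'" by (rule straighten_unique[OF T h(3) T_B])
    have iB: "?i \<rho> ` (\<rho> ` B) = B" unfolding image_comp inv_o_Sym(1)[OF S(1)] by simp
    have "?i \<rho> ` (?g ` ?T) = B" unfolding gT by (rule iB)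
    then have s2: "straighten (?g ` ?T) = ?i \<rho>" by (rule straighten_unique[OF gTr R_inv[OF h(1)]])
    have ii: "?i (?i \<rho>) = \<rho>" using S(1) by (simp add: Sym_def permutes_inv_inv)
    have "?i \<rho> \<circ> (?g \<circ> ?i \<rho>') = \<gamma>"
      unfolding comp_assoc inv_o_Sym(2)[OF S(3)] comp_id cancel(2)[OF S(1)] ..
    then show "(case case a of (\<rho>, \<gamma>, \<rho>') \<Rightarrow> (\<rho> \<circ> (\<gamma> \<circ> \<rho>'), ?i \<rho>' ` B) of
        (g, T) \<Rightarrow> (?i (straighten (g ` T)), straighten (g ` T) \<circ> (g \<circ> ?i (straighten T)), straighten T)) = a"
      unfolding a by (simp only: prod.case s1 s2 ii)
    show "(case a of (\<rho>, \<gamma>, \<rho>') \<Rightarrow> (\<rho> \<circ> (\<gamma> \<circ> \<rho>'), ?i \<rho>' ` B)) \<in> ?P"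
      unfolding a using Sym_comp[OF S(1) Sym_comp[OF S(2,3)]] T gTr by (simp only: prod.case mem_Sigma_iff mem_Collect_eq)
    show "(case case a of (\<rho>, \<gamma>, \<rho>') \<Rightarrow> (\<rho> \<circ> (\<gamma> \<circ> \<rho>'), ?i \<rho>' ` B) of (g, T) \<Rightarrow> F g) =
        (case a of (\<rho>, \<gamma>, \<rho>') \<Rightarrow> F (\<rho> \<circ> (\<gamma> \<circ> \<rho>')))"
      unfolding a by (simp only: prod.case)
  next
    fix b assume "b \<in> ?P"
    then obtain g T where b: "b = (g, T)" and g: "g \<in> Sym d" and T: "T \<in> Tr" "g ` T \<in> Tr" by blast
    let ?s = "straighten T" and ?s' = "straighten (g ` T)"
    note R2 = straighten_R[OF T(1)] straighten_R[OF T(2)]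
    have S: "?s \<in> Sym d" "?s' \<in> Sym d" using R2 R_Sym by blast+
    have isB: "?i ?s ` B = T"
      unfolding straighten_image[OF T(1), symmetric] image_comp inv_o_Sym(1)[OF S(1)] by simp
    have "?s' \<circ> (g \<circ> ?i ?s) \<in> C"
      unfolding C_iff using Sym_comp[OF S(2) Sym_comp[OF g Sym_inv[OF S(1)]]] isB straighten_image[OF T(2)]
      by (simp only: image_comp[symmetric])
    then show "(case b of (g, T) \<Rightarrow> (?i (straighten (g ` T)), straighten (g ` T) \<circ> (g \<circ> ?i (straighten T)), straighten T)) \<in> R \<times> C \<times> R"
      unfolding b using R_inv[OF R2(2)] R2(1) by (simp only: prod.case mem_Sigma_iff)
    have "?i ?s' \<circ> (?s' \<circ> (g \<circ> ?i ?s) \<circ> ?s) = g"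
      unfolding comp_assoc inv_o_Sym(1)[OF S(1)] comp_id cancel(2)[OF S(2)] ..
    then show "(case case b of (g, T) \<Rightarrow> (?i (straighten (g ` T)), straighten (g ` T) \<circ> (g \<circ> ?i (straighten T)), straighten T) of
        (\<rho>, \<gamma>, \<rho>') \<Rightarrow> (\<rho> \<circ> (\<gamma> \<circ> \<rho>'), ?i \<rho>' ` B)) = b"
      unfolding b by (simp only: prod.case isB)
  qed
  also have "\<dots> = (\<Sum>g\<in>Sym d. \<Sum>T\<in>{T \<in> Tr. g ` T \<in> Tr}. F g)"
    by (rule sum.Sigma[symmetric]) (use finite_Tr in auto)
  also have "\<dots> = (\<Sum>g\<in>Sym d. tcount g * F g)"
    unfolding tcount_def sum_distrib_right
  proof (rule sum.cong[OF refl])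
    fix g
    show "(\<Sum>T\<in>{T \<in> Tr. g ` T \<in> Tr}. F g) = (\<Sum>T\<in>Tr. (if g ` T \<in> Tr then 1 else 0) * F g)"
      unfolding sum.inter_filter[OF finite_Tr] by (intro sum.cong refl) simp
  qed
  finally show ?thesis .
qed

text \<open>Taking images under \<open>g\<close> matches the transversals counted on both
  sides.\<close>

lemma tcount_inv:
  assumes g: "g \<in> Sym d" shows "tcount (inv_into UNIV g) = tcount g"
proof -
  let ?i = "inv_into UNIV g"
  have io: "?i ` (g ` T) = T" "g ` (?i ` T) = T" for T
    unfolding image_comp inv_o_Sym[OF g] by simp_all
  have "(\<Sum>T\<in>{T \<in> Tr. ?i ` T \<in> Tr}. 1 :: 'k) = (\<Sum>T\<in>{T \<in> Tr. g ` T \<in> Tr}. 1)"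
    by (rule sum.reindex_bij_witness[where j="\<lambda>T. ?i ` T" and i="\<lambda>T. g ` T"]) (simp_all only: io mem_Collect_eq simp_thms)
  then show ?thesis unfolding tcount_def by (simp add: sum.inter_filter[OF finite_Tr, symmetric])
qed

section \<open>Transversals under a 3-cycle\<close>

context
  fixes c :: "nat \<Rightarrow> nat" and p q r' :: nat
  assumes cS: "c \<in> Sym d" and cp: "c p = q" and cq: "c q = r'" and cr: "c r' = p"
    and cx: "\<And>x. x \<noteq> p \<Longrightarrow> x \<noteq> q \<Longrightarrow> x \<noteq> r' \<Longrightarrow> c x = x"
    and lt: "p < d" "q < d" "r' < d" and ne: "p \<noteq> q" "q \<noteq> r'" "p \<noteq> r'"
begin

lemma cycle_mem: "p \<in> c ` U \<longleftrightarrow> r' \<in> U" "q \<in> c ` U \<longleftrightarrow> p \<in> U" "r' \<in> c ` U \<longleftrightarrow> q \<in> U"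
  using inj_image_mem_iff[OF Sym_inj[OF cS]] cp cq cr by metis+

lemma cycle_Int:
  assumes "p \<notin> Q" "q \<notin> Q" "r' \<notin> Q" shows "c ` U \<inter> Q = U \<inter> Q"
proof -
  have "x \<in> c ` U \<longleftrightarrow> x \<in> U" if "x \<in> Q" for x
  proof -
    have "c x = x" using that assms by (intro cx) auto
    then show ?thesis using inj_image_mem_iff[OF Sym_inj[OF cS], of x U] by simp
  qed
  then show ?thesis by blast
qed

definition hits :: "nat set \<Rightarrow> 'k" where
  "hits U = (if U \<in> Tr then 1 else 0) + (if c ` U \<in> Tr then 1 else 0) + (if c ` (c ` U) \<in> Tr then 1 else 0)"

lemma tcount_cycle:
  "tcount \<sigma> + tcount (c \<circ> \<sigma>) + tcount (c \<circ> c \<circ> \<sigma>) = (\<Sum>T\<in>Tr. hits (\<sigma> ` T))"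
  unfolding tcount_def hits_def image_comp[symmetric] sum.distrib ..

abbreviation "rest x \<equiv> trow (fst (t x)) - {x}"

lemma odd_row:
  "x < d \<Longrightarrow> odd (card (V \<inter> trow (fst (t x)))) \<longleftrightarrow> (x \<in> V) \<noteq> odd (card (V \<inter> rest x))"
proof -
  assume "x < d"
  then have "trow (fst (t x)) = insert x (rest x)" by (auto simp: trow_def)
  then show ?thesis using odd_card_insert[of x "rest x" V] finite_trow by (metis Diff_iff finite_Diff insertI1)
qed

text \<open>The points \<open>p\<close>, \<open>q\<close> fill a row and exactly one must lie in the
  set, while membership of \<open>r'\<close> is prescribed by the rest of its row. An even number of
  the three rotations of the membership pattern meets both conditions.\<close>

lemma hits_same_row:
  assumes row: "fst (t p) = fst (t q)" and U: "U \<subseteq> {..<d}"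
  shows "hits U = 0"
proof -
  let ?i = "fst (t p)" and ?j = "fst (t r')"
  have i: "?i < N" and j: "?j < N" by (rule cell(1)[OF lt(1)], rule cell(1)[OF lt(3)])
  have sub: "{p, q} \<subseteq> trow ?i" using lt row by (auto simp: trow_def)
  have "2 \<le> card (trow ?i)" using card_mono[OF finite_trow sub] ne by simp
  then have l2: "l ! ?i = 2" using card_trow[OF i] l_nth[OF i] by (simp split: if_splits)
  then have pq: "trow ?i = {p, q}" using card_subset_eq[OF finite_trow sub] card_trow[OF i] ne by simp
  have ij: "?i \<noteq> ?j"
  proof
    assume "?i = ?j"
    then have "r' \<in> trow ?i" using lt by (simp add: trow_def)
    then show False using pq ne by simp
  qed
  define W where "W V \<longleftrightarrow> (\<forall>k<N. k \<noteq> ?i \<longrightarrow> k \<noteq> ?j \<longrightarrow> (odd (card (V \<inter> trow k)) \<longleftrightarrow> l ! k = 2))" for V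
  define y where "y V \<longleftrightarrow> (l ! ?j = 2) \<noteq> odd (card (V \<inter> rest r'))" for V
  have char: "V \<in> Tr \<longleftrightarrow> W V \<and> (p \<in> V) \<noteq> (q \<in> V) \<and> (r' \<in> V) = y V" if "V \<subseteq> {..<d}" for V
  proof -
    have "V \<in> Tr \<longleftrightarrow> W V \<and> (odd (card (V \<inter> trow ?i)) \<longleftrightarrow> l ! ?i = 2) \<and> (odd (card (V \<inter> trow ?j)) \<longleftrightarrow> l ! ?j = 2)"
      using that i j unfolding Tr_def W_def by blast
    moreover have "odd (card (V \<inter> trow ?i)) \<longleftrightarrow> (p \<in> V) \<noteq> (q \<in> V)"
      unfolding pq using ne by (auto simp: Int_insert_right)
    ultimately show ?thesis unfolding odd_row[OF lt(3)] y_def using l2 by blast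
  qed
  have inv: "W (c ` V) = W V" "y (c ` V) = y V" for V
  proof -
    have "c ` V \<inter> trow k = V \<inter> trow k" if "k \<noteq> ?i" "k \<noteq> ?j" for k
      by (rule cycle_Int) (use that row in \<open>auto simp: trow_def\<close>)
    then show "W (c ` V) = W V" unfolding W_def by simp
    have "c ` V \<inter> rest r' = V \<inter> rest r'"
      by (rule cycle_Int) (use ij row in \<open>auto simp: trow_def\<close>)
    then show "y (c ` V) = y V" unfolding y_def by simp
  qed
  have cU: "c ` U \<subseteq> {..<d}" "c ` (c ` U) \<subseteq> {..<d}" using Sym_image[OF cS] U by blast+
  show ?thesis
    unfolding hits_def char[OF U] char[OF cU(1)] char[OF cU(2)] inv cycle_mem
    by (cases "p \<in> U"; cases "q \<in> U"; cases "r' \<in> U"; cases "y U"; cases "W U") (simp_all add: add_self)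
qed

definition other_rows :: "nat set \<Rightarrow> bool" where
  "other_rows V \<longleftrightarrow> (\<forall>k\<in>{..<N} - {fst (t p), fst (t q), fst (t r')}. odd (card (V \<inter> trow k)) \<longleftrightarrow> l ! k = 2)"

text \<open>Each of the three rows prescribes membership of its point. If the other rows are right,
  the size of \<open>U\<close> makes the prescribed pattern as large as the actual one, so one
  rotation matches, or all three if the pattern is constant: an odd number.\<close>

lemma hits_distinct_rows:
  assumes rows: "fst (t p) \<noteq> fst (t q)" "fst (t q) \<noteq> fst (t r')" "fst (t p) \<noteq> fst (t r')"
    and U: "U \<subseteq> {..<d}" and cU: "card U = (\<Sum>i<N. l ! i - 1)"
  shows "hits U = (if other_rows U then 1 else 0)"
proof -
  let ?I = "{fst (t p), fst (t q), fst (t r')}"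
  define y where "y x V \<longleftrightarrow> (l ! fst (t x) = 2) \<noteq> odd (card (V \<inter> rest x))" for x V
  have IN: "fst (t p) < N" "fst (t q) < N" "fst (t r') < N" using lt by (simp_all only: cell(1))
  have char: "V \<in> Tr \<longleftrightarrow> other_rows V \<and> (p \<in> V) = y p V \<and> (q \<in> V) = y q V \<and> (r' \<in> V) = y r' V"
    if "V \<subseteq> {..<d}" for V
  proof -
    have "V \<in> Tr \<longleftrightarrow> other_rows V \<and> (\<forall>x\<in>{p, q, r'}. odd (card (V \<inter> trow (fst (t x)))) \<longleftrightarrow> l ! fst (t x) = 2)"
      using that IN unfolding Tr_def other_rows_def by blast
    then show ?thesis unfolding y_def using odd_row[OF lt(1), of V] odd_row[OF lt(2), of V] odd_row[OF lt(3), of V] by auto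
  qed
  have inv: "other_rows (c ` V) = other_rows V" "y p (c ` V) = y p V" "y q (c ` V) = y q V" "y r' (c ` V) = y r' V" for V
  proof -
    have "c ` V \<inter> trow k = V \<inter> trow k" if "k \<notin> ?I" for k
      by (rule cycle_Int) (use that in \<open>auto simp: trow_def\<close>)
    then show "other_rows (c ` V) = other_rows V" unfolding other_rows_def by simp
    have "c ` V \<inter> rest x = V \<inter> rest x" if "x \<in> {p, q, r'}" for x
      by (rule cycle_Int) (use that rows in \<open>auto simp: trow_def\<close>)
    then show "y p (c ` V) = y p V" "y q (c ` V) = y q V" "y r' (c ` V) = y r' V" unfolding y_def by simp_all
  qed
  have cUd: "c ` U \<subseteq> {..<d}" "c ` (c ` U) \<subseteq> {..<d}" using Sym_image[OF cS] U by blast+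
  \<comment> \<open>The other rows already have their required sizes, so the common total forces the
    same number of members among the three points.\<close>
  have weight: "of_bool (p \<in> U) + of_bool (q \<in> U) + of_bool (r' \<in> U) = (of_bool (y p U) + of_bool (y q U) + of_bool (y r' U) :: nat)"
    if W: "other_rows U"
  proof -
    have split: "(\<Sum>i<N. g i) = (\<Sum>i\<in>{..<N} - ?I. g i) + (g (fst (t p)) + g (fst (t q)) + g (fst (t r')))" for g :: "nat \<Rightarrow> nat"
    proof -
      have "(\<Sum>i<N. g i) = (\<Sum>i\<in>{..<N} - ?I. g i) + (\<Sum>i\<in>?I. g i)"
        by (rule sum.subset_diff) (use IN in auto)
      then show ?thesis using rows by simp
    qed
    have other: "card (U \<inter> trow k) = l ! k - 1" if "k \<in> {..<N} - ?I" for k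
      using W that by (intro card_Int_row) (auto simp: other_rows_def)
    have rest_eq: "(\<Sum>i\<in>{..<N} - ?I. card (U \<inter> trow i)) = (\<Sum>i\<in>{..<N} - ?I. l ! i - 1)"
      by (rule sum.cong[OF refl other])
    have eq: "card (U \<inter> trow (fst (t p))) + card (U \<inter> trow (fst (t q))) + card (U \<inter> trow (fst (t r'))) =
        (l ! fst (t p) - 1) + (l ! fst (t q) - 1) + (l ! fst (t r') - 1)"
      using cU card_by_rows[OF U] split[of "\<lambda>i. card (U \<inter> trow i)"] split[of "\<lambda>i. l ! i - 1"] rest_eq by simp
    have one: "card (U \<inter> trow (fst (t x))) + of_bool (y x U) = of_bool (x \<in> U) + (l ! fst (t x) - 1)"
      if x: "x < d" for x
    proof -
      have i: "fst (t x) < N" by (rule cell(1)[OF x])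
      have ins: "trow (fst (t x)) = insert x (rest x)" using x by (auto simp: trow_def)
      have "card (U \<inter> insert x (rest x)) = of_bool (x \<in> U) + card (U \<inter> rest x)"
        by (rule card_Int_insert) (simp_all add: finite_trow)
      then have "card (U \<inter> trow (fst (t x))) = of_bool (x \<in> U) + card (U \<inter> rest x)"
        by (simp only: ins[symmetric])
      moreover have "card (U \<inter> rest x) \<le> l ! fst (t x) - 1"
      proof -
        have "card (U \<inter> rest x) \<le> card (rest x)" by (rule card_mono) (auto simp: finite_trow)
        also have "\<dots> = card (trow (fst (t x))) - 1" by (rule card_Diff_singleton) (use x in \<open>simp add: trow_def\<close>)
        finally show ?thesis using card_trow[OF i] by simp
      qed
      moreover have "l ! fst (t x) = 1 \<or> l ! fst (t x) = 2" using l_nth[OF i] by (simp split: if_splits)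
      ultimately show ?thesis unfolding y_def by (auto simp: le_Suc_eq)
    qed
    show ?thesis using eq one[OF lt(1)] one[OF lt(2)] one[OF lt(3)] by linarith
  qed
  show ?thesis
  proof (cases "other_rows U")
    case True
    show ?thesis
      unfolding hits_def char[OF U] char[OF cUd(1)] char[OF cUd(2)] inv cycle_mem
      using weight[OF True] True
      by (cases "p \<in> U"; cases "q \<in> U"; cases "r' \<in> U"; cases "y p U"; cases "y q U"; cases "y r' U") (simp_all add: add_self)
  next
    case False
    then show ?thesis unfolding hits_def char[OF U] char[OF cUd(1)] char[OF cUd(2)] inv by simp
  qed
qed

text \<open>\<open>N\<close> conditions on \<open>T\<close> and \<open>N - 3\<close> on its image
  are \<open>2N - 3 = 4n - 1\<close> parity conditions on subsets of \<open>d = 4n\<close> points,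
  one fewer than points. Here the \<open>2n + 1\<close> rows of the shape matter.\<close>

lemma sum_hits_distinct_rows:
  assumes rows: "fst (t p) \<noteq> fst (t q)" "fst (t q) \<noteq> fst (t r')" "fst (t p) \<noteq> fst (t r')" and s: "\<sigma> \<in> Sym d"
  shows "(\<Sum>T\<in>Tr. hits (\<sigma> ` T)) = 0"
proof -
  let ?I = "{fst (t p), fst (t q), fst (t r')}"
  let ?K = "{..<N} <+> ({..<N} - ?I)"
  define Z where "Z k = (case k of Inl i \<Rightarrow> trow i | Inr i \<Rightarrow> {x. \<sigma> x \<in> trow i})" for k
  define \<epsilon> where "\<epsilon> k = (case k of Inl i \<Rightarrow> l ! i = 2 | Inr i \<Rightarrow> l ! i = (2 :: nat))" for k
  have I: "?I \<subseteq> {..<N}" using cell(1)[OF lt(1)] cell(1)[OF lt(2)] cell(1)[OF lt(3)] by simp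
  have "card ?I = 3" using rows by simp
  then have "card ({..<N} - ?I) = N - 3" using card_Diff_subset[OF _ I] by simp
  then have cK: "card ?K = N + (N - 3)" by (simp add: card_Plus)
  have ltK: "card ?K < card {..<d}" unfolding cK using n by (simp add: d_eq)
  have pre: "card (\<sigma> ` T \<inter> trow i) = card (T \<inter> {x. \<sigma> x \<in> trow i})" for T i
  proof -
    have "\<sigma> ` T \<inter> trow i = \<sigma> ` (T \<inter> {x. \<sigma> x \<in> trow i})" by auto
    then show ?thesis using card_image[of \<sigma> "T \<inter> {x. \<sigma> x \<in> trow i}"] Sym_inj[OF s] inj_on_subset by fastforce
  qed
  have "(\<Sum>T\<in>Tr. hits (\<sigma> ` T)) = (\<Sum>T\<in>Tr. if other_rows (\<sigma> ` T) then 1 else 0)"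
  proof (intro sum.cong refl hits_distinct_rows[OF rows])
    fix T assume T: "T \<in> Tr"
    show "\<sigma> ` T \<subseteq> {..<d}" by (rule Sym_image[OF s TrD(1)[OF T]])
    show "card (\<sigma> ` T) = (\<Sum>i<N. l ! i - 1)"
      using card_Tr[OF T] card_image[of \<sigma> T] Sym_inj[OF s] inj_on_subset by fastforce
  qed
  also have "\<dots> = (\<Sum>T | T \<in> Tr \<and> other_rows (\<sigma> ` T). 1)"
    by (simp add: sum.inter_filter[OF finite_Tr, symmetric])
  also have "{T. T \<in> Tr \<and> other_rows (\<sigma> ` T)} =
      {T. T \<subseteq> {..<d} \<and> (\<forall>k\<in>?K. odd (card (T \<inter> Z k)) \<longleftrightarrow> \<epsilon> k)}"
  proof (rule Set.set_eqI)
    fix T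
    have "(\<forall>k\<in>?K. odd (card (T \<inter> Z k)) \<longleftrightarrow> \<epsilon> k) \<longleftrightarrow>
        (\<forall>i<N. odd (card (T \<inter> trow i)) \<longleftrightarrow> l ! i = 2) \<and> other_rows (\<sigma> ` T)"
      unfolding other_rows_def pre ball_Plus by (auto simp: Z_def \<epsilon>_def)
    then show "T \<in> {T. T \<in> Tr \<and> other_rows (\<sigma> ` T)} \<longleftrightarrow>
        T \<in> {T. T \<subseteq> {..<d} \<and> (\<forall>k\<in>?K. odd (card (T \<inter> Z k)) \<longleftrightarrow> \<epsilon> k)}"
      unfolding Tr_def mem_Collect_eq by blast
  qed
  also have "(\<Sum>T | T \<subseteq> {..<d} \<and> (\<forall>k\<in>?K. odd (card (T \<inter> Z k)) \<longleftrightarrow> \<epsilon> k). 1) = (0 :: 'k)"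
    by (rule even_solutions[OF _ _ ltK]) simp_all
  finally show ?thesis .
qed

end

text \<open>If two of the three points share a row, rotating the names makes them \<open>p\<close>
  and \<open>q\<close>.\<close>

lemma tcount_three_cycle:
  assumes s: "\<sigma> \<in> Sym d" and cS: "c \<in> Sym d" and c: "c = transpose p q \<circ> transpose q r'" "p \<noteq> q" "q \<noteq> r'" "p \<noteq> r'"
  shows "tcount \<sigma> + tcount (c \<circ> \<sigma>) + tcount (c \<circ> c \<circ> \<sigma>) = 0"
proof -
  have v: "c p = q" "c q = r'" "c r' = p" "\<And>x. x \<noteq> p \<Longrightarrow> x \<noteq> q \<Longrightarrow> x \<noteq> r' \<Longrightarrow> c x = x"
    using c by (auto simp: transpose_def)
  have "x < d" if "c x \<noteq> x" for x using cS that permutes_not_in[of c "{..<d}" x] by (auto simp: Sym_def)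
  then have lt: "p < d" "q < d" "r' < d" using v c(2-) by metis+
  have ne: "p \<noteq> q" "q \<noteq> r'" "p \<noteq> r'" "q \<noteq> p" "r' \<noteq> q" "r' \<noteq> p" using c(2-) by auto
  have cx2: "\<And>x. x \<noteq> q \<Longrightarrow> x \<noteq> r' \<Longrightarrow> x \<noteq> p \<Longrightarrow> c x = x" "\<And>x. x \<noteq> r' \<Longrightarrow> x \<noteq> p \<Longrightarrow> x \<noteq> q \<Longrightarrow> c x = x"
    using v(4) by blast+
  have im: "\<sigma> ` T \<subseteq> {..<d}" if "T \<in> Tr" for T by (rule Sym_image[OF s TrD(1)[OF that]])
  have "(\<Sum>T\<in>Tr. hits c (\<sigma> ` T)) = 0"
  proof (cases "fst (t p) = fst (t q) \<or> fst (t q) = fst (t r') \<or> fst (t r') = fst (t p)")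
    case True
    then have "hits c U = 0" if "U \<subseteq> {..<d}" for U
      using hits_same_row[OF cS v(1-4) lt ne(1-3) _ that] hits_same_row[OF cS v(2,3,1) cx2(1) lt(2,3,1) ne(2,6,4) _ that]
        hits_same_row[OF cS v(3,1,2) cx2(2) lt(3,1,2) ne(6,1,5) _ that] by blast
    then show ?thesis using im by simp
  next
    case False
    then show ?thesis by (intro sum_hits_distinct_rows[OF cS v(1-4) lt ne(1-3) _ _ _ s]) auto
  qed
  then show ?thesis using tcount_cycle[OF cS v(1-4) lt ne(1-3), of \<sigma>] by simp
qed

text \<open>The first column has \<open>2n + 1\<close> positions but there are only
  \<open>2n\<close> letters, so some column transposition fixes the word and the column sum cancels
  in pairs.\<close>

lemma tcount_plain:
  fixes \<phi> :: "(nat \<Rightarrow> nat) \<Rightarrow> 'k"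
  assumes w: "\<And>i. i < d \<Longrightarrow> w i < 2 * n"
  shows "(\<Sum>g\<in>Sym d. tcount g * \<phi> (w \<circ> g)) = 0"
proof -
  have "(\<Sum>\<gamma>\<in>C. \<phi> (w \<circ> (\<rho> \<circ> (\<gamma> \<circ> \<rho>')))) = 0" if h: "\<rho> \<in> R" for \<rho> \<rho>'
  proof -
    have hS: "\<rho> \<in> Sym d" using h R_Sym by blast
    let ?A = "{x \<in> {..<d}. snd (t x) = 0}"
    have "bij_betw (\<lambda>i. place i 0) {..<N} ?A"
    proof (rule bij_betw_byWitness[where f'="\<lambda>x. fst (t x)"])
      have cl: "i < col_len l 0" if "i < N" for i
      proof -
        have "0 < l ! i" unfolding l_nth[OF that] by simp
        then show ?thesis using that cell_iff[OF part, of i 0] by (simp add: length_l)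
      qed
      show "\<forall>a\<in>{..<N}. fst (t (place a 0)) = a" using place(2)[OF cl] by simp
      show "\<forall>a'\<in>?A. place (fst (t a')) 0 = a'"
      proof
        fix x assume x: "x \<in> ?A"
        then have "fst (t x) < col_len l 0" using t_cell[of x] by simp
        from t_inj[OF place(1)[OF this]] place(2)[OF this] show "place (fst (t x)) 0 = x" using x by simp
      qed
      show "(\<lambda>i. place i 0) ` {..<N} \<subseteq> ?A" using place[OF cl] by auto
      show "(\<lambda>x. fst (t x)) ` ?A \<subseteq> {..<N}" using cell(1) by auto
    qed
    then have cA: "card ?A = N" using bij_betw_same_card by fastforce
    have "\<not> inj_on (w \<circ> \<rho>) ?A"
    proof
      assume "inj_on (w \<circ> \<rho>) ?A"
      then have "card ?A \<le> card {..<2 * n}" by (rule card_inj_on_le) (use w Sym_lt[OF hS] in auto)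
      then show False using cA by simp
    qed
    then obtain x y where xy: "x < d" "y < d" "snd (t x) = snd (t y)" "x \<noteq> y" and eq: "w (\<rho> x) = w (\<rho> y)"
      by (auto simp: inj_on_def)
    define s where "s = transpose x y"
    have sC: "s \<in> C" unfolding s_def by (rule transpose_C[OF xy(1-3)])
    have ss: "s \<circ> (s \<circ> \<gamma>) = \<gamma>" for \<gamma> by (simp add: s_def comp_assoc[symmetric])
    have ws: "w \<circ> (\<rho> \<circ> s) = w \<circ> \<rho>" using eq by (auto simp: s_def transpose_def)
    show ?thesis
    proof (rule sum_involution_eq_0[where h="\<lambda>\<gamma>. s \<circ> \<gamma>"])
      show "finite C" by (rule finite_CR(1))
      fix \<gamma> assume g: "\<gamma> \<in> C"
      show "s \<circ> \<gamma> \<in> C" by (rule C_comp[OF sC g])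
      show "s \<circ> (s \<circ> \<gamma>) = \<gamma>" by (rule ss)
      have "w \<circ> (\<rho> \<circ> (s \<circ> \<gamma> \<circ> \<rho>')) = w \<circ> (\<rho> \<circ> s) \<circ> (\<gamma> \<circ> \<rho>')" by (simp only: comp_assoc)
      also have "\<dots> = w \<circ> (\<rho> \<circ> (\<gamma> \<circ> \<rho>'))" unfolding ws by (simp only: comp_assoc)
      finally show "\<phi> (w \<circ> (\<rho> \<circ> (s \<circ> \<gamma> \<circ> \<rho>'))) = \<phi> (w \<circ> (\<rho> \<circ> (\<gamma> \<circ> \<rho>')))" by (simp only:)
      show "s \<circ> \<gamma> \<noteq> \<gamma>"
      proof
        assume "s \<circ> \<gamma> = \<gamma>"
        then have "s (\<gamma> (inv_into UNIV \<gamma> x)) = \<gamma> (inv_into UNIV \<gamma> x)" by (metis comp_apply)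
        then have "s x = x" using Sym_inverses(1)[of \<gamma> d x] g C_Sym by auto
        then show False using xy(4) by (simp add: s_def)
      qed
    qed
  qed
  then have zero: "(\<Sum>\<rho>\<in>R. \<Sum>\<rho>'\<in>R. \<Sum>\<gamma>\<in>C. \<phi> (w \<circ> (\<rho> \<circ> (\<gamma> \<circ> \<rho>')))) = 0" by simp
  have "(\<Sum>(\<rho>, \<gamma>, \<rho>')\<in>R \<times> C \<times> R. \<phi> (w \<circ> (\<rho> \<circ> (\<gamma> \<circ> \<rho>')))) = (\<Sum>\<rho>\<in>R. \<Sum>\<gamma>\<in>C. \<Sum>\<rho>'\<in>R. \<phi> (w \<circ> (\<rho> \<circ> (\<gamma> \<circ> \<rho>'))))"
    by (simp only: sum.cartesian_product)
  also have "\<dots> = (\<Sum>\<rho>\<in>R. \<Sum>\<rho>'\<in>R. \<Sum>\<gamma>\<in>C. \<phi> (w \<circ> (\<rho> \<circ> (\<gamma> \<circ> \<rho>'))))"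
    by (rule sum.cong[OF refl], rule sum.swap)
  finally show ?thesis using sum_RCR[of "\<lambda>g. \<phi> (w \<circ> g)"] zero by simp
qed

text \<open>The relations on the right are those on the left for the inverses, since
  \<open>tcount\<close> is invariant under inversion.\<close>

theorem tcount_kills: "kills 0 0 d {..<2 * n} tcount"
proof (rule three_cycle_annihilator_kills[OF d_eq])
  have S: "\<sigma> \<in> Sym d \<longleftrightarrow> \<sigma> permutes {0..<d}" for \<sigma> by (simp add: Sym_def lessThan_atLeast0)
  fix \<sigma> c :: "nat \<Rightarrow> nat"
  assume s: "\<sigma> permutes {0..<d}" and c: "c permutes {0..<d}" and c3: "c \<circ> c \<circ> c = id"
    and "\<exists>p q r. p \<noteq> q \<and> q \<noteq> r \<and> p \<noteq> r \<and> c = transpose p q \<circ> transpose q r"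
  then obtain p q r' where pqr: "c = transpose p q \<circ> transpose q r'" "p \<noteq> q" "q \<noteq> r'" "p \<noteq> r'" by blast
  have sS: "\<sigma> \<in> Sym d" and cS: "c \<in> Sym d" using s c S by auto
  show "tcount \<sigma> + tcount (c \<circ> \<sigma>) + tcount (c \<circ> c \<circ> \<sigma>) = 0" by (rule tcount_three_cycle[OF sS cS pqr])
  have ic: "inv_into UNIV c = c \<circ> c" by (rule inv_unique_comp) (use c3 in \<open>simp_all only: comp_assoc\<close>)
  have ccS: "c \<circ> c \<in> Sym d" by (rule Sym_comp[OF cS cS])
  have icc: "inv_into UNIV (c \<circ> c) = c" unfolding ic[symmetric] using c by (simp add: permutes_inv_inv)
  have isS: "inv_into UNIV \<sigma> \<in> Sym d" by (rule Sym_inv[OF sS])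
  have 1: "tcount (\<sigma> \<circ> c) = tcount (c \<circ> c \<circ> inv_into UNIV \<sigma>)"
    using tcount_inv[OF Sym_comp[OF sS cS]] by (simp only: inv_comp_Sym[OF sS cS] ic)
  have 2: "tcount (\<sigma> \<circ> (c \<circ> c)) = tcount (c \<circ> inv_into UNIV \<sigma>)"
    using tcount_inv[OF Sym_comp[OF sS ccS]] by (simp only: inv_comp_Sym[OF sS ccS] icc)
  show "tcount \<sigma> + tcount (\<sigma> \<circ> c) + tcount (\<sigma> \<circ> (c \<circ> c)) = 0"
    unfolding 1 2 using tcount_three_cycle[OF isS cS pqr] by (simp only: tcount_inv[OF sS] add_ac)
next
  have S: "{\<sigma>. \<sigma> permutes {0..<d}} = Sym d" by (simp add: Sym_def lessThan_atLeast0)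
  fix \<phi> :: "(nat \<Rightarrow> nat) \<Rightarrow> 'k" and w assume "\<forall>i\<in>{0..<d}. w i < 2 * n"
  then show "(\<Sum>\<sigma> | \<sigma> permutes {0..<d}. tcount \<sigma> * \<phi> (w \<circ> \<sigma>)) = 0"
    unfolding S by (intro tcount_plain) simp
qed

end

section \<open>Vanishing of the simple functors\<close>

context young_tableau
begin

definition splits :: "nat \<Rightarrow> nat \<Rightarrow> bool" where
  "splits a b \<longleftrightarrow> (\<exists>f \<in> Homs d (young_module d l) (tensor_rep d (mnP a b :: 'k mat)).
     \<exists>g \<in> Homs d (tensor_rep d (mnP a b)) (young_module d l). g * f = 1\<^sub>m (rdim (young_module d l :: 'k srep)))"

lemma splits_of_faithful:
  assumes "faithful_obj d (mnP a b :: 'k mat)" shows "splits a b"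
proof -
  obtain i p where c: "carries (young_module d l) i p" by (rule young_module_carries[OF young_module_exists])
  have "rdim (tensor_rep d (mnP a b :: 'k mat)) = dim_row (mnP a b :: 'k mat) ^ d"
    by (simp add: rdim_tensor_rep dim_mnP)
  then show ?thesis
    unfolding splits_def by (rule split_of_faithful[OF young_module_exists c tensor_rep_is_rep _ assms])
qed

text \<open>The object \<open>mnP d 0\<close> is faithful by \<open>kills_eq_0\<close>, so the Young
  module is a summand of its tensor power.\<close>

lemma in_B_young: "in_B d (young_module d l :: 'k srep)"
proof -
  have "faithful_obj d (mnP d 0 :: 'k mat)"
    unfolding faithful_obj_mnP
  proof (intro allI impI)
    fix f :: "(nat \<Rightarrow> nat) \<Rightarrow> 'k" and \<sigma>
    assume "kills d 0 d {..<d + 2 * 0} f" "\<sigma> permutes {0..<d}"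
    then show "f \<sigma> = 0" by (rule kills_eq_0[rotated 2]) (cases d, auto)
  qed
  then have "splits d 0" by (rule splits_of_faithful)
  then obtain f g where "f \<in> Homs d (young_module d l :: 'k srep) (tensor_rep d (mnP d 0 :: 'k mat))" "g \<in> Homs d (tensor_rep d (mnP d 0 :: 'k mat)) (young_module d l :: 'k srep)" "g * f = 1\<^sub>m (rdim (young_module d l :: 'k srep))"
    unfolding splits_def by blast
  moreover have "is_rep d (young_module d l :: 'k srep)" using young_module_exists by (simp add: is_young_module_def indecomposable_def)
  ultimately have "is_summand d (young_module d l :: 'k srep) (tensor_rep d (mnP d 0 :: 'k mat))" using is_summand_of_split tensor_rep_is_rep by blast
  then show ?thesis by (rule in_BI[OF mnP_Ver4p])
qed

lemma frakD_vanishes_iff: "frakD_vanishes d l (mnP a b :: 'k mat) \<longleftrightarrow> \<not> splits a b"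
proof -
  obtain i p where c: "carries (young_module d l :: 'k srep) i p" by (rule young_module_carries[OF young_module_exists])
  have "in_B d (tensor_rep d (mnP a b :: 'k mat))" by (rule in_BI[OF mnP_Ver4p is_summand_refl[OF tensor_rep_is_rep]])
  then show ?thesis
    unfolding frakD_vanishes_def frakD_def splits_def
    using simple_functor_singleton_iff[OF in_B_young carries_ne(2)[OF c] young_local[OF young_module_exists c]] by blast
qed

lemma vanishes_of_product:
  assumes "rep_sum d (tensor_rep d (mnP a b :: 'k mat)) R * (rep_sum d (tensor_rep d (mnP a b :: 'k mat)) C * rep_sum d (tensor_rep d (mnP a b :: 'k mat)) R) = 0\<^sub>m (rdim (tensor_rep d (mnP a b :: 'k mat))) (rdim (tensor_rep d (mnP a b :: 'k mat)))"
  shows "frakD_vanishes d l (mnP a b :: 'k mat)"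
proof -
  obtain i p where c: "carries (young_module d l :: 'k srep) i p" by (rule young_module_carries[OF young_module_exists])
  show ?thesis
    unfolding frakD_vanishes_iff splits_def by (rule no_split[OF young_module_exists c tensor_rep_is_rep assms])
qed

lemma braid_hom_mat_sum:
  "braid_hom d (mnP a b) f = mat_sum (rdim (tensor_rep d (mnP a b :: 'k mat))) (Sym d) (\<lambda>\<sigma>. f \<sigma> \<cdot>\<^sub>m tensor_rep d (mnP a b :: 'k mat) \<sigma>)"
proof -
  have "dim_row (tensor_rep d (mnP a b :: 'k mat) \<sigma>) = rdim (tensor_rep d (mnP a b :: 'k mat))" "dim_col (tensor_rep d (mnP a b :: 'k mat) \<sigma>) = rdim (tensor_rep d (mnP a b :: 'k mat))" if "\<sigma> \<in> Sym d" for \<sigma>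
    using is_repD(4,5)[OF tensor_rep_is_rep that] by auto
  then show ?thesis
    by (intro eq_matI) (auto simp: braid_hom_def mat_sum_def rdim_tensor_rep dim_mnP intro!: sum.cong)
qed

text \<open>For one column the row group is trivial and the column group is
  \<open>S\<^sub>d\<close>, so the product of sums is the sum of all permutations.\<close>

lemma vanishes_column:
  assumes l: "l = replicate d 1" and lt: "a + 4 * b < d"
  shows "frakD_vanishes d l (mnP a b :: 'k mat)"
proof (rule vanishes_of_product)
  let ?n = "rdim (tensor_rep d (mnP a b :: 'k mat))"
  have snd0: "snd (t x) = 0" if "x < d" for x
    using t_cell[OF that] cell_iff[OF part, of "fst (t x)" "snd (t x)"] by (auto simp: l)
  have "\<rho> = id" if h: "\<rho> \<in> R" for \<rho>
  proof
    fix x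
    have S: "\<rho> \<in> Sym d" using h R_Sym by blast
    show "\<rho> x = id x"
    proof (cases "x < d")
      case True
      then show ?thesis
        using t_inj[OF Sym_lt[OF S True] True R_fst[OF h True]] snd0 Sym_lt[OF S True] by simp
    next
      case False
      then show ?thesis using S permutes_not_in[of \<rho> "{..<d}" x] by (simp add: Sym_def)
    qed
  qed
  then have R: "R = {id}" using id_CR(2) by blast
  have C: "C = Sym d" using snd0 Sym_lt by (auto simp: column_stabilizer_def)
  have one: "rep_sum d (tensor_rep d (mnP a b :: 'k mat)) R = 1\<^sub>m ?n"
    unfolding R by (rule eq_matI) (simp_all add: mat_sum_def is_repD(2)[OF tensor_rep_is_rep])
  have "rep_sum d (tensor_rep d (mnP a b :: 'k mat)) C = braid_hom d (mnP a b) (\<lambda>_. 1)"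
    unfolding braid_hom_mat_sum C by (rule eq_matI)
      (use is_repD(4,5)[OF tensor_rep_is_rep] in \<open>auto simp: mat_sum_def intro!: sum.cong\<close>)
  also have "\<dots> = 0\<^sub>m ?n ?n"
    using norm_kills[OF lt] by (simp add: braid_hom_eq_0_iff rdim_tensor_rep)
  finally have zero: "rep_sum d (tensor_rep d (mnP a b :: 'k mat)) C = 0\<^sub>m ?n ?n" .
  show "rep_sum d (tensor_rep d (mnP a b :: 'k mat)) R * (rep_sum d (tensor_rep d (mnP a b :: 'k mat)) C * rep_sum d (tensor_rep d (mnP a b :: 'k mat)) R) = 0\<^sub>m ?n ?n"
    unfolding one zero by simp
qed

end

context double_tableau
begin

text \<open>Multiplying out the three sums gives the group algebra element \<open>tcount\<close>,
  which acts by zero.\<close>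

lemma vanishes_double: "frakD_vanishes d l (mnP 0 n :: 'k mat)"
proof (rule vanishes_of_product)
  let ?W = "tensor_rep d (mnP 0 n :: 'k mat)" and ?n = "rdim (tensor_rep d (mnP 0 n :: 'k mat))"
  note rep = tensor_rep_is_rep[of d 0 n]
  have W: "?W \<sigma> \<in> carrier_mat ?n ?n" if "\<sigma> \<in> Sym d" for \<sigma> by (rule is_repD(1)[OF rep that])
  have CR: "C \<subseteq> Sym d" "R \<subseteq> Sym d" by (rule C_Sym, rule R_Sym)
  have 1: "rep_sum d ?W C * rep_sum d ?W R = mat_sum ?n (C \<times> R) (\<lambda>(\<gamma>, \<rho>'). ?W \<gamma> * ?W \<rho>')"
    by (rule mat_sum_mult) (use W CR in blast)+
  have 2: "rep_sum d ?W R * mat_sum ?n (C \<times> R) (\<lambda>(\<gamma>, \<rho>'). ?W \<gamma> * ?W \<rho>') =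
      mat_sum ?n (R \<times> (C \<times> R)) (\<lambda>(\<rho>, p). ?W \<rho> * (case p of (\<gamma>, \<rho>') \<Rightarrow> ?W \<gamma> * ?W \<rho>'))"
  proof (rule mat_sum_mult)
    show "?W \<rho> \<in> carrier_mat ?n ?n" if "\<rho> \<in> R" for \<rho> using that W CR by blast
    fix p assume "p \<in> C \<times> R"
    then obtain \<gamma> \<rho>' where p: "p = (\<gamma>, \<rho>')" "\<gamma> \<in> Sym d" "\<rho>' \<in> Sym d" using CR by blast
    show "(case p of (\<gamma>, \<rho>') \<Rightarrow> ?W \<gamma> * ?W \<rho>') \<in> carrier_mat ?n ?n"
      unfolding p(1) prod.case by (rule mult_carrier_mat[OF W[OF p(2)] W[OF p(3)]])
  qed
  have "mat_sum ?n (R \<times> (C \<times> R)) (\<lambda>(\<rho>, p). ?W \<rho> * (case p of (\<gamma>, \<rho>') \<Rightarrow> ?W \<gamma> * ?W \<rho>')) = braid_hom d (mnP 0 n) tcount"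
  proof (rule eq_matI)
    fix i j assume "i < dim_row (braid_hom d (mnP 0 n) tcount)" "j < dim_col (braid_hom d (mnP 0 n) tcount)"
    then have ij: "i < ?n" "j < ?n" by (simp_all add: braid_hom_mat_sum)
    have "mat_sum ?n (R \<times> (C \<times> R)) (\<lambda>(\<rho>, p). ?W \<rho> * (case p of (\<gamma>, \<rho>') \<Rightarrow> ?W \<gamma> * ?W \<rho>')) $$ (i, j) =
        (\<Sum>(\<rho>, \<gamma>, \<rho>')\<in>R \<times> C \<times> R. ?W (\<rho> \<circ> (\<gamma> \<circ> \<rho>')) $$ (i, j))"
      unfolding mat_sum_def index_mat(1)[OF ij] prod.case
    proof (intro sum.cong refl)
      fix x assume "x \<in> R \<times> (C \<times> R)"
      then obtain \<rho> \<gamma> \<rho>' where x: "x = (\<rho>, \<gamma>, \<rho>')" "\<rho> \<in> Sym d" "\<gamma> \<in> Sym d" "\<rho>' \<in> Sym d" using CR by blast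
      show "(case x of (\<rho>, p) \<Rightarrow> ?W \<rho> * (case p of (\<gamma>, \<rho>') \<Rightarrow> ?W \<gamma> * ?W \<rho>')) $$ (i, j) =
          (case x of (\<rho>, \<gamma>, \<rho>') \<Rightarrow> ?W (\<rho> \<circ> (\<gamma> \<circ> \<rho>')) $$ (i, j))"
        unfolding x(1) prod.case is_repD(3)[OF rep x(2) Sym_comp[OF x(3,4)]] is_repD(3)[OF rep x(3,4)] ..
    qed
    also have "\<dots> = (\<Sum>g\<in>Sym d. tcount g * ?W g $$ (i, j))" by (rule sum_RCR)
    also have "\<dots> = braid_hom d (mnP 0 n) tcount $$ (i, j)"
      using ij by (simp add: braid_hom_def rdim_tensor_rep dim_mnP)
    finally show "mat_sum ?n (R \<times> (C \<times> R)) (\<lambda>(\<rho>, p). ?W \<rho> * (case p of (\<gamma>, \<rho>') \<Rightarrow> ?W \<gamma> * ?W \<rho>')) $$ (i, j) =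
        braid_hom d (mnP 0 n) tcount $$ (i, j)" .
  qed (simp_all add: braid_hom_mat_sum)
  also have "\<dots> = 0\<^sub>m ?n ?n"
    using braid_hom_eq_0_iff[of d 0 n tcount] tcount_kills by (simp add: rdim_tensor_rep)
  finally show "rep_sum d ?W R * (rep_sum d ?W C * rep_sum d ?W R) = 0\<^sub>m ?n ?n"
    unfolding 1 2 .
qed

end

section \<open>The two critical shapes and the equivalence\<close>

lemma column_partition: "is_partition d (replicate d 1)" "two_restricted (replicate d 1)"
proof -
  show "is_partition d (replicate d 1)"
    by (simp add: is_partition_def sorted_wrt_iff_nth_less sum_list_replicate)
  show "two_restricted (replicate d 1)"
    by (simp add: two_restricted_def row_len_def)
qed

lemma double_partition:
  assumes n: "0 < n"
  shows "is_partition (4 * n) (replicate (2 * n - 1) 2 @ [1, 1])" "two_restricted (replicate (2 * n - 1) 2 @ [1, 1])"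
proof -
  show "is_partition (4 * n) (replicate (2 * n - 1) 2 @ [1, 1])"
    using n by (auto simp: is_partition_def sorted_wrt_append sorted_wrt_iff_nth_less[of _ "replicate _ _"] sum_list_replicate)
  have "row_len (replicate (2 * n - 1) 2 @ [1, 1]) i = (if i < 2 * n - 1 then 2 else if i < 2 * n + 1 then 1 else 0)" for i
    using n by (auto simp: row_len_def nth_append nth_Cons')
  then show "two_restricted (replicate (2 * n - 1) 2 @ [1, 1])"
    by (auto simp: two_restricted_def)
qed

text \<open>Proved as a cycle: the inequalities give faithfulness, faithfulness gives nonvanishing,
  and nonvanishing gives the inequalities.\<close>

theorem proposition4p43:
  fixes X :: "'k::alg_closed_field mat" and m n d :: nat
  assumes "CHAR('k) = 2"
    and "d > 0"
    and "X = mnP m n"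
  shows "(faithful_obj d X \<longleftrightarrow> m + 4 * n \<ge> d \<and> m + 2 * n \<ge> 1 + d div 2) \<and>
    (faithful_obj d X \<longleftrightarrow> (\<forall>l. is_partition d l \<and> two_restricted l \<longrightarrow> \<not> frakD_vanishes d l X))"
proof -
  interpret char_two "TYPE('k)" by unfold_locales (rule assms(1))
  let ?cond = "m + 4 * n \<ge> d \<and> m + 2 * n \<ge> 1 + d div 2"
  let ?nonzero = "\<forall>l. is_partition d l \<and> two_restricted l \<longrightarrow> \<not> frakD_vanishes d l X"
  have 1: "faithful_obj d X" if "?cond"
    unfolding assms(3) faithful_obj_mnP
  proof (intro allI impI)
    fix f :: "(nat \<Rightarrow> nat) \<Rightarrow> 'k" and \<sigma>
    assume "kills m 0 d {..<m + 2 * n} f" "\<sigma> permutes {0..<d}"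
    then show "f \<sigma> = 0" by (rule kills_eq_0[rotated 2]) (use that in simp_all)
  qed
  have 2: ?nonzero if faith: "faithful_obj d X"
  proof (intro allI impI)
    fix l assume l: "is_partition d l \<and> two_restricted l"
    then obtain t where "is_tableau d l t" using tableau_exists by blast
    then interpret young_tableau d l t "TYPE('k)" by unfold_locales (use l in auto)
    show "\<not> frakD_vanishes d l X"
      using splits_of_faithful faith unfolding assms(3) frakD_vanishes_iff by blast
  qed
  have 3: ?cond if ?nonzero
  proof (rule ccontr)
    assume no: "\<not> ?cond"
    show False
    proof (cases "m + 4 * n < d")
      case True
      obtain t where tab: "is_tableau d (replicate d 1) t" by (rule tableau_exists[OF column_partition(1)[of d]])
      interpret young_tableau d "replicate d 1" t "TYPE('k)"
        by unfold_locales (rule column_partition tab)+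
      have "frakD_vanishes d (replicate d 1) X" unfolding assms(3) by (rule vanishes_column[OF refl True])
      then show False using that[rule_format, OF conjI[OF column_partition]] by contradiction
    next
      case False
      then have mn: "m = 0" "d = 4 * n" using no by linarith+
      then have n: "0 < n" using assms(2) by simp
      let ?l = "replicate (2 * n - 1) 2 @ [1, 1]"
      have dp: "is_partition d ?l" "two_restricted ?l"
        unfolding mn(2) by (rule double_partition[OF n])+
      obtain t where tab: "is_tableau d ?l t" by (rule tableau_exists[OF dp(1)])
      interpret double_tableau d ?l t "TYPE('k)" n
        by unfold_locales (rule dp tab n refl)+
      have "frakD_vanishes d ?l X" unfolding assms(3) mn(1) by (rule vanishes_double)
      then show False using that[rule_format, OF conjI[OF dp]] by contradiction
    qed
  qed
  show ?thesis using 1 2 3 by blast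
qed

end
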